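(* Let $x\in\mathbb{R}$. For $q>0$, $$\mathbb{E}_x\left(\int_0^\infty e^{-qt}\,dL_t\right)=e^{-\varphi(q)b}\,\frac{r^{(q)}(x)}{\varphi(q)\,q\int_b^\infty e^{-\varphi(q)y}W^{(q)}(y)\,dy}-\delta\,\overline{\mathbb{W}}^{(q)}(x-b),$$ where $r^{(q)}(x):=Z^{(q)}(x)+q\delta\int_b^x\mathbb{W}^{(q)}(x-y)W^{(q)}(y)\,dy$. For $q=0$, the expectation $\mathbb{E}_x\left(\int_0^\infty dL_t\right)$ is infinite.
   Context: Let $X=(X_t)_{t\ge0}$ be a spectrally negative Lévy process (no positive jumps, not the negative of a subordinator); $\mathbb{P}_x$ is its law when $X_0=x$, with expectation $\mathbb{E}_x$. Its Laplace exponent is $\psi(\theta)=\log\mathbb{E}_0[e^{\theta X_1}]=\gamma\theta+\frac{\sigma^2}{2}\theta^2+\int_{(-\infty,0)}(e^{\theta x}-1-\theta x1_{\{x>-1\}})\Pi(dx)$, $\theta\ge0$, with $\gamma\in\mathbb{R}$, $\sigma\ge0$ and Lévy measure $\Pi$ on $(-\infty,0)$, $\int(1\wedge x^2)\Pi(dx)<\infty$. If $X$ has paths of bounded variation, then $X_t=X_0+ct-S_t$ with $c:=\gamma-\int_{(-1,0)}x\,\Pi(dx)>0$ and $S$ a driftless subordinator. Fix $b>0$ and $\delta\ge0$, and assume $\delta<c$ whenever $X$ has paths of bounded variation. Put $Y_t:=X_t-\delta t$, a spectrally negative Lévy process with Laplace exponent $\psi_Y(\theta)=\psi(\theta)-\delta\theta$.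 Refracted-reflected process $V$ under $\mathbb{P}_x$ (reflected at $0$, refracted above $b$): Step 0: set $V_{0-}=x$; if $x\ge0$ set $\underline\tau:=0$ and go to Step 1, otherwise set $\overline\tau:=0$ and go to Step 2. Step 1: let $(\widetilde A_t)_{t\ge\underline\tau}$ be the refracted Lévy process started at time $\underline\tau$ at level $x$, i.e. the unique strong solution of $d\widetilde A_t=dX_t-\delta1_{\{\widetilde A_t>b\}}dt$ with $\widetilde A_{\underline\tau}=x$; let $\overline\tau:=\inf\{t>\underline\tau:\widetilde A_t<0\}$, set $V_t=\widetilde A_t$ for $\underline\tau\le t<\overline\tau$, and go to Step 2. Step 2: let $\widetilde U_t=(X_t-X_{\overline\tau})+\sup_{\overline\tau\le s\le t}(-(X_s-X_{\overline\tau}))\vee0$, $t\ge\overline\tau$, be the process reflected at $0$ started at time $\overline\tau$ at $0$; let $\underline\tau:=\inf\{t>\overline\tau:\widetilde U_t>b\}$, set $V_t=\widetilde U_t$ for $\overline\tau\le t<\underline\tau$, set $x=b$, and go to Step 1. Define $L_t:=\delta\int_0^t1_{\{V_s>b\}}ds$, $t\ge0$. Scale functions: for $q\ge0$, $\Phi(q):=\sup\{\lambda\ge0:\psi(\lambda)=q\}$ and $\varphi(q):=\sup\{\lambda\ge0:\psi_Y(\lambda)=q\}$. $W^{(q)}$ (resp. $\mathbb{W}^{(q)}$) is the scale function of $X$ (resp. $Y$): zero on $(-\infty,0)$, continuous and strictly increasing on $[0,\infty)$, with $\int_0^\infty e^{-\theta x}W^{(q)}(x)dx=1/(\psi(\theta)-q)$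 for $\theta>\Phi(q)$ (resp. $\int_0^\infty e^{-\theta x}\mathbb{W}^{(q)}(x)dx=1/(\psi_Y(\theta)-q)$ for $\theta>\varphi(q)$). Also, for $x\in\mathbb{R}$, $Z^{(q)}(x):=1+q\int_0^xW^{(q)}(y)dy$ and $\overline{\mathbb{W}}^{(q)}(x):=\int_0^x\mathbb{W}^{(q)}(y)dy$. Integrals $\int_b^x\mathbb{W}^{(q)}(x-y)\cdots dy$ vanish for $x\le b$.
   Formalization: The claim for q = 0 that the expectation is infinite is proved for δ > 0 only; for δ = 0, which the setting allows, L is identically 0 and the expectation is 0, so the claim fails there. The formula for q > 0 is proved for every δ ≥ 0. *)

theory Defs
  imports "HOL-Probability.Probability"
begin

text \<open>Paths and processes are indexed by \<^typ>\<open>real\<close>; only times \<open>t \<ge> 0\<close> are relevant.\<close>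

definition cadlag :: "(real \<Rightarrow> real) \<Rightarrow> bool" where
  "cadlag f \<longleftrightarrow> (\<forall>t\<ge>0. (f \<longlongrightarrow> f t) (at_right t)) \<and> (\<forall>t>0. \<exists>l. (f \<longlongrightarrow> l) (at_left t))"

definition no_positive_jumps :: "(real \<Rightarrow> real) \<Rightarrow> bool" where
  "no_positive_jumps f \<longleftrightarrow> (\<forall>t>0. \<forall>l. (f \<longlongrightarrow> l) (at_left t) \<longrightarrow> f t \<le> l)"

definition locally_bounded_variation :: "(real \<Rightarrow> real) \<Rightarrow> bool" where
  "locally_bounded_variation f \<longleftrightarrow>
     (\<forall>T\<ge>0. \<exists>B. \<forall>n. \<forall>t :: nat \<Rightarrow> real. mono t \<and> 0 \<le> t 0 \<and> t n \<le> T \<longrightarrow>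
        (\<Sum>i<n. \<bar>f (t (Suc i)) - f (t i)\<bar>) \<le> B)"

locale levy_process = prob_space M for M :: "'a measure" +
  fixes X :: "real \<Rightarrow> 'a \<Rightarrow> real"
  assumes measurable_process: "\<And>t. 0 \<le> t \<Longrightarrow> X t \<in> borel_measurable M"
    and starts_at_zero: "AE \<omega> in M. X 0 \<omega> = 0"
    and cadlag_paths: "AE \<omega> in M. cadlag (\<lambda>t. X t \<omega>)"
    and independent_increments:
      "\<And>(t :: nat \<Rightarrow> real) n. mono t \<Longrightarrow> 0 \<le> t 0 \<Longrightarrow>
         indep_vars (\<lambda>_. borel) (\<lambda>i \<omega>. X (t (Suc i)) \<omega> - X (t i) \<omega>) {..<n}"
    and stationary_increments:
      "\<And>s t. 0 \<le> s \<Longrightarrow> s \<le> t \<Longrightarrow>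
         distr M borel (\<lambda>\<omega>. X t \<omega> - X s \<omega>) = distr M borel (X (t - s))"

locale spectrally_negative_levy_process = levy_process +
  assumes no_positive_jumps: "AE \<omega> in M. no_positive_jumps (\<lambda>t. X t \<omega>)"
    and not_neg_subordinator: "\<not> (AE \<omega> in M. antimono_on {0..} (\<lambda>t. X t \<omega>))"

definition bounded_variation_paths :: "'a measure \<Rightarrow> (real \<Rightarrow> 'a \<Rightarrow> real) \<Rightarrow> bool" where
  "bounded_variation_paths M X \<longleftrightarrow> (AE \<omega> in M. locally_bounded_variation (\<lambda>t. X t \<omega>))"

definition laplace_exponent :: "'a measure \<Rightarrow> (real \<Rightarrow> 'a \<Rightarrow> real) \<Rightarrow> real \<Rightarrow> real" where
  "laplace_exponent M X \<theta> = ln (\<integral>\<omega>. exp (\<theta> * X 1 \<omega>) \<partial>M)"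

definition neg_levy_measure :: "real measure \<Rightarrow> bool" where
  "neg_levy_measure \<nu> \<longleftrightarrow> sets \<nu> = sets borel \<and> emeasure \<nu> {0..} = 0 \<and>
     (\<integral>\<^sup>+x. ennreal (min 1 (x\<^sup>2)) \<partial>\<nu>) < \<infinity>"

definition levy_khintchine :: "real \<Rightarrow> real \<Rightarrow> real measure \<Rightarrow> real \<Rightarrow> real" where
  "levy_khintchine \<gamma> \<sigma> \<nu> \<theta> = \<gamma> * \<theta> + \<sigma>\<^sup>2 / 2 * \<theta>\<^sup>2 +
     (LINT x:{..<0}|\<nu>. exp (\<theta> * x) - 1 - \<theta> * x * indicator {-1<..} x)"

definition has_levy_triplet ::
    "'a measure \<Rightarrow> (real \<Rightarrow> 'a \<Rightarrow> real) \<Rightarrow> real \<Rightarrow> real \<Rightarrow> real measure \<Rightarrow> bool" where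
  "has_levy_triplet M X \<gamma> \<sigma> \<nu> \<longleftrightarrow> 0 \<le> \<sigma> \<and> neg_levy_measure \<nu> \<and>
     (\<forall>\<theta>\<ge>0. integrable M (\<lambda>\<omega>. exp (\<theta> * X 1 \<omega>)) \<and>
        laplace_exponent M X \<theta> = levy_khintchine \<gamma> \<sigma> \<nu> \<theta>)"

definition laplace_root :: "'a measure \<Rightarrow> (real \<Rightarrow> 'a \<Rightarrow> real) \<Rightarrow> real \<Rightarrow> real" where
  "laplace_root M X q = Sup {\<theta>. 0 \<le> \<theta> \<and> laplace_exponent M X \<theta> = q}"

text \<open>
  For \<open>q = 0\<close> strict monotonicity fails when \<open>X\<close> is a pure drift; only \<open>q > 0\<close> is used.
\<close>
definition scale_function ::
    "'a measure \<Rightarrow> (real \<Rightarrow> 'a \<Rightarrow> real) \<Rightarrow> real \<Rightarrow> (real \<Rightarrow> real) \<Rightarrow> bool" where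
  "scale_function M X q W \<longleftrightarrow>
     (\<forall>x<0. W x = 0) \<and> continuous_on {0..} W \<and> strict_mono_on {0..} W \<and>
     (\<forall>\<theta>>laplace_root M X q.
        set_integrable lborel {0..} (\<lambda>x. exp (- \<theta> * x) * W x) \<and>
        (LBINT x:{0..}. exp (- \<theta> * x) * W x) = 1 / (laplace_exponent M X \<theta> - q))"

definition scale_Z :: "real \<Rightarrow> (real \<Rightarrow> real) \<Rightarrow> real \<Rightarrow> real" where
  "scale_Z q W x = 1 + q * (LBINT y=0..x. W y)"

definition scale_bar :: "(real \<Rightarrow> real) \<Rightarrow> real \<Rightarrow> real" where
  "scale_bar W x = (LBINT y=0..x. W y)"

text \<open>
  Here \<open>W\<close> and \<open>WY\<close> are the scale functions of \<open>X\<close> and of \<open>Y\<close>. For \<open>x \<le> b\<close> the oriented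
  integral is zero, since \<open>WY\<close> vanishes on the negative half-line.
\<close>
definition scale_r ::
    "real \<Rightarrow> real \<Rightarrow> real \<Rightarrow> (real \<Rightarrow> real) \<Rightarrow> (real \<Rightarrow> real) \<Rightarrow> real \<Rightarrow> real" where
  "scale_r \<delta> b q W WY x = scale_Z q W x + q * \<delta> * (LBINT y=b..x. WY (x - y) * W y)"

text \<open>
  Everything is constructed pathwise, from a path \<open>f\<close> of the driving process.

  The equation \<open>dA = dX - \<delta> 1{A > b} dt\<close> has at most one solution for each fixed Borel path: the
  difference \<open>D\<close> of two solutions is absolutely continuous and \<open>D\<^sup>2\<close> is nonincreasing. Hence
  \<open>THE\<close> selects, on almost every path, the value of the unique strong solution. Membership in
  \<open>extensional\<close> fixes the irrelevant values before time \<open>\<tau>\<close>.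
\<close>
definition refracted_solution ::
    "real \<Rightarrow> real \<Rightarrow> (real \<Rightarrow> real) \<Rightarrow> real \<Rightarrow> real \<Rightarrow> (real \<Rightarrow> real) \<Rightarrow> bool" where
  "refracted_solution \<delta> b f \<tau> x A \<longleftrightarrow>
     A \<in> extensional {\<tau>..} \<and> A \<in> borel_measurable borel \<and>
     (\<forall>t\<ge>\<tau>. A t = x + (f t - f \<tau>) - \<delta> * (LBINT s:{\<tau>..t}. of_bool (A s > b)))"

definition refracted_path ::
    "real \<Rightarrow> real \<Rightarrow> (real \<Rightarrow> real) \<Rightarrow> real \<Rightarrow> real \<Rightarrow> real \<Rightarrow> real" where
  "refracted_path \<delta> b f \<tau> x = (THE A. refracted_solution \<delta> b f \<tau> x A)"

definition reflected_path :: "(real \<Rightarrow> real) \<Rightarrow> real \<Rightarrow> real \<Rightarrow> real" where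
  "reflected_path f \<tau> t = (f t - f \<tau>) + max (SUP s\<in>{\<tau>..t}. - (f s - f \<tau>)) 0"

text \<open>
  A stage is one execution of Step 1 (\<open>Refracted \<tau> x\<close>, started at time \<open>\<tau>\<close> at level \<open>x\<close>) or of
  Step 2 (\<open>Reflected \<tau>\<close>, started at time \<open>\<tau>\<close> at level \<open>0\<close>). It occupies the time interval from
  \<open>stage_start\<close> (included) to \<open>stage_end\<close> (excluded), which may be empty or unbounded.
\<close>
datatype stage = Refracted real real | Reflected real

fun stage_start :: "stage \<Rightarrow> real" where
  "stage_start (Refracted \<tau> x) = \<tau>"
| "stage_start (Reflected \<tau>) = \<tau>"

fun stage_path :: "real \<Rightarrow> real \<Rightarrow> (real \<Rightarrow> real) \<Rightarrow> stage \<Rightarrow> real \<Rightarrow> real" where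
  "stage_path \<delta> b f (Refracted \<tau> x) = refracted_path \<delta> b f \<tau> x"
| "stage_path \<delta> b f (Reflected \<tau>) = reflected_path f \<tau>"

fun stage_end :: "real \<Rightarrow> real \<Rightarrow> (real \<Rightarrow> real) \<Rightarrow> stage \<Rightarrow> ereal" where
  "stage_end \<delta> b f (Refracted \<tau> x) = (INF t\<in>{t. \<tau> < t \<and> refracted_path \<delta> b f \<tau> x t < 0}. ereal t)"
| "stage_end \<delta> b f (Reflected \<tau>) = (INF t\<in>{t. \<tau> < t \<and> reflected_path f \<tau> t > b}. ereal t)"

fun next_stage :: "real \<Rightarrow> real \<Rightarrow> (real \<Rightarrow> real) \<Rightarrow> stage \<Rightarrow> stage option" where
  "next_stage \<delta> b f (Refracted \<tau> x) =
     (case stage_end \<delta> b f (Refracted \<tau> x) of ereal \<tau>' \<Rightarrow> Some (Reflected \<tau>') | _ \<Rightarrow> None)"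
| "next_stage \<delta> b f (Reflected \<tau>) =
     (case stage_end \<delta> b f (Reflected \<tau>) of ereal \<tau>' \<Rightarrow> Some (Refracted \<tau>' b) | _ \<Rightarrow> None)"

primrec stages :: "real \<Rightarrow> real \<Rightarrow> real \<Rightarrow> (real \<Rightarrow> real) \<Rightarrow> nat \<Rightarrow> stage option" where
  "stages \<delta> b x f 0 = Some (if 0 \<le> x then Refracted 0 x else Reflected 0)"
| "stages \<delta> b x f (Suc n) = Option.bind (stages \<delta> b x f n) (next_stage \<delta> b f)"

text \<open>
  The intervals of distinct stages are disjoint. Almost surely they cover the half-line, because
  the successive passages from \<open>0\<close> up to \<open>b\<close> are independent and identically distributed.
\<close>
definition refracted_reflected :: "real \<Rightarrow> real \<Rightarrow> real \<Rightarrow> (real \<Rightarrow> real) \<Rightarrow> real \<Rightarrow> real" where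
  "refracted_reflected \<delta> b x f t =
     (THE v. \<exists>n s. stages \<delta> b x f n = Some s \<and> stage_start s \<le> t \<and> ereal t < stage_end \<delta> b f s \<and>
        v = stage_path \<delta> b f s t)"

text \<open>
  The process \<open>L\<close>, extended by \<open>0\<close> to negative times, so that \<^const>\<open>interval_measure\<close> of it
  is the Stieltjes measure \<open>dL\<close> on the half-line.
\<close>
definition refraction_time :: "real \<Rightarrow> real \<Rightarrow> real \<Rightarrow> (real \<Rightarrow> real) \<Rightarrow> real \<Rightarrow> real" where
  "refraction_time \<delta> b x f t =
     \<delta> * (LBINT s:{0..t}. of_bool (refracted_reflected \<delta> b x f s > b))"

text \<open>
  The expectation of \<open>\<integral> exp(- q t) dL\<^sub>t\<close> under \<open>P\<^sub>x\<close>, where \<open>P\<^sub>x\<close> is realised as the law of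
  \<open>x + X\<close> for a process \<open>X\<close> started at \<open>0\<close> under \<open>M\<close>. The construction is meaningful on almost every path
  only; the value of the outer integral does not depend on the exceptional null set.
\<close>
definition expected_discounted_L ::
    "'a measure \<Rightarrow> (real \<Rightarrow> 'a \<Rightarrow> real) \<Rightarrow> real \<Rightarrow> real \<Rightarrow> real \<Rightarrow> real \<Rightarrow> ennreal" where
  "expected_discounted_L M X \<delta> b x q =
     (\<integral>\<^sup>+\<omega>. (\<integral>\<^sup>+t\<in>{0..}. ennreal (exp (- q * t))
        \<partial>interval_measure (refraction_time \<delta> b x (\<lambda>t. x + X t \<omega>))) \<partial>M)"

end

theory Submission
  imports Defs "HOL-Complex_Analysis.Complex_Analysis" "HOL-Real_Asymp.Real_Asymp"
begin

text \<open>
 Neither the strong Markov property nor a decomposition at passage times is used: the process is approximated by the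
 Euler scheme \<open>V' = max 0 (V + dX - \<delta> h 1{V > b})\<close>. By uniqueness of bilateral Laplace transforms in the starting
 point, convolutions with a scale function satisfy Dynkin's formula
 \<open>exp (- q h) E (W * f)(v + X h) = (W * f) v + \<integral>{0..h} exp (- q s) E f (v + X s) ds\<close>. Hence, along the scheme, \<open>r\<close> is
 harmonic up to \<open>o(h)\<close> per step, while \<open>w x = \<integral>{0..x - b} WY\<close> has source \<open>1\<close> above \<open>b\<close>. As \<open>w / r\<close> tends to a constant
 \<open>\<rho>\<close> at infinity, the expected discounted time above \<open>b\<close> is \<open>\<rho> * r - w\<close>.

 Pathwise, the glued process is the unique fixed point of an equation for its refraction time, and the Euler scheme
 converges to it by compactness and uniqueness as soon as the path spends no time sliding along the level \<open>b\<close>. This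
 holds almost surely because \<open>P (0 \<le> X u \<le> \<delta> u)\<close> tends to \<open>0\<close> in mean as \<open>u\<close> tends to \<open>0\<close>. For \<open>q = 0\<close> the value follows by
 monotone comparison with \<open>q\<close> tending to \<open>0\<close>.
\<close>

text \<open>The obstacle is the lack of smoothness: scale functions are only continuous, so no
  generator can be applied and every estimate comes from the integrated identity
  \<open>dynkin_cv\<close>. That identity describes one free step of \<open>X\<close> or of
  \<open>Y\<close>, whereas a step started just below \<open>b\<close> may end above it and a step
  started near \<open>0\<close> spends time below \<open>0\<close>. Such defects are charged to
  short windows around \<open>b\<close> and \<open>0\<close>, in which the chain spends a time of
  the order of their width. This is why \<open>F c\<close> and \<open>r c\<close> with
  \<open>c\<close> slightly above \<open>b\<close> stand in for the functions of the theorem, and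
  why a bound on the mean of exp (\<phi> * V) is required: the errors grow like exp (\<phi> * x).
  Reflection increases exp (\<phi> * x), so a second scale function enters, at the discount p = q +
  \<delta> * \<phi> for which the right inverse of \<psi> takes the value \<phi>; its
  \<open>Z\<close> is constant on the negative half-line and grows at the same rate. The drift
  condition enters as \<psi> z > \<delta> * z for some z > 0, which treats bounded and unbounded
  variation together.\<close>

abbreviation "nexp x \<equiv> ennreal (exp x)"

abbreviation nn_lborel :: "(real \<Rightarrow> ennreal) \<Rightarrow> ennreal" (binder "\<L> " 10)
  where "nn_lborel f \<equiv> nn_integral lborel f"

abbreviation (in prob_space) nn_expectation :: "('a \<Rightarrow> ennreal) \<Rightarrow> ennreal" (binder "\<E> " 10)
  where "nn_expectation f \<equiv> nn_integral M f"

abbreviation (input) "ind \<equiv> indicator"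

abbreviation (input) seq_tendsto :: "(nat \<Rightarrow> 'a::topological_space) \<Rightarrow> 'a \<Rightarrow> bool" (infix "---->" 60)
  where "f ----> l \<equiv> f \<longlonglongrightarrow> l"

abbreviation (input) eventually_seq :: "(nat \<Rightarrow> bool) \<Rightarrow> bool" (binder "EV " 10)
  where "eventually_seq P \<equiv> eventually P sequentially"

section \<open>Exponential moments and bilateral Laplace transforms\<close>

lemma exp_mult_abs_le:
 fixes a x :: real
 shows "exp (a * \<bar>x\<bar>) <= exp (a * x) + exp (- a * x)"
 by (cases "x >= 0") auto

text \<open>The power series of \<open>exp (z * x)\<close> about \<open>z0\<close> may be integrated
  termwise. Its absolute partial sums are dominated by
  \<open>exp (\<rho> * \<bar>x\<bar>) * exp (Re z0 * x)\<close>, and splitting by the sign of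
  \<open>x\<close> bounds this by \<open>G\<close>, whose exponents \<open>Re z0 + \<rho>\<close>
  and \<open>Re z0 - \<rho>\<close> still lie in the strip.\<close>

lemma mgf_holomorphic:
 fixes \<mu> :: "real measure"
 assumes sets: "sets \<mu> = sets borel"
  and int: "!!s. \<bar>s\<bar> < a ==> integrable \<mu> (%x. exp (s * x))"
 shows "(%z. CLINT x|\<mu>. exp (z * complex_of_real x)) holomorphic_on {z. \<bar>Re z\<bar> < a}"
proof -
 note sets [measurable_cong]
 have loc: "EX r>0. (%z. CLINT x|\<mu>. exp (z * complex_of_real x)) holomorphic_on ball z0 r"
  if z0: "\<bar>Re z0\<bar> < a" for z0
 proof -
  define r where "r = a - \<bar>Re z0\<bar>"
  have r: "r > 0" using z0 by (simp add: r_def)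
  define c where "c n = (CLINT x|\<mu>. complex_of_real x ^ n / fact n * exp (z0 * complex_of_real x))" for n
  have "(%z. CLINT x|\<mu>. exp (z * complex_of_real x)) holomorphic_on ball z0 r"
  proof (rule power_series_holomorphic)
   fix w assume w: "w \<in> ball z0 r"
   define \<rho> where "\<rho> = cmod (w - z0)"
   have \<rho>: "0 <= \<rho>" "\<rho> + \<bar>Re z0\<bar> < a" using w by (auto simp: \<rho>_def r_def dist_norm norm_minus_commute)
   define G where "G x = exp ((\<rho> + Re z0) * x) + exp ((Re z0 - \<rho>) * x)" for x :: real
   have G_int: "integrable \<mu> G"
    unfolding G_def using \<rho> by (intro Bochner_Integration.integrable_add int) (auto simp: abs_if split: if_splits)
   have G_ge: "exp (\<rho> * \<bar>x\<bar>) * exp (Re z0 * x) <= G x" for x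
   proof -
    have "exp (\<rho> * \<bar>x\<bar>) * exp (Re z0 * x) <= (exp (\<rho> * x) + exp (- \<rho> * x)) * exp (Re z0 * x)"
     by (intro mult_right_mono exp_mult_abs_le) auto
    also have "... = G x" by (simp add: G_def exp_add [symmetric] algebra_simps)
    finally show ?thesis .
   qed
   define f where "f n x = ((w - z0) * complex_of_real x) ^ n / fact n * exp (z0 * complex_of_real x)" for n and x :: real
   have f_meas [measurable]: "f n \<in> borel_measurable \<mu>" for n unfolding f_def by measurable
   have norm_f: "norm (f n x) = (\<rho> * \<bar>x\<bar>) ^ n / fact n * exp (Re z0 * x)" for n x
    by (simp add: f_def norm_mult norm_divide norm_power \<rho>_def)
   have exp_sums: "(%n. (\<rho> * \<bar>x\<bar>) ^ n / fact n) sums exp (\<rho> * \<bar>x\<bar>)" for x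
    using exp_converges[of "\<rho> * \<bar>x\<bar>"] by (simp add: scaleR_conv_of_real divide_inverse mult.commute)
   have partial: "(\<Sum>i<n. norm (f i x)) <= G x" for n x
   proof -
    have "(\<Sum>i<n. norm (f i x)) = (\<Sum>i<n. (\<rho> * \<bar>x\<bar>) ^ i / fact i) * exp (Re z0 * x)"
     by (simp add: norm_f sum_distrib_right)
    also have "... <= exp (\<rho> * \<bar>x\<bar>) * exp (Re z0 * x)"
     using exp_sums[of x] \<rho>(1)
     by (intro mult_right_mono) (auto simp: sums_iff intro!: sum_le_suminf[of "%n. (\<rho> * \<bar>x\<bar>) ^ n / fact n" "{..<n}", THEN order_trans])
    finally show ?thesis using G_ge[of x] by linarith
   qed
   have single: "norm (f n x) <= G x" for n x
    using partial[of x "Suc n"] sum_nonneg[of "{..<n}" "%i. norm (f i x)"] by simp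
   have f_int: "integrable \<mu> (f n)" for n
   proof (rule Bochner_Integration.integrable_bound[OF G_int])
    have "0 <= G x" for x by (simp add: G_def add_nonneg_nonneg)
    then show "AE x in \<mu>. norm (f n x) <= norm (G x)" using single[of n] by simp
   qed simp
   have summ: "summable (%i. norm (f i x))" for x
    by (rule summableI_nonneg_bounded[OF _ partial]) auto
   have "summable (%i. LINT x|\<mu>. norm (f i x))"
   proof (rule summableI_nonneg_bounded)
    fix n
    have "(\<Sum>i<n. LINT x|\<mu>. norm (f i x)) = (LINT x|\<mu>. (\<Sum>i<n. norm (f i x)))"
     using f_int by (simp add: Bochner_Integration.integral_sum)
    also have "... <= (LINT x|\<mu>. G x)"
     using f_int by (intro integral_mono G_int) (auto intro: partial)
    finally show "(\<Sum>i<n. LINT x|\<mu>. norm (f i x)) <= (LINT x|\<mu>. G x)" .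
   qed auto
   then have "(%i. integral\<^sup>L \<mu> (f i)) sums (CLINT x|\<mu>. (\<Sum>i. f i x))"
    using f_int summ by (intro sums_integral) auto
   moreover have "(\<Sum>i. f i x) = exp (w * complex_of_real x)" for x
   proof -
    have "(%n. ((w - z0) * complex_of_real x) ^ n / fact n) sums exp ((w - z0) * complex_of_real x)"
     using exp_converges[of "(w - z0) * complex_of_real x"] by (simp add: scaleR_conv_of_real divide_inverse mult.commute)
    then have "(%n. f n x) sums (exp ((w - z0) * complex_of_real x) * exp (z0 * complex_of_real x))"
     unfolding f_def by (rule sums_mult2)
    then show ?thesis by (simp add: sums_iff exp_add [symmetric] algebra_simps)
   qed
   moreover have "integral\<^sup>L \<mu> (f i) = c i * (w - z0) ^ i" for i
   proof -
    have "integral\<^sup>L \<mu> (f i) = (CLINT x|\<mu>. (w - z0) ^ i * (complex_of_real x ^ i / fact i * exp (z0 * complex_of_real x)))"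
     unfolding f_def by (intro Bochner_Integration.integral_cong) (auto simp: power_mult_distrib mult_ac)
    also have "... = (w - z0) ^ i * c i" unfolding c_def by simp
    finally show ?thesis by (simp add: mult.commute)
   qed
   ultimately show "(%n. c n * (w - z0) ^ n) sums (CLINT x|\<mu>. exp (w * complex_of_real x))"
    by simp
  qed
  then show ?thesis using r by blast
 qed
 show ?thesis
  unfolding holomorphic_on_def
 proof
  fix z0 :: complex assume "z0 \<in> {z. \<bar>Re z\<bar> < a}"
  then obtain r where "r > 0" "(%z. CLINT x|\<mu>. exp (z * complex_of_real x)) holomorphic_on ball z0 r"
   using loc by auto
  then have "(%z. CLINT x|\<mu>. exp (z * complex_of_real x)) field_differentiable at z0"
   by (meson centre_in_ball holomorphic_on_imp_differentiable_at open_ball)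
  then show "(%z. CLINT x|\<mu>. exp (z * complex_of_real x)) field_differentiable at z0 within {z. \<bar>Re z\<bar> < a}"
   by (rule field_differentiable_at_within)
 qed
qed

text \<open>Equality on a real segment spreads to the strip by analytic continuation, in particular
  to the imaginary axis, where it equates characteristic functions. As
  \<open>Levy_uniqueness\<close> speaks of probability measures, both sides are divided by the
  common mass \<open>c\<close>; mass zero is a separate case.\<close>

lemma mgf_unique:
 fixes \<mu> \<nu> :: "real measure"
 assumes sets: "sets \<mu> = sets borel" "sets \<nu> = sets borel" and a: "a > 0"
  and int: "!!s. \<bar>s\<bar> < a ==> integrable \<mu> (%x. exp (s * x))" "!!s. \<bar>s\<bar> < a ==> integrable \<nu> (%x. exp (s * x))"
  and eq: "!!s. \<bar>s\<bar> < a ==> (LINT x|\<mu>. exp (s * x)) = (LINT x|\<nu>. exp (s * x))"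
 shows "\<mu> = \<nu>"
proof -
 define F where "F \<mu> z = (CLINT x|\<mu>. exp (z * complex_of_real x))" for \<mu> z
 have sp: "space \<mu> = UNIV" "space \<nu> = UNIV" using sets_eq_imp_space_eq[OF sets(1)] sets_eq_imp_space_eq[OF sets(2)] by simp_all
 have real_eq: "F \<mu> (complex_of_real s) = F \<nu> (complex_of_real s)" if "\<bar>s\<bar> < a" for s
 proof -
  have "F M (complex_of_real s) = complex_of_real (LINT x|M. exp (s * x))" for M :: "real measure"
   unfolding F_def by (subst integral_complex_of_real [symmetric]) (simp add: exp_of_real flip: of_real_mult)
  then show ?thesis using eq[OF that] by simp
 qed
 have strip: "F \<mu> z = F \<nu> z" if "\<bar>Re z\<bar> < a" for z
 proof -
  let ?S = "{z. \<bar>Re z\<bar> < a}"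
  have S: "?S = {z. - a < Re z} \<inter> {z. Re z < a}" by auto
  have "F \<mu> z - F \<nu> z = 0"
  proof (rule analytic_continuation[where f = "%z. F \<mu> z - F \<nu> z" and S = "?S" and U = "complex_of_real ` {-a<..<a}" and \<xi> = 0])
   show "(%z. F \<mu> z - F \<nu> z) holomorphic_on ?S"
    unfolding F_def by (intro holomorphic_on_diff mgf_holomorphic sets int)
   show "open ?S" unfolding S by (intro open_Int open_halfspace_Re_gt open_halfspace_Re_lt)
   show "connected ?S"
    unfolding S by (intro convex_connected convex_Int convex_halfspace_Re_gt convex_halfspace_Re_lt)
   show "complex_of_real ` {-a<..<a} \<subseteq> ?S" by auto
   show "0 \<in> ?S" using a by simp
   show "0 islimpt complex_of_real ` {-a<..<a}"
    unfolding islimpt_approachable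
   proof (intro allI impI)
    fix e :: real assume e: "e > 0"
    show "\<exists>x'\<in>complex_of_real ` {- a<..<a}. x' ~= 0 & dist x' 0 < e"
     using e a by (intro bexI[of _ "complex_of_real (min (a/2) (e/2))"]) (auto simp: min_def)
   qed
   show "!!z. z \<in> complex_of_real ` {- a<..<a} ==> F \<mu> z - F \<nu> z = 0" using real_eq by auto
   show "z \<in> ?S" using that by simp
  qed
  then show ?thesis by simp
 qed
 have ch: "(CLINT x|\<mu>. iexp (t * x)) = (CLINT x|\<nu>. iexp (t * x))" for t
  using strip[of "\<i> * complex_of_real t"] a by (simp add: F_def mult_ac)
 have fin: "finite_measure \<mu>" "finite_measure \<nu>"
  using int[of 0] a sp by (auto intro!: finite_measureI simp: integrable_iff_bounded ennreal_1)
 define c where "c = measure \<mu> UNIV"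
 have c': "measure \<nu> UNIV = c" using eq[of 0] a sp by (simp add: c_def)
 interpret m: finite_measure \<mu> by fact
 interpret n: finite_measure \<nu> by fact
 show ?thesis
 proof (cases "c = 0")
  case True
  have "emeasure \<mu> A = 0" "emeasure \<nu> A = 0" for A
   using m.bounded_measure[of A] n.bounded_measure[of A] sp c' True
   by (auto simp: c_def m.emeasure_eq_measure n.emeasure_eq_measure)
    (metis ennreal_0 measure_le_0_iff n.emeasure_eq_measure)+
  then show ?thesis by (intro measure_eqI) (auto simp: sets)
 next
  case False
  then have c: "c > 0" by (simp add: c_def less_le)
  define N where "N = (%\<mu> :: real measure. density \<mu> (%_. ennreal (1 / c)))"
  have rd: "real_distribution (N M)" if "finite_measure M" "sets M = sets borel" "measure M UNIV = c" for M
  proof -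
   have spM: "space M = UNIV" using sets_eq_imp_space_eq[OF that(2)] by simp
   have "emeasure M UNIV = ennreal c"
    using that finite_measure.emeasure_eq_measure[OF that(1)] by simp
   then have "emeasure (N M) (space (N M)) = 1"
    using c by (simp add: N_def emeasure_density_const spM sets.top[of M, unfolded spM] flip: ennreal_mult)
   then have "prob_space (N M)" by (rule prob_spaceI)
   then show ?thesis
    unfolding real_distribution_def real_distribution_axioms_def by (simp add: N_def that(2) )
  qed
  have int_scale: "(CLINT x|N M. g x) = complex_of_real (1/c) * (CLINT x|M. g x)" if [measurable_cong]: "sets M = sets borel" and [measurable]: "g \<in> borel_measurable borel" for M and g :: "real => complex"
   unfolding N_def using c by (subst integral_density) (auto simp: scaleR_conv_of_real)
  have "N \<mu> = N \<nu>"
  proof (rule Levy_uniqueness)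
   show "char (N \<mu>) = char (N \<nu>)"
    using ch by (auto simp: char_def int_scale sets fun_eq_iff)
  qed (use c' in \<open>auto intro!: rd fin sets simp: c_def\<close>)
  have "emeasure \<mu> A = emeasure \<nu> A" if A: "A \<in> sets borel" for A
  proof -
   have "ennreal (1/c) * emeasure \<mu> A = ennreal (1/c) * emeasure \<nu> A"
    using arg_cong[OF \<open>N \<mu> = N \<nu>\<close>, of "%M. emeasure M A"] A sets
    by (simp add: N_def emeasure_density_const)
   then show ?thesis using c by (simp add: ennreal_mult_cancel_left)
  qed
  then show ?thesis by (intro measure_eqI) (auto simp: sets)
 qed
qed

text \<open>Weighting by \<open>exp (- z * v)\<close> at the fixed point \<open>z = z0 + 1\<close>
  turns \<open>P\<close> and \<open>Q\<close> into densities of finite measures. Varying the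
  exponent by \<open>\<bar>s\<bar> < 1\<close> then gives their moment generating functions.\<close>

lemma bilateral_laplace_unique:
 fixes P Q :: "real => ennreal"
 assumes [measurable]: "P \<in> borel_measurable borel" "Q \<in> borel_measurable borel"
  and eq: "!!z. z > z0 ==> (\<L> v. nexp (- z * v) * P v) = (\<L> v. nexp (- z * v) * Q v)"
  and fin: "!!z. z > z0 ==> (\<L> v. nexp (- z * v) * Q v) < \<infinity>"
 shows "AE v in lborel. P v = Q v"
proof -
 define z where "z = z0 + 1"
 define m where "m = (%P. density lborel (%v. nexp (- z * v) * P v))"
 have nni: "(\<integral>\<^sup>+x. nexp (s * x) \<partial>m R) = (\<L> v. nexp (- (z - s) * v) * R v)"
  if [measurable]: "R \<in> borel_measurable borel" for R s
 proof -
  have "(\<integral>\<^sup>+x. nexp (s * x) \<partial>m R) = (\<L> v. nexp (- z * v) * R v * nexp (s * v))"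
   unfolding m_def by (subst nn_integral_density) auto
  also have "... = (\<L> v. nexp (- (z - s) * v) * R v)"
  proof (rule nn_integral_cong)
   fix v
   have "nexp (- (z - s) * v) = nexp (- z * v) * nexp (s * v)"
    by (simp add: exp_add[symmetric] algebra_simps flip: ennreal_mult)
   then show "nexp (- z * v) * R v * nexp (s * v) = nexp (- (z - s) * v) * R v"
    by (simp add: mult_ac)
  qed
  finally show ?thesis .
 qed
 have "m P = m Q"
 proof (rule mgf_unique[where a = 1])
  fix s :: real assume s: "\<bar>s\<bar> < 1"
  have e: "(\<integral>\<^sup>+x. nexp (s * x) \<partial>m P) = (\<integral>\<^sup>+x. nexp (s * x) \<partial>m Q)"
   using eq[of "z - s"] s by (simp add: nni z_def)
  moreover have fQ: "(\<integral>\<^sup>+x. nexp (s * x) \<partial>m Q) < \<infinity>"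
   using fin[of "z - s"] s by (simp add: nni z_def)
  ultimately show "integrable (m P) (%x. exp (s * x))" "integrable (m Q) (%x. exp (s * x))"
   by (auto simp: integrable_iff_bounded m_def)
  show "(LINT x|m P. exp (s * x)) = (LINT x|m Q. exp (s * x))"
   using e by (subst (1 2) integral_eq_nn_integral) (auto simp: m_def)
 qed (auto simp: m_def)
 then have "AE v in lborel. nexp (- z * v) * P v = nexp (- z * v) * Q v"
  unfolding m_def by (intro sigma_finite_measure.density_unique sigma_finite_lborel) auto
 then show ?thesis by eventually_elim (simp add: ennreal_mult_cancel_left)
qed

text \<open>Every interval to the right of \<open>v\<close> has positive measure, so points of
  equality accumulate at \<open>v\<close> from the right. Convergence is asked only along sequences
  in \<open>(v, v + 1]\<close>, which leaves room for a dominating function.\<close>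

lemma AE_eq_right_limit:
 fixes P Q :: "real => 'b::t2_space"
 assumes ae: "AE v in lborel. P v = Q v"
  and P: "!!u. (!!n. v < u n) ==> (!!n. u n <= v + 1) ==> u ----> v ==> (%n. P (u n)) ----> P v"
  and Q: "!!u. (!!n. v < u n) ==> (!!n. u n <= v + 1) ==> u ----> v ==> (%n. Q (u n)) ----> Q v"
 shows "P v = Q v"
proof -
 have "EX x. v < x & x < v + e & P x = Q x" if e: "e > 0" for e :: real
 proof (rule ccontr)
  assume none: "~ ?thesis"
  obtain N where N: "N \<in> null_sets lborel" "{x. P x ~= Q x} \<subseteq> N"
   using ae by (auto simp: eventually_ae_filter)
  have "{v<..<v+e} \<subseteq> N" using none N(2) by auto
  then have "emeasure lborel {v<..<v+e} <= emeasure lborel N"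
   using N(1) by (intro emeasure_mono) auto
  then show False using N(1) e by (auto simp: null_sets_def)
 qed
 then have "ALL n. EX x. v < x & x < v + 1 / real (Suc n) & P x = Q x" by simp
 then obtain u where u: "!!n. v < u n" "!!n. u n < v + 1 / real (Suc n)" "!!n. P (u n) = Q (u n)"
  by metis
 have le: "u n <= v + 1" for n
  using u(2)[of n] by (smt (verit) divide_le_eq_1_pos of_nat_0_less_iff of_nat_1 of_nat_le_iff Suc_le_mono le0 One_nat_def zero_less_Suc)
 have lim: "u ----> v"
 proof (rule tendsto_sandwich)
  show "(%n. v) ----> v" by simp
  show "(%n. v + 1 / real (Suc n)) ----> v" by real_asymp
 qed (use u(1,2) in \<open>auto intro!: always_eventually less_imp_le\<close>)
 show ?thesis
  using P[OF u(1) le lim] Q[OF u(1) le lim] u(3) LIMSEQ_unique by (metis (no_types, lifting) ext)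
qed

text \<open>A right-continuous process is the pointwise limit of its values on a grid just to the right.\<close>
lemma right_continuous_joint_measurable:
 fixes X :: "real => 'a => real"
 assumes meas: "!!t. 0 <= t ==> X t \<in> borel_measurable M"
  and right: "!!t w. 0 <= t ==> ((%s. X s w) \<longlongrightarrow> X t w) (at_right t)"
 shows "(%p. X (max 0 (fst p)) (snd p)) \<in> borel_measurable (borel \<Otimes>\<^sub>M M)"
proof (rule borel_measurable_LIMSEQ_metric[where
   f = "%n p. X (max 0 ((real_of_int \<lfloor>max 0 (fst p) * real (Suc n)\<rfloor> + 1) / real (Suc n))) (snd p)"])
 fix n
 show "(%p. X (max 0 ((real_of_int \<lfloor>max 0 (fst p) * real (Suc n)\<rfloor> + 1) / real (Suc n))) (snd p))
  \<in> borel_measurable (borel \<Otimes>\<^sub>M M)"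
 proof (rule measurable_compose_countable[where
    f = "%i p. X (max 0 ((real_of_int i + 1) / real (Suc n))) (snd p)"])
  fix i :: int
  show "(%p. X (max 0 ((real_of_int i + 1) / real (Suc n))) (snd p)) \<in> borel_measurable (borel \<Otimes>\<^sub>M M)"
   using meas[of "max 0 ((real_of_int i + 1) / real (Suc n))"] by (intro measurable_compose[OF measurable_snd]) auto
 qed measurable
next
 fix p :: "real \<times> 'a"
 define t where "t = max 0 (fst p)"
 define d where "d n = (real_of_int \<lfloor>t * real (Suc n)\<rfloor> + 1) / real (Suc n)" for n
 have t: "0 <= t" by (simp add: t_def)
 have d_gt: "t < d n" and d_le: "d n <= t + 1 / real (Suc n)" for n
 proof -
  have fl: "real_of_int \<lfloor>t * real (Suc n)\<rfloor> <= t * real (Suc n)" "t * real (Suc n) < real_of_int \<lfloor>t * real (Suc n)\<rfloor> + 1"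
   by linarith+
  show "t < d n" using fl(2) unfolding d_def by (subst pos_less_divide_eq) auto
  have "t + 1 / real (Suc n) = (t * real (Suc n) + 1) / real (Suc n)" by (simp add: add_divide_distrib del: of_nat_Suc)
  then show "d n <= t + 1 / real (Suc n)" using fl(1) unfolding d_def by (simp add: divide_right_mono del: of_nat_Suc)
 qed
 have "d ----> t"
 proof (rule tendsto_sandwich)
  show "(%n. t) ----> t" by simp
  show "(%n. t + 1 / real (Suc n)) ----> t" by real_asymp
 qed (use d_gt d_le in \<open>auto intro!: always_eventually less_imp_le\<close>)
 then have "filterlim d (at_right t) sequentially"
  using d_gt by (auto simp: filterlim_at intro!: always_eventually)
 then have "(%n. X (d n) (snd p)) ----> X t (snd p)"
  using right[OF t] by (rule filterlim_compose[rotated])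
 moreover have "max 0 (d n) = d n" for n using t d_gt[of n] by simp
 ultimately show "(%n. X (max 0 ((real_of_int \<lfloor>max 0 (fst p) * real (Suc n)\<rfloor> + 1) / real (Suc n))) (snd p))
   ----> X (max 0 (fst p)) (snd p)"
  by (simp add: d_def t_def)
qed

lemma right_continuous_borel_measurable:
 fixes f :: "real => real"
 assumes "!!t. 0 <= t ==> (f \<longlongrightarrow> f t) (at_right t)"
 shows "(%t. f (max 0 t)) \<in> borel_measurable borel"
proof -
 have "(%p :: real \<times> unit. f (max 0 (fst p))) \<in> borel_measurable (borel \<Otimes>\<^sub>M count_space UNIV)"
  using right_continuous_joint_measurable[of "%t _. f t" "count_space (UNIV :: unit set)"] assms by simp
 from measurable_compose[OF measurable_Pair2'[of "()" "count_space UNIV"] this]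
 show ?thesis by simp
qed

section \<open>Laplace exponent, its right inverse, and small-time tails\<close>

locale exp_process = prob_space M for M :: "'a measure" +
 fixes X :: "real => 'a => real" and \<psi> :: "real => real"
 assumes X_measurable: "!!t. 0 <= t ==> X t \<in> borel_measurable M"
  and X_right: "!!t w. 0 <= t ==> ((%s. X s w) \<longlongrightarrow> X t w) (at_right t)"
  and X_zero: "!!w. X 0 w = 0"
  and mgf_integrable: "!!t z. 0 <= t ==> 0 <= z ==> integrable M (%w. exp (z * X t w))"
  and mgf: "!!t z. 0 <= t ==> 0 <= z ==> (LINT w|M. exp (z * X t w)) = exp (t * \<psi> z)"
  and \<psi>_quadratic: "EX C. ALL z>=0. \<psi> z <= C * (1 + z\<^sup>2)"
  and \<psi>_somewhere_pos: "EX z>0. 0 < \<psi> z"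
begin

lemma nn_mgf:
 assumes "0 <= t" "0 <= z"
 shows "(\<E> w. nexp (z * X t w)) = nexp (t * \<psi> z)"
 using nn_integral_eq_integral[OF mgf_integrable[OF assms]] mgf[OF assms] by simp

lemma \<psi>_zero: "\<psi> 0 = 0"
 using mgf[of 1 0] prob_space by simp

text \<open>Hoelder's inequality: each exponential is divided by its mean, convexity of
  \<open>exp\<close> is applied pointwise, and the right-hand side then integrates to 1.\<close>

lemma \<psi>_convex:
 assumes "0 <= a" "0 <= b" "0 <= u" "u <= 1"
 shows "\<psi> (u * a + (1 - u) * b) <= u * \<psi> a + (1 - u) * \<psi> b"
proof -
 define c where "c = u * a + (1 - u) * b"
 have c: "0 <= c" using assms by (simp add: c_def)
 have conv: "exp (u * s + (1 - u) * t) <= u * exp s + (1 - u) * exp t" for s t :: real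
 proof -
  have "convex_on UNIV (exp :: real => real)" by (rule exp_convex)
  from convex_onD[OF this, of "1 - u" s t] show ?thesis using assms by simp
 qed
 have pt: "exp (- (u * \<psi> a + (1 - u) * \<psi> b)) * exp (c * X 1 w)
   <= u * (exp (- \<psi> a) * exp (a * X 1 w)) + (1 - u) * (exp (- \<psi> b) * exp (b * X 1 w))" for w
  using conv[of "a * X 1 w - \<psi> a" "b * X 1 w - \<psi> b"]
  by (simp add: c_def exp_add [symmetric] algebra_simps flip: exp_diff exp_minus)
 have "(LINT w|M. exp (- (u * \<psi> a + (1 - u) * \<psi> b)) * exp (c * X 1 w))
   <= (LINT w|M. u * (exp (- \<psi> a) * exp (a * X 1 w)) + (1 - u) * (exp (- \<psi> b) * exp (b * X 1 w)))"
  using pt by (intro integral_mono Bochner_Integration.integrable_add integrable_mult_right mgf_integrable c assms) auto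
 also have "... = 1"
  using assms by (subst Bochner_Integration.integral_add)
   (auto intro!: integrable_mult_right mgf_integrable simp: mgf exp_minus)
 finally have "exp (- (u * \<psi> a + (1 - u) * \<psi> b) + \<psi> c) <= 1"
  using c by (simp add: mgf exp_add)
 then show ?thesis unfolding c_def by simp
qed

lemma \<psi>_star:
 assumes "0 < a" "a <= b"
 shows "\<psi> a <= a / b * \<psi> b"
 using \<psi>_convex[of b 0 "a / b"] assms \<psi>_zero by simp

lemma \<psi>_ratio_mono:
 assumes "0 < a" "a <= b"
 shows "\<psi> a / a <= \<psi> b / b"
 using \<psi>_star[OF assms] assms by (simp add: field_simps)

lemma \<psi>_continuous_on: "continuous_on {0<..} \<psi>"
proof (rule convex_on_continuous)
 show "convex_on {0<..} \<psi>"
  unfolding convex_on_def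
 proof (intro conjI ballI allI impI)
  fix x y u v :: real assume h: "x \<in> {0<..}" "y \<in> {0<..}" "0 <= u" "0 <= v" "u + v = 1"
  then have v: "v = 1 - u" by simp
  show "\<psi> (u *\<^sub>R x + v *\<^sub>R y) <= u * \<psi> x + v * \<psi> y"
   using \<psi>_convex[of x y u] h unfolding v by simp
 qed simp
qed simp

definition root :: "real => real" where
 "root q = Sup {z. 0 <= z & \<psi> z = q}"

text \<open>Convexity gives continuity on the open half-line only, so the intermediate value theorem
  needs a positive left end. Chords through the origin supply both ends: going out along one reaches
  \<open>z2\<close> with value at least \<open>q\<close>, going back along the next reaches
  \<open>z3\<close> with value at most \<open>q\<close>.\<close>

lemma root_exists:
 assumes q: "0 < q"
 shows "EX z>0. \<psi> z = q"
proof -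
 obtain z1 where z1: "z1 > 0" "\<psi> z1 > 0" using \<psi>_somewhere_pos by auto
 define z2 where "z2 = z1 * max 1 (q / \<psi> z1)"
 have z2: "z1 <= z2" using z1 by (simp add: z2_def)
 then have z2_pos: "0 < z2" using z1 by simp
 have "max 1 (q / \<psi> z1) * \<psi> z1 <= \<psi> z2"
  using \<psi>_star[OF z1(1) z2] z1 by (simp add: z2_def field_simps)
 moreover have "q <= max 1 (q / \<psi> z1) * \<psi> z1"
  using mult_right_mono[of "q / \<psi> z1" "max 1 (q / \<psi> z1)" "\<psi> z1"] z1 by simp
 ultimately have q2: "q <= \<psi> z2" by linarith
 define z3 where "z3 = z2 * (q / \<psi> z2)"
 have z3: "0 < z3" "z3 <= z2" using z2_pos q q2 by (simp_all add: z3_def field_simps)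
 have "\<psi> z3 <= z3 / z2 * \<psi> z2" by (rule \<psi>_star[OF z3])
 also have "... = q" using z2_pos q q2 by (simp add: z3_def)
 finally have "\<psi> z3 <= q" .
 moreover have "continuous_on {z3..z2} \<psi>"
  using z3 by (intro continuous_on_subset[OF \<psi>_continuous_on]) auto
 ultimately obtain x where "z3 <= x" "x <= z2" "\<psi> x = q"
  using IVT'[of \<psi> z3 q z2] q2 z3 by auto
 then show ?thesis using z3 by (intro exI[of _ x]) auto
qed

lemma root_unique:
 assumes q: "0 < q" and z: "0 < z" "\<psi> z = q"
 shows "root q = z"
proof -
 have "\<eta> = z" if "0 <= \<eta>" "\<psi> \<eta> = q" for \<eta>
 proof (rule ccontr)
  assume ne: "\<eta> ~= z"
  have "\<eta> ~= 0" using that q \<psi>_zero by auto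
  then have "0 < \<eta>" using that by simp
  then consider "\<eta> < z" | "z < \<eta>" using ne by linarith
  then show False
  proof cases
   case 1 then show False using \<psi>_star[of \<eta> z] \<open>0 < \<eta>\<close> z that q by (simp add: field_simps)
  next
   case 2 then show False using \<psi>_star[of z \<eta>] \<open>0 < \<eta>\<close> z that q by (simp add: field_simps)
  qed
 qed
 then have "{z. 0 <= z & \<psi> z = q} = {z}" using z by auto
 then show ?thesis by (simp add: root_def)
qed

lemma
 assumes q: "0 < q"
 shows root_pos: "0 < root q" and \<psi>_root: "\<psi> (root q) = q"
 using root_exists[OF q] root_unique[OF q] by auto

text \<open>The chord through the origin, continued past \<open>root q\<close>. This linear lower
  bound controls the pole of \<open>1 / (\<psi> z - q)\<close> at \<open>root q\<close>, and the
  growth constant \<open>root q / q\<close> of the scale function stems from it.\<close>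

lemma \<psi>_slope:
 assumes q: "0 < q" and "root q <= z"
 shows "q / root q * (z - root q) <= \<psi> z - q"
 using \<psi>_star[OF root_pos[OF q] assms(2)] root_pos[OF q] \<psi>_root[OF q] assms by (simp add: field_simps)

lemma \<psi>_gt_root:
 assumes q: "0 < q" and "root q < z"
 shows "q < \<psi> z"
proof -
 have "0 < q / root q * (z - root q)" using assms root_pos[OF q] by simp
 then show ?thesis using \<psi>_slope[OF q] assms by (smt (verit))
qed

lemma \<psi>_lt_root:
 assumes q: "0 < q" and "0 < z" "z < root q"
 shows "\<psi> z < q"
proof -
 have "\<psi> z <= z / root q * q" using \<psi>_star[of z "root q"] \<psi>_root[OF q] assms by simp
 also have "... < 1 * q" using assms root_pos[OF q] by (intro mult_strict_right_mono) auto
 finally show ?thesis by simp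
qed

lemma root_mono:
 assumes "0 < p" "p <= q"
 shows "root p <= root q"
 using \<psi>_lt_root[of p] \<psi>_gt_root[of p "root q"] \<psi>_root[of p] \<psi>_root[of q] \<psi>_gt_root[of q "root p"] assms
 by (smt (verit))

text \<open>Chernoff bound with exponent \<open>1 / sqrt h\<close>; the quadratic growth of \<open>\<psi>\<close> keeps \<open>h * \<psi> (k + 1 / sqrt h)\<close> bounded.\<close>
lemma exp_tail_small:
 assumes k: "0 <= k" and \<eta>: "0 < \<eta>" and e: "0 < e"
 shows "\<forall>\<^sub>F h in at_right 0. (\<E> w. nexp (k * X h w) * ind {\<eta><..} (X h w)) <= ennreal (e * h)"
proof -
 obtain C where C: "!!z. z >= 0 ==> \<psi> z <= C * (1 + z\<^sup>2)" using \<psi>_quadratic by auto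
 define D where "D = max C 0"
 have D: "\<psi> z <= D * (1 + z\<^sup>2)" if "z >= 0" for z
  using C[OF that] mult_right_mono[of C D "1 + z\<^sup>2"] by (simp add: D_def)
 have D0: "D >= 0" by (simp add: D_def)
 have bound: "(\<E> w. nexp (k * X h w) * ind {\<eta><..} (X h w))
   <= nexp (- \<eta> / sqrt h + h * (D * (1 + (k + 1 / sqrt h)\<^sup>2)))" if h: "0 < h" for h
 proof -
  define \<mu> where "\<mu> = 1 / sqrt h"
  have \<mu>: "\<mu> > 0" using h by (simp add: \<mu>_def)
  have [measurable]: "X h \<in> borel_measurable M" using h X_measurable by simp
  have "(\<E> w. nexp (k * X h w) * ind {\<eta><..} (X h w))
    <= (\<E> w. nexp (- \<mu> * \<eta>) * nexp ((k + \<mu>) * X h w))"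
  proof (rule nn_integral_mono)
   fix w
   show "nexp (k * X h w) * ind {\<eta><..} (X h w) <= nexp (- \<mu> * \<eta>) * nexp ((k + \<mu>) * X h w)"
    using \<mu> by (auto simp: indicator_def simp flip: ennreal_mult exp_add intro!: ennreal_leI simp: algebra_simps)
  qed
  also have "... = nexp (- \<mu> * \<eta>) * nexp (h * \<psi> (k + \<mu>))"
   using h k \<mu> by (subst nn_integral_cmult) (auto simp: nn_mgf)
  also have "... = nexp (- \<mu> * \<eta> + h * \<psi> (k + \<mu>))" by (simp flip: ennreal_mult exp_add)
  also have "... <= nexp (- \<mu> * \<eta> + h * (D * (1 + (k + \<mu>)\<^sup>2)))"
   using h k \<mu> by (intro ennreal_leI) (auto intro!: mult_left_mono D)
  finally show ?thesis by (simp add: \<mu>_def)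
 qed
 have "((%h. exp (- \<eta> / sqrt h + h * (D * (1 + (k + 1 / sqrt h)\<^sup>2))) / h) \<longlongrightarrow> 0) (at_right 0)"
  using \<eta> D0 k by real_asymp
 then have "\<forall>\<^sub>F h in at_right 0. exp (- \<eta> / sqrt h + h * (D * (1 + (k + 1 / sqrt h)\<^sup>2))) / h < e"
  using e by (rule order_tendstoD)
 moreover have "\<forall>\<^sub>F h :: real in at_right 0. 0 < h" by (rule eventually_at_right_less)
 ultimately show ?thesis
 proof eventually_elim
  case (elim h)
  then have "exp (- \<eta> / sqrt h + h * (D * (1 + (k + 1 / sqrt h)\<^sup>2))) <= e * h" by (simp add: field_simps)
  then show ?case using bound[OF elim(2)] by (meson ennreal_leI order_trans)
 qed
qed

lemma small_time_lower_tail: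
 assumes "0 < \<eta>"
 shows "((%h. measure M {u\<in>space M. X h u < - \<eta>}) \<longlongrightarrow> 0) (at_right 0)"
proof (rule tendsto_at_right_sequentially[of 0 1])
 fix S :: "nat => real" assume S: "!!n. 0 < S n" "S ----> 0"
 have [measurable]: "X (S n) \<in> borel_measurable M" for n using X_measurable S(1)[of n] by simp
 have lim: "(%n. ind {..<-\<eta>} (X (S n) u) :: real) ----> 0" for u
 proof -
  have "filterlim S (at_right 0) sequentially" using S by (auto simp: filterlim_at less_imp_neq[OF S(1), symmetric] intro!: always_eventually)
  then have "(%n. X (S n) u) ----> 0"
   using X_right[of 0 u] X_zero by (auto intro: filterlim_compose)
  then have "EV n. - \<eta> < X (S n) u" using assms by (intro order_tendstoD) auto
  then show ?thesis
   by (intro tendsto_eventually) (auto elim!: eventually_mono)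
 qed
 have "(%n. LINT u|M. ind {..<-\<eta>} (X (S n) u) :: real) ----> (LINT u|M. 0)"
 proof (rule integral_dominated_convergence[where w = "%_. 1"])
  show "AE u in M. (%n. ind {..<-\<eta>} (X (S n) u) :: real) ----> 0"
   using lim by (intro AE_I2)
 qed (auto simp: indicator_def)
 moreover have "(LINT u|M. ind {..<-\<eta>} (X (S n) u) :: real) = measure M {u\<in>space M. X (S n) u < - \<eta>}" for n
 proof -
  have "(LINT u|M. ind {..<-\<eta>} (X (S n) u) :: real) = (LINT u|M. ind {u\<in>space M. X (S n) u < - \<eta>} u)"
   by (intro Bochner_Integration.integral_cong) (auto simp: indicator_def)
  then show ?thesis by simp
 qed
 ultimately show "(%n. measure M {u\<in>space M. X (S n) u < - \<eta>}) ----> 0" by simp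
qed simp

end

section \<open>Convolution with a scale function\<close>

lemma nn_exp_tail:
 fixes z a :: real
 assumes "0 < z"
 shows "(\<L> x. nexp (- z * x) * ind {a..} x) = ennreal (exp (- z * a) / z)"
proof -
 have "(\<L> x. nexp (- z * x) * ind {a..} x) = ennreal (0 - (- exp (- z * a) / z))"
 proof (rule nn_integral_FTC_atLeast)
  show "DERIV (%x. - exp (- z * x) / z) x :> exp (- z * x)" for x
   using assms by (auto intro!: derivative_eq_intros)
  show "((%x. - exp (- z * x) / z) \<longlongrightarrow> 0) at_top" using assms by real_asymp
 qed auto
 then show ?thesis by simp
qed

lemma set_integral_exp_neg:
 fixes z :: real
 assumes "0 < z"
 shows "set_integrable lborel {0..} (%x. exp (- z * x))" "(LBINT x:{0..}. exp (- z * x)) = 1 / z"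
proof -
 have nn: "(\<L> x. ennreal (ind {0..} x *\<^sub>R exp (- z * x))) = ennreal (1 / z)"
  using nn_exp_tail[OF assms, of 0] by (simp add: ennreal_mult' ennreal_indicator mult.commute)
 then show "set_integrable lborel {0..} (%x. exp (- z * x))"
  unfolding set_integrable_def by (intro integrableI_nonneg) (auto simp: indicator_def)
 show "(LBINT x:{0..}. exp (- z * x)) = 1 / z"
  unfolding set_lebesgue_integral_def using nn assms
  by (subst integral_eq_nn_integral) (auto simp: indicator_def)
qed

locale scale_process = exp_process +
 fixes q :: real and W :: "real => real"
 assumes q_pos: "0 < q"
  and W_neg: "!!x. x < 0 ==> W x = 0"
  and W_cont: "continuous_on {0..} W"
  and W_strict: "strict_mono_on {0..} W"
  and W_integrable: "!!z. root q < z ==> set_integrable lborel {0..} (%x. exp (- z * x) * W x)"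
  and W_laplace: "!!z. root q < z ==> (LBINT x:{0..}. exp (- z * x) * W x) = 1 / (\<psi> z - q)"
begin

text \<open>The sign of \<open>W\<close> has to be read off from its transform. If
  \<open>W 0 < 0\<close>, then \<open>W\<close> stays below \<open>- m\<close> on some
  \<open>[0, d)\<close>. For large \<open>z\<close> the transform is at most \<open>- m / z\<close>
  plus a remainder of order \<open>exp (- (z - z1) * d)\<close>, hence negative, whereas it equals
  \<open>1 / (\<psi> z - q)\<close>.\<close>

lemma W_zero_nonneg: "0 <= W 0"
proof (rule ccontr)
 assume neg: "~ 0 <= W 0"
 define m where "m = - W 0 / 2"
 have m: "0 < m" using neg by (simp add: m_def)
 have "EX d>0. \<forall>x\<in>{0..}. dist x 0 < d --> dist (W x) (W 0) < m"
  using W_cont m unfolding continuous_on_iff by (metis atLeast_iff order_refl)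
 then obtain d where d: "d > 0" "!!x. 0 <= x ==> x < d ==> W x <= - m"
  by (force simp: dist_real_def m_def)
 define z1 where "z1 = root q + 1"
 have z1: "root q < z1" "0 < z1" using root_pos[OF q_pos] by (auto simp: z1_def)
 note exp_int = set_integral_exp_neg
 define K where "K = (LBINT x:{0..}. exp (- z1 * x) * (\<bar>W x\<bar> + m))"
 have K_int: "set_integrable lborel {0..} (%x. exp (- z1 * x) * (\<bar>W x\<bar> + m))"
 proof -
  have "set_integrable lborel {0..} (%x. \<bar>exp (- z1 * x) * W x\<bar> + m * exp (- z1 * x))"
   using set_integrable_abs[OF W_integrable[OF z1(1)]] exp_int[OF z1(2)] by (intro set_integral_add set_integrable_mult_right)
  then show ?thesis by (simp add: abs_mult algebra_simps)
 qed
 have positive: "0 < - m / z + exp (- (z - z1) * d) * K" if z: "z >= z1" for z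
 proof -
  have z': "root q < z" "0 < z" using z z1 by auto
  have pt: "exp (- z * x) * W x <= - m * exp (- z * x) + exp (- (z - z1) * d) * (exp (- z1 * x) * (\<bar>W x\<bar> + m))" if x: "0 <= x" for x
  proof (cases "x < d")
   case True
   have "exp (- z * x) * W x <= exp (- z * x) * (- m)" using d(2)[OF x True] by (intro mult_left_mono) auto
   moreover have "0 <= exp (- (z - z1) * d) * (exp (- z1 * x) * (\<bar>W x\<bar> + m))" using m by simp
   ultimately show ?thesis by (simp add: mult.commute)
  next
   case False
   have "exp (- z * x) * (W x + m) <= exp (- z * x) * (\<bar>W x\<bar> + m)" by (intro mult_left_mono) auto
   also have "... = exp (- (z - z1) * x) * (exp (- z1 * x) * (\<bar>W x\<bar> + m))"
   proof -
    have "exp (- z * x) = exp (- (z - z1) * x) * exp (- z1 * x)" by (simp add: exp_add [symmetric] algebra_simps)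
    then show ?thesis by simp
   qed
   also have "... <= exp (- (z - z1) * d) * (exp (- z1 * x) * (\<bar>W x\<bar> + m))"
   proof (rule mult_right_mono)
    show "exp (- (z - z1) * x) <= exp (- (z - z1) * d)"
     using mult_left_mono[of d x "z - z1"] False z by (simp add: algebra_simps)
   qed (use m in simp)
   finally show ?thesis by (simp add: algebra_simps)
  qed
  have "0 < 1 / (\<psi> z - q)" using \<psi>_gt_root[OF q_pos z'(1)] by simp
  also have "... = (LBINT x:{0..}. exp (- z * x) * W x)" using W_laplace[OF z'(1)] by simp
  also have "... <= (LBINT x:{0..}. - m * exp (- z * x) + exp (- (z - z1) * d) * (exp (- z1 * x) * (\<bar>W x\<bar> + m)))"
   using pt by (intro set_integral_mono W_integrable z' set_integral_add set_integrable_mult_right exp_int K_int) auto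
  also have "... = (LBINT x:{0..}. - m * exp (- z * x)) + (LBINT x:{0..}. exp (- (z - z1) * d) * (exp (- z1 * x) * (\<bar>W x\<bar> + m)))"
   by (intro set_integral_add(2) set_integrable_mult_right impI exp_int z' K_int)
  also have "... = - m * (LBINT x:{0..}. exp (- z * x)) + exp (- (z - z1) * d) * K"
   unfolding K_def by (simp only: set_integral_mult_right)
  also have "... = - m / z + exp (- (z - z1) * d) * K"
   by (simp only: exp_int(2)[OF z'(2)]) simp
  finally show ?thesis .
 qed
 have "\<forall>\<^sub>F z in at_top. m < z * (exp (- (z - z1) * d) * K)"
  using eventually_ge_at_top[of z1] eventually_gt_at_top[of 0]
 proof eventually_elim
  case (elim z)
  then have "m / z < exp (- (z - z1) * d) * K" using positive[of z] by simp
  then show ?case using elim(2) by (simp add: pos_divide_less_eq mult.commute)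
 qed
 moreover have "((%z. z * (exp (- (z - z1) * d) * K)) \<longlongrightarrow> 0) at_top" using d(1) by real_asymp
 then have "\<forall>\<^sub>F z in at_top. z * (exp (- (z - z1) * d) * K) < m" using m by (rule order_tendstoD)
 ultimately have "\<forall>\<^sub>F z :: real in at_top. False" by eventually_elim simp
 then show False by simp
qed

lemma W_strict_less: "0 <= x ==> x < y ==> W x < W y"
 using W_strict by (auto simp: strict_mono_on_def)

lemma W_mono: "x <= y ==> W x <= W y"
 using W_strict_less[of x y] W_strict_less[of 0 y] W_neg[of x] W_neg[of y] W_zero_nonneg
 by (cases "x = y"; cases "x < 0"; cases "y <= 0") (auto simp: not_less le_less)

lemma W_nonneg: "0 <= W x"
 using W_mono[of 0 x] W_neg[of x] W_zero_nonneg by (cases "x < 0") auto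

lemma W_pos: "0 < x ==> 0 < W x"
 using W_strict_less[of 0 x] W_zero_nonneg by simp

lemma W_borel [measurable]: "W \<in> borel_measurable borel"
 by (rule borel_measurable_mono) (auto intro: monoI W_mono)

lemma W_right: "(W \<longlongrightarrow> W x) (at_right x)"
proof (cases "x < 0")
 case True
 then have "\<forall>\<^sub>F y in at_right x. y < 0" by (simp add: eventually_at_right_less order_tendstoD(2)[OF tendsto_ident_at])
 then have "\<forall>\<^sub>F y in at_right x. W y = W x" by eventually_elim (use True W_neg in auto)
 then show ?thesis by (rule tendsto_eventually)
next
 case False
 then have "(W \<longlongrightarrow> W x) (at x within {0..})" using W_cont by (auto simp: continuous_on_def)
 then show ?thesis by (rule tendsto_mono[rotated]) (use False in \<open>auto intro!: at_le\<close>)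
qed

lemma W_laplace_nn:
 assumes "root q < z"
 shows "(\<L> x. ennreal (exp (- z * x) * W x)) = ennreal (1 / (\<psi> z - q))"
proof -
 have eq: "ind {0..} x *\<^sub>R (exp (- z * x) * W x) = exp (- z * x) * W x" for x
  using W_neg[of x] by (auto simp: indicator_def)
 have "integrable lborel (%x. exp (- z * x) * W x)" "(LINT x|lborel. exp (- z * x) * W x) = 1 / (\<psi> z - q)"
  using W_integrable[OF assms] W_laplace[OF assms] unfolding set_integrable_def set_lebesgue_integral_def eq by auto
 then show ?thesis using nn_integral_eq_integral[of lborel "%x. exp (- z * x) * W x"] W_nonneg by simp
qed

text \<open>By monotonicity, \<open>W x\<close> times the integral of \<open>exp (- z * y)\<close>
  over \<open>y \<ge> x\<close> is at most the whole transform.\<close>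

lemma W_bound:
 assumes "root q < z"
 shows "W x <= z / (\<psi> z - q) * exp (z * x)"
proof -
 have z: "0 < z" "0 < \<psi> z - q" using assms root_pos[OF q_pos] \<psi>_gt_root[OF q_pos assms] by auto
 have "ennreal (W x * (exp (- z * x) / z)) = ennreal (W x) * (\<L> y. nexp (- z * y) * ind {x..} y)"
  unfolding nn_exp_tail[OF z(1)] by (rule ennreal_mult) (use W_nonneg z in auto)
 also have "... = (\<L> y. ennreal (W x) * (nexp (- z * y) * ind {x..} y))"
  by (simp add: nn_integral_cmult)
 also have "... <= (\<L> y. ennreal (exp (- z * y) * W y))"
  using W_mono[of x] W_nonneg by (intro nn_integral_mono)
   (auto simp: indicator_def mult.commute simp flip: ennreal_mult intro!: ennreal_leI mult_left_mono)
 also have "... = ennreal (1 / (\<psi> z - q))" by (rule W_laplace_nn[OF assms])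
 finally have "W x * (exp (- z * x) / z) <= 1 / (\<psi> z - q)" using z by (simp add: ennreal_le_iff)
 then have "W x * exp (- z * x) <= z / (\<psi> z - q)" using z by (simp add: field_simps)
 then have "W x * exp (- z * x) * exp (z * x) <= z / (\<psi> z - q) * exp (z * x)" by (intro mult_right_mono) auto
 then show ?thesis by (simp add: mult.assoc exp_add [symmetric])
qed

text \<open>Transforms are divided by \<open>\<psi> z - q\<close>, so \<open>cv f\<close> plays the
  role of a solution \<open>g\<close> of \<open>A g - q * g = f\<close>, with \<open>A\<close> the
  generator of the process. Extended values postpone all questions of integrability.\<close>

definition cv :: "(real => real) => real => ennreal" where
 "cv f x = (\<L> y. ennreal (W (x - y) * f y))"

lemma cv_measurable [measurable]:
 assumes [measurable]: "f \<in> borel_measurable borel"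
 shows "cv f \<in> borel_measurable borel"
 unfolding cv_def by measurable

lemma cv_flip:
 assumes [measurable]: "f \<in> borel_measurable borel"
 shows "cv f x = (\<L> z. ennreal (W z * f (x - z)))"
 unfolding cv_def by (subst nn_integral_real_affine[where c = "-1" and t = x]) auto

lemma cv_laplace:
 assumes [measurable]: "f \<in> borel_measurable borel" and f: "!!x. 0 <= f x" and "root q < z"
 shows "(\<L> v. nexp (- z * v) * cv f v)
  = ennreal (1 / (\<psi> z - q)) * (\<L> y. ennreal (exp (- z * y) * f y))"
proof -
 have "(\<L> v. nexp (- z * v) * cv f v)
   = (\<L> v. (\<L> y. ennreal (exp (- z * v) * W (v - y) * f y)))"
  unfolding cv_def using f W_nonneg
  by (intro nn_integral_cong) (auto simp: nn_integral_cmult [symmetric] mult.assoc simp flip: ennreal_mult)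
 also have "... = (\<L> y. (\<L> v. ennreal (exp (- z * v) * W (v - y) * f y)))"
  by (rule lborel_pair.Fubini') measurable
 also have "... = (\<L> y. ennreal (1 / (\<psi> z - q)) * ennreal (exp (- z * y) * f y))"
 proof (rule nn_integral_cong)
  fix y
  have "(\<L> v. ennreal (exp (- z * v) * W (v - y) * f y))
    = (\<L> v. ennreal (exp (- z * (y + v)) * W v * f y))"
   by (subst nn_integral_real_affine[where c = 1 and t = y]) auto
  also have "... = (\<L> v. ennreal (exp (- z * y) * f y) * ennreal (exp (- z * v) * W v))"
   using f W_nonneg by (intro nn_integral_cong) (auto simp: exp_add algebra_simps exp_diff exp_minus divide_simps simp flip: ennreal_mult)
  also have "... = ennreal (exp (- z * y) * f y) * ennreal (1 / (\<psi> z - q))"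
   by (subst nn_integral_cmult) (use W_laplace_nn[OF assms(3)] in auto)
  finally show "(\<L> v. ennreal (exp (- z * v) * W (v - y) * f y)) = ennreal (1 / (\<psi> z - q)) * ennreal (exp (- z * y) * f y)"
   by (simp add: mult.commute)
 qed
 also have "... = ennreal (1 / (\<psi> z - q)) * (\<L> y. ennreal (exp (- z * y) * f y))"
  by (rule nn_integral_cmult) measurable
 finally show ?thesis .
qed

lemma cv_bound:
 assumes [measurable]: "f \<in> borel_measurable borel" and f: "!!x. 0 <= f x" "!!x. f x <= B" "!!x. x < a ==> f x = 0"
 shows "cv f x <= ennreal (B * W (x - a) * max 0 (x - a))"
proof -
 have B: "0 <= B" using f(1,2) order_trans by blast
 have "cv f x <= (\<L> y. ennreal (B * W (x - a)) * ind {a..max a x} y)"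
  unfolding cv_def
 proof (rule nn_integral_mono)
  fix y
  show "ennreal (W (x - y) * f y) <= ennreal (B * W (x - a)) * ind {a..max a x} y"
  proof (cases "y \<in> {a..x}")
   case True
   then have "W (x - y) * f y <= W (x - a) * B" using f W_nonneg by (intro mult_mono W_mono) auto
   then show ?thesis using True by (auto simp: mult.commute intro!: ennreal_leI)
  next
   case False
   then have "W (x - y) * f y = 0" using f(3)[of y] W_neg[of "x - y"] by auto
   then show ?thesis by (simp only: ennreal_0 zero_le)
  qed
 qed
 also have "... = ennreal (B * W (x - a)) * ennreal (max a x - a)"
  by (simp add: nn_integral_cmult)
 also have "... = ennreal (B * W (x - a) * (max a x - a))" using B W_nonneg by (simp flip: ennreal_mult)
 also have "max a x - a = max 0 (x - a)" by auto
 finally show ?thesis .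
qed

end

section \<open>Discounted occupation integrals and the Dynkin identity\<close>

context exp_process
begin

lemma X_joint [measurable]: "(%p. X (max 0 (fst p)) (snd p)) \<in> borel_measurable (borel \<Otimes>\<^sub>M M)"
 by (rule right_continuous_joint_measurable) (auto intro: X_measurable X_right)

lemma X_joint' [measurable (raw)]:
 assumes "f \<in> borel_measurable N" "g \<in> N \<rightarrow>\<^sub>M M"
 shows "(%x. X (max 0 (f x)) (g x)) \<in> borel_measurable N"
 using measurable_compose[OF measurable_Pair[OF assms] X_joint] by simp

lemma nn_exp_discounted_interval:
 fixes r h :: real
 assumes "0 <= h" "r ~= 0"
 shows "(\<L> s. nexp (r * s) * ind {0..h} s) = ennreal ((exp (r * h) - 1) / r)"
proof -
 have "(\<L> s. nexp (r * s) * ind {0..h} s) = ennreal (exp (r * h) / r - exp (r * 0) / r)"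
  by (rule nn_integral_FTC_Icc) (use assms in \<open>auto intro!: derivative_eq_intros\<close>)
 then show ?thesis using assms by (simp add: diff_divide_distrib)
qed

text \<open>The resolvent of the process truncated at time \<open>h\<close>. Writing
  \<open>max 0 s\<close> makes the integrand total in \<open>s\<close>, in the form in which joint
  measurability is available.\<close>

definition occ :: "real => (real => real) => real => real => ennreal" where
 "occ q f h v = (\<L> s. (\<E> w. ennreal (exp (- q * s) * f (v + X (max 0 s) w))) * ind {0..h} s)"

lemma occ_measurable [measurable]:
 assumes [measurable]: "f \<in> borel_measurable borel"
 shows "occ q f h \<in> borel_measurable borel"
 unfolding occ_def by measurable

lemma occ_mono:
 assumes "!!x. f x <= g x"
 shows "occ q f h v <= occ q g h v"
 unfolding occ_def using assms by (intro nn_integral_mono mult_right_mono) (auto intro!: nn_integral_mono ennreal_leI mult_left_mono)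

lemma occ_add:
 assumes [measurable]: "f \<in> borel_measurable borel" "g \<in> borel_measurable borel" and "!!x. 0 <= f x" "!!x. 0 <= g x"
 shows "occ q (%x. f x + g x) h v = occ q f h v + occ q g h v"
proof -
 have "(\<E> w. ennreal (exp (- q * s) * (f (v + X (max 0 s) w) + g (v + X (max 0 s) w))))
   = (\<E> w. ennreal (exp (- q * s) * f (v + X (max 0 s) w)))
   + (\<E> w. ennreal (exp (- q * s) * g (v + X (max 0 s) w)))" for s
  using assms(3,4) by (subst nn_integral_add [symmetric])
   (auto intro!: nn_integral_cong simp: distrib_left simp flip: ennreal_plus)
 then show ?thesis
  unfolding occ_def by (simp add: distrib_right nn_integral_add)
qed

lemma occ_cmult:
 assumes [measurable]: "f \<in> borel_measurable borel" and "!!x. 0 <= f x" "0 <= c"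
 shows "occ q (%x. c * f x) h v = ennreal c * occ q f h v"
proof -
 have "(\<E> w. ennreal (exp (- q * s) * (c * f (v + X (max 0 s) w))))
   = ennreal c * (\<E> w. ennreal (exp (- q * s) * f (v + X (max 0 s) w)))" for s
  using assms(2,3) by (subst nn_integral_cmult [symmetric]) (auto intro!: nn_integral_cong simp: mult_ac simp flip: ennreal_mult)
 then show ?thesis
  unfolding occ_def by (simp add: mult.assoc nn_integral_cmult)
qed

lemma occ_one:
 assumes "0 < q" "0 <= h"
 shows "occ q (%_. 1) h v = ennreal ((1 - exp (- q * h)) / q)"
proof -
 have "occ q (%_. 1) h v = (\<L> s. nexp (- q * s) * ind {0..h} s)"
  unfolding occ_def by (simp add: emeasure_space_1)
 also have "... = ennreal ((exp (- q * h) - 1) / (- q))"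
  using assms by (intro nn_exp_discounted_interval) auto
 also have "(exp (- q * h) - 1) / (- q) = (1 - exp (- q * h)) / q"
  using assms by (simp add: field_simps)
 finally show ?thesis .
qed

lemma occ_le:
 assumes "0 < q" "0 <= h" "!!x. f x <= B" "0 <= B"
 shows "occ q f h v <= ennreal (B * h)"
proof -
 have "occ q f h v <= (\<L> s. ennreal B * ind {0..h} s)"
  unfolding occ_def
 proof (rule nn_integral_mono)
  fix s
  show "(\<E> w. ennreal (exp (- q * s) * f (v + X (max 0 s) w))) * ind {0..h} s <= ennreal B * ind {0..h} s"
  proof (cases "s \<in> {0..h}")
   case True
   have "exp (- q * s) * f y <= B" for y
   proof -
    have "exp (- q * s) * f y <= exp (- q * s) * B" using assms by (intro mult_left_mono) auto
    also have "... <= 1 * B" using assms True by (intro mult_right_mono) auto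
    finally show ?thesis by simp
   qed
   then have "(\<E> w. ennreal (exp (- q * s) * f (v + X (max 0 s) w))) <= (\<E> w. ennreal B)"
    by (intro nn_integral_mono ennreal_leI)
   then show ?thesis using True by (simp add: emeasure_space_1)
  qed simp
 qed
 also have "... = ennreal B * ennreal h" using assms by (simp add: nn_integral_cmult)
 finally show ?thesis using assms by (simp add: ennreal_mult)
qed

text \<open>Translating \<open>v\<close> by \<open>X s\<close> produces the factor
  \<open>exp (z * X s)\<close>, whose mean is \<open>exp (s * \<psi> z)\<close>. What remains is the
  time integral of \<open>exp ((\<psi> z - q) * s)\<close> over \<open>[0, h]\<close>.\<close>

lemma occ_laplace:
 assumes [measurable]: "f \<in> borel_measurable borel" and f: "!!x. 0 <= f x" and "0 < z" "q < \<psi> z" "0 <= h"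
 shows "(\<L> v. nexp (- z * v) * occ q f h v)
  = ennreal ((exp ((\<psi> z - q) * h) - 1) / (\<psi> z - q)) * (\<L> y. ennreal (exp (- z * y) * f y))"
proof -
 let ?F = "(\<L> y. ennreal (exp (- z * y) * f y))"
 let ?I = "ind {0..h} :: real => ennreal"
 have inner: "(\<L> v. (\<E> w. ennreal (exp (- z * v) * (exp (- q * s) * f (v + X (max 0 s) w)))))
   = nexp ((\<psi> z - q) * s) * ?F" if s: "0 <= s" for s
 proof -
  interpret pair_sigma_finite lborel M by standard
  have "(\<L> v. (\<E> w. ennreal (exp (- z * v) * (exp (- q * s) * f (v + X (max 0 s) w)))))
    = (\<E> w. (\<L> v. ennreal (exp (- z * v) * (exp (- q * s) * f (v + X (max 0 s) w)))))"
   by (rule Fubini'[symmetric]) measurable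
  also have "... = (\<E> w. nexp (- q * s) * nexp (z * X s w) * ?F)"
  proof (rule nn_integral_cong)
   fix w
   have "(\<L> v. ennreal (exp (- z * v) * (exp (- q * s) * f (v + X (max 0 s) w))))
     = (\<L> v. ennreal (exp (- z * (- X s w + 1 * v)) * (exp (- q * s) * f ((- X s w + 1 * v) + X (max 0 s) w))))"
    by (subst nn_integral_real_affine[where c = 1 and t = "- X s w"]) auto
   also have "... = (\<L> v. (nexp (- q * s) * nexp (z * X s w)) * ennreal (exp (- z * v) * f v))"
   proof (rule nn_integral_cong)
    fix v
    have "exp (- z * (- X s w + 1 * v)) = exp (z * X s w) * exp (- z * v)"
     by (simp add: exp_add [symmetric] algebra_simps)
    then show "ennreal (exp (- z * (- X s w + 1 * v)) * (exp (- q * s) * f ((- X s w + 1 * v) + X (max 0 s) w)))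
     = (nexp (- q * s) * nexp (z * X s w)) * ennreal (exp (- z * v) * f v)"
     using s f by (simp add: mult_ac flip: ennreal_mult)
   qed
   also have "... = nexp (- q * s) * nexp (z * X s w) * ?F"
    by (rule nn_integral_cmult) measurable
   finally show "(\<L> v. ennreal (exp (- z * v) * (exp (- q * s) * f (v + X (max 0 s) w))))
    = nexp (- q * s) * nexp (z * X s w) * ?F" .
  qed
  also have "... = nexp (- q * s) * nexp (s * \<psi> z) * ?F"
   using X_measurable[OF s] nn_mgf[of s z] s assms(3) by (simp add: nn_integral_multc nn_integral_cmult)
  also have "nexp (- q * s) * nexp (s * \<psi> z) = nexp ((\<psi> z - q) * s)"
   by (simp add: algebra_simps flip: ennreal_mult exp_add)
  finally show ?thesis .
 qed
 have "(\<L> v. nexp (- z * v) * occ q f h v)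
  = (\<L> v. (\<L> s. (\<E> w. ennreal (exp (- z * v) * (exp (- q * s) * f (v + X (max 0 s) w)))) * ?I s))"
 proof (rule nn_integral_cong)
  fix v
  have "nexp (- z * v) * occ q f h v
    = (\<L> s. nexp (- z * v) * ((\<E> w. ennreal (exp (- q * s) * f (v + X (max 0 s) w))) * ?I s))"
   unfolding occ_def by (rule nn_integral_cmult[symmetric]) measurable
  also have "... = (\<L> s. (\<E> w. ennreal (exp (- z * v) * (exp (- q * s) * f (v + X (max 0 s) w)))) * ?I s)"
  proof (rule nn_integral_cong)
   fix s
   have "(\<E> w. ennreal (exp (- z * v) * (exp (- q * s) * f (v + X (max 0 s) w))))
    = (\<E> w. nexp (- z * v) * ennreal (exp (- q * s) * f (v + X (max 0 s) w)))"
    using f by (intro nn_integral_cong ennreal_mult) auto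
   also have "... = nexp (- z * v) * (\<E> w. ennreal (exp (- q * s) * f (v + X (max 0 s) w)))"
    by (rule nn_integral_cmult) measurable
   finally show "nexp (- z * v) * ((\<E> w. ennreal (exp (- q * s) * f (v + X (max 0 s) w))) * ?I s)
    = (\<E> w. ennreal (exp (- z * v) * (exp (- q * s) * f (v + X (max 0 s) w)))) * ?I s"
    by (simp add: mult.assoc)
  qed
  finally show "nexp (- z * v) * occ q f h v
   = (\<L> s. (\<E> w. ennreal (exp (- z * v) * (exp (- q * s) * f (v + X (max 0 s) w)))) * ?I s)" .
 qed
 also have "... = (\<L> s. (\<L> v. (\<E> w. ennreal (exp (- z * v) * (exp (- q * s) * f (v + X (max 0 s) w)))) * ?I s))"
  by (rule lborel_pair.Fubini') measurable
 also have "... = (\<L> s. (nexp ((\<psi> z - q) * s) * ?I s) * ?F)"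
 proof (rule nn_integral_cong)
  fix s
  have "(\<L> v. (\<E> w. ennreal (exp (- z * v) * (exp (- q * s) * f (v + X (max 0 s) w)))) * ?I s)
   = (\<L> v. (\<E> w. ennreal (exp (- z * v) * (exp (- q * s) * f (v + X (max 0 s) w))))) * ?I s"
   by (rule nn_integral_multc) measurable
  then show "(\<L> v. (\<E> w. ennreal (exp (- z * v) * (exp (- q * s) * f (v + X (max 0 s) w)))) * ?I s)
   = (nexp ((\<psi> z - q) * s) * ?I s) * ?F"
   using inner[of s] by (auto simp: indicator_def)
 qed
 also have "... = (\<L> s. nexp ((\<psi> z - q) * s) * ?I s) * ?F"
  by (rule nn_integral_multc) measurable
 also have "(\<L> s. nexp ((\<psi> z - q) * s) * ?I s) = ennreal ((exp ((\<psi> z - q) * h) - 1) / (\<psi> z - q))"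
  using assms by (intro nn_exp_discounted_interval) auto
 finally show ?thesis .
qed

end

lemma filterlim_at_right_seq:
 fixes u :: "nat => real"
 assumes "!!n. x < u n" "u ----> x"
 shows "filterlim u (at_right x) sequentially"
 using assms by (auto simp: filterlim_at less_imp_neq[OF assms(1), symmetric] intro!: always_eventually)

context scale_process
begin

lemma cv_finite:
 assumes "f \<in> borel_measurable borel" and "!!x. 0 <= f x" "!!x. f x <= B" "!!x. x < a ==> f x = 0"
 shows "cv f x < \<infinity>"
proof -
 have "cv f x <= ennreal (B * W (x - a) * max 0 (x - a))" by (rule cv_bound[OF assms])
 then show ?thesis by (simp add: order_le_less_trans)
qed

lemma cv_exp_bound:
 assumes "f \<in> borel_measurable borel" and f: "!!x. 0 <= f x" "!!x. f x <= B" "!!x. x < a ==> f x = 0" and z: "root q < z"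
 shows "cv f x <= ennreal (B * z / (\<psi> z - q) * exp ((z + 1) * (x - a)))"
proof -
 have B: "0 <= B" using f(1,2) order_trans by blast
 have z': "0 < z" "0 < \<psi> z - q" using z root_pos[OF q_pos] \<psi>_gt_root[OF q_pos z] by auto
 have mx: "max 0 (x - a) <= exp (x - a)" using exp_ge_add_one_self[of "x - a"] by (smt (verit) exp_ge_zero)
 have "B * W (x - a) * max 0 (x - a) <= B * (z / (\<psi> z - q) * exp (z * (x - a))) * exp (x - a)"
  using B z' W_nonneg by (intro mult_mono mx mult_left_mono W_bound[OF z] mult_nonneg_nonneg) auto
 also have "... = B * z / (\<psi> z - q) * exp ((z + 1) * (x - a))"
  by (simp add: distrib_right exp_add)
 finally have "B * W (x - a) * max 0 (x - a) <= B * z / (\<psi> z - q) * exp ((z + 1) * (x - a))" .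
 moreover have "cv f x <= ennreal (B * W (x - a) * max 0 (x - a))" by (rule cv_bound[OF assms(1) f])
 ultimately show ?thesis by (meson ennreal_leI order_trans)
qed

lemma cv_tendsto:
 assumes [measurable]: "f \<in> borel_measurable borel" and f: "!!x. 0 <= f x" "!!x. f x <= B" "!!x. x < a ==> f x = 0"
  and u: "!!n. u n <= c" and lim: "AE z in lborel. (%n. f (u n - z)) ----> f (x - z)"
 shows "(%n. cv f (u n)) ----> cv f x"
proof -
 have B: "0 <= B" using f(1,2) order_trans by blast
 define w where "w z = ennreal (B * W (c - a)) * ind {0..max 0 (c - a)} z" for z
 show ?thesis
  unfolding cv_flip[OF assms(1)]
 proof (rule nn_integral_dominated_convergence[where w = w])
  fix n
  show "AE z in lborel. ennreal (W z * f (u n - z)) <= w z"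
  proof (rule AE_I2)
   fix z
   show "ennreal (W z * f (u n - z)) <= w z"
   proof (cases "0 <= z & a <= u n - z")
    case True
    then have "W z * f (u n - z) <= W (c - a) * B" using u[of n] f W_nonneg by (intro mult_mono W_mono) auto
    then show ?thesis using True u[of n] by (auto simp: w_def mult.commute intro!: ennreal_leI)
   next
    case False
    then have "W z * f (u n - z) = 0" using f(3)[of "u n - z"] W_neg[of z] by auto
    then show ?thesis by (simp only: ennreal_0 zero_le)
   qed
  qed
 next
  show "AE z in lborel. (%n. ennreal (W z * f (u n - z))) ----> ennreal (W z * f (x - z))"
   using lim by eventually_elim (intro tendsto_ennrealI tendsto_mult_left)
  show "integral\<^sup>N lborel w < \<infinity>"
   unfolding w_def by (subst nn_integral_cmult) (auto simp: ennreal_mult_less_top)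
  show "w \<in> borel_measurable lborel" unfolding w_def by measurable
 qed measurable
qed

lemma occ_right:
 assumes [measurable]: "f \<in> borel_measurable borel" and f: "!!x. 0 <= f x" "!!x. f x <= B"
  and right: "!!x. (f \<longlongrightarrow> f x) (at_right x)"
  and u: "!!n. v < u n" "u ----> v" and h: "0 <= h"
 shows "(%n. occ q f h (u n)) ----> occ q f h v"
proof -
 have B: "0 <= B" using f(1,2) order_trans by blast
 have le: "exp (- q * s) * f y <= B" if "0 <= s" for s y
 proof -
  have "exp (- q * s) * f y <= 1 * B" using that q_pos f by (intro mult_mono) auto
  then show ?thesis by simp
 qed
 have inner: "(%n. (\<E> k. ennreal (exp (- q * s) * f (u n + X (max 0 s) k)))) ----> (\<E> k. ennreal (exp (- q * s) * f (v + X (max 0 s) k)))"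
  if s: "0 <= s" for s
 proof (rule nn_integral_dominated_convergence[where w = "%_. ennreal B"])
  show "AE k in M. (%n. ennreal (exp (- q * s) * f (u n + X (max 0 s) k))) ----> ennreal (exp (- q * s) * f (v + X (max 0 s) k))"
  proof (rule AE_I2)
   fix k
   have "filterlim (%n. u n + X (max 0 s) k) (at_right (v + X (max 0 s) k)) sequentially"
    using u by (intro filterlim_at_right_seq) (auto intro: tendsto_add)
   then have "(%n. f (u n + X (max 0 s) k)) ----> f (v + X (max 0 s) k)"
    by (rule filterlim_compose[OF right])
   then show "(%n. ennreal (exp (- q * s) * f (u n + X (max 0 s) k))) ----> ennreal (exp (- q * s) * f (v + X (max 0 s) k))"
    by (intro tendsto_ennrealI tendsto_mult_left)
  qed
  show "!!j. AE k in M. ennreal (exp (- q * s) * f (u j + X (max 0 s) k)) <= ennreal B"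
   using le[OF s] by (intro AE_I2 ennreal_leI)
  show "integral\<^sup>N M (%_. ennreal B) < \<infinity>" by (simp add: emeasure_space_1)
 qed measurable
 show ?thesis
  unfolding occ_def
 proof (rule nn_integral_dominated_convergence[where w = "%s. ennreal B * ind {0..h} s"])
  show "AE s in lborel. (%n. (\<E> k. ennreal (exp (- q * s) * f (u n + X (max 0 s) k))) * ind {0..h} s) ----> (\<E> k. ennreal (exp (- q * s) * f (v + X (max 0 s) k))) * ind {0..h} s"
   using inner by (intro AE_I2) (auto simp: indicator_def)
  show "!!j. AE s in lborel. (\<E> k. ennreal (exp (- q * s) * f (u j + X (max 0 s) k))) * ind {0..h} s <= ennreal B * ind {0..h} s"
  proof (rule AE_I2)
   fix j s
   show "(\<E> k. ennreal (exp (- q * s) * f (u j + X (max 0 s) k))) * ind {0..h} s <= ennreal B * ind {0..h} s"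
   proof (cases "s \<in> {0..h}")
    case True
    have "(\<E> k. ennreal (exp (- q * s) * f (u j + X (max 0 s) k))) <= (\<E> k. ennreal B)"
     using le True by (intro nn_integral_mono ennreal_leI) auto
    then show ?thesis using True by (simp add: emeasure_space_1)
   qed simp
  qed
  show "(\<L> s. ennreal B * ind {0..h} s) < \<infinity>"
   using B h by (simp add: nn_integral_cmult flip: ennreal_mult)
 qed measurable
qed

text \<open>Both sides have the same bilateral Laplace transform in \<open>v\<close> and are right-continuous in \<open>v\<close>.\<close>
theorem dynkin_cv:
 assumes [measurable]: "f \<in> borel_measurable borel" and f: "!!x. 0 <= f x" "!!x. f x <= B" "!!x. x < a ==> f x = 0"
  and right: "!!x. (f \<longlongrightarrow> f x) (at_right x)" and h: "0 <= h"
 shows "nexp (- q * h) * (\<E> k. cv f (v + X h k)) = cv f v + occ q f h v"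
proof -
 have [measurable]: "X h \<in> borel_measurable M" using h by (rule X_measurable)
 have B: "0 <= B" using f(1,2) order_trans by blast
 define P where "P v = nexp (- q * h) * (\<E> k. cv f (v + X h k))" for v
 define Q where "Q v = cv f v + occ q f h v" for v
 have P_meas [measurable]: "P \<in> borel_measurable borel" unfolding P_def by measurable
 have Q_meas [measurable]: "Q \<in> borel_measurable borel" unfolding Q_def by measurable
 have F_fin: "(\<L> y. ennreal (exp (- s * y) * f y)) < \<infinity>" if s: "0 < s" for s
 proof -
  have "(\<L> y. ennreal (exp (- s * y) * f y)) <= (\<L> y. ennreal B * (nexp (- s * y) * ind {a..} y))"
   using f B by (intro nn_integral_mono) (auto simp: indicator_def mult.commute not_le intro!: ennreal_leI mult_right_mono simp flip: ennreal_mult)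
  also have "... = ennreal B * ennreal (exp (- s * a) / s)"
   using nn_exp_tail[OF s, of a] by (simp add: nn_integral_cmult)
  finally show ?thesis by (auto simp: less_top[symmetric] top_unique ennreal_mult_eq_top_iff)
 qed
 have Ptr: "(\<L> v. nexp (- s * v) * P v)
   = ennreal (exp ((\<psi> s - q) * h) / (\<psi> s - q)) * (\<L> y. ennreal (exp (- s * y) * f y))" if s: "root q < s" for s
 proof -
  have s': "0 < s" "0 < \<psi> s - q" using s root_pos[OF q_pos] \<psi>_gt_root[OF q_pos s] by auto
  interpret pair_sigma_finite lborel M by standard
  let ?C = "(\<L> v. nexp (- s * v) * cv f v)"
  have "(\<L> v. nexp (- s * v) * P v)
    = (\<L> v. (\<E> k. nexp (- q * h) * (nexp (- s * v) * cv f (v + X h k))))"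
   unfolding P_def by (intro nn_integral_cong) (simp add: nn_integral_cmult mult_ac)
  also have "... = (\<E> k. (\<L> v. nexp (- q * h) * (nexp (- s * v) * cv f (v + X h k))))"
   by (rule Fubini'[symmetric]) measurable
  also have "... = (\<E> k. nexp (- q * h) * nexp (s * X h k) * ?C)"
  proof (rule nn_integral_cong)
   fix k
   have "(\<L> v. nexp (- s * v) * cv f (v + X h k))
     = (\<L> v. nexp (- s * (- X h k + 1 * v)) * cv f ((- X h k + 1 * v) + X h k))"
    by (subst nn_integral_real_affine[where c = 1 and t = "- X h k"]) auto
   also have "... = (\<L> v. nexp (s * X h k) * (nexp (- s * v) * cv f v))"
   proof (rule nn_integral_cong)
    fix v
    have "exp (- s * (- X h k + 1 * v)) = exp (s * X h k) * exp (- s * v)"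
     by (simp add: exp_add [symmetric] algebra_simps)
    then show "nexp (- s * (- X h k + 1 * v)) * cv f ((- X h k + 1 * v) + X h k)
     = nexp (s * X h k) * (nexp (- s * v) * cv f v)"
     by (simp add: ennreal_mult mult.assoc)
   qed
   also have "... = nexp (s * X h k) * ?C" by (rule nn_integral_cmult) measurable
   finally have *: "(\<L> v. nexp (- s * v) * cv f (v + X h k)) = nexp (s * X h k) * ?C" .
   show "(\<L> v. nexp (- q * h) * (nexp (- s * v) * cv f (v + X h k)))
    = nexp (- q * h) * nexp (s * X h k) * ?C"
    using * by (subst nn_integral_cmult) (auto simp: mult.assoc)
  qed
  also have "... = nexp (- q * h) * nexp (h * \<psi> s) * ?C"
   using nn_mgf[of h s] h s' by (simp add: nn_integral_multc nn_integral_cmult)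
  also have "nexp (- q * h) * nexp (h * \<psi> s) = nexp ((\<psi> s - q) * h)"
   by (simp add: algebra_simps flip: ennreal_mult exp_add)
  also have "?C = ennreal (1 / (\<psi> s - q)) * (\<L> y. ennreal (exp (- s * y) * f y))"
   by (rule cv_laplace) (use f s in auto)
  also have "nexp ((\<psi> s - q) * h) * (ennreal (1 / (\<psi> s - q)) * (\<L> y. ennreal (exp (- s * y) * f y)))
   = ennreal (exp ((\<psi> s - q) * h) / (\<psi> s - q)) * (\<L> y. ennreal (exp (- s * y) * f y))"
   using s' by (simp add: mult.assoc[symmetric] flip: ennreal_mult)
  finally show ?thesis .
 qed
 have Qtr: "(\<L> v. nexp (- s * v) * Q v)
   = ennreal (exp ((\<psi> s - q) * h) / (\<psi> s - q)) * (\<L> y. ennreal (exp (- s * y) * f y))" if s: "root q < s" for s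
 proof -
  have s': "0 < s" "0 < \<psi> s - q" using s root_pos[OF q_pos] \<psi>_gt_root[OF q_pos s] by auto
  let ?F = "(\<L> y. ennreal (exp (- s * y) * f y))"
  have "(\<L> v. nexp (- s * v) * Q v)
   = (\<L> v. nexp (- s * v) * cv f v) + (\<L> v. nexp (- s * v) * occ q f h v)"
   unfolding Q_def by (simp add: distrib_left nn_integral_add)
  also have "... = ennreal (1 / (\<psi> s - q)) * ?F + ennreal ((exp ((\<psi> s - q) * h) - 1) / (\<psi> s - q)) * ?F"
   using f s s' h by (subst cv_laplace; (subst occ_laplace)?) auto
  also have "... = ennreal (1 / (\<psi> s - q) + (exp ((\<psi> s - q) * h) - 1) / (\<psi> s - q)) * ?F"
   using s' h by (subst ennreal_plus) (auto simp: distrib_right)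
  also have "1 / (\<psi> s - q) + (exp ((\<psi> s - q) * h) - 1) / (\<psi> s - q) = exp ((\<psi> s - q) * h) / (\<psi> s - q)"
   by (simp add: diff_divide_distrib)
  finally show ?thesis .
 qed
 have "AE v in lborel. P v = Q v"
 proof (rule bilateral_laplace_unique[where ?z0.0 = "root q"])
  fix s assume s: "root q < s"
  then have "0 < s" using root_pos[OF q_pos] by simp
  then show "(\<L> v. nexp (- s * v) * Q v) < \<infinity>"
   using F_fin[of s] unfolding Qtr[OF s] by (auto simp: less_top[symmetric] top_unique ennreal_mult_eq_top_iff)
  show "(\<L> v. nexp (- s * v) * P v) = (\<L> v. nexp (- s * v) * Q v)"
   unfolding Ptr[OF s] Qtr[OF s] ..
 qed measurable
 then have "P v = Q v"
 proof (rule AE_eq_right_limit)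
  fix u :: "nat => real" assume u: "!!n. v < u n" "!!n. u n <= v + 1" "u ----> v"
  have right': "(%n. f (u n + y)) ----> f (v + y)" for y
  proof -
   have "filterlim (%n. u n + y) (at_right (v + y)) sequentially"
    using u by (intro filterlim_at_right_seq) (auto intro: tendsto_add)
   then show ?thesis by (rule filterlim_compose[OF right])
  qed
  have cvlim: "(%n. cv f (u n + y)) ----> cv f (v + y)" for y
   using right'[of "y - z" for z] u(2)
   by (intro cv_tendsto[where a = a and B = B and c = "v + 1 + y"] f assms(1) AE_I2) (auto simp: algebra_simps)
  show "(%n. Q (u n)) ----> Q v"
   unfolding Q_def using cvlim[of 0] by (intro tendsto_add occ_right[where B = B] assms(1) f right u h) auto
  \<comment> \<open>\<open>cv f\<close> may grow exponentially, so the limit under the expectation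
    needs a dominating exponential moment of \<open>X h\<close>; any exponent above
    \<open>root q\<close> serves.\<close>
  define s where "s = root q + 1"
  have s: "root q < s" by (simp add: s_def)
  have s': "0 < s" "0 < \<psi> s - q" using s root_pos[OF q_pos] \<psi>_gt_root[OF q_pos s] by auto
  define K where "K = B * s / (\<psi> s - q)"
  have K: "0 <= K" using B s' by (simp add: K_def)
  have "(%n. (\<E> k. cv f (u n + X h k))) ----> (\<E> k. cv f (v + X h k))"
  proof (rule nn_integral_dominated_convergence[where w = "%k. ennreal (K * exp ((s + 1) * (v + 1 - a))) * nexp ((s + 1) * X h k)"])
   fix n
   show "AE k in M. cv f (u n + X h k) <= ennreal (K * exp ((s + 1) * (v + 1 - a))) * nexp ((s + 1) * X h k)"
   proof (rule AE_I2)
    fix k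
    have "cv f (u n + X h k) <= ennreal (K * exp ((s + 1) * (u n + X h k - a)))"
     unfolding K_def by (rule cv_exp_bound[OF assms(1) f s])
    also have "... <= ennreal (K * exp ((s + 1) * (v + 1 + X h k - a)))"
     using u(2)[of n] K s' by (intro ennreal_leI mult_left_mono) auto
    also have "... = ennreal (K * exp ((s + 1) * (v + 1 - a)) * exp ((s + 1) * X h k))"
     by (simp add: mult.assoc flip: exp_add) (simp add: algebra_simps)
    also have "... = ennreal (K * exp ((s + 1) * (v + 1 - a))) * nexp ((s + 1) * X h k)"
     using K by (intro ennreal_mult) auto
    finally show "cv f (u n + X h k) <= ennreal (K * exp ((s + 1) * (v + 1 - a))) * nexp ((s + 1) * X h k)" .
   qed
  next
   have "(\<E> k. nexp ((s + 1) * X h k)) = nexp (h * \<psi> (s + 1))"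
    using h s' by (intro nn_mgf) auto
   then show "(\<E> k. ennreal (K * exp ((s + 1) * (v + 1 - a))) * nexp ((s + 1) * X h k)) < \<infinity>"
    by (subst nn_integral_cmult) (auto simp: ennreal_mult_less_top)
  qed (auto simp: cvlim)
  then show "(%n. P (u n)) ----> P v"
   unfolding P_def by (intro ennreal_tendsto_cmult) auto
 qed
 then show ?thesis by (simp add: P_def Q_def)
qed

end

section \<open>Exponential monotonicity and growth of the scale function\<close>

context scale_process
begin

lemma indicator_Ico_right:
 fixes a b x :: real
 shows "((ind {a..<b} :: real => real) \<longlongrightarrow> ind {a..<b} x) (at_right x)"
proof -
 have "\<forall>\<^sub>F y in at_right x. (ind {a..<b} y :: real) = ind {a..<b} x"
 proof -
  consider "x < a" | "a <= x" "x < b" | "a <= x" "b <= x" by linarith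
  then show ?thesis
  proof cases
   case 1
   then have "\<forall>\<^sub>F y in at_right x. y \<in> {x<..<a}" by (intro eventually_at_right_real)
   then show ?thesis by eventually_elim (use 1 in auto)
  next
   case 2
   then have "\<forall>\<^sub>F y in at_right x. y \<in> {x<..<b}" by (intro eventually_at_right_real)
   then show ?thesis by eventually_elim (use 2 in auto)
  next
   case 3
   then have "\<forall>\<^sub>F y in at_right x. y \<in> {x<..<x+1}" by (intro eventually_at_right_real) auto
   then show ?thesis by eventually_elim (use 3 in auto)
  qed
 qed
 then show ?thesis by (rule tendsto_eventually)
qed

text \<open>Convolution with a window averages \<open>W\<close> over shifts between \<open>a\<close>
  and \<open>b\<close>, so \<open>W\<close> is trapped between shifted averages. Results on
  \<open>cv\<close> are carried back to \<open>W\<close> in this way.\<close>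

lemma cv_Ico:
 assumes "a <= b"
 shows "cv (ind {a..<b}) x <= ennreal ((b - a) * W (x - a))"
  and "ennreal ((b - a) * W (x - b)) <= cv (ind {a..<b}) x"
proof -
 have "cv (ind {a..<b}) x <= (\<L> y. ennreal (W (x - a)) * ind {a..<b} y)"
  unfolding cv_def by (intro nn_integral_mono) (auto simp: indicator_def intro!: ennreal_leI W_mono)
 also have "... = ennreal ((b - a) * W (x - a))"
  using assms W_nonneg by (subst nn_integral_cmult) (auto simp: mult.commute simp flip: ennreal_mult)
 finally show "cv (ind {a..<b}) x <= ennreal ((b - a) * W (x - a))" .
 have "ennreal ((b - a) * W (x - b)) = (\<L> y. ennreal (W (x - b)) * ind {a..<b} y)"
  using assms W_nonneg by (subst nn_integral_cmult) (auto simp: mult.commute simp flip: ennreal_mult)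
 also have "... <= cv (ind {a..<b}) x"
  unfolding cv_def by (intro nn_integral_mono) (auto simp: indicator_def intro!: ennreal_leI W_mono)
 finally show "ennreal ((b - a) * W (x - b)) <= cv (ind {a..<b}) x" .
qed

text \<open>
 Maximum principle: at an interior maximum point \<open>x0\<close> of \<open>g / exp (z * x)\<close> on \<open>(-\<infinity>, c]\<close> the identity
 \<open>dynkin_cv\<close> would push \<open>g\<close> above the strict supersolution \<open>exp (z * x)\<close> at a linear rate in time, whereas the
 process exceeds \<open>c\<close> only with probability \<open>o(h)\<close>, having no positive jumps.
\<close>
lemma window_exp_mono_lt:
 assumes eps: "0 < eps" and s: "0 < s" "s < root q" and x: "x <= c" "0 < c"
 shows "enn2real (cv (ind {0..<eps}) x) * exp (- s * x) <= enn2real (cv (ind {0..<eps}) c) * exp (- s * c)"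
proof -
 define f :: "real => real" where "f = ind {0..<eps}"
 have f_meas [measurable]: "f \<in> borel_measurable borel" unfolding f_def by measurable
 have f: "!!x. 0 <= f x" "!!x. f x <= 1" "!!x. x < 0 ==> f x = 0" by (auto simp: f_def indicator_def)
 have f_right: "(f \<longlongrightarrow> f x) (at_right x)" for x unfolding f_def by (rule indicator_Ico_right)
 define g where "g x = enn2real (cv f x)" for x
 have cv_g: "cv f x = ennreal (g x)" for x
  using cv_finite[OF f_meas f] by (simp add: g_def)
 have g0: "0 <= g x" for x by (simp add: g_def)
 have g_neg: "g x = 0" if "x <= 0" for x
 proof -
  have "cv f x <= ennreal (1 * W (x - 0) * max 0 (x - 0))" by (rule cv_bound[OF f_meas f])
  then show ?thesis using that by (simp add: g_def)
 qed
 have g_cont: "isCont g x" for x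
  unfolding continuous_within_sequentially
 proof (intro allI impI, clarsimp)
  fix u :: "nat => real" assume u: "u ----> x"
  then have "Bseq u" by (rule convergent_imp_Bseq[OF convergentI])
  then obtain K where "!!n. \<bar>u n\<bar> <= K" unfolding Bseq_def by auto
  then have K: "!!n. u n <= K" by (meson abs_le_D1)
  have ae: "AE z in lborel. (%n. f (u n - z)) ----> f (x - z)"
  proof -
   have "AE z in lborel. z ~= x" "AE z in lborel. z ~= x - eps"
    using AE_lborel_singleton by auto
   then show ?thesis
   proof eventually_elim
    case (elim z)
    have "(%n. u n - z) ----> x - z" using u by (intro tendsto_intros)
    moreover have "isCont f (x - z)"
     unfolding f_def isCont_def[symmetric] using elim eps by (subst isCont_indicator) (auto simp: frontier_def closure_atLeastLessThan)
    ultimately show ?case by (rule isCont_tendsto_compose[rotated])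
   qed
  qed
  have "(%n. cv f (u n)) ----> cv f x"
   by (rule cv_tendsto[where B = 1 and a = 0, OF f_meas f K ae])
  then have "(%n. enn2real (cv f (u n))) ----> enn2real (cv f x)"
   using cv_finite[OF f_meas f] by (intro tendsto_enn2real) auto
  then show "(g \<circ> u) ----> g x" by (simp add: g_def o_def)
 qed
 have "continuous_on {0..c} (%x. g x * exp (- s * x))"
  by (intro continuous_intros continuous_at_imp_continuous_on ballI g_cont)
 then obtain x0 where x0: "x0 \<in> {0..c}" "!!y. y \<in> {0..c} ==> g y * exp (- s * y) <= g x0 * exp (- s * x0)"
  using continuous_attains_sup[of "{0..c}" "%x. g x * exp (- s * x)"] x(2) by auto
 define \<rho> where "\<rho> = g x0 * exp (- s * x0)"
 have \<rho>: "g y * exp (- s * y) <= \<rho>" if "y <= c" for y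
  using x0(2)[of y] that g_neg[of y] g0[of x0] by (cases "0 <= y") (auto simp: \<rho>_def)
 have \<rho>0: "0 <= \<rho>" by (simp add: \<rho>_def g0)
 have "\<rho> <= g c * exp (- s * c)"
 proof (rule ccontr)
  assume less: "~ ?thesis"
  then have \<rho>_pos: "0 < \<rho>" using g0[of c] by (smt (verit) mult_nonneg_nonneg exp_ge_zero)
  have x0c: "x0 < c" using x0(1) less by (cases "x0 = c") (auto simp: \<rho>_def)
  have g_le: "g y <= \<rho> * exp (s * y)" if "y <= c" for y
   using mult_right_mono[OF \<rho>[OF that], of "exp (s * y)"] by (simp add: mult.assoc flip: exp_add)
  have g_x0: "g x0 = \<rho> * exp (s * x0)" by (simp add: \<rho>_def mult.assoc flip: exp_add)
  define A where "A = g x0"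
  have A: "0 < A" using \<rho>_pos by (simp add: A_def g_x0)
  \<comment> \<open>Positive because \<open>s < root q\<close>: the discounted mean of
    \<open>exp (s * X h)\<close> is \<open>exp (- d * h)\<close>, which makes
    \<open>exp (s * x)\<close> a strict supersolution.\<close>
  define d where "d = q - \<psi> s"
  have d: "0 < d" using \<psi>_lt_root[OF q_pos s] by (simp add: d_def)
  define s1 where "s1 = root q + 1"
  have s1: "root q < s1" by (simp add: s1_def)
  have s1': "0 < s1" "0 < \<psi> s1 - q" using s1 root_pos[OF q_pos] \<psi>_gt_root[OF q_pos s1] by auto
  define K where "K = s1 / (\<psi> s1 - q) * exp ((s1 + 1) * x0)"
  have K: "0 < K" using s1' by (simp add: K_def)
  have g_bd: "g (x0 + y) <= K * exp ((s1 + 1) * y)" for y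
  proof -
   have "ennreal (g (x0 + y)) <= ennreal (1 * s1 / (\<psi> s1 - q) * exp ((s1 + 1) * (x0 + y - 0)))"
    unfolding cv_g[symmetric] by (rule cv_exp_bound[OF f_meas f s1])
   also have "1 * s1 / (\<psi> s1 - q) * exp ((s1 + 1) * (x0 + y - 0)) = K * exp ((s1 + 1) * y)"
    by (simp add: K_def distrib_left exp_add)
   finally show ?thesis using K by (simp add: ennreal_le_iff)
  qed
  \<comment> \<open>Makes the contribution of paths beyond \<open>c\<close> at most
    \<open>A * d * h / 4\<close>, against a deficit \<open>A * (1 - exp (- d * h))\<close> larger
    than \<open>A * d * h / 2\<close>.\<close>
  define e where "e = A * d / (4 * K)"
  have e: "0 < e" using A d K by (simp add: e_def)
  have "\<forall>\<^sub>F h in at_right 0. (\<E> w. nexp ((s1 + 1) * X h w) * ind {c - x0<..} (X h w)) <= ennreal (e * h)"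
   using exp_tail_small[of "s1 + 1" "c - x0" e] s1' x0c e by simp
  moreover have "((%h. (1 - exp (- d * h)) / h) \<longlongrightarrow> d) (at_right 0)" by real_asymp
  then have "\<forall>\<^sub>F h in at_right 0. d / 2 < (1 - exp (- d * h)) / h"
   using d by (intro order_tendstoD) auto
  moreover have "\<forall>\<^sub>F h :: real in at_right 0. 0 < h" by (rule eventually_at_right_less)
  ultimately have "\<forall>\<^sub>F h :: real in at_right 0. False"
  proof eventually_elim
   case (elim h)
   have [measurable]: "X h \<in> borel_measurable M" using elim(3) by (intro X_measurable) simp
   have "ennreal A <= nexp (- q * h) * (\<E> w. cv f (x0 + X h w))"
    using elim(3) by (subst dynkin_cv[OF f_meas f f_right]) (auto simp: cv_g A_def)
   also have "(\<E> w. cv f (x0 + X h w))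
    <= (\<E> w. ennreal A * nexp (s * X h w) + ennreal K * (nexp ((s1 + 1) * X h w) * ind {c - x0<..} (X h w)))"
   proof (rule nn_integral_mono)
    fix w
    show "cv f (x0 + X h w) <= ennreal A * nexp (s * X h w) + ennreal K * (nexp ((s1 + 1) * X h w) * ind {c - x0<..} (X h w))"
    proof (cases "x0 + X h w <= c")
     case True
     have "cv f (x0 + X h w) <= ennreal (A * exp (s * X h w))"
      using g_le[OF True] by (simp add: cv_g A_def g_x0 distrib_left exp_add mult.assoc ennreal_leI)
     then show ?thesis using A True by (simp add: ennreal_mult)
    next
     case False
     have "cv f (x0 + X h w) <= ennreal (K * exp ((s1 + 1) * X h w))"
      using g_bd by (simp add: cv_g ennreal_leI)
     also have "... = ennreal K * (nexp ((s1 + 1) * X h w) * ind {c - x0<..} (X h w))"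
      using K False by (simp add: ennreal_mult)
     also have "... <= ennreal A * nexp (s * X h w) + ..." by simp
     finally show ?thesis .
    qed
   qed
   also have "... = ennreal A * (\<E> w. nexp (s * X h w))
     + ennreal K * (\<E> w. nexp ((s1 + 1) * X h w) * ind {c - x0<..} (X h w))"
    by (subst nn_integral_add) (auto simp: nn_integral_cmult)
   also have "... <= ennreal A * nexp (h * \<psi> s) + ennreal K * ennreal (e * h)"
    using elim s by (intro add_mono mult_left_mono) (auto simp: nn_mgf)
   also have "... = ennreal (A * exp (h * \<psi> s) + K * (e * h))"
    using A K e elim by (simp flip: ennreal_mult ennreal_plus)
   finally have "ennreal A <= nexp (- q * h) * ennreal (A * exp (h * \<psi> s) + K * (e * h))"
    by (simp add: mult_left_mono)
   also have "... = ennreal (exp (- q * h) * (A * exp (h * \<psi> s) + K * (e * h)))" 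
    by (rule ennreal_mult[symmetric]) (use A K e elim in auto)
   finally have "A <= exp (- q * h) * (A * exp (h * \<psi> s) + K * (e * h))"
    using A K e elim by (simp add: ennreal_le_iff)
   also have "... = A * exp (- d * h) + exp (- q * h) * (K * (e * h))"
    by (simp add: d_def distrib_left mult.left_commute[of _ A] exp_add [symmetric] algebra_simps)
   also have "... <= A * exp (- d * h) + 1 * (K * (e * h))"
    using A K e elim q_pos by (intro add_mono mult_right_mono) auto
   finally have "A * (1 - exp (- d * h)) <= A * d / 4 * h" using K by (simp add: e_def algebra_simps)
   moreover have "A * (d / 2 * h) < A * (1 - exp (- d * h))"
   proof (rule mult_strict_left_mono)
    show "d / 2 * h < 1 - exp (- d * h)" using elim(2,3) by (simp add: pos_less_divide_eq)
   qed (rule A)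
   moreover have "0 < A * d * h" using A d elim by simp
   ultimately show ?case by simp
  qed
  then show False by (simp add: trivial_limit_at_right_real)
 qed
 then have "g x * exp (- s * x) <= g c * exp (- s * c)" using \<rho>[OF x(1)] by simp
 then show ?thesis by (simp add: g_def f_def)
qed

text \<open>The classical reason is that \<open>W x * exp (- root q * x)\<close> is the scale
  function of an exponentially tilted process. Here no measure is changed: \<open>s\<close> tends to
  \<open>root q\<close> from the left in the window estimate, then the window shrinks. Shrinking
  uses continuity of \<open>W\<close> from the left and so treats \<open>x > 0\<close>; the point
  \<open>x = 0\<close> follows by a limit from the right.\<close>

lemma W_exp_mono:
 assumes "x <= y"
 shows "W x * exp (- root q * x) <= W y * exp (- root q * y)"
proof -
 let ?\<Phi> = "root q"
 have win: "W (x - eps) * exp (- ?\<Phi> * x) <= W y * exp (- ?\<Phi> * y)" if eps: "0 < eps" and xy: "x <= y" "0 < y" for eps x y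
 proof -
  let ?g = "%x. enn2real (cv (ind {0..<eps}) x)"
  have "((%s. ?g x * exp (- s * x)) \<longlongrightarrow> ?g x * exp (- ?\<Phi> * x)) (at_left ?\<Phi>)"
   "((%s. ?g y * exp (- s * y)) \<longlongrightarrow> ?g y * exp (- ?\<Phi> * y)) (at_left ?\<Phi>)"
   by (auto intro!: tendsto_intros)
  moreover have "\<forall>\<^sub>F s in at_left ?\<Phi>. s \<in> {0<..<?\<Phi>}" by (intro eventually_at_left_real root_pos q_pos)
  then have "\<forall>\<^sub>F s in at_left ?\<Phi>. ?g x * exp (- s * x) <= ?g y * exp (- s * y)"
   by eventually_elim (use window_exp_mono_lt[OF eps _ _ xy] in auto)
  ultimately have lim: "?g x * exp (- ?\<Phi> * x) <= ?g y * exp (- ?\<Phi> * y)"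
   by (intro tendsto_le[of "at_left ?\<Phi>"]) auto
  have fin: "cv (ind {0..<eps}) z < \<infinity>" for z
   by (rule cv_finite[where B = 1 and a = 0]) (auto simp: indicator_def)
  have up: "?g z <= eps * W z" for z
   using cv_Ico(1)[of 0 eps z] eps W_nonneg[of z] by (intro enn2real_leI) auto
  have low: "eps * W (z - eps) <= ?g z" for z
  proof -
   have "enn2real (ennreal (eps * W (z - eps))) <= ?g z"
    using cv_Ico(2)[of 0 eps z] eps fin by (intro enn2real_mono) auto
   then show ?thesis using eps W_nonneg by simp
  qed
  have "eps * W (x - eps) * exp (- ?\<Phi> * x) <= ?g x * exp (- ?\<Phi> * x)" using low[of x] by (intro mult_right_mono) auto
  also note lim
  also have "?g y * exp (- ?\<Phi> * y) <= eps * W y * exp (- ?\<Phi> * y)" using up[of y] by (intro mult_right_mono) auto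
  finally show ?thesis using eps by simp
 qed
 have pos: "W x * exp (- ?\<Phi> * x) <= W y * exp (- ?\<Phi> * y)" if xy: "0 < x" "x <= y" for x y
 proof -
  have "(W \<longlongrightarrow> W x) (at x)"
   using W_cont xy(1) by (intro continuous_on_interior[unfolded continuous_within isCont_def, of "{0..}" W x, unfolded isCont_def]) auto
  then have "((%eps. W (x - eps)) \<longlongrightarrow> W x) (at_right 0)"
  proof (rule filterlim_compose)
   show "filterlim (%eps. x - eps) (at x) (at_right 0)"
    unfolding filterlim_at by (auto intro!: tendsto_eq_intros simp: eventually_at_filter)
  qed
  then have "((%eps. W (x - eps) * exp (- ?\<Phi> * x)) \<longlongrightarrow> W x * exp (- ?\<Phi> * x)) (at_right 0)"
   by (intro tendsto_intros)
  moreover have "\<forall>\<^sub>F eps in at_right 0. W (x - eps) * exp (- ?\<Phi> * x) <= W y * exp (- ?\<Phi> * y)"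
   using eventually_at_right_less[of "0 :: real"] by eventually_elim (use win xy in auto)
  ultimately show ?thesis by (intro tendsto_upperbound[where F = "at_right 0"]) auto
 qed
 consider "x < 0" | "x = y" | "0 <= x" "x < y" using assms by linarith
 then show ?thesis
 proof cases
  case 1 then show ?thesis using W_neg[of x] W_nonneg[of y] by simp
 next
  case 3
  have "((%z. W z * exp (- ?\<Phi> * z)) \<longlongrightarrow> W x * exp (- ?\<Phi> * x)) (at_right x)"
   by (intro tendsto_intros W_right)
  moreover have "\<forall>\<^sub>F z in at_right x. z \<in> {x<..<y}" using 3 by (intro eventually_at_right_real)
  then have "\<forall>\<^sub>F z in at_right x. W z * exp (- ?\<Phi> * z) <= W y * exp (- ?\<Phi> * y)"
   by eventually_elim (use 3 pos in auto)
  ultimately show ?thesis by (intro tendsto_upperbound[where F = "at_right x"]) auto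
 qed simp
qed

text \<open>By \<open>W_exp_mono\<close> the tilted function stays above its value at
  \<open>x\<close> on all of \<open>[x, \<infinity>)\<close>, which bounds the transform at
  \<open>root q + r\<close> from below by that value times \<open>exp (- r * x) / r\<close>. The
  chord bound gives at most \<open>root q / (q * r)\<close> from above. The factors \<open>r\<close>
  cancel, and \<open>r\<close> tends to \<open>0\<close>.\<close>

lemma W_exp_le: "W x * exp (- root q * x) <= root q / q"
proof -
 let ?\<Phi> = "root q"
 have \<Phi>: "0 < ?\<Phi>" by (rule root_pos[OF q_pos])
 have bd: "W x * exp (- ?\<Phi> * x) <= ?\<Phi> / q * exp (r * x)" if r: "0 < r" for r
 proof -
  define z where "z = ?\<Phi> + r"
  have z: "?\<Phi> < z" using r by (simp add: z_def)
  have sl: "q / ?\<Phi> * r <= \<psi> z - q" using \<psi>_slope[OF q_pos, of z] r by (simp add: z_def)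
  have sl0: "0 < q / ?\<Phi> * r" using q_pos \<Phi> r by simp
  have w0: "0 <= W x * exp (- ?\<Phi> * x)" using W_nonneg by simp
  have "ennreal (W x * exp (- ?\<Phi> * x) * (exp (- r * x) / r))
    = ennreal (W x * exp (- ?\<Phi> * x)) * (\<L> y. nexp (- r * y) * ind {x..} y)"
   unfolding nn_exp_tail[OF r] by (rule ennreal_mult) (use w0 r in auto)
  also have "... = (\<L> y. ennreal (W x * exp (- ?\<Phi> * x)) * (nexp (- r * y) * ind {x..} y))"
   by (simp add: nn_integral_cmult)
  also have "... <= (\<L> y. ennreal (exp (- z * y) * W y))"
  proof (rule nn_integral_mono)
   fix y
   show "ennreal (W x * exp (- ?\<Phi> * x)) * (nexp (- r * y) * ind {x..} y) <= ennreal (exp (- z * y) * W y)"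
   proof (cases "x <= y")
    case True
    have "W x * exp (- ?\<Phi> * x) * exp (- r * y) <= W y * exp (- ?\<Phi> * y) * exp (- r * y)"
     by (intro mult_right_mono W_exp_mono True) auto
    also have "... = exp (- z * y) * W y"
     by (simp add: z_def mult.assoc flip: exp_add) (simp add: algebra_simps)
    finally show ?thesis using True w0 by (simp add: ennreal_leI flip: ennreal_mult)
   qed simp
  qed
  also have "... = ennreal (1 / (\<psi> z - q))" by (rule W_laplace_nn[OF z])
  also have "... <= ennreal (1 / (q / ?\<Phi> * r))" using sl sl0 by (intro ennreal_leI frac_le) auto
  finally have "W x * exp (- ?\<Phi> * x) * (exp (- r * x) / r) <= 1 / (q / ?\<Phi> * r)"
   by (rule iffD1[OF ennreal_le_iff, rotated]) (use q_pos r \<Phi> in simp)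
  then have "W x * exp (- ?\<Phi> * x) * exp (- r * x) <= ?\<Phi> / q" using r q_pos \<Phi> by (simp add: field_simps)
  then have "W x * exp (- ?\<Phi> * x) * exp (- r * x) * exp (r * x) <= ?\<Phi> / q * exp (r * x)"
   by (intro mult_right_mono) auto
  then show ?thesis by (simp add: mult.assoc flip: exp_add)
 qed
 have "((%r. ?\<Phi> / q * exp (r * x)) \<longlongrightarrow> ?\<Phi> / q * exp (0 * x)) (at_right 0)"
  by (intro tendsto_intros)
 moreover have "\<forall>\<^sub>F r in at_right 0. W x * exp (- ?\<Phi> * x) <= ?\<Phi> / q * exp (r * x)"
  using eventually_at_right_less[of "0 :: real"] by eventually_elim (rule bd)
 ultimately show ?thesis by (intro tendsto_lowerbound[where F = "at_right 0" and f = "%r. ?\<Phi> / q * exp (r * x)"]) auto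
qed

end

lemma indicator_Ici_right:
 fixes a x :: real
 shows "((ind {a..} :: real => real) \<longlongrightarrow> ind {a..} x) (at_right x)"
proof -
 have "\<forall>\<^sub>F y in at_right x. (ind {a..} y :: real) = ind {a..} x"
 proof (cases "x < a")
  case True
  then have "\<forall>\<^sub>F y in at_right x. y \<in> {x<..<a}" by (intro eventually_at_right_real)
  then show ?thesis by eventually_elim (use True in auto)
 next
  case False
  then have "\<forall>\<^sub>F y in at_right x. y \<in> {x<..<x+1}" by (intro eventually_at_right_real) auto
  then show ?thesis by eventually_elim (use False in auto)
 qed
 then show ?thesis by (rule tendsto_eventually)
qed

section \<open>Real-valued Dynkin identity and asymptotics at infinity\<close>

context scale_process
begin

lemma occ_finite:
 assumes "0 <= h" "!!x. f x <= B" "0 <= B"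
 shows "occ q f h v < \<infinity>"
proof -
 have "occ q f h v <= ennreal (B * h)" by (rule occ_le[OF q_pos assms])
 then show ?thesis by (simp add: order_le_less_trans)
qed

lemma dynkin_real:
 assumes [measurable]: "f \<in> borel_measurable borel" and f: "!!x. 0 <= f x" "!!x. f x <= B" "!!x. x < a ==> f x = 0"
  and right: "!!x. (f \<longlongrightarrow> f x) (at_right x)" and h: "0 <= h"
 shows "integrable M (%w. enn2real (cv f (v + X h w)))"
  and "exp (- q * h) * (LINT w|M. enn2real (cv f (v + X h w))) = enn2real (cv f v) + enn2real (occ q f h v)"
proof -
 have [measurable]: "X h \<in> borel_measurable M" using h by (rule X_measurable)
 have B: "0 <= B" using f(1,2) order_trans by blast
 have fin: "cv f x < \<infinity>" for x by (rule cv_finite[OF assms(1) f])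
 have ofin: "occ q f h v < \<infinity>" by (rule occ_finite[OF h f(2) B])
 have eq: "nexp (- q * h) * (\<E> w. ennreal (enn2real (cv f (v + X h w)))) = cv f v + occ q f h v"
 proof -
  have "nexp (- q * h) * (\<E> w. cv f (v + X h w)) = cv f v + occ q f h v"
   by (rule dynkin_cv[OF assms(1) f right h])
  then show ?thesis using fin by simp
 qed
 have lt: "(\<E> w. ennreal (enn2real (cv f (v + X h w)))) < \<infinity>"
 proof (rule ccontr)
  assume "~ ?thesis"
  then have "(\<E> w. ennreal (enn2real (cv f (v + X h w)))) = \<top>"
   by (metis infinity_ennreal_def less_top)
  then have "cv f v + occ q f h v = \<top>" using eq by (simp add: ennreal_mult_top)
  then show False using fin[of v] ofin by auto
 qed
 show int: "integrable M (%w. enn2real (cv f (v + X h w)))"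
  using lt by (intro integrableI_nonneg) auto
 have "ennreal (exp (- q * h) * (LINT w|M. enn2real (cv f (v + X h w)))) = ennreal (enn2real (cv f v) + enn2real (occ q f h v))"
  using eq fin[of v] ofin nn_integral_eq_integral[OF int] by (simp add: ennreal_mult integral_nonneg_AE)
 then show "exp (- q * h) * (LINT w|M. enn2real (cv f (v + X h w))) = enn2real (cv f v) + enn2real (occ q f h v)"
  by (subst (asm) ennreal_inj) (auto intro!: mult_nonneg_nonneg integral_nonneg_AE)
qed

text \<open>Finite by \<open>W_exp_le\<close>. The same constant occurs for every source, so it
  cancels when two convolutions are compared at infinity.\<close>

definition W_lim :: real where
 "W_lim = (SUP x. W x * exp (- root q * x))"

lemma W_lim: "((%x. W x * exp (- root q * x)) \<longlongrightarrow> W_lim) at_top" and W_lim_pos: "0 < W_lim"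
proof -
 have bdd: "bdd_above (range (%x. W x * exp (- root q * x)))"
  using W_exp_le by (intro bdd_aboveI[where M = "root q / q"]) auto
 show "((%x. W x * exp (- root q * x)) \<longlongrightarrow> W_lim) at_top"
  unfolding W_lim_def
 proof (rule order_tendstoI)
  fix a assume "a < (SUP x. W x * exp (- root q * x))"
  then obtain x where x: "a < W x * exp (- root q * x)" using less_cSUP_iff[OF _ bdd] by auto
  have "ALL y>=x. a < W y * exp (- root q * y)"
   by (intro allI impI) (rule order_less_le_trans[OF x W_exp_mono])
  then show "\<forall>\<^sub>F x in at_top. a < W x * exp (- root q * x)" by (auto simp: eventually_at_top_linorder)
 next
  fix a assume "(SUP x. W x * exp (- root q * x)) < a"
  moreover have "W x * exp (- root q * x) <= (SUP x. W x * exp (- root q * x))" for x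
   by (rule cSUP_upper[OF UNIV_I bdd])
  ultimately show "\<forall>\<^sub>F x in at_top. W x * exp (- root q * x) < a"
   by (intro always_eventually allI) (rule order_le_less_trans)
 qed
 have "0 < W 1 * exp (- root q * 1)" using W_pos[of 1] by simp
 also have "... <= W_lim" unfolding W_lim_def by (rule cSUP_upper[OF _ bdd]) simp
 finally show "0 < W_lim" .
qed

text \<open>Distributing \<open>exp (- root q * x)\<close> over kernel and source leaves the kernel
  \<open>W u * exp (- root q * u)\<close>, which is bounded by \<open>root q / q\<close> and tends
  to \<open>W_lim\<close>; dominated convergence applies.\<close>

lemma cv_asymp:
 assumes [measurable]: "f \<in> borel_measurable borel" and f: "!!x. 0 <= f x"
  and fin: "(\<L> y. ennreal (exp (- root q * y) * f y)) < \<infinity>"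
 shows "((%x. nexp (- root q * x) * cv f x) \<longlongrightarrow> ennreal W_lim * (\<L> y. ennreal (exp (- root q * y) * f y))) at_top"
proof (rule tendsto_at_topI_sequentially)
 fix u :: "nat => real" assume u: "filterlim u at_top sequentially"
 have eq: "nexp (- root q * x) * cv f x
   = (\<L> y. ennreal (W (x - y) * exp (- root q * (x - y))) * ennreal (exp (- root q * y) * f y))" for x
 proof -
  have "nexp (- root q * x) * cv f x = (\<L> y. nexp (- root q * x) * ennreal (W (x - y) * f y))"
   unfolding cv_def by (rule nn_integral_cmult[symmetric]) measurable
  also have "... = (\<L> y. ennreal (W (x - y) * exp (- root q * (x - y))) * ennreal (exp (- root q * y) * f y))"
  proof (rule nn_integral_cong)
   fix y
   have "exp (- root q * x) = exp (- root q * (x - y)) * exp (- root q * y)"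
    by (simp add: exp_add [symmetric] algebra_simps)
   then show "nexp (- root q * x) * ennreal (W (x - y) * f y)
    = ennreal (W (x - y) * exp (- root q * (x - y))) * ennreal (exp (- root q * y) * f y)"
    using f W_nonneg by (simp add: mult_ac flip: ennreal_mult)
  qed
  finally show ?thesis .
 qed
 have "(%n. (\<L> y. ennreal (W (u n - y) * exp (- root q * (u n - y))) * ennreal (exp (- root q * y) * f y)))
   ----> (\<L> y. ennreal W_lim * ennreal (exp (- root q * y) * f y))"
 proof (rule nn_integral_dominated_convergence[where w = "%y. ennreal (root q / q) * ennreal (exp (- root q * y) * f y)"])
  show "!!j. AE y in lborel. ennreal (W (u j - y) * exp (- root q * (u j - y))) * ennreal (exp (- root q * y) * f y)
    <= ennreal (root q / q) * ennreal (exp (- root q * y) * f y)"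
   by (intro AE_I2 mult_right_mono ennreal_leI W_exp_le) auto
  show "(\<L> y. ennreal (root q / q) * ennreal (exp (- root q * y) * f y)) < \<infinity>"
   using fin by (subst nn_integral_cmult) (auto simp: ennreal_mult_less_top)
  show "AE y in lborel. (%n. ennreal (W (u n - y) * exp (- root q * (u n - y))) * ennreal (exp (- root q * y) * f y))
   ----> ennreal W_lim * ennreal (exp (- root q * y) * f y)"
  proof (rule AE_I2)
   fix y
   have "filterlim (%n. u n - y) at_top sequentially"
    using filterlim_tendsto_add_at_top[OF tendsto_const[of "-y"] u] by simp
   then have "(%n. W (u n - y) * exp (- root q * (u n - y))) ----> W_lim"
    by (rule filterlim_compose[OF W_lim])
   then show "(%n. ennreal (W (u n - y) * exp (- root q * (u n - y))) * ennreal (exp (- root q * y) * f y))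
    ----> ennreal W_lim * ennreal (exp (- root q * y) * f y)"
    using W_lim_pos by (intro tendsto_mult_ennreal tendsto_ennrealI tendsto_const) auto
  qed
 qed measurable
 then show "(%n. nexp (- root q * u n) * cv f (u n)) ----> ennreal W_lim * (\<L> y. ennreal (exp (- root q * y) * f y))"
  unfolding eq by (subst (asm) nn_integral_cmult) auto
qed

lemma cv_asymp_real:
 assumes "f \<in> borel_measurable borel" "!!x. 0 <= f x" "!!x. f x <= B" "!!x. x < a ==> f x = 0"
  and fin: "(\<L> y. ennreal (exp (- root q * y) * f y)) = ennreal J" "0 <= J"
 shows "((%x. exp (- root q * x) * enn2real (cv f x)) \<longlongrightarrow> W_lim * J) at_top"
proof -
 have "((%x. nexp (- root q * x) * cv f x) \<longlongrightarrow> ennreal W_lim * ennreal J) at_top"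
  using cv_asymp[OF assms(1,2)] fin by simp
 then have "((%x. enn2real (nexp (- root q * x) * cv f x)) \<longlongrightarrow> enn2real (ennreal W_lim * ennreal J)) at_top"
  by (intro tendsto_enn2real) (auto simp: ennreal_mult_less_top intro!: always_eventually)
 then show ?thesis using W_lim_pos fin(2) by (simp add: enn2real_mult)
qed

end

section \<open>Harmonic functions of the refracted-reflected dynamics\<close>

lemma nn_exp_Ici:
 fixes z a :: real
 assumes "0 < z"
 shows "(\<L> x. ennreal (exp (- z * x) * ind {a..} x)) = ennreal (exp (- z * a) / z)"
 unfolding nn_exp_tail[OF assms, symmetric] by (intro nn_integral_cong) (auto simp: indicator_def)

context scale_process
begin

lemma cv_right:
 assumes [measurable]: "f \<in> borel_measurable borel" and f: "!!x. 0 <= f x" "!!x. f x <= B" "!!x. x < a ==> f x = 0"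
  and right: "!!x. (f \<longlongrightarrow> f x) (at_right x)" and u: "!!n. v < u n" "!!n. u n <= v + 1" "u ----> v"
 shows "(%n. cv f (u n)) ----> cv f v"
proof (rule cv_tendsto[OF assms(1) f u(2)])
 show "AE z in lborel. (%n. f (u n - z)) ----> f (v - z)"
 proof (rule AE_I2)
  fix z
  have "filterlim (%n. u n - z) (at_right (v - z)) sequentially"
   using u by (intro filterlim_at_right_seq) (auto intro: tendsto_diff)
  then show "(%n. f (u n - z)) ----> f (v - z)" by (rule filterlim_compose[OF right])
 qed
qed

lemma cv_mono: "(!!x. f x <= g x) ==> cv f x <= cv g x"
 unfolding cv_def by (intro nn_integral_mono ennreal_leI mult_left_mono W_nonneg)

lemma cv_add:
 assumes [measurable]: "f \<in> borel_measurable borel" "g \<in> borel_measurable borel" and "!!x. 0 <= f x" "!!x. 0 <= g x"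
 shows "cv (%x. f x + g x) x = cv f x + cv g x"
 unfolding cv_def using assms(3,4) W_nonneg by (simp add: distrib_left nn_integral_add)

lemma cv_cmult:
 assumes [measurable]: "f \<in> borel_measurable borel" and "!!x. 0 <= f x" "0 <= c"
 shows "cv (%x. c * f x) x = ennreal c * cv f x"
 unfolding cv_def using assms W_nonneg
 by (simp add: nn_integral_cmult [symmetric] mult.left_commute flip: ennreal_mult)

lemma cv_cong_le:
 assumes "!!y. y <= x ==> f y = g y"
 shows "cv f x = cv g x"
 unfolding cv_def
proof (rule nn_integral_cong)
 fix y
 show "ennreal (W (x - y) * f y) = ennreal (W (x - y) * g y)"
  using assms[of y] W_neg[of "x - y"] by (cases "y <= x") auto
qed

lemma cv_eq_0:
 assumes "!!y. y < a ==> f y = 0" "x <= a"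
 shows "cv f x = 0"
proof -
 have "AE y in lborel. y ~= x" by (rule AE_lborel_singleton)
 then have "AE y in lborel. ennreal (W (x - y) * f y) = 0"
 proof eventually_elim
  case (elim y)
  then show ?case using assms W_neg[of "x - y"] by (cases "y < x") auto
 qed
 then have "cv f x = (\<integral>\<^sup>+y. 0 \<partial>(lborel :: real measure))" unfolding cv_def by (rule nn_integral_cong_AE)
 then show ?thesis by simp
qed

end

locale refracted_scales =
 X: scale_process M X \<psi> q W +
 Y: scale_process M "%t w. X t w - \<delta> * t" "%z. \<psi> z - \<delta> * z" q WY
 for M :: "'a measure" and X \<psi> q W and \<delta> :: real and WY +
 fixes b :: real
 assumes \<delta>_pos: "0 < \<delta>" and b_pos: "0 < b"
begin

abbreviation "\<phi> \<equiv> Y.root q"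

lemma \<phi>_pos: "0 < \<phi>" by (rule Y.root_pos[OF X.q_pos])

lemma \<psi>_\<phi>: "\<psi> \<phi> = q + \<delta> * \<phi>"
 using Y.\<psi>_root[OF X.q_pos] by simp

lemma root_less: "X.root q < \<phi>"
 using X.\<psi>_lt_root[OF X.q_pos \<phi>_pos] X.\<psi>_root[OF X.q_pos] \<psi>_\<phi> \<delta>_pos \<phi>_pos
 by (smt (verit) mult_pos_pos)

lemma Ici_good:
 "(ind {c..} :: real => real) \<in> borel_measurable borel"
 "0 <= (ind {c..} x :: real)" "(ind {c..} x :: real) <= 1" "x < c ==> (ind {c..} x :: real) = 0"
 "((ind {c..} :: real => real) \<longlongrightarrow> ind {c..} x) (at_right x)"
 by (auto simp: indicator_Ici_right)

text \<open>Truncation turns \<open>W\<close> into a bounded source vanishing on the left, as the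
  Dynkin identity requires. The cut \<open>c\<close> takes the place of the refraction
  level.\<close>

definition Wcut :: "real => real => real" where
 "Wcut c y = W y * ind {0..<c} y"

lemma Wcut_good:
 "Wcut c \<in> borel_measurable borel" "0 <= Wcut c x" "Wcut c x <= W c" "x < 0 ==> Wcut c x = 0"
 "(Wcut c \<longlongrightarrow> Wcut c x) (at_right x)"
proof -
 show "Wcut c \<in> borel_measurable borel" unfolding Wcut_def[abs_def] by measurable
 show "(Wcut c \<longlongrightarrow> Wcut c x) (at_right x)"
  unfolding Wcut_def[abs_def] by (intro tendsto_mult X.W_right X.indicator_Ico_right)
qed (auto simp: Wcut_def indicator_def X.W_nonneg X.W_mono)

text \<open>A partial fraction identity: with \<open>A = \<psi> z - q\<close> and
  \<open>B = A - \<delta> * z\<close> the transforms satisfy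
  \<open>1 / (A * z) + \<delta> / (A * B) = 1 / (B * z)\<close>. It relates the integrated scale
  functions of \<open>X\<close> and \<open>Y\<close>.\<close>

lemma cv_identity: "X.cv (ind {0..}) x + ennreal \<delta> * Y.cv W x = Y.cv (ind {0..}) x"
proof (rule AE_eq_right_limit)
 note [measurable] = Ici_good(1)
 show "AE v in lborel. X.cv (ind {0..}) v + ennreal \<delta> * Y.cv W v = Y.cv (ind {0..}) v"
 proof (rule bilateral_laplace_unique[where ?z0.0 = \<phi>])
  fix z assume z: "\<phi> < z"
  have z0: "0 < z" using z \<phi>_pos by simp
  have zX: "X.root q < z" using z root_less by simp
  have p: "0 < \<psi> z - q" "0 < \<psi> z - \<delta> * z - q" using X.\<psi>_gt_root[OF X.q_pos zX] Y.\<psi>_gt_root[OF X.q_pos z] by auto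
  have tY: "(\<L> v. nexp (- z * v) * Y.cv (ind {0..}) v) = ennreal (1 / (\<psi> z - \<delta> * z - q) * (1 / z))"
   using p z0 by (subst Y.cv_laplace[OF _ _ z]) (use nn_exp_Ici[OF z0, of 0] in \<open>auto simp flip: ennreal_mult\<close>)
  have tX: "(\<L> v. nexp (- z * v) * X.cv (ind {0..}) v) = ennreal (1 / (\<psi> z - q) * (1 / z))"
   using p z0 by (subst X.cv_laplace[OF _ _ zX]) (use nn_exp_Ici[OF z0, of 0] in \<open>auto simp flip: ennreal_mult\<close>)
  have tW: "(\<L> v. nexp (- z * v) * Y.cv W v) = ennreal (1 / (\<psi> z - \<delta> * z - q) * (1 / (\<psi> z - q)))"
   using p by (subst Y.cv_laplace[OF _ _ z]) (use X.W_laplace_nn[OF zX] in \<open>auto simp: X.W_nonneg simp flip: ennreal_mult\<close>)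
  show "(\<L> v. nexp (- z * v) * Y.cv (ind {0..}) v) < \<infinity>"
   unfolding tY by simp
  have "(\<L> v. nexp (- z * v) * (X.cv (ind {0..}) v + ennreal \<delta> * Y.cv W v))
   = (\<L> v. nexp (- z * v) * X.cv (ind {0..}) v + ennreal \<delta> * (nexp (- z * v) * Y.cv W v))"
   by (simp add: distrib_left mult_ac)
  also have "... = ennreal (1 / (\<psi> z - q) * (1 / z)) + ennreal \<delta> * ennreal (1 / (\<psi> z - \<delta> * z - q) * (1 / (\<psi> z - q)))"
  proof -
   have m1: "(%v. nexp (- z * v) * X.cv (ind {0..}) v) \<in> borel_measurable lborel"
    and m2: "(%v. nexp (- z * v) * Y.cv W v) \<in> borel_measurable lborel" by measurable
   show ?thesis by (subst nn_integral_add) (simp_all only: m1 m2 nn_integral_cmult[OF m2] tX tW borel_measurable_const borel_measurable_times_ennreal)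
  qed
  also have "... = ennreal (1 / (\<psi> z - q) * (1 / z) + \<delta> * (1 / (\<psi> z - \<delta> * z - q) * (1 / (\<psi> z - q))))"
   using p z0 \<delta>_pos by (simp flip: ennreal_mult ennreal_plus)
  also have "1 / (\<psi> z - q) * (1 / z) + \<delta> * (1 / (\<psi> z - \<delta> * z - q) * (1 / (\<psi> z - q))) = 1 / (\<psi> z - \<delta> * z - q) * (1 / z)"
  proof -
   have frac: "1 / A * (1 / z) + \<delta> * (1 / B * (1 / A)) = 1 / B * (1 / z)" if "A > 0" "B > 0" "A = B + \<delta> * z" for A B
    using that(1,2) z0 by (simp add: divide_simps) (simp add: that(3) algebra_simps)
   show ?thesis by (rule frac) (use p in simp_all)
  qed
  finally show "(\<L> v. nexp (- z * v) * (X.cv (ind {0..}) v + ennreal \<delta> * Y.cv W v))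
   = (\<L> v. nexp (- z * v) * Y.cv (ind {0..}) v)" unfolding tY .
 qed measurable
next
 fix u :: "nat => real" assume u: "!!n. x < u n" "!!n. u n <= x + 1" "u ----> x"
 show "(%n. Y.cv (ind {0..}) (u n)) ----> Y.cv (ind {0..}) x"
  by (rule Y.cv_right[OF Ici_good u])
 \<comment> \<open>\<open>W\<close> is unbounded, but near \<open>x\<close> the convolution sees it
   only up to \<open>x + 1\<close>, so a cut at \<open>x + 2\<close> changes nothing.\<close>
 have cut: "Y.cv W y = Y.cv (Wcut (x + 2)) y" if "y <= x + 1" for y
  using that X.W_neg by (intro Y.cv_cong_le) (auto simp: Wcut_def indicator_def)
 have "(%n. Y.cv (Wcut (x + 2)) (u n)) ----> Y.cv (Wcut (x + 2)) x"
  by (rule Y.cv_right[OF Wcut_good u])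
 then have "(%n. Y.cv W (u n)) ----> Y.cv W x" using u(2) by (simp add: cut)
 then show "(%n. X.cv (ind {0..}) (u n) + ennreal \<delta> * Y.cv W (u n)) ----> X.cv (ind {0..}) x + ennreal \<delta> * Y.cv W x"
  by (intro tendsto_add X.cv_right[OF Ici_good u] ennreal_tendsto_cmult) auto
qed

text \<open>For \<open>c = b\<close> this is the term \<open>scale_bar WY (x - b)\<close> of the
  theorem.\<close>

definition F :: "real => real => real" where
 "F c x = enn2real (Y.cv (ind {c..}) x)"

definition G :: "real => real => real" where
 "G c x = enn2real (Y.cv (Wcut c) x)"

definition Z :: "real => real" where
 "Z x = 1 + q * enn2real (X.cv (ind {0..}) x)"

text \<open>For \<open>c = b\<close> this is the function \<open>scale_r\<close> of the theorem,
  rearranged by \<open>cv_identity\<close> so that every summand is a convolution for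
  \<open>Y\<close> with a bounded source.\<close>

definition r :: "real => real => real" where
 "r c x = 1 + q * F 0 x - \<delta> * q * G c x"

lemma cv_F: "Y.cv (ind {c..}) x = ennreal (F c x)"
 using Y.cv_finite[OF Ici_good(1-4)] by (simp add: F_def)

lemma cv_G: "Y.cv (Wcut c) x = ennreal (G c x)"
 using Y.cv_finite[OF Wcut_good(1-4)] by (simp add: G_def)

lemma cv_Z: "X.cv (ind {0..}) x = ennreal ((Z x - 1) / q)"
 using X.cv_finite[OF Ici_good(1-4)] X.q_pos by (simp add: Z_def)

lemma F_nonneg: "0 <= F c x" and G_nonneg: "0 <= G c x" and Z_ge_1: "1 <= Z x"
 using X.q_pos by (simp_all add: F_def G_def Z_def)

lemma borel_FGZ [measurable]: "F c \<in> borel_measurable borel" "G c \<in> borel_measurable borel" "Z \<in> borel_measurable borel"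
 "r c \<in> borel_measurable borel"
proof -
 note [measurable] = Ici_good(1) Wcut_good(1)
 show F: "F c \<in> borel_measurable borel" for c unfolding F_def[abs_def] by measurable
 show G: "G c \<in> borel_measurable borel" unfolding G_def[abs_def] by measurable
 show "Z \<in> borel_measurable borel" unfolding Z_def[abs_def] by measurable
 note [measurable] = F G
 show "r c \<in> borel_measurable borel" unfolding r_def[abs_def] by measurable
qed

lemma F_zero: "x <= c ==> F c x = 0"
 unfolding F_def by (subst Y.cv_eq_0[of c]) auto

lemma G_zero: "x <= 0 ==> G c x = 0"
 unfolding G_def by (subst Y.cv_eq_0[of 0]) (auto simp: Wcut_good)

lemma r_neg: "x <= 0 ==> r c x = 1"
 by (simp add: r_def F_zero G_zero)

lemma Z_neg: "x <= 0 ==> Z x = 1"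
 unfolding Z_def by (subst X.cv_eq_0[of 0]) auto

text \<open>By \<open>cv_identity\<close> the difference \<open>r c x - Z x\<close> is
  \<open>\<delta> * q\<close> times the part of \<open>Y.cv W x\<close> that comes from sources at
  or above \<open>c\<close>. The kernel looks only to the left of \<open>x\<close>, so this part
  vanishes up to \<open>c\<close>.\<close>

lemma r_ge_Z: "Z x <= r c x" and r_eq_Z: "x <= c ==> r c x = Z x"
proof -
 have "Y.cv W x ~= \<top>"
 proof
  assume "Y.cv W x = \<top>"
  then have "Y.cv (ind {0..}) x = \<top>" using cv_identity[of x] \<delta>_pos by (simp add: ennreal_mult_top)
  then show False by (simp add: cv_F)
 qed
 then obtain w where w: "Y.cv W x = ennreal w" "0 <= w" by (cases "Y.cv W x") auto
 have id: "(Z x - 1) / q + \<delta> * w = F 0 x"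
  using cv_identity[of x] \<delta>_pos w X.q_pos Z_ge_1[of x] F_nonneg[of 0 x]
  by (simp add: cv_F cv_Z flip: ennreal_mult ennreal_plus)
 have "Y.cv (Wcut c) x <= Y.cv W x"
  by (rule Y.cv_mono) (auto simp: Wcut_def indicator_def X.W_nonneg)
 then have "G c x <= w" using w by (simp add: cv_G)
 then have "\<delta> * q * G c x <= \<delta> * q * w" using \<delta>_pos X.q_pos by (intro mult_left_mono) auto
 moreover have zw: "q * F 0 x - \<delta> * q * w = Z x - 1"
  using X.q_pos by (simp add: id[symmetric] field_simps)
 ultimately show "Z x <= r c x" by (simp add: r_def)
 assume xc: "x <= c"
 have ae: "AE y in lborel. ennreal (WY (x - y) * Wcut c y) = ennreal (WY (x - y) * W y)"
  using AE_lborel_singleton[of x]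
 proof eventually_elim
  case (elim y)
  then show ?case using X.W_neg[of y] Y.W_neg[of "x - y"] xc by (auto simp: Wcut_def indicator_def)
 qed
 have "Y.cv (Wcut c) x = Y.cv W x"
  unfolding Y.cv_def by (rule nn_integral_cong_AE[OF ae])
 then have "G c x = w" using w G_nonneg[of c x] by (simp add: cv_G)
 then show "r c x = Z x" using zw by (simp add: r_def)
qed

lemma r_ge_1: "1 <= r c x"
 using r_ge_Z[of x c] Z_ge_1[of x] by simp

lemma r_le: "r c x <= 1 + q * F 0 x"
 using G_nonneg[of c x] \<delta>_pos X.q_pos by (simp add: r_def)

text \<open>The constants of \<open>Y.cv_exp_bound\<close> at the exponent
  \<open>\<phi> + 1\<close>; the further unit in \<open>k0\<close> absorbs the linear factor coming
  from the length of the support.\<close>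

definition k0 :: real where "k0 = \<phi> + 2"
definition K0 :: real where "K0 = (\<phi> + 1) / (\<psi> (\<phi> + 1) - \<delta> * (\<phi> + 1) - q)"

lemma k0_pos: "0 < k0" and K0_pos: "0 < K0"
 using \<phi>_pos Y.\<psi>_gt_root[OF X.q_pos, of "\<phi> + 1"] by (auto simp: k0_def K0_def)

lemma F_exp_bound: "F c x <= K0 * exp (k0 * (x - c))"
proof -
 have "Y.cv (ind {c..}) x <= ennreal (1 * (\<phi> + 1) / (\<psi> (\<phi> + 1) - \<delta> * (\<phi> + 1) - q) * exp ((\<phi> + 1 + 1) * (x - c)))"
  by (rule Y.cv_exp_bound[OF Ici_good(1-4)]) (auto intro: less_add_one)
 then have "ennreal (F c x) <= ennreal (K0 * exp (k0 * (x - c)))" by (simp add: cv_F K0_def k0_def add.assoc)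
 then show ?thesis using K0_pos by (simp add: ennreal_le_iff)
qed

text \<open>The difference is a convolution with a window of width \<open>c - b\<close>. The rate
  \<open>\<phi>\<close> comes from \<open>Y.W_exp_le\<close> and is the one for which
  \<open>exp_moment\<close> controls the chain; the cruder rate \<open>k0\<close> would be too large
  there.\<close>

lemma F_diff: 
 assumes "b <= c"
 shows "F c x <= F b x" "F b x - F c x <= (c - b) * (\<phi> / q) * exp (\<phi> * x)"
proof -
 have ind: "(ind {b..} y :: real) = ind {c..} y + ind {b..<c} y" for y
  using assms by (auto simp: indicator_def)
 have add: "Y.cv (ind {b..}) x = Y.cv (ind {c..}) x + Y.cv (ind {b..<c}) x"
  unfolding ind[abs_def] by (rule Y.cv_add) auto
 have "Y.cv (ind {b..<c}) x <= ennreal ((c - b) * WY (x - b))" by (rule Y.cv_Ico(1)[OF assms])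
 also have "... <= ennreal ((c - b) * (\<phi> / q * exp (\<phi> * x)))"
 proof (intro ennreal_leI mult_left_mono)
  have "WY (x - b) <= WY x" using b_pos by (intro Y.W_mono) simp
  also have "WY x = WY x * exp (- \<phi> * x) * exp (\<phi> * x)" by (simp add: mult.assoc flip: exp_add)
  also have "... <= \<phi> / q * exp (\<phi> * x)" by (intro mult_right_mono Y.W_exp_le) auto
  finally show "WY (x - b) <= \<phi> / q * exp (\<phi> * x)" .
 qed (use assms in auto)
 finally have le: "Y.cv (ind {b..<c}) x <= ennreal ((c - b) * (\<phi> / q * exp (\<phi> * x)))" .
 then obtain y where y: "Y.cv (ind {b..<c}) x = ennreal y" "0 <= y"
  by (cases "Y.cv (ind {b..<c}) x") (auto simp: top_unique)
 have "y <= (c - b) * (\<phi> / q * exp (\<phi> * x))"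
  using le y assms \<phi>_pos X.q_pos by (simp add: ennreal_le_iff)
 moreover have "F b x = F c x + y"
  using add y F_nonneg[of c x] F_nonneg[of b x] by (simp add: cv_F flip: ennreal_plus)
 ultimately show "F c x <= F b x" "F b x - F c x <= (c - b) * (\<phi> / q) * exp (\<phi> * x)" using y by auto
qed

lemma G_diff: 
 assumes "b <= c"
 shows "G b x <= G c x" "G c x - G b x <= W c * ((c - b) * (\<phi> / q) * exp (\<phi> * x))"
proof -
 have sum: "Wcut c y = Wcut b y + W y * ind {b..<c} y" for y
  using assms b_pos by (auto simp: indicator_def Wcut_def)
 have add: "Y.cv (Wcut c) x = Y.cv (Wcut b) x + Y.cv (%y. W y * ind {b..<c} y) x"
  unfolding sum[abs_def] by (rule Y.cv_add) (auto simp: Wcut_good X.W_nonneg)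
 have "Y.cv (%y. W y * ind {b..<c} y) x <= Y.cv (%y. W c * ind {b..<c} y) x"
  by (rule Y.cv_mono) (auto simp: indicator_def intro: X.W_mono)
 also have "... = ennreal (W c) * Y.cv (ind {b..<c}) x"
  by (rule Y.cv_cmult) (auto simp: X.W_nonneg)
 finally have le: "Y.cv (%y. W y * ind {b..<c} y) x <= ennreal (W c) * Y.cv (ind {b..<c}) x" .
 have ind: "(ind {b..} y :: real) = ind {c..} y + ind {b..<c} y" for y
  using assms by (auto simp: indicator_def)
 have addF: "Y.cv (ind {b..}) x = Y.cv (ind {c..}) x + Y.cv (ind {b..<c}) x"
  unfolding ind[abs_def] by (rule Y.cv_add) auto
 have "Y.cv (ind {b..<c}) x = ennreal (F b x - F c x)"
 proof -
  obtain y where y: "Y.cv (ind {b..<c}) x = ennreal y" "0 <= y"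
   using addF by (cases "Y.cv (ind {b..<c}) x") (auto simp: cv_F)
  then show ?thesis using addF F_nonneg[of c x] F_nonneg[of b x] by (auto simp: cv_F simp flip: ennreal_plus)
 qed
 then have le': "Y.cv (%y. W y * ind {b..<c} y) x <= ennreal (W c * (F b x - F c x))"
  using le F_diff(1)[OF assms] X.W_nonneg by (simp add: ennreal_mult)
 then obtain y where y: "Y.cv (%y. W y * ind {b..<c} y) x = ennreal y" "0 <= y"
  by (cases "Y.cv (%y. W y * ind {b..<c} y) x") (auto simp: top_unique)
 have "y <= W c * (F b x - F c x)"
  using le' y F_diff(1)[OF assms] X.W_nonneg by (simp add: ennreal_le_iff)
 also have "... <= W c * ((c - b) * (\<phi> / q) * exp (\<phi> * x))"
  by (intro mult_left_mono F_diff assms X.W_nonneg)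
 finally have "y <= W c * ((c - b) * (\<phi> / q) * exp (\<phi> * x))" .
 moreover have "G c x = G b x + y"
  using add y G_nonneg[of c x] G_nonneg[of b x] by (simp add: cv_G flip: ennreal_plus)
 ultimately show "G b x <= G c x" "G c x - G b x <= W c * ((c - b) * (\<phi> / q) * exp (\<phi> * x))" using y by auto
qed

end

section \<open>One-step estimates for the two functions\<close>

context refracted_scales
begin

text \<open>
 \<open>g\<close> solves the refracted-reflected equation with source \<open>-\<kappa>\<close> above \<open>b\<close>, up to moving the refraction level
 from \<open>b\<close> to \<open>c > b\<close>: the gap keeps the one-step error below \<open>b\<close> of order \<open>o(h)\<close>, and the error above \<open>b\<close>
 is controlled by the time spent in \<open>(-\<infinity>, c)\<close>.
\<close>
definition admissible :: "(real => real) => real => bool" where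
 "admissible g \<kappa> \<longleftrightarrow> g \<in> borel_measurable borel & (ALL x. 0 <= g x) & (EX K>=0. EX k>=0. ALL c. b < c & c <= b + 1 --> (EX g'. g' \<in> borel_measurable borel & (ALL x. 0 <= g' x) &
  (ALL x<=0. g' x = g' 0) & (ALL x>=0. \<bar>g x - g' x\<bar> <= K * (c - b) * exp (\<phi> * x)) &
  (ALL v h. b < v --> 0 < h -->
   nexp (- q * h) * (\<E> w. ennreal (g' (v + (X h w - \<delta> * h)))) <= ennreal (g' v + \<kappa> * ((1 - exp (- q * h)) / q)) &
   ennreal (g' v + \<kappa> * ((1 - exp (- q * h)) / q)) <= nexp (- q * h) * (\<E> w. ennreal (g' (v + (X h w - \<delta> * h))))
    + ennreal K * Y.occ q (ind {..<c}) h v) &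
  (ALL v h. 0 <= v --> v <= b --> 0 < h -->
   nexp (- q * h) * (\<E> w. ennreal (g' (v + X h w))) <= ennreal (g' v)
    + ennreal K * (\<E> w. nexp (k * X h w) * ind {c - b<..} (X h w)) &
   ennreal (g' v) <= nexp (- q * h) * (\<E> w. ennreal (g' (v + X h w)))
    + ennreal K * Y.occ q (ind {..<0}) h v)))"

lemma X_meas [measurable]: "0 <= h ==> X h \<in> borel_measurable M"
 by (rule X.X_measurable)

lemma occ_X_le_Y: "X.occ q (ind {..<0}) h v <= Y.occ q (ind {..<0}) h v"
 unfolding X.occ_def Y.occ_def
proof (intro nn_integral_mono mult_right_mono ennreal_leI mult_left_mono)
 fix s w
 have "0 <= \<delta> * max 0 s" using \<delta>_pos by (intro mult_nonneg_nonneg) auto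
 then show "(ind {..<0} (v + X (max 0 s) w) :: real) <= ind {..<0} (v + (X (max 0 s) w - \<delta> * max 0 s))"
  by (auto simp: indicator_def)
qed auto

lemma occ_complement:
 assumes "0 < h"
 shows "Y.occ q (ind {c..}) h v + Y.occ q (ind {..<c}) h v = ennreal ((1 - exp (- q * h)) / q)"
  and "X.occ q (ind {c..}) h v + X.occ q (ind {..<c}) h v = ennreal ((1 - exp (- q * h)) / q)"
proof -
 have ind: "(ind {c..} x :: real) + ind {..<c} x = 1" for x by (auto simp: indicator_def)
 show "Y.occ q (ind {c..}) h v + Y.occ q (ind {..<c}) h v = ennreal ((1 - exp (- q * h)) / q)"
  using assms by (subst Y.occ_add[symmetric]) (auto simp: ind Y.occ_one[OF X.q_pos])
 show "X.occ q (ind {c..}) h v + X.occ q (ind {..<c}) h v = ennreal ((1 - exp (- q * h)) / q)"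
  using assms by (subst X.occ_add[symmetric]) (auto simp: ind X.occ_one[OF X.q_pos])
qed

lemma occ_real:
 assumes h: "0 < h"
 shows "0 <= enn2real (Y.occ q (ind A) h v)" "Y.occ q (ind A) h v = ennreal (enn2real (Y.occ q (ind A) h v))"
  "X.occ q (ind A) h v = ennreal (enn2real (X.occ q (ind A) h v))"
  "Y.occ q (Wcut c) h v = ennreal (enn2real (Y.occ q (Wcut c) h v))"
 using Y.occ_finite[of h "ind A" 1 v] X.occ_finite[of h "ind A" 1 v] Y.occ_finite[of h "Wcut c" "W c" v] h
 by (auto simp: indicator_def Wcut_good X.W_nonneg less_top)

lemma w_step_above:
 assumes h: "0 < h" and c: "0 <= c"
 shows "nexp (- q * h) * (\<E> w. ennreal (F c (v + (X h w - \<delta> * h)))) <= ennreal (F c v + 1 * ((1 - exp (- q * h)) / q))"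
  and "ennreal (F c v + 1 * ((1 - exp (- q * h)) / q)) <= nexp (- q * h) * (\<E> w. ennreal (F c (v + (X h w - \<delta> * h))))
    + Y.occ q (ind {..<c}) h v"
proof -
 have D: "nexp (- q * h) * (\<E> w. Y.cv (ind {c..}) (v + (X h w - \<delta> * h))) = Y.cv (ind {c..}) v + Y.occ q (ind {c..}) h v"
  by (rule Y.dynkin_cv[OF Ici_good]) (use h in auto)
 have one: "ennreal (F c v + 1 * ((1 - exp (- q * h)) / q)) = ennreal (F c v) + (Y.occ q (ind {c..}) h v + Y.occ q (ind {..<c}) h v)"
  unfolding occ_complement(1)[OF h] using F_nonneg[of c v] h X.q_pos by (simp flip: ennreal_plus)
 show "nexp (- q * h) * (\<E> w. ennreal (F c (v + (X h w - \<delta> * h)))) <= ennreal (F c v + 1 * ((1 - exp (- q * h)) / q))"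
  "ennreal (F c v + 1 * ((1 - exp (- q * h)) / q)) <= nexp (- q * h) * (\<E> w. ennreal (F c (v + (X h w - \<delta> * h))))
    + Y.occ q (ind {..<c}) h v"
  unfolding one cv_F[symmetric] D by (simp_all add: add.assoc add_left_mono)
qed

text \<open>Discounting the constant 1 loses \<open>q\<close> times the discounted time; the term
  \<open>q * F 0\<close> gives back the share spent above \<open>0\<close>. What is missing is the
  time \<open>o3\<close> below \<open>0\<close> and the source \<open>o2\<close> of
  \<open>G c\<close>, both bounded by the time \<open>o4\<close> spent below
  \<open>c\<close>.\<close>

lemma r_step_above:
 assumes h: "0 < h" and c: "0 < c"
 shows "nexp (- q * h) * (\<E> w. ennreal (r c (v + (X h w - \<delta> * h)))) <= ennreal (r c v)"
  and "ennreal (r c v) <= nexp (- q * h) * (\<E> w. ennreal (r c (v + (X h w - \<delta> * h))))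
    + ennreal (q + \<delta> * q * W c) * Y.occ q (ind {..<c}) h v"
proof -
 have h0: "0 <= h" using h by simp
 let ?D = "exp (- q * h)"
 let ?Y = "%w. X h w - \<delta> * h"
 define o1 where "o1 = enn2real (Y.occ q (ind {0..}) h v)"
 define o2 where "o2 = enn2real (Y.occ q (Wcut c) h v)"
 define o3 where "o3 = enn2real (Y.occ q (ind {..<0}) h v)"
 define o4 where "o4 = enn2real (Y.occ q (ind {..<c}) h v)"
 have o: "0 <= o1" "0 <= o2" "0 <= o3" "0 <= o4" by (auto simp: o1_def o2_def o3_def o4_def)
 have iF: "integrable M (%w. F 0 (v + ?Y w))" and eF: "?D * (LINT w|M. F 0 (v + ?Y w)) = F 0 v + o1"
  using Y.dynkin_real[OF Ici_good h0] unfolding F_def o1_def by auto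
 have iG: "integrable M (%w. G c (v + ?Y w))" and eG: "?D * (LINT w|M. G c (v + ?Y w)) = G c v + o2"
  using Y.dynkin_real[OF Wcut_good h0] unfolding G_def o2_def by auto
 have ir: "integrable M (%w. r c (v + ?Y w))"
  unfolding r_def using iF iG by (intro Bochner_Integration.integrable_diff Bochner_Integration.integrable_add integrable_mult_right) auto
 have "(LINT w|M. r c (v + ?Y w)) = 1 + q * (LINT w|M. F 0 (v + ?Y w)) - \<delta> * q * (LINT w|M. G c (v + ?Y w))"
  unfolding r_def using iF iG by (simp add: X.prob_space)
 then have "?D * (LINT w|M. r c (v + ?Y w)) = ?D * (1 + q * (LINT w|M. F 0 (v + ?Y w)) - \<delta> * q * (LINT w|M. G c (v + ?Y w)))"
  by (rule arg_cong)
 also have "... = ?D + q * (?D * (LINT w|M. F 0 (v + ?Y w))) - \<delta> * q * (?D * (LINT w|M. G c (v + ?Y w)))"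
  by (simp add: algebra_simps)
 also have "... = r c v - (1 - ?D - q * o1) - \<delta> * q * o2" unfolding eF eG by (simp add: r_def algebra_simps)
 also have "1 - ?D - q * o1 = q * o3"
 proof -
  have "ennreal (o1 + o3) = ennreal ((1 - ?D) / q)"
   using occ_complement(1)[OF h, of 0 v] o unfolding o1_def o3_def by (simp add: occ_real(2)[OF h, symmetric])
  then have "o1 + o3 = (1 - ?D) / q" using o h X.q_pos by (subst (asm) ennreal_inj) auto
  then show ?thesis using X.q_pos by (simp add: field_simps)
 qed
 finally have e: "?D * (LINT w|M. r c (v + ?Y w)) = r c v - q * o3 - \<delta> * q * o2" .
 have nn: "ennreal ?D * (\<E> w. ennreal (r c (v + ?Y w))) = ennreal (r c v - q * o3 - \<delta> * q * o2)"
  unfolding e[symmetric] using r_ge_1[of c] ir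
  by (subst nn_integral_eq_integral) (auto simp: ennreal_mult' intro!: order_trans[OF zero_le_one])
 show "ennreal ?D * (\<E> w. ennreal (r c (v + ?Y w))) <= ennreal (r c v)"
 proof -
  have "0 <= q * o3 + \<delta> * q * o2" using o X.q_pos \<delta>_pos by (intro add_nonneg_nonneg mult_nonneg_nonneg) auto
  then show ?thesis unfolding nn by (intro ennreal_leI) simp
 qed
 have o34: "o3 <= o4"
  unfolding o3_def o4_def using c Y.occ_finite[of h "ind {..<c}" 1 v] h
  by (intro enn2real_mono Y.occ_mono) (auto simp: indicator_def)
 have o24: "o2 <= W c * o4"
 proof -
  have "Y.occ q (Wcut c) h v <= Y.occ q (%x. W c * ind {..<c} x) h v"
   by (rule Y.occ_mono) (auto simp: Wcut_def indicator_def X.W_nonneg intro: X.W_mono)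
  also have "... = ennreal (W c) * Y.occ q (ind {..<c}) h v"
   by (rule Y.occ_cmult) (auto simp: X.W_nonneg)
  finally have "Y.occ q (Wcut c) h v <= ennreal (W c * o4)"
   unfolding o4_def using X.W_nonneg occ_real(2)[OF h] by (simp add: ennreal_mult)
  then show ?thesis unfolding o2_def using X.W_nonneg o(4) by (intro enn2real_leI) auto
 qed
 have "r c v = (r c v - q * o3 - \<delta> * q * o2) + (q * o3 + \<delta> * q * o2)" by simp
 also have "... <= (r c v - q * o3 - \<delta> * q * o2) + (q * o4 + \<delta> * q * (W c * o4))"
  using o34 o24 X.q_pos \<delta>_pos by (intro add_mono mult_left_mono order_refl) auto
 also have "... = (r c v - q * o3 - \<delta> * q * o2) + (q + \<delta> * q * W c) * o4" by (simp add: algebra_simps)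
 finally have "ennreal (r c v) <= ennreal ((r c v - q * o3 - \<delta> * q * o2) + (q + \<delta> * q * W c) * o4)"
  by (rule ennreal_leI)
 also have "... <= ennreal (r c v - q * o3 - \<delta> * q * o2) + ennreal ((q + \<delta> * q * W c) * o4)"
 proof -
  have "0 <= r c v - q * o3 - \<delta> * q * o2"
   unfolding e[symmetric] by (intro mult_nonneg_nonneg integral_nonneg_AE AE_I2) (auto intro: order_trans[OF zero_le_one r_ge_1])
  moreover have "0 <= (q + \<delta> * q * W c) * o4"
   using o X.q_pos \<delta>_pos X.W_nonneg by (intro mult_nonneg_nonneg add_nonneg_nonneg) auto
  ultimately show ?thesis by (subst ennreal_plus) auto
 qed
 also have "ennreal ((q + \<delta> * q * W c) * o4) = ennreal (q + \<delta> * q * W c) * Y.occ q (ind {..<c}) h v"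
  unfolding o4_def using X.q_pos \<delta>_pos X.W_nonneg by (simp add: ennreal_mult occ_real(2)[OF h, symmetric])
 finally show "ennreal (r c v) <= ennreal ?D * (\<E> w. ennreal (r c (v + ?Y w)))
    + ennreal (q + \<delta> * q * W c) * Y.occ q (ind {..<c}) h v"
  unfolding nn .
qed

lemma disc_le_1: "0 < h ==> nexp (- q * h) * a <= a"
 using mult_right_mono[of "nexp (- q * h)" 1 a] X.q_pos by (simp add: ennreal_le_1)

text \<open>\<open>F c\<close> vanishes up to \<open>c\<close>, so from a level at most
  \<open>b\<close> something is gained only if a single step exceeds the gap
  \<open>c - b\<close>.\<close>

lemma w_step_below:
 assumes h: "0 < h" and c: "b < c" and v: "v <= b"
 shows "nexp (- q * h) * (\<E> w. ennreal (F c (v + X h w)))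
  <= ennreal K0 * (\<E> w. nexp (k0 * X h w) * ind {c - b<..} (X h w))"
proof -
 have "nexp (- q * h) * (\<E> w. ennreal (F c (v + X h w))) <= (\<E> w. ennreal (F c (v + X h w)))"
  using h by (rule disc_le_1)
 also have "... <= (\<E> w. ennreal K0 * (nexp (k0 * X h w) * ind {c - b<..} (X h w)))"
 proof (rule nn_integral_mono)
  fix w
  show "ennreal (F c (v + X h w)) <= ennreal K0 * (nexp (k0 * X h w) * ind {c - b<..} (X h w))"
  proof (cases "X h w <= c - b")
   case True
   then show ?thesis using v by (simp add: F_zero)
  next
   case False
   have "F c (v + X h w) <= K0 * exp (k0 * (v + X h w - c))" by (rule F_exp_bound)
   also have "... <= K0 * exp (k0 * X h w)" using K0_pos k0_pos c v by (intro mult_left_mono) auto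
   finally have "ennreal (F c (v + X h w)) <= ennreal (K0 * exp (k0 * X h w))" by (rule ennreal_leI)
   then show ?thesis using False K0_pos by (simp add: ennreal_mult)
  qed
 qed
 also have "... = ennreal K0 * (\<E> w. nexp (k0 * X h w) * ind {c - b<..} (X h w))"
  using h by (intro nn_integral_cmult) auto
 finally show ?thesis .
qed

text \<open>The same balance for \<open>X\<close>: discounting 1 loses \<open>q\<close> times the
  discounted time, the convolution returns the share spent above \<open>0\<close>, and only the time
  below \<open>0\<close> is left over.\<close>

lemma Z_step:
 assumes h: "0 < h"
 shows "nexp (- q * h) * (\<E> w. ennreal (Z (v + X h w))) <= ennreal (Z v)"
  and "ennreal (Z v) = nexp (- q * h) * (\<E> w. ennreal (Z (v + X h w))) + ennreal q * X.occ q (ind {..<0}) h v"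
proof -
 have h0: "0 <= h" using h by simp
 let ?D = "exp (- q * h)"
 let ?f = "%x. enn2real (X.cv (ind {0..}) x)"
 define o1 where "o1 = enn2real (X.occ q (ind {0..}) h v)"
 define o3 where "o3 = enn2real (X.occ q (ind {..<0}) h v)"
 have o: "0 <= o1" "0 <= o3" by (auto simp: o1_def o3_def)
 have iF: "integrable M (%w. ?f (v + X h w))" and eF: "?D * (LINT w|M. ?f (v + X h w)) = ?f v + o1"
  using X.dynkin_real[OF Ici_good h0] unfolding o1_def by auto
 have iZ: "integrable M (%w. Z (v + X h w))"
  unfolding Z_def using iF by (intro Bochner_Integration.integrable_add integrable_mult_right) auto
 have "(LINT w|M. Z (v + X h w)) = 1 + q * (LINT w|M. ?f (v + X h w))"
  unfolding Z_def using iF by (simp add: X.prob_space)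
 then have "?D * (LINT w|M. Z (v + X h w)) = ?D * (1 + q * (LINT w|M. ?f (v + X h w)))"
  by (rule arg_cong)
 also have "... = ?D + q * (?D * (LINT w|M. ?f (v + X h w)))"
  by (simp add: algebra_simps)
 also have "... = Z v - (1 - ?D - q * o1)" unfolding eF by (simp add: Z_def algebra_simps)
 also have "1 - ?D - q * o1 = q * o3"
 proof -
  have "ennreal (o1 + o3) = ennreal ((1 - ?D) / q)"
   using occ_complement(2)[OF h, of 0 v] o unfolding o1_def o3_def by (simp add: occ_real(3)[OF h, symmetric])
  then have "o1 + o3 = (1 - ?D) / q" using o h X.q_pos by (subst (asm) ennreal_inj) auto
  then show ?thesis using X.q_pos by (simp add: field_simps)
 qed
 finally have e: "?D * (LINT w|M. Z (v + X h w)) = Z v - q * o3" .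
 have nn: "ennreal ?D * (\<E> w. ennreal (Z (v + X h w))) = ennreal (Z v - q * o3)"
  unfolding e[symmetric] using Z_ge_1 iZ
  by (subst nn_integral_eq_integral) (auto simp: ennreal_mult' intro!: order_trans[OF zero_le_one])
 have pos: "0 <= Z v - q * o3"
  unfolding e[symmetric] by (intro mult_nonneg_nonneg integral_nonneg_AE AE_I2) (auto intro: order_trans[OF zero_le_one Z_ge_1])
 show "ennreal ?D * (\<E> w. ennreal (Z (v + X h w))) <= ennreal (Z v)"
  unfolding nn using o X.q_pos by (intro ennreal_leI) auto
 have "ennreal (Z v) = ennreal ((Z v - q * o3) + q * o3)" by simp
 also have "... = ennreal (Z v - q * o3) + ennreal (q * o3)" using pos o X.q_pos by (intro ennreal_plus) auto
 also have "ennreal (q * o3) = ennreal q * X.occ q (ind {..<0}) h v"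
  unfolding o3_def using X.q_pos by (simp add: ennreal_mult occ_real(3)[OF h, symmetric])
 finally show "ennreal (Z v) = ennreal ?D * (\<E> w. ennreal (Z (v + X h w))) + ennreal q * X.occ q (ind {..<0}) h v"
  unfolding nn .
qed

text \<open>Up to \<open>c\<close> the function \<open>r c\<close> is \<open>Z\<close>, for which
  the step is already known. The remaining case is a step exceeding the gap \<open>c - b\<close>,
  where the crude exponential bound suffices because such steps have mean contribution
  \<open>o(h)\<close>.\<close>

lemma r_step_below:
 assumes h: "0 < h" and c: "b < c" and v: "v <= b"
 shows "nexp (- q * h) * (\<E> w. ennreal (r c (v + X h w)))
  <= ennreal (r c v) + ennreal (1 + q * K0 * exp (k0 * b)) * (\<E> w. nexp (k0 * X h w) * ind {c - b<..} (X h w))"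
  and "ennreal (r c v) <= nexp (- q * h) * (\<E> w. ennreal (r c (v + X h w)))
    + ennreal q * Y.occ q (ind {..<0}) h v"
proof -
 let ?K = "1 + q * K0 * exp (k0 * b)"
 have K: "0 <= ?K" using X.q_pos K0_pos by simp
 let ?T = "(\<E> w. nexp (k0 * X h w) * ind {c - b<..} (X h w))"
 have [measurable]: "X h \<in> borel_measurable M" using h by simp
 have rZ: "r c v = Z v" using v c by (intro r_eq_Z) simp
 have "(\<E> w. ennreal (r c (v + X h w)))
  <= (\<E> w. ennreal (Z (v + X h w)) + ennreal ?K * (nexp (k0 * X h w) * ind {c - b<..} (X h w)))"
 proof (rule nn_integral_mono)
  fix w
  show "ennreal (r c (v + X h w)) <= ennreal (Z (v + X h w)) + ennreal ?K * (nexp (k0 * X h w) * ind {c - b<..} (X h w))"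
  proof (cases "X h w <= c - b")
   case True
   then show ?thesis using v by (simp add: r_eq_Z)
  next
   case False
   have x0: "0 <= X h w" using False c by simp
   have "r c (v + X h w) <= 1 + q * F 0 (v + X h w)" by (rule r_le)
   also have "... <= exp (k0 * X h w) + q * (K0 * exp (k0 * b) * exp (k0 * X h w))"
   proof (intro add_mono mult_left_mono)
    show "1 <= exp (k0 * X h w)" using x0 k0_pos by simp
    have "F 0 (v + X h w) <= K0 * exp (k0 * (v + X h w - 0))" by (rule F_exp_bound)
    also have "... <= K0 * exp (k0 * (b + X h w))" using K0_pos k0_pos v by (intro mult_left_mono) auto
    also have "... = K0 * exp (k0 * b) * exp (k0 * X h w)" by (simp add: distrib_left exp_add)
    finally show "F 0 (v + X h w) <= K0 * exp (k0 * b) * exp (k0 * X h w)" .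
   qed (use X.q_pos in simp)
   also have "... = ?K * exp (k0 * X h w)" by (simp add: algebra_simps)
   finally have "ennreal (r c (v + X h w)) <= ennreal (?K * exp (k0 * X h w))" by (rule ennreal_leI)
   also have "... = ennreal ?K * (nexp (k0 * X h w) * ind {c - b<..} (X h w))"
    using False K by (simp add: ennreal_mult)
   finally show ?thesis by (simp add: add_increasing)
  qed
 qed
 also have "... = (\<E> w. ennreal (Z (v + X h w))) + ennreal ?K * ?T"
  by (subst nn_integral_add) (auto simp: nn_integral_cmult)
 finally have "nexp (- q * h) * (\<E> w. ennreal (r c (v + X h w)))
  <= nexp (- q * h) * ((\<E> w. ennreal (Z (v + X h w))) + ennreal ?K * ?T)"
  by (rule mult_left_mono) simp
 also have "... = nexp (- q * h) * (\<E> w. ennreal (Z (v + X h w))) + nexp (- q * h) * (ennreal ?K * ?T)"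
  by (rule distrib_left)
 also have "... <= ennreal (r c v) + ennreal ?K * ?T"
  unfolding rZ by (intro add_mono Z_step h disc_le_1)
 finally show "nexp (- q * h) * (\<E> w. ennreal (r c (v + X h w))) <= ennreal (r c v) + ennreal ?K * ?T" .
 have "ennreal (r c v) = nexp (- q * h) * (\<E> w. ennreal (Z (v + X h w))) + ennreal q * X.occ q (ind {..<0}) h v"
  unfolding rZ by (rule Z_step(2)[OF h])
 also have "... <= nexp (- q * h) * (\<E> w. ennreal (r c (v + X h w))) + ennreal q * Y.occ q (ind {..<0}) h v"
  by (intro add_mono mult_left_mono nn_integral_mono ennreal_leI r_ge_Z occ_X_le_Y) auto
 finally show "ennreal (r c v) <= nexp (- q * h) * (\<E> w. ennreal (r c (v + X h w)))
    + ennreal q * Y.occ q (ind {..<0}) h v" .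
qed

end

section \<open>Admissibility of the two functions and the limit of their ratio\<close>

context refracted_scales
begin

lemma admissible_w: "admissible (F b) 1"
proof -
 have Kn: "0 <= max 1 (max K0 (\<phi> / q))" by simp
 show ?thesis
  unfolding admissible_def
 proof (rule conjI[OF borel_FGZ(1)], rule conjI[OF allI[OF F_nonneg]], rule exI[of _ "max 1 (max K0 (\<phi> / q))"],
   rule conjI[OF Kn], rule exI[of _ k0], rule conjI[OF less_imp_le[OF k0_pos]], intro allI impI)
 fix c assume c: "b < c & c <= b + 1"
 let ?K = "max 1 (max K0 (\<phi> / q))"
 show "EX g'. g' \<in> borel_measurable borel & (ALL x. 0 <= g' x) &
  (ALL x<=0. g' x = g' 0) & (ALL x>=0. \<bar>F b x - g' x\<bar> <= ?K * (c - b) * exp (\<phi> * x)) &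
  (ALL v h. b < v --> 0 < h -->
   nexp (- q * h) * (\<E> w. ennreal (g' (v + (X h w - \<delta> * h)))) <= ennreal (g' v + 1 * ((1 - exp (- q * h)) / q)) &
   ennreal (g' v + 1 * ((1 - exp (- q * h)) / q)) <= nexp (- q * h) * (\<E> w. ennreal (g' (v + (X h w - \<delta> * h))))
    + ennreal ?K * Y.occ q (ind {..<c}) h v) &
  (ALL v h. 0 <= v --> v <= b --> 0 < h -->
   nexp (- q * h) * (\<E> w. ennreal (g' (v + X h w))) <= ennreal (g' v)
    + ennreal ?K * (\<E> w. nexp (k0 * X h w) * ind {c - b<..} (X h w)) &
   ennreal (g' v) <= nexp (- q * h) * (\<E> w. ennreal (g' (v + X h w)))
    + ennreal ?K * Y.occ q (ind {..<0}) h v)"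
 proof (intro exI[of _ "F c"] conjI allI impI borel_FGZ F_nonneg)
  fix x :: real assume "x <= 0" then show "F c x = F c 0" using c b_pos by (simp add: F_zero)
 next
  fix x :: real assume "0 <= x"
  have "\<bar>F b x - F c x\<bar> = F b x - F c x" using F_diff(1)[of c x] c by simp
  also have "... <= (\<phi> / q) * (c - b) * exp (\<phi> * x)" using F_diff(2)[of c x] c by (simp add: mult_ac)
  also have "... <= ?K * (c - b) * exp (\<phi> * x)" using c by (intro mult_right_mono) auto
  finally show "\<bar>F b x - F c x\<bar> <= ?K * (c - b) * exp (\<phi> * x)" .
 next
  fix v h :: real assume h: "b < v" "0 < h"
  show "nexp (- q * h) * (\<E> w. ennreal (F c (v + (X h w - \<delta> * h)))) <= ennreal (F c v + 1 * ((1 - exp (- q * h)) / q))"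
   by (rule w_step_above(1)) (use c h b_pos in auto)
  have "ennreal (F c v + 1 * ((1 - exp (- q * h)) / q)) <= nexp (- q * h) * (\<E> w. ennreal (F c (v + (X h w - \<delta> * h))))
    + Y.occ q (ind {..<c}) h v"
   by (rule w_step_above(2)) (use c h b_pos in auto)
  also have "... <= nexp (- q * h) * (\<E> w. ennreal (F c (v + (X h w - \<delta> * h)))) + ennreal ?K * Y.occ q (ind {..<c}) h v"
  proof (intro add_left_mono)
   have "1 * Y.occ q (ind {..<c}) h v <= ennreal ?K * Y.occ q (ind {..<c}) h v"
    by (intro mult_right_mono) (auto simp flip: ennreal_1 intro!: ennreal_leI)
   then show "Y.occ q (ind {..<c}) h v <= ennreal ?K * Y.occ q (ind {..<c}) h v" by simp
  qed
  finally show "ennreal (F c v + 1 * ((1 - exp (- q * h)) / q)) <= nexp (- q * h) * (\<E> w. ennreal (F c (v + (X h w - \<delta> * h))))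
    + ennreal ?K * Y.occ q (ind {..<c}) h v" .
 next
  fix v h :: real assume h: "0 <= v" "v <= b" "0 < h"
  have "nexp (- q * h) * (\<E> w. ennreal (F c (v + X h w)))
   <= ennreal K0 * (\<E> w. nexp (k0 * X h w) * ind {c - b<..} (X h w))"
   by (rule w_step_below) (use c h in auto)
  also have "... <= ennreal ?K * (\<E> w. nexp (k0 * X h w) * ind {c - b<..} (X h w))"
   by (intro mult_right_mono ennreal_leI) auto
  finally show "nexp (- q * h) * (\<E> w. ennreal (F c (v + X h w))) <= ennreal (F c v)
    + ennreal ?K * (\<E> w. nexp (k0 * X h w) * ind {c - b<..} (X h w))"
   by (simp add: add_increasing)
  have "F c v = 0" using h c by (simp add: F_zero)
  then show "ennreal (F c v) <= nexp (- q * h) * (\<E> w. ennreal (F c (v + X h w)))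
    + ennreal ?K * Y.occ q (ind {..<0}) h v" by simp
 qed
qed
qed

lemma admissible_r: "admissible (r b) 0"
proof -
 let ?K = "max (\<delta> * q * W (b + 1) * (\<phi> / q)) (max (q + \<delta> * q * W (b + 1)) (1 + q * K0 * exp (k0 * b)))"
 have "0 <= 1 + q * K0 * exp (k0 * b)" using X.q_pos K0_pos by simp
 then have Kn: "0 <= ?K" by (simp add: le_max_iff_disj)
 have r_nonneg: "0 <= r b x" for x using r_ge_1[of b x] by simp
 show ?thesis
  unfolding admissible_def
 proof (rule conjI[OF borel_FGZ(4)], rule conjI[OF allI[OF r_nonneg]], rule exI[of _ ?K],
   rule conjI[OF Kn], rule exI[of _ k0], rule conjI[OF less_imp_le[OF k0_pos]], intro allI impI)
 fix c assume c: "b < c & c <= b + 1"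
 show "EX g'. g' \<in> borel_measurable borel & (ALL x. 0 <= g' x) &
  (ALL x<=0. g' x = g' 0) & (ALL x>=0. \<bar>r b x - g' x\<bar> <= ?K * (c - b) * exp (\<phi> * x)) &
  (ALL v h. b < v --> 0 < h -->
   nexp (- q * h) * (\<E> w. ennreal (g' (v + (X h w - \<delta> * h)))) <= ennreal (g' v + 0 * ((1 - exp (- q * h)) / q)) &
   ennreal (g' v + 0 * ((1 - exp (- q * h)) / q)) <= nexp (- q * h) * (\<E> w. ennreal (g' (v + (X h w - \<delta> * h))))
    + ennreal ?K * Y.occ q (ind {..<c}) h v) &
  (ALL v h. 0 <= v --> v <= b --> 0 < h -->
   nexp (- q * h) * (\<E> w. ennreal (g' (v + X h w))) <= ennreal (g' v)
    + ennreal ?K * (\<E> w. nexp (k0 * X h w) * ind {c - b<..} (X h w)) &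
   ennreal (g' v) <= nexp (- q * h) * (\<E> w. ennreal (g' (v + X h w)))
    + ennreal ?K * Y.occ q (ind {..<0}) h v)"
 proof (intro exI[of _ "r c"] conjI allI impI borel_FGZ)
  fix x show "0 <= r c x" using r_ge_1[of c x] by simp
 next
  fix x :: real assume "x <= 0" then show "r c x = r c 0" by (simp add: r_neg)
 next
  fix x :: real assume "0 <= x"
  have dq: "0 <= \<delta> * q" using \<delta>_pos X.q_pos by simp
  have "\<bar>r b x - r c x\<bar> = \<bar>\<delta> * q * (G c x - G b x)\<bar>" by (simp add: r_def algebra_simps)
  also have "... = \<delta> * q * (G c x - G b x)" using G_diff(1)[of c x] c dq by simp
  also have "... <= \<delta> * q * (W c * ((c - b) * (\<phi> / q) * exp (\<phi> * x)))" using c dq by (intro mult_left_mono G_diff) auto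
  also have "... <= \<delta> * q * (W (b + 1) * ((c - b) * (\<phi> / q) * exp (\<phi> * x)))"
   using c dq \<phi>_pos X.q_pos by (intro mult_left_mono[OF mult_right_mono] X.W_mono) auto
  also have "... = \<delta> * q * W (b + 1) * (\<phi> / q) * (c - b) * exp (\<phi> * x)" by (simp add: mult_ac)
  also have "... <= ?K * (c - b) * exp (\<phi> * x)" using c by (intro mult_right_mono) auto
  finally show "\<bar>r b x - r c x\<bar> <= ?K * (c - b) * exp (\<phi> * x)" .
 next
  fix v h :: real assume h: "b < v" "0 < h"
  have c0: "0 < c" using c b_pos by simp
  show "nexp (- q * h) * (\<E> w. ennreal (r c (v + (X h w - \<delta> * h)))) <= ennreal (r c v + 0 * ((1 - exp (- q * h)) / q))"
   using r_step_above(1)[OF h(2) c0] by simp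
  have "q + \<delta> * q * W c <= q + \<delta> * q * W (b + 1)" using c \<delta>_pos X.q_pos by (intro add_left_mono mult_left_mono X.W_mono) auto
  then have le: "q + \<delta> * q * W c <= ?K" by linarith
  have "ennreal (r c v) <= nexp (- q * h) * (\<E> w. ennreal (r c (v + (X h w - \<delta> * h))))
    + ennreal (q + \<delta> * q * W c) * Y.occ q (ind {..<c}) h v"
   by (rule r_step_above(2)[OF h(2) c0])
  also have "... <= nexp (- q * h) * (\<E> w. ennreal (r c (v + (X h w - \<delta> * h)))) + ennreal ?K * Y.occ q (ind {..<c}) h v"
   by (intro add_left_mono mult_right_mono ennreal_leI le) simp
  finally show "ennreal (r c v + 0 * ((1 - exp (- q * h)) / q)) <= nexp (- q * h) * (\<E> w. ennreal (r c (v + (X h w - \<delta> * h))))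
    + ennreal ?K * Y.occ q (ind {..<c}) h v" by simp
 next
  fix v h :: real assume h: "0 <= v" "v <= b" "0 < h"
  have c': "b < c" using c by simp
  have "nexp (- q * h) * (\<E> w. ennreal (r c (v + X h w)))
   <= ennreal (r c v) + ennreal (1 + q * K0 * exp (k0 * b)) * (\<E> w. nexp (k0 * X h w) * ind {c - b<..} (X h w))"
   by (rule r_step_below(1)[OF h(3) c' h(2)])
  also have "... <= ennreal (r c v) + ennreal ?K * (\<E> w. nexp (k0 * X h w) * ind {c - b<..} (X h w))"
   by (intro add_left_mono mult_right_mono ennreal_leI) auto
  finally show "nexp (- q * h) * (\<E> w. ennreal (r c (v + X h w)))
   <= ennreal (r c v) + ennreal ?K * (\<E> w. nexp (k0 * X h w) * ind {c - b<..} (X h w))" .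
  have le: "q <= ?K" using \<delta>_pos X.q_pos X.W_nonneg[of "b + 1"] by (smt (verit) mult_nonneg_nonneg max.cobounded1 max.cobounded2)
  have "ennreal (r c v) <= nexp (- q * h) * (\<E> w. ennreal (r c (v + X h w)))
    + ennreal q * Y.occ q (ind {..<0}) h v"
   by (rule r_step_below(2)[OF h(3) c' h(2)])
  also have "... <= nexp (- q * h) * (\<E> w. ennreal (r c (v + X h w))) + ennreal ?K * Y.occ q (ind {..<0}) h v"
   by (intro add_left_mono mult_right_mono ennreal_leI le) simp
  finally show "ennreal (r c v) <= nexp (- q * h) * (\<E> w. ennreal (r c (v + X h w)))
    + ennreal ?K * Y.occ q (ind {..<0}) h v" .
 qed
qed
qed

definition Tail :: real where
 "Tail = enn2real (\<L> y. ennreal (exp (- \<phi> * y) * W y) * ind {b..} y)"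

text \<open>As \<open>\<psi> \<phi> - q = \<delta> * \<phi>\<close>, the whole transform of
  \<open>W\<close> at \<open>\<phi>\<close> is \<open>1 / (\<delta> * \<phi>)\<close>; the cut at
  \<open>b\<close> splits it into two finite parts. The upper part is positive since
  \<open>W\<close> is positive on \<open>[b, b + 1]\<close>.\<close>

lemma tail_split:
 shows "(\<L> y. ennreal (exp (- \<phi> * y) * W y) * ind {b..} y) = ennreal Tail" (is ?A)
  and "(\<L> y. ennreal (exp (- \<phi> * y) * Wcut b y)) = ennreal (1 / (\<delta> * \<phi>) - Tail)" (is ?B)
  and "0 <= 1 / (\<delta> * \<phi>) - Tail" (is ?C)
  and "0 < Tail" (is ?D)
proof -
 note [measurable] = Wcut_good(1)
 have tot: "(\<L> y. ennreal (exp (- \<phi> * y) * W y)) = ennreal (1 / (\<delta> * \<phi>))"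
  using X.W_laplace_nn[OF root_less] \<psi>_\<phi> by simp
 have "(\<L> y. ennreal (exp (- \<phi> * y) * W y))
  = (\<L> y. ennreal (exp (- \<phi> * y) * Wcut b y) + ennreal (exp (- \<phi> * y) * W y) * ind {b..} y)"
  using X.W_neg by (intro nn_integral_cong) (auto simp: Wcut_def indicator_def)
 also have "... = (\<L> y. ennreal (exp (- \<phi> * y) * Wcut b y)) + (\<L> y. ennreal (exp (- \<phi> * y) * W y) * ind {b..} y)"
  by (rule nn_integral_add) auto
 finally have sum: "(\<L> y. ennreal (exp (- \<phi> * y) * Wcut b y)) + (\<L> y. ennreal (exp (- \<phi> * y) * W y) * ind {b..} y) = ennreal (1 / (\<delta> * \<phi>))"
  using tot by simp
 then obtain s t where st: "(\<L> y. ennreal (exp (- \<phi> * y) * Wcut b y)) = ennreal s" "0 <= s"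
  "(\<L> y. ennreal (exp (- \<phi> * y) * W y) * ind {b..} y) = ennreal t" "0 <= t"
  by (cases "(\<L> y. ennreal (exp (- \<phi> * y) * Wcut b y))"; cases "(\<L> y. ennreal (exp (- \<phi> * y) * W y) * ind {b..} y)") auto
 have T: "Tail = t" using st by (simp add: Tail_def)
 have st': "s = 1 / (\<delta> * \<phi>) - t"
  using sum st \<delta>_pos \<phi>_pos by (simp flip: ennreal_plus)
 show ?A ?B ?C using st st' T by simp_all
 have "0 < t"
 proof (rule ccontr)
  assume "~ 0 < t"
  then have "(\<L> y. ennreal (exp (- \<phi> * y) * W y) * ind {b..} y) = 0" using st by simp
  then have ae: "AE y in lborel. ennreal (exp (- \<phi> * y) * W y) * ind {b..} y = 0"
   by (subst (asm) nn_integral_0_iff_AE) auto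
  have ne: "ennreal (exp (- \<phi> * y) * W y) * ind {b..} y ~= 0" if "b <= y" for y
   using that X.W_pos[of y] b_pos by simp
  have "AE y in lborel. y \<notin> {b..b+1}" using ae by eventually_elim (use ne in auto)
  then have "emeasure lborel {b..b+1} = 0" by (subst (asm) AE_iff_measurable[of "{b..b+1}"]) auto
  then show False by simp
 qed
 then show ?D using T by simp
qed

text \<open>Both functions grow like \<open>exp (\<phi> * x)\<close>; the constant is where the formula of the theorem comes from.\<close>
lemma w_r_ratio: "((%x. F b x / r b x) \<longlongrightarrow> exp (- \<phi> * b) / (\<phi> * q * \<delta> * Tail)) at_top"
proof -
 have Fl: "((%x. exp (- \<phi> * x) * F c x) \<longlongrightarrow> Y.W_lim * (exp (- \<phi> * c) / \<phi>)) at_top" for c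
  unfolding F_def by (rule Y.cv_asymp_real[OF Ici_good(1-4)]) (use nn_exp_Ici[OF \<phi>_pos, of c] \<phi>_pos in auto)
 have Gl: "((%x. exp (- \<phi> * x) * G b x) \<longlongrightarrow> Y.W_lim * (1 / (\<delta> * \<phi>) - Tail)) at_top"
  unfolding G_def by (rule Y.cv_asymp_real[OF Wcut_good(1-4)]) (use tail_split in auto)
 have "((%x. exp (- p * x)) \<longlongrightarrow> 0) at_top" if "0 < p" for p :: real using that by real_asymp
 then have el: "((%x. exp (- \<phi> * x)) \<longlongrightarrow> 0) at_top" using \<phi>_pos by blast
 have rl: "((%x. exp (- \<phi> * x) * r b x) \<longlongrightarrow> 0 + q * (Y.W_lim * (exp (- \<phi> * 0) / \<phi>)) - \<delta> * q * (Y.W_lim * (1 / (\<delta> * \<phi>) - Tail))) at_top"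
 proof -
  have "exp (- \<phi> * x) * r b x = exp (- \<phi> * x) + q * (exp (- \<phi> * x) * F 0 x) - \<delta> * q * (exp (- \<phi> * x) * G b x)" for x
   by (simp add: r_def algebra_simps)
  then show ?thesis by (simp only:) (intro tendsto_intros el Fl Gl)
 qed
 \<comment> \<open>The leading terms cancel: the transform of the whole of \<open>W\<close> at
   \<open>\<phi>\<close> is \<open>1 / (\<delta> * \<phi>)\<close>, so only the part beyond
   \<open>b\<close> survives.\<close>
 have lim: "0 + q * (Y.W_lim * (exp (- \<phi> * 0) / \<phi>)) - \<delta> * q * (Y.W_lim * (1 / (\<delta> * \<phi>) - Tail)) = q * \<delta> * Tail * Y.W_lim"
  using \<delta>_pos \<phi>_pos by (simp add: field_simps)
 have "((%x. (exp (- \<phi> * x) * F b x) / (exp (- \<phi> * x) * r b x)) \<longlongrightarrow> (Y.W_lim * (exp (- \<phi> * b) / \<phi>)) / (q * \<delta> * Tail * Y.W_lim)) at_top"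
  using X.q_pos \<delta>_pos tail_split(4) Y.W_lim_pos by (intro tendsto_divide Fl rl[unfolded lim]) auto
 moreover have "(Y.W_lim * (exp (- \<phi> * b) / \<phi>)) / (q * \<delta> * Tail * Y.W_lim) = exp (- \<phi> * b) / (\<phi> * q * \<delta> * Tail)"
  using Y.W_lim_pos by (simp add: field_simps)
 ultimately show ?thesis by simp
qed

end

section \<open>The Euler scheme as a Markov chain\<close>

primrec euler :: "real => real => real => real => (nat => real) => nat => real" where
 "euler \<delta> b h x d 0 = x"
| "euler \<delta> b h x d (Suc i) = max 0 (euler \<delta> b h x d i + d i - (if b < euler \<delta> b h x d i then \<delta> * h else 0))"

lemma euler_cong: "(!!j. j < i ==> d j = d' j) ==> euler \<delta> b h x d i = euler \<delta> b h x d' i"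
 by (induction i) auto

lemma euler_nonneg: "0 <= x ==> 0 <= euler \<delta> b h x d i"
 by (cases i) auto

lemma euler_measurable:
 assumes "{..<i} \<subseteq> I"
 shows "(%d. euler \<delta> b h x d i) \<in> borel_measurable (PiM I (%_. borel))"
 using assms
proof (induction i)
 case (Suc i)
 have [measurable]: "(%d. euler \<delta> b h x d i) \<in> borel_measurable (PiM I (%_. borel))"
  using Suc by (intro Suc.IH) auto
 have [measurable]: "(%d. d i) \<in> borel_measurable (PiM I (%_. borel :: real measure))"
  using Suc.prems by (intro measurable_component_singleton) auto
 show ?case by simp
qed simp

text \<open>The second family of scale functions belongs to the discount \<open>p\<close> with
  \<open>\<psi> \<phi> = p\<close>. Hence \<open>X.root p = \<phi>\<close>, and the function
  \<open>Z\<close> at discount \<open>p\<close> grows at the rate \<open>\<phi>\<close> of the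
  errors.\<close>

locale refracted_chain =
 refracted_scales M X \<psi> q W \<delta> WY b +
 P: refracted_scales M X \<psi> p Wp \<delta> WYp b
 for M :: "'a measure" and X \<psi> q W \<delta> WY b p Wp WYp +
 fixes x0 :: real
 assumes p: "p = q + \<delta> * \<phi>" and x0: "0 <= x0"
  and indep: "!!(t :: nat => real) n. mono t ==> 0 <= t 0 ==>
    X.indep_vars (%_. borel) (%i w. X (t (Suc i)) w - X (t i) w) {..<n}"
  and stat: "!!s t. 0 <= s ==> s <= t ==> distr M borel (%w. X t w - X s w) = distr M borel (X (t - s))"
begin

definition V :: "real => nat => 'a => real" where
 "V h i w = euler \<delta> b h x0 (%j. X (real (Suc j) * h) w - X (real j * h) w) i"

lemma V_zero: "V h 0 w = x0" by (simp add: V_def)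

lemma V_nonneg: "0 <= V h i w" unfolding V_def by (rule euler_nonneg[OF x0])

lemma V_measurable [measurable]:
 assumes h: "0 < h"
 shows "V h i \<in> borel_measurable M"
proof (induction i)
 case 0 then show ?case by (simp add: V_def[abs_def])
next
 case (Suc i)
 note [measurable] = Suc
 have [measurable]: "X (real j * h) \<in> borel_measurable M" for j using h by (intro X_meas) simp
 have "V h (Suc i) w = max 0 (V h i w + (X (real (Suc i) * h) w - X (real i * h) w) - (if b < V h i w then \<delta> * h else 0))" for w
  by (simp add: V_def)
 then show ?case by (simp add: measurable_cong[of M "V h (Suc i)"] del: of_nat_Suc)
qed

text \<open>The Markov property: \<open>V h i\<close> is a function of the increments before index
  \<open>i\<close>, hence independent of the next one, which has the law of
  \<open>X h\<close>.\<close>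

lemma V_step:
 assumes h: "0 < h" and [measurable]: "g \<in> borel_measurable borel"
 shows "(\<E> w. g (V h (Suc i) w))
  = (\<E> w. (\<E> w'. g (max 0 (V h i w + X h w' - (if b < V h i w then \<delta> * h else 0)))))"
proof -
 define d where "d j w = X (real (Suc j) * h) w - X (real j * h) w" for j w
 have [measurable]: "V h i \<in> borel_measurable M" using h by (rule V_measurable)
 have [measurable]: "X h \<in> borel_measurable M" using h by (intro X_meas) simp
 have "X.indep_vars (%_. borel) d {..<Suc i}"
  unfolding d_def using h indep[of "%j. real j * h" "Suc i"] by (simp add: mono_def)
 then have "X.indep_var (PiM {..<i} (%_. borel)) (%w. \<lambda>j\<in>{..<i}. d j w) (PiM {i} (%_. borel)) (%w. \<lambda>j\<in>{i}. d j w)"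
  by (rule X.indep_var_restrict) auto
 then have "X.indep_var borel ((%e. euler \<delta> b h x0 e i) \<circ> (%w. \<lambda>j\<in>{..<i}. d j w)) borel ((%e. e i) \<circ> (%w. \<lambda>j\<in>{i}. d j w))"
  by (rule X.indep_var_compose) (auto intro!: euler_measurable measurable_component_singleton)
 moreover have "(%e. euler \<delta> b h x0 e i) \<circ> (%w. \<lambda>j\<in>{..<i}. d j w) = V h i"
  by (auto simp: V_def d_def fun_eq_iff intro!: euler_cong)
 moreover have "(%e. e i) \<circ> (%w. \<lambda>j\<in>{i}. d j w) = d i" by auto
 ultimately have "X.indep_var borel (V h i) borel (d i)" by simp
 then have [measurable]: "d i \<in> borel_measurable M" and
  joint: "distr M borel (V h i) \<Otimes>\<^sub>M distr M borel (d i) = distr M (borel \<Otimes>\<^sub>M borel) (%w. (V h i w, d i w))"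
  by (auto simp: X.indep_var_distribution_eq)
 have dd: "distr M borel (d i) = distr M borel (X h)"
  using stat[of "real i * h" "real (Suc i) * h"] h by (simp add: d_def[abs_def] algebra_simps)
 define \<Phi> where "\<Phi> z = g (max 0 (fst z + snd z - (if b < fst z then \<delta> * h else 0)))" for z
 have [measurable]: "\<Phi> \<in> borel_measurable (borel \<Otimes>\<^sub>M borel)" unfolding \<Phi>_def by measurable
 interpret D: prob_space "distr M borel (X h)" by (rule X.prob_space_distr) measurable
 have "(\<E> w. g (V h (Suc i) w)) = (\<E> w. \<Phi> (V h i w, d i w))"
  by (simp add: \<Phi>_def V_def d_def)
 also have "... = (\<integral>\<^sup>+z. \<Phi> z \<partial>distr M (borel \<Otimes>\<^sub>M borel) (%w. (V h i w, d i w)))"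
  by (rule nn_integral_distr[symmetric]) measurable
 also have "... = (\<integral>\<^sup>+z. \<Phi> z \<partial>(distr M borel (V h i) \<Otimes>\<^sub>M distr M borel (X h)))"
  by (simp only: joint[symmetric] dd)
 also have "... = (\<integral>\<^sup>+v. \<integral>\<^sup>+y. \<Phi> (v, y) \<partial>distr M borel (X h) \<partial>distr M borel (V h i))"
  by (rule D.nn_integral_fst[symmetric]) (simp add: borel_prod)
 also have "... = (\<integral>\<^sup>+v. (\<E> w'. \<Phi> (v, X h w')) \<partial>distr M borel (V h i))"
  by (intro nn_integral_cong nn_integral_distr) auto
 also have "... = (\<E> w. (\<E> w'. \<Phi> (V h i w, X h w')))"
  by (rule nn_integral_distr) measurable
 finally show ?thesis by (simp add: \<Phi>_def)
qed

lemma root_p: "X.root p = \<phi>"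
 using X.root_unique[of p \<phi>] P.X.q_pos \<phi>_pos \<psi>_\<phi> p by simp

lemma P_Z_mono: "x <= y ==> P.Z x <= P.Z y"
proof -
 assume xy: "x <= y"
 have "P.X.cv (ind {0..}) x <= P.X.cv (ind {0..}) y"
  unfolding P.X.cv_def using xy by (intro nn_integral_mono ennreal_leI mult_right_mono P.X.W_mono) auto
 then have "(P.Z x - 1) / p <= (P.Z y - 1) / p"
  unfolding P.cv_Z using P.X.q_pos P.Z_ge_1 by (subst (asm) ennreal_le_iff) auto
 then show "P.Z x <= P.Z y" using P.X.q_pos by (simp add: divide_le_cancel)
qed

text \<open>A Lyapunov function adapted to both mechanisms: \<open>P.Z\<close> is constant on the
  negative half-line, so reflection does not raise it; it is increasing, so the refraction drift can
  only lower it; and a free step of \<open>X\<close> multiplies its mean by at most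
  \<open>exp (p * h)\<close>.\<close>

lemma P_Z_moment:
 assumes h: "0 < h"
 shows "(\<E> w. ennreal (P.Z (V h i w))) <= ennreal (exp (p * (real i * h)) * P.Z x0)"
proof (induction i)
 case 0 then show ?case by (simp add: V_zero X.emeasure_space_1)
next
 case (Suc i)
 have [measurable]: "V h i \<in> borel_measurable M" using h by (rule V_measurable)
 have "(\<E> w. ennreal (P.Z (V h (Suc i) w)))
  = (\<E> w. (\<E> w'. ennreal (P.Z (max 0 (V h i w + X h w' - (if b < V h i w then \<delta> * h else 0))))))"
  by (rule V_step[OF h]) measurable
 also have "... <= (\<E> w. nexp (p * h) * ennreal (P.Z (V h i w)))"
 proof (rule nn_integral_mono)
  fix w
  let ?v = "V h i w"
  have "(\<E> w'. ennreal (P.Z (max 0 (?v + X h w' - (if b < ?v then \<delta> * h else 0))))) <= (\<E> w'. ennreal (P.Z (?v + X h w')))"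
  proof (intro nn_integral_mono ennreal_leI)
   fix w'
   have "P.Z (max 0 (?v + X h w' - (if b < ?v then \<delta> * h else 0))) = P.Z (?v + X h w' - (if b < ?v then \<delta> * h else 0))"
    using P.Z_neg by (auto simp: max_def)
   also have "... <= P.Z (?v + X h w')" using h \<delta>_pos by (intro P_Z_mono) auto
   finally show "P.Z (max 0 (?v + X h w' - (if b < ?v then \<delta> * h else 0))) <= P.Z (?v + X h w')" .
  qed
  also have "... = nexp (p * h) * (nexp (- p * h) * (\<E> w'. ennreal (P.Z (?v + X h w'))))"
   by (simp add: mult.assoc[symmetric] flip: ennreal_mult exp_add)
  also have "... <= nexp (p * h) * ennreal (P.Z ?v)"
   by (intro mult_left_mono P.Z_step(1) h) simp
  finally show "(\<E> w'. ennreal (P.Z (max 0 (?v + X h w' - (if b < ?v then \<delta> * h else 0))))) <= nexp (p * h) * ennreal (P.Z ?v)" .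
 qed
 also have "... = nexp (p * h) * (\<E> w. ennreal (P.Z (V h i w)))"
  by (rule nn_integral_cmult) measurable
 also have "... <= nexp (p * h) * ennreal (exp (p * (real i * h)) * P.Z x0)"
  by (intro mult_left_mono Suc) simp
 also have "... = ennreal (exp (p * h) * (exp (p * (real i * h)) * P.Z x0))"
  using P.Z_ge_1[of x0] by (intro ennreal_mult[symmetric]) auto
 also have "exp (p * h) * (exp (p * (real i * h)) * P.Z x0) = exp (p * (real (Suc i) * h)) * P.Z x0"
  by (simp add: mult.assoc[symmetric] exp_add[symmetric]) (simp add: algebra_simps)
 finally show ?case .
qed

text \<open>A window of width \<open>1/2\<close> bounds \<open>P.Z x\<close> below by a multiple of
  \<open>Wp (x - 1/2)\<close>, and exponential monotonicity with \<open>X.root p = \<phi>\<close>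
  compares this with \<open>Wp (1/2)\<close>. On \<open>[0, 1]\<close> the bound
  \<open>P.Z x \<ge> 1\<close> is enough.\<close>

lemma P_Z_lower: "EX c>0. ALL x>=0. c * exp (\<phi> * x) <= P.Z x"
proof -
 define c1 where "c1 = p / 2 * Wp (1/2) * exp (- \<phi>)"
 have c1: "0 < c1" using P.X.q_pos P.X.W_pos[of "1/2"] by (simp add: c1_def)
 have big: "c1 * exp (\<phi> * x) <= P.Z x" if x: "1 <= x" for x
 proof -
  have "ennreal ((1/2 - 0) * Wp (x - 1/2)) <= P.X.cv (ind {0..<1/2}) x" by (rule P.X.cv_Ico(2)) simp
  also have "... <= P.X.cv (ind {0..}) x" by (rule P.X.cv_mono) (auto simp: indicator_def)
  also have "... = ennreal ((P.Z x - 1) / p)" by (rule P.cv_Z)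
  finally have "1/2 * Wp (x - 1/2) <= (P.Z x - 1) / p"
   using P.X.q_pos P.Z_ge_1[of x] by (subst (asm) ennreal_le_iff) auto
  then have le: "p / 2 * Wp (x - 1/2) <= P.Z x" using P.X.q_pos by (simp add: field_simps)
  have "Wp (1/2) * exp (- \<phi> * (1/2)) <= Wp (x - 1/2) * exp (- \<phi> * (x - 1/2))"
   using P.X.W_exp_mono[of "1/2" "x - 1/2"] x by (simp only: root_p)
  then have "Wp (1/2) * exp (- \<phi> * (1/2)) * exp (\<phi> * (x - 1/2)) <= Wp (x - 1/2) * exp (- \<phi> * (x - 1/2)) * exp (\<phi> * (x - 1/2))"
   by (intro mult_right_mono) auto
  then have "Wp (1/2) * exp (\<phi> * (x - 1)) <= Wp (x - 1/2)"
   by (simp add: mult.assoc exp_add[symmetric]) (simp add: algebra_simps)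
  then have "p / 2 * (Wp (1/2) * exp (\<phi> * (x - 1))) <= p / 2 * Wp (x - 1/2)"
   using P.X.q_pos by (intro mult_left_mono) auto
  moreover have "p / 2 * (Wp (1/2) * exp (\<phi> * (x - 1))) = c1 * exp (\<phi> * x)"
   by (simp add: c1_def right_diff_distrib exp_diff exp_minus field_simps)
  ultimately show ?thesis using le by simp
 qed
 have small: "exp (- \<phi>) * exp (\<phi> * x) <= P.Z x" if "0 <= x" "x <= 1" for x
 proof -
  have "exp (- \<phi>) * exp (\<phi> * x) = exp (\<phi> * (x - 1))" by (simp add: exp_add[symmetric] algebra_simps)
  also have "... <= 1" using that \<phi>_pos by (simp add: mult_le_0_iff)
  finally show ?thesis using P.Z_ge_1[of x] by simp
 qed
 have "min c1 (exp (- \<phi>)) * exp (\<phi> * x) <= P.Z x" if "0 <= x" for x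
 proof (cases "x <= 1")
  case True
  have "min c1 (exp (- \<phi>)) * exp (\<phi> * x) <= exp (- \<phi>) * exp (\<phi> * x)" by (intro mult_right_mono) auto
  then show ?thesis using small[OF that True] by linarith
 next
  case False
  have "min c1 (exp (- \<phi>)) * exp (\<phi> * x) <= c1 * exp (\<phi> * x)" by (intro mult_right_mono) auto
  then show ?thesis using big[of x] False by linarith
 qed
 then show ?thesis using c1 by (intro exI[of _ "min c1 (exp (- \<phi>))"]) auto
qed

lemma exp_moment: "EX C>=0. ALL h i. 0 < h --> real i * h <= T --> (\<E> w. nexp (\<phi> * V h i w)) <= ennreal C"
proof -
 obtain c where c: "0 < c" "!!x. 0 <= x ==> c * exp (\<phi> * x) <= P.Z x" using P_Z_lower by auto
 define C where "C = exp (p * T) * P.Z x0 / c"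
 have Z0: "0 <= P.Z x0" using P.Z_ge_1[of x0] by simp
 have "(\<E> w. nexp (\<phi> * V h i w)) <= ennreal C" if h: "0 < h" "real i * h <= T" for h i
 proof -
  have [measurable]: "V h i \<in> borel_measurable M" using h(1) by (rule V_measurable)
  have "(\<E> w. nexp (\<phi> * V h i w)) <= (\<E> w. ennreal (1 / c) * ennreal (P.Z (V h i w)))"
  proof (rule nn_integral_mono)
   fix w
   have "exp (\<phi> * V h i w) <= 1 / c * P.Z (V h i w)"
    using c(2)[OF V_nonneg, of h i w] c(1) by (simp add: field_simps)
   then show "nexp (\<phi> * V h i w) <= ennreal (1 / c) * ennreal (P.Z (V h i w))"
    using c(1) P.Z_ge_1[of "V h i w"] by (simp add: ennreal_leI flip: ennreal_mult)
  qed
  also have "... = ennreal (1 / c) * (\<E> w. ennreal (P.Z (V h i w)))"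
   by (rule nn_integral_cmult) measurable
  also have "... <= ennreal (1 / c) * ennreal (exp (p * (real i * h)) * P.Z x0)"
   by (intro mult_left_mono P_Z_moment h) simp
  also have "... = ennreal (1 / c * (exp (p * (real i * h)) * P.Z x0))"
   using c(1) Z0 by (intro ennreal_mult[symmetric]) auto
  also have "... <= ennreal C"
  proof (rule ennreal_leI)
   have "exp (p * (real i * h)) * P.Z x0 <= exp (p * T) * P.Z x0"
    using h P.X.q_pos Z0 by (intro mult_right_mono) auto
   then show "1 / c * (exp (p * (real i * h)) * P.Z x0) <= C"
    using c(1) by (simp add: C_def divide_right_mono)
  qed
  finally show ?thesis .
 qed
 moreover have "0 <= C" using c(1) Z0 by (simp add: C_def)
 ultimately show ?thesis by blast
qed

text \<open>The convolution with the window serves as a potential: by \<open>Y.dynkin_cv\<close> a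
  free step of \<open>Y\<close> raises its discounted mean by exactly the occupation of the window.
  A step of the chain ends no lower than the free step of \<open>Y\<close> and the potential is
  increasing, so the sum telescopes. The result is proportional to the width;
  \<open>-1 \<le> \<alpha>\<close> accounts for the factor \<open>exp \<phi>\<close>.\<close>

lemma occupation_sum:
 assumes h: "0 < h" and ab: "\<alpha> <= \<beta>" "-1 <= \<alpha>"
 shows "(\<Sum>i<N. nexp (- q * (real i * h)) * (\<E> w. Y.occ q (ind {\<alpha>..<\<beta>}) h (V h i w)))
  <= ennreal ((\<beta> - \<alpha>) * (\<phi> / q * exp \<phi>)) * (\<E> w. nexp (\<phi> * V h N w))"
proof -
 let ?f = "ind {\<alpha>..<\<beta>} :: real => real"
 have f0: "?f \<in> borel_measurable borel" "!!x. 0 <= ?f x" "!!x. ?f x <= 1" "!!x. x < \<alpha> ==> ?f x = 0"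
  by (auto simp: indicator_def)
 note f = f0 X.indicator_Ico_right[of \<alpha> \<beta>]
 note [measurable] = f(1)
 have mV [measurable]: "V h i \<in> borel_measurable M" for i using h by (rule V_measurable)
 have [measurable]: "X h \<in> borel_measurable M" using h by (intro X_meas) simp
 have cv_mono': "Y.cv ?f x <= Y.cv ?f y" if "x <= y" for x y
  unfolding Y.cv_def using that by (intro nn_integral_mono ennreal_leI mult_right_mono Y.W_mono) auto
 have "(\<Sum>i<N. nexp (- q * (real i * h)) * (\<E> w. Y.occ q ?f h (V h i w)))
  <= nexp (- q * (real N * h)) * (\<E> w. Y.cv ?f (V h N w))"
 proof (induction N)
  case 0 then show ?case by simp
 next
  case (Suc N)
  have "(\<E> w. Y.cv ?f (V h N w)) + (\<E> w. Y.occ q ?f h (V h N w))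
   = (\<E> w. Y.cv ?f (V h N w) + Y.occ q ?f h (V h N w))"
   by (rule nn_integral_add[symmetric]) auto
  also have "... <= (\<E> w. nexp (- q * h) * (\<E> w'. Y.cv ?f (max 0 (V h N w + X h w' - (if b < V h N w then \<delta> * h else 0)))))"
  proof (rule nn_integral_mono)
   fix w
   have "Y.cv ?f (V h N w) + Y.occ q ?f h (V h N w) = nexp (- q * h) * (\<E> w'. Y.cv ?f (V h N w + (X h w' - \<delta> * h)))"
    by (rule Y.dynkin_cv[OF f, symmetric]) (use h in auto)
   also have "... <= nexp (- q * h) * (\<E> w'. Y.cv ?f (max 0 (V h N w + X h w' - (if b < V h N w then \<delta> * h else 0))))"
   proof (intro mult_left_mono nn_integral_mono cv_mono')
    have "0 <= \<delta> * h" using h \<delta>_pos by simp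
    then show "V h N w + (X h w' - \<delta> * h) <= max 0 (V h N w + X h w' - (if b < V h N w then \<delta> * h else 0))" for w'
     by (auto simp: le_max_iff_disj)
   qed simp
   finally show "Y.cv ?f (V h N w) + Y.occ q ?f h (V h N w)
    <= nexp (- q * h) * (\<E> w'. Y.cv ?f (max 0 (V h N w + X h w' - (if b < V h N w then \<delta> * h else 0))))" .
  qed
  also have "... = nexp (- q * h) * (\<E> w. Y.cv ?f (V h (Suc N) w))"
  proof (subst V_step[OF h])
   note X_meas [measurable del]
   show "(\<E> w. nexp (- q * h) * (\<E> w'. Y.cv ?f (max 0 (V h N w + X h w' - (if b < V h N w then \<delta> * h else 0)))))
    = nexp (- q * h) * (\<E> w. (\<E> w'. Y.cv ?f (max 0 (V h N w + X h w' - (if b < V h N w then \<delta> * h else 0)))))"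
    by (rule nn_integral_cmult) measurable
  qed measurable
  finally have step: "(\<E> w. Y.cv ?f (V h N w)) + (\<E> w. Y.occ q ?f h (V h N w))
   <= nexp (- q * h) * (\<E> w. Y.cv ?f (V h (Suc N) w))" .
  have "(\<Sum>i<Suc N. nexp (- q * (real i * h)) * (\<E> w. Y.occ q ?f h (V h i w)))
   <= nexp (- q * (real N * h)) * (\<E> w. Y.cv ?f (V h N w)) + nexp (- q * (real N * h)) * (\<E> w. Y.occ q ?f h (V h N w))"
   using Suc by (simp add: add_right_mono)
  also have "... = nexp (- q * (real N * h)) * ((\<E> w. Y.cv ?f (V h N w)) + (\<E> w. Y.occ q ?f h (V h N w)))"
   by (simp add: distrib_left)
  also have "... <= nexp (- q * (real N * h)) * (nexp (- q * h) * (\<E> w. Y.cv ?f (V h (Suc N) w)))"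
   by (intro mult_left_mono step) simp
  also have "... = nexp (- q * (real (Suc N) * h)) * (\<E> w. Y.cv ?f (V h (Suc N) w))"
   by (simp add: mult.assoc[symmetric] exp_add[symmetric] distrib_right distrib_left add.commute flip: ennreal_mult)
  finally show ?case .
 qed
 also have "... <= 1 * (\<E> w. Y.cv ?f (V h N w))"
  using h X.q_pos by (intro mult_right_mono) (auto simp: ennreal_le_1)
 also have "... <= (\<E> w. ennreal ((\<beta> - \<alpha>) * (\<phi> / q * exp \<phi>)) * nexp (\<phi> * V h N w))"
  unfolding mult_1
 proof (rule nn_integral_mono)
  fix w
  let ?x = "V h N w"
  have "WY (?x - \<alpha>) = WY (?x - \<alpha>) * exp (- \<phi> * (?x - \<alpha>)) * exp (\<phi> * (?x - \<alpha>))" by (simp add: mult.assoc flip: exp_add)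
  also have "... <= \<phi> / q * exp (\<phi> * (?x + 1))"
   using ab \<phi>_pos X.q_pos Y.W_nonneg by (intro mult_mono Y.W_exp_le) auto
  also have "... = \<phi> / q * exp \<phi> * exp (\<phi> * ?x)" by (simp add: distrib_left exp_add)
  finally have "(\<beta> - \<alpha>) * WY (?x - \<alpha>) <= (\<beta> - \<alpha>) * (\<phi> / q * exp \<phi> * exp (\<phi> * ?x))"
   using ab by (intro mult_left_mono) auto
  then have "Y.cv ?f ?x <= ennreal ((\<beta> - \<alpha>) * (\<phi> / q * exp \<phi>) * exp (\<phi> * ?x))"
   using Y.cv_Ico(1)[OF ab(1), of ?x] by (simp add: mult.assoc) (meson ennreal_leI order_trans)
  moreover have "ennreal ((\<beta> - \<alpha>) * (\<phi> / q * exp \<phi>) * exp (\<phi> * ?x)) = ennreal ((\<beta> - \<alpha>) * (\<phi> / q * exp \<phi>)) * nexp (\<phi> * ?x)"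
   by (rule ennreal_mult) (use ab \<phi>_pos X.q_pos in auto)
  ultimately show "Y.cv ?f ?x <= ennreal ((\<beta> - \<alpha>) * (\<phi> / q * exp \<phi>)) * nexp (\<phi> * ?x)"
   by simp
 qed
 also have "... = ennreal ((\<beta> - \<alpha>) * (\<phi> / q * exp \<phi>)) * (\<E> w. nexp (\<phi> * V h N w))"
  by (rule nn_integral_cmult) measurable
 finally show ?thesis .
qed

end

section \<open>Accumulation of the one-step errors along the chain\<close>

context refracted_chain
begin

definition stepE :: "real => (real => ennreal) => real => ennreal" where
 "stepE h g v = (\<E> w. g (max 0 (v + X h w - (if b < v then \<delta> * h else 0))))"

lemma stepE_measurable [measurable]:
 assumes h: "0 < h" and [measurable]: "g \<in> borel_measurable borel"
 shows "stepE h g \<in> borel_measurable borel"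
proof -
 note X_meas [measurable del]
 have [measurable]: "X h \<in> borel_measurable M" using h by (intro X_meas) simp
 show ?thesis unfolding stepE_def[abs_def] by measurable
qed

lemma V_stepE:
 assumes "0 < h" "g \<in> borel_measurable borel"
 shows "(\<E> w. g (V h (Suc i) w)) = (\<E> w. stepE h g (V h i w))"
 unfolding stepE_def by (rule V_step[OF assms])

lemma disc_Suc: "nexp (- q * (real (Suc N) * h)) = nexp (- q * (real N * h)) * nexp (- q * h)"
 by (simp add: exp_add[symmetric] distrib_right distrib_left add.commute flip: ennreal_mult)

lemma accumulate_upper:
 assumes h: "0 < h" and [measurable]: "g \<in> borel_measurable borel" "u \<in> borel_measurable borel"
  and step: "!!v. 0 <= v ==> nexp (- q * h) * stepE h g v <= g v + u v"
 shows "nexp (- q * (real N * h)) * (\<E> w. g (V h N w))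
  <= g x0 + (\<Sum>i<N. nexp (- q * (real i * h)) * (\<E> w. u (V h i w)))"
proof (induction N)
 case 0 then show ?case by (simp add: V_zero X.emeasure_space_1)
next
 case (Suc N)
 note V_measurable [measurable del]
 have [measurable]: "V h i \<in> borel_measurable M" for i using h by (rule V_measurable)
 note stepE_measurable [measurable del]
 have [measurable]: "stepE h g \<in> borel_measurable borel" using h by (rule stepE_measurable) measurable
 let ?D = "%N. nexp (- q * (real N * h))"
 have "?D (Suc N) * (\<E> w. g (V h (Suc N) w)) = ?D N * (\<E> w. nexp (- q * h) * stepE h g (V h N w))"
  unfolding disc_Suc by (subst V_stepE[OF h], measurable) (simp add: nn_integral_cmult mult.assoc)
 also have "... <= ?D N * (\<E> w. g (V h N w) + u (V h N w))"
  by (intro mult_left_mono nn_integral_mono step V_nonneg) simp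
 also have "... = ?D N * (\<E> w. g (V h N w)) + ?D N * (\<E> w. u (V h N w))"
  by (subst nn_integral_add) (auto simp: distrib_left)
 also have "... <= g x0 + (\<Sum>i<N. ?D i * (\<E> w. u (V h i w))) + ?D N * (\<E> w. u (V h N w))"
  by (intro add_right_mono Suc)
 finally show ?case by (simp add: add.assoc)
qed

lemma accumulate_lower:
 assumes h: "0 < h" and [measurable]: "g \<in> borel_measurable borel" "u \<in> borel_measurable borel" "s \<in> borel_measurable borel"
  and step: "!!v. 0 <= v ==> g v + s v <= nexp (- q * h) * stepE h g v + u v"
 shows "g x0 + (\<Sum>i<N. nexp (- q * (real i * h)) * (\<E> w. s (V h i w)))
  <= nexp (- q * (real N * h)) * (\<E> w. g (V h N w))
   + (\<Sum>i<N. nexp (- q * (real i * h)) * (\<E> w. u (V h i w)))"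
proof (induction N)
 case 0 then show ?case by (simp add: V_zero X.emeasure_space_1)
next
 case (Suc N)
 note V_measurable [measurable del]
 have [measurable]: "V h i \<in> borel_measurable M" for i using h by (rule V_measurable)
 note stepE_measurable [measurable del]
 have [measurable]: "stepE h g \<in> borel_measurable borel" using h by (rule stepE_measurable) measurable
 let ?D = "%N. nexp (- q * (real N * h))"
 let ?S = "%s N. (\<Sum>i<N. ?D i * (\<E> w. s (V h i w)))"
 have "g x0 + ?S s (Suc N) = (g x0 + ?S s N) + ?D N * (\<E> w. s (V h N w))"
  by (simp add: add.assoc)
 also have "... <= (?D N * (\<E> w. g (V h N w)) + ?S u N) + ?D N * (\<E> w. s (V h N w))"
  by (intro add_right_mono Suc)
 also have "... = ?D N * (\<E> w. g (V h N w) + s (V h N w)) + ?S u N"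
  by (subst nn_integral_add) (auto simp: distrib_left ac_simps)
 also have "... <= ?D N * (\<E> w. nexp (- q * h) * stepE h g (V h N w) + u (V h N w)) + ?S u N"
  by (intro add_right_mono mult_left_mono nn_integral_mono step V_nonneg) simp
 also have "(\<E> w. nexp (- q * h) * stepE h g (V h N w) + u (V h N w))
   = nexp (- q * h) * (\<E> w. g (V h (Suc N) w)) + (\<E> w. u (V h N w))"
  by (subst V_stepE[OF h], measurable) (simp add: nn_integral_add nn_integral_cmult)
 also have "?D N * ... + ?S u N = ?D (Suc N) * (\<E> w. g (V h (Suc N) w)) + ?S u (Suc N)"
  unfolding disc_Suc by (simp add: distrib_left ac_simps)
 finally show ?case .
qed

text \<open>The step estimates charge the time in a half-line, while \<open>occupation_sum\<close>
  treats windows. Starting above \<open>a\<close>, the process is either in the window reaching down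
  to \<open>a - eps\<close> or has fallen by more than \<open>eps\<close>, which has probability at
  most \<open>t0\<close> at each time up to \<open>h\<close>.\<close>

lemma occ_split:
 assumes h: "0 < h" and v: "a <= v" and t0: "0 <= t0" "!!s. 0 < s ==> s <= h ==> measure M {w\<in>space M. X s w - \<delta> * s < - eps} <= t0" and eps: "0 < eps"
 shows "Y.occ q (ind {..<c}) h v <= Y.occ q (ind {a - eps..<c}) h v + ennreal (t0 * h)"
proof -
 let ?Y = "%s w. X (max 0 s) w - \<delta> * max 0 s"
 note X_meas [measurable del]
 have [measurable]: "X (max 0 s) \<in> borel_measurable M" for s by (intro X_meas) simp
 have P: "(\<E> w. ind {..<-eps} (?Y s w)) <= ennreal t0" if s: "0 <= s" "s <= h" for s
 proof -
  have "(\<E> w. ind {..<-eps} (?Y s w)) = (\<E> w. ind {w\<in>space M. ?Y s w < - eps} w)"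
   by (intro nn_integral_cong) (auto simp: indicator_def)
  also have "... = ennreal (measure M {w\<in>space M. ?Y s w < - eps})"
   by (subst nn_integral_indicator) (auto simp: X.emeasure_eq_measure)
  also have "... <= ennreal t0"
   using s t0 eps X.X_zero by (cases "s = 0") (auto intro!: ennreal_leI)
  finally show ?thesis .
 qed
 have "Y.occ q (ind {..<c}) h v
  <= (\<L> s. (\<E> w. ennreal (exp (- q * s) * ind {a - eps..<c} (v + ?Y s w))) * ind {0..h} s + ennreal t0 * ind {0..h} s)"
  unfolding Y.occ_def
 proof (rule nn_integral_mono)
  fix s
  show "(\<E> w. ennreal (exp (- q * s) * ind {..<c} (v + ?Y s w))) * ind {0..h} s
   <= (\<E> w. ennreal (exp (- q * s) * ind {a - eps..<c} (v + ?Y s w))) * ind {0..h} s + ennreal t0 * ind {0..h} s"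
  proof (cases "s \<in> {0..h}")
   case True
   have "(\<E> w. ennreal (exp (- q * s) * ind {..<c} (v + ?Y s w)))
    <= (\<E> w. ennreal (exp (- q * s) * ind {a - eps..<c} (v + ?Y s w)) + ind {..<-eps} (?Y s w))"
    using v True X.q_pos by (intro nn_integral_mono) (auto simp: indicator_def ennreal_le_1)
   also have "... = (\<E> w. ennreal (exp (- q * s) * ind {a - eps..<c} (v + ?Y s w))) + (\<E> w. ind {..<-eps} (?Y s w))"
    by (rule nn_integral_add) measurable
   also have "... <= (\<E> w. ennreal (exp (- q * s) * ind {a - eps..<c} (v + ?Y s w))) + ennreal t0"
    using P[of s] True by (intro add_left_mono) auto
   finally show ?thesis using True by simp
  qed simp
 qed
 also have "... = Y.occ q (ind {a - eps..<c}) h v + (\<L> s. ennreal t0 * ind {0..h} s)"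
  unfolding Y.occ_def by (rule nn_integral_add) measurable
 also have "(\<L> s. ennreal t0 * ind {0..h} s) = ennreal (t0 * h)"
  using t0 h by (simp add: nn_integral_cmult ennreal_mult)
 finally show ?thesis .
qed

text \<open>The factor \<open>(1 - exp (- q * h)) / q\<close> is the discounted length of one step;
  membership is decided by the level at the left end of the step.\<close>

definition above_sum :: "real => nat => ennreal" where
 "above_sum h N = (\<Sum>i<N. nexp (- q * (real i * h)) * (\<E> w. ennreal ((1 - exp (- q * h)) / q) * ind {b<..} (V h i w)))"

lemma discounted_sum_le:
 assumes h: "0 < h"
 shows "(\<Sum>i<N. nexp (- q * (real i * h)) * ennreal a) <= ennreal (real N * a)"
proof -
 have "(\<Sum>i<N. nexp (- q * (real i * h)) * ennreal a) <= (\<Sum>i<N. 1 * ennreal a)"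
  using h X.q_pos by (intro sum_mono mult_right_mono) (auto simp: ennreal_le_1)
 also have "... = ennreal (real N * a)" by (simp add: ennreal_mult' ennreal_of_nat_eq_real_of_nat)
 finally show ?thesis .
qed

text \<open>The order of choices matters: the gap \<eta> is fixed so that all errors proportional to
  it are at most \<open>e / 2\<close>, then \<open>t0\<close> bounds the error per unit of time, and
  only then is the step size made small. With step \<open>1 / Suc n\<close> and
  \<open>T * Suc n\<close> steps the horizon is exactly \<open>T\<close>.\<close>

lemma chain_limit:
 assumes adm: "admissible g \<kappa>" and \<kappa>: "0 <= \<kappa>" and T: "0 < T" and e: "0 < e"
 shows "EV n.
  nexp (- q * real T) * (\<E> w. ennreal (g (V (1 / real (Suc n)) (T * Suc n) w)))
    <= ennreal (g x0) + ennreal \<kappa> * above_sum (1 / real (Suc n)) (T * Suc n) + ennreal e &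
  ennreal (g x0) + ennreal \<kappa> * above_sum (1 / real (Suc n)) (T * Suc n)
    <= nexp (- q * real T) * (\<E> w. ennreal (g (V (1 / real (Suc n)) (T * Suc n) w))) + ennreal e"
proof -
 let ?A = "%K k c g'. ALL v h. b < v --> 0 < h -->
   nexp (- q * h) * (\<E> w. ennreal (g' (v + (X h w - \<delta> * h)))) <= ennreal (g' v + \<kappa> * ((1 - exp (- q * h)) / q)) &
   ennreal (g' v + \<kappa> * ((1 - exp (- q * h)) / q)) <= nexp (- q * h) * (\<E> w. ennreal (g' (v + (X h w - \<delta> * h))))
    + ennreal K * Y.occ q (ind {..<c}) h v"
 let ?B = "%K k c g'. ALL v h. 0 <= v --> v <= b --> 0 < h -->
   nexp (- q * h) * (\<E> w. ennreal (g' (v + X h w))) <= ennreal (g' v)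
    + ennreal K * (\<E> w. nexp (k * X h w) * ind {c - b<..} (X h w)) &
   ennreal (g' v) <= nexp (- q * h) * (\<E> w. ennreal (g' (v + X h w)))
    + ennreal K * Y.occ q (ind {..<0}) h v"
 let ?R = "%K k c g'. g' \<in> borel_measurable borel & (ALL x. 0 <= g' x) &
  (ALL x<=0. g' x = g' 0) & (ALL x>=0. \<bar>g x - g' x\<bar> <= K * (c - b) * exp (\<phi> * x)) & ?A K k c g' & ?B K k c g'"
 note adm' = adm[unfolded admissible_def]
 have g_meas: "g \<in> borel_measurable borel" and g_nn': "ALL x. 0 <= g x"
  and ex0: "EX K>=0. EX k>=0. ALL c. b < c & c <= b + 1 --> (EX g'. ?R K k c g')"
  by (rule adm'[THEN conjunct1] adm'[THEN conjunct2, THEN conjunct1] adm'[THEN conjunct2, THEN conjunct2])+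
 have g_nn: "0 <= g x" for x using g_nn' by (rule spec)
 from ex0 obtain K k where K: "0 <= K" "0 <= k" and ex: "ALL c. b < c & c <= b + 1 --> (EX g'. ?R K k c g')"
  by (elim exE conjE) (rule that)
 note [measurable] = g_meas
 obtain C where C: "0 <= C" "!!h i. 0 < h ==> real i * h <= real T ==> (\<E> w. nexp (\<phi> * V h i w)) <= ennreal C"
  using exp_moment[of "real T"] by blast
 define C2 where "C2 = \<phi> / q * exp \<phi>"
 have C2: "0 <= C2" using \<phi>_pos X.q_pos by (simp add: C2_def)
 \<comment> \<open>The coefficient of \<eta> in the total error: replacing \<open>g\<close> by
   \<open>g'\<close> at the start and at the end, and the occupation of a window of width \<eta>
   below \<open>0\<close> and one of width \<open>2 * \<eta>\<close> around
   \<open>b\<close>.\<close>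
 define E where "E = K * exp (\<phi> * x0) + K * C + K * (3 * C2 * C)"
 have E: "0 <= E" using K C C2 by (simp add: E_def)
 define \<eta> where "\<eta> = min 1 (e / (2 * (E + 1)))"
 have \<eta>: "0 < \<eta>" "\<eta> <= 1" using e E by (auto simp: \<eta>_def)
 have \<eta>E: "\<eta> * E <= e / 2"
 proof -
  have "\<eta> * E <= e / (2 * (E + 1)) * (E + 1)" using E e by (intro mult_mono) (auto simp: \<eta>_def)
  also have "... = e / 2" using E by (simp add: field_simps)
  finally show ?thesis .
 qed
 \<comment> \<open>Each of the \<open>T / h\<close> steps may cost \<open>K * t0 * h\<close>, so the
   total stays below \<open>e / 2\<close>.\<close>
 define t0 where "t0 = e / (2 * (K * real T + 1))"
 have KT: "0 <= K * real T" using K by simp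
 have t0: "0 < t0" using e KT by (simp add: t0_def)
 have t0T: "real T * (K * t0) <= e / 2"
 proof -
  have "real T * (K * t0) <= (K * real T + 1) * t0" using t0 by (simp add: algebra_simps)
  also have "... = e / 2" using KT by (simp add: t0_def field_simps)
  finally show ?thesis .
 qed
 define c where "c = b + \<eta>"
 have c: "b < c" "c <= b + 1" "c - b = \<eta>" using \<eta> by (auto simp: c_def)
 from ex have "b < c & c <= b + 1 --> (EX g'. ?R K k c g')" by (rule spec)
 then have "EX g'. ?R K k c g'" by (rule mp) (use c in simp)
 then obtain g' where R: "?R K k c g'" by (rule exE)
 note Rs = R[THEN conjunct1] R[THEN conjunct2, THEN conjunct1] R[THEN conjunct2, THEN conjunct2, THEN conjunct1]
  R[THEN conjunct2, THEN conjunct2, THEN conjunct2, THEN conjunct1] R[THEN conjunct2, THEN conjunct2, THEN conjunct2, THEN conjunct2, THEN conjunct1]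
  R[THEN conjunct2, THEN conjunct2, THEN conjunct2, THEN conjunct2, THEN conjunct2]
 have g'_meas: "g' \<in> borel_measurable borel" and g'_nn': "ALL x. 0 <= g' x" and g'_neg': "ALL x<=0. g' x = g' 0"
  and g_g'': "ALL x>=0. \<bar>g x - g' x\<bar> <= K * (c - b) * exp (\<phi> * x)" and A: "?A K k c g'" and B: "?B K k c g'"
  by (rule Rs)+
 have g'_nn: "0 <= g' x" for x using g'_nn' by (rule spec)
 note g'_neg = g'_neg'[rule_format]
 note g_g' = g_g''[rule_format, unfolded c(3)]
 note above = A[rule_format, THEN conjunct1] A[rule_format, THEN conjunct2]
 note below = B[rule_format, THEN conjunct1, unfolded c(3)] B[rule_format, THEN conjunct2]
 note [measurable] = g'_meas
 have "\<forall>\<^sub>F h in at_right 0. (\<E> w. nexp (k * X h w) * ind {\<eta><..} (X h w)) <= ennreal (t0 * h)"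
  using X.exp_tail_small[of k \<eta> t0] K \<eta> t0 by simp
 moreover have "\<forall>\<^sub>F h in at_right 0. measure M {w\<in>space M. X h w - \<delta> * h < - \<eta>} < t0"
  using Y.small_time_lower_tail[OF \<eta>(1)] t0 by (intro order_tendstoD)
 ultimately have "\<forall>\<^sub>F h in at_right 0. (\<E> w. nexp (k * X h w) * ind {\<eta><..} (X h w)) <= ennreal (t0 * h)
  & measure M {w\<in>space M. X h w - \<delta> * h < - \<eta>} < t0" by (rule eventually_conj)
 then obtain d where d: "0 < d" "!!h. 0 < h ==> h < d ==> (\<E> w. nexp (k * X h w) * ind {\<eta><..} (X h w)) <= ennreal (t0 * h)"
  "!!h. 0 < h ==> h < d ==> measure M {w\<in>space M. X h w - \<delta> * h < - \<eta>} < t0"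
  unfolding eventually_at_right_field by blast
 have "(%n. 1 / real (Suc n)) ----> 0" by real_asymp
 then have "EV n. 1 / real (Suc n) < d" using d(1) by (rule order_tendstoD)
 then show ?thesis
 proof eventually_elim
  case (elim n)
  define h where "h = 1 / real (Suc n)"
  define N where "N = T * Suc n"
  have h: "0 < h" "h < d" using elim by (auto simp: h_def)
  have Nh: "real N * h = real T" unfolding N_def h_def of_nat_mult by simp
  note V_measurable [measurable del]
  have [measurable]: "V h i \<in> borel_measurable M" for i using h(1) by (rule V_measurable)
  have CN: "(\<E> w. nexp (\<phi> * V h N w)) <= ennreal C" by (rule C(2)[OF h(1)]) (simp add: Nh)
  let ?r = "(1 - exp (- q * h)) / q"
  have r: "0 <= ?r" using h X.q_pos by simp
  have kr: "0 <= \<kappa> * ?r" by (rule mult_nonneg_nonneg[OF \<kappa> r])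
  let ?g = "%v. ennreal (g' v)"
  let ?s = "%v. ennreal (\<kappa> * ?r) * ind {b<..} v"
  let ?D = "%i. nexp (- q * (real i * h))"
  have s_sum: "(\<Sum>i<N. ?D i * (\<E> w. ?s (V h i w))) = ennreal \<kappa> * above_sum h N"
  proof -
   have "(\<E> w. ?s (V h i w)) = ennreal \<kappa> * (\<E> w. ennreal ?r * ind {b<..} (V h i w))" for i
    unfolding ennreal_mult[OF \<kappa> r] mult.assoc by (rule nn_integral_cmult) measurable
   then show ?thesis by (simp add: above_sum_def sum_distrib_left mult.left_commute)
  qed
  have g'_max: "g' (max 0 y) = g' y" for y
  proof (cases "y <= 0")
   case True
   then show ?thesis using g'_neg[OF True] by (simp add: max_def)
  qed (simp add: max_def)
  have step_above: "stepE h ?g v = (\<E> w. ennreal (g' (v + (X h w - \<delta> * h))))" if "b < v" for v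
   unfolding stepE_def g'_max using that by (simp add: add_diff_eq)
  have step_below: "stepE h ?g v = (\<E> w. ennreal (g' (v + X h w)))" if "v <= b" for v
   unfolding stepE_def g'_max using that by simp
  have "?D N * (\<E> w. ?g (V h N w)) <= ?g x0 + (\<Sum>i<N. ?D i * (\<E> w. ?s (V h i w) + ennreal (K * (t0 * h))))"
  proof (rule accumulate_upper[OF h(1)])
   fix v :: real assume v: "0 <= v"
   show "nexp (- q * h) * stepE h ?g v <= ?g v + (?s v + ennreal (K * (t0 * h)))"
   proof (cases "b < v")
    case True
    have "nexp (- q * h) * stepE h ?g v <= ennreal (g' v + \<kappa> * ?r)"
     unfolding step_above[OF True] by (rule above(1)[OF True h(1)])
    also have "... = ?g v + ?s v" unfolding ennreal_plus[OF g'_nn kr] using True by simp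
    finally show ?thesis by (simp add: add.assoc[symmetric] add_increasing2)
   next
    case False
    then have vb: "v <= b" by simp
    have "nexp (- q * h) * stepE h ?g v <= ?g v + ennreal K * (\<E> w. nexp (k * X h w) * ind {\<eta><..} (X h w))"
     unfolding step_below[OF vb] by (rule below(1)[OF v vb h(1)])
    also have "... <= ?g v + ennreal K * ennreal (t0 * h)"
     by (intro add_left_mono mult_left_mono d h) simp
    finally show ?thesis using False K t0 h by (simp add: ennreal_mult)
   qed
  qed measurable
  also have "(\<Sum>i<N. ?D i * (\<E> w. ?s (V h i w) + ennreal (K * (t0 * h))))
    = (\<Sum>i<N. ?D i * (\<E> w. ?s (V h i w))) + (\<Sum>i<N. ?D i * ennreal (K * (t0 * h)))"
   by (simp add: nn_integral_add X.emeasure_space_1 distrib_left sum.distrib)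
  also have "... <= ennreal \<kappa> * above_sum h N + ennreal (e / 2)"
  proof (rule add_mono)
   have "(\<Sum>i<N. ?D i * ennreal (K * (t0 * h))) <= ennreal (real N * (K * (t0 * h)))"
    by (rule discounted_sum_le[OF h(1)])
   also have "real N * (K * (t0 * h)) = (real N * h) * (K * t0)" by (simp add: mult_ac)
   also have "ennreal ... <= ennreal (e / 2)" unfolding Nh by (intro ennreal_leI t0T)
   finally show "(\<Sum>i<N. ?D i * ennreal (K * (t0 * h))) <= ennreal (e / 2)" .
  qed (simp only: s_sum order_refl)
  finally have upper: "?D N * (\<E> w. ?g (V h N w)) <= ?g x0 + (ennreal \<kappa> * above_sum h N + ennreal (e / 2))"
   by (simp add: add_left_mono)
  let ?f1 = "ind {0 - \<eta>..<0} :: real => real"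
  let ?f2 = "ind {b - \<eta>..<c} :: real => real"
  let ?u = "%v. ennreal K * (Y.occ q ?f1 h v + Y.occ q ?f2 h v) + ennreal (K * (t0 * h))"
  have ms: "measure M {w\<in>space M. X s w - \<delta> * s < - \<eta>} <= t0" if "0 < s" "s <= h" for s
   using d(3)[of s] that h by simp
  have "?g x0 + (\<Sum>i<N. ?D i * (\<E> w. ?s (V h i w))) <= ?D N * (\<E> w. ?g (V h N w)) + (\<Sum>i<N. ?D i * (\<E> w. ?u (V h i w)))"
  proof (rule accumulate_lower[OF h(1)])
   fix v :: real assume v: "0 <= v"
   show "?g v + ?s v <= nexp (- q * h) * stepE h ?g v + ?u v"
   proof (cases "b < v")
    case True
    have "?g v + ?s v = ennreal (g' v + \<kappa> * ?r)" unfolding ennreal_plus[OF g'_nn kr] using True by simp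
    also have "... <= nexp (- q * h) * stepE h ?g v + ennreal K * Y.occ q (ind {..<c}) h v"
     unfolding step_above[OF True] by (rule above(2)[OF True h(1)])
    also have "... <= nexp (- q * h) * stepE h ?g v + ennreal K * (Y.occ q ?f2 h v + ennreal (t0 * h))"
     using True t0 ms \<eta> by (intro add_left_mono mult_left_mono occ_split[OF h(1)]) auto
    also have "... <= nexp (- q * h) * stepE h ?g v + ?u v"
     using K t0 h by (simp add: distrib_left ennreal_mult add_left_mono add_right_mono add_increasing)
    finally show ?thesis .
   next
    case False
    then have vb: "v <= b" by simp
    have "?g v + ?s v = ?g v" using False by simp
    also have "... <= nexp (- q * h) * stepE h ?g v + ennreal K * Y.occ q (ind {..<0}) h v"
     unfolding step_below[OF vb] by (rule below(2)[OF v vb h(1)])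
    also have "... <= nexp (- q * h) * stepE h ?g v + ennreal K * (Y.occ q ?f1 h v + ennreal (t0 * h))"
     using v t0 ms \<eta> by (intro add_left_mono mult_left_mono occ_split[OF h(1)]) auto
    also have "... <= nexp (- q * h) * stepE h ?g v + ?u v"
     using K t0 h by (simp add: distrib_left ennreal_mult add_left_mono add_right_mono add_increasing2 add.assoc)
    finally show ?thesis .
   qed
  qed measurable
  also have "(\<Sum>i<N. ?D i * (\<E> w. ?u (V h i w)))
   = ennreal K * ((\<Sum>i<N. ?D i * (\<E> w. Y.occ q ?f1 h (V h i w))) + (\<Sum>i<N. ?D i * (\<E> w. Y.occ q ?f2 h (V h i w))))
   + (\<Sum>i<N. ?D i * ennreal (K * (t0 * h)))"
  proof -
   have "(\<E> w. ?u (V h i w)) = ennreal K * ((\<E> w. Y.occ q ?f1 h (V h i w)) + (\<E> w. Y.occ q ?f2 h (V h i w))) + ennreal (K * (t0 * h))" for i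
    by (simp add: nn_integral_add nn_integral_cmult X.emeasure_space_1)
   then show ?thesis by (simp add: distrib_left sum.distrib sum_distrib_left mult.left_commute)
  qed
  also have "... <= ennreal K * (ennreal ((0 - (0 - \<eta>)) * C2) * ennreal C + ennreal ((c - (b - \<eta>)) * C2) * ennreal C) + ennreal (e / 2)"
  proof (intro add_mono mult_left_mono)
   have "(\<Sum>i<N. ?D i * (\<E> w. Y.occ q ?f1 h (V h i w))) <= ennreal ((0 - (0 - \<eta>)) * C2) * (\<E> w. nexp (\<phi> * V h N w))"
    unfolding C2_def by (rule occupation_sum[OF h(1)]) (use \<eta> in auto)
   also have "... <= ennreal ((0 - (0 - \<eta>)) * C2) * ennreal C" by (intro mult_left_mono CN) simp
   finally show "(\<Sum>i<N. ?D i * (\<E> w. Y.occ q ?f1 h (V h i w))) <= ennreal ((0 - (0 - \<eta>)) * C2) * ennreal C" .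
   have "(\<Sum>i<N. ?D i * (\<E> w. Y.occ q ?f2 h (V h i w))) <= ennreal ((c - (b - \<eta>)) * C2) * (\<E> w. nexp (\<phi> * V h N w))"
    unfolding C2_def by (rule occupation_sum[OF h(1)]) (use \<eta> c b_pos in auto)
   also have "... <= ennreal ((c - (b - \<eta>)) * C2) * ennreal C" by (intro mult_left_mono CN) simp
   finally show "(\<Sum>i<N. ?D i * (\<E> w. Y.occ q ?f2 h (V h i w))) <= ennreal ((c - (b - \<eta>)) * C2) * ennreal C" .
   have "(\<Sum>i<N. ?D i * ennreal (K * (t0 * h))) <= ennreal (real N * (K * (t0 * h)))"
    by (rule discounted_sum_le[OF h(1)])
   also have "real N * (K * (t0 * h)) = (real N * h) * (K * t0)" by (simp add: mult_ac)
   also have "ennreal ... <= ennreal (e / 2)" unfolding Nh by (intro ennreal_leI t0T)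
   finally show "(\<Sum>i<N. ?D i * ennreal (K * (t0 * h))) <= ennreal (e / 2)" .
  qed simp
  also have "... = ennreal (\<eta> * (K * (3 * C2 * C)) + e / 2)"
  proof -
   have "(0 - (0 - \<eta>)) * C2 = \<eta> * C2" "(c - (b - \<eta>)) * C2 = 2 * \<eta> * C2" by (auto simp: c_def)
   then show ?thesis using K C C2 \<eta> e by (simp add: algebra_simps flip: ennreal_mult ennreal_plus)
  qed
  finally have lower: "?g x0 + ennreal \<kappa> * above_sum h N <= ?D N * (\<E> w. ?g (V h N w)) + ennreal (\<eta> * (K * (3 * C2 * C)) + e / 2)"
   unfolding s_sum by (simp add: add_left_mono)
  have DT: "?D N = nexp (- q * real T)" by (simp add: Nh)
  have D1: "?D N <= 1" using X.q_pos by (simp add: Nh ennreal_le_1)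
  have Keta: "0 <= K * \<eta>" using K \<eta> by simp
  have dist: "(\<E> w. ennreal (f1 (V h N w))) <= (\<E> w. ennreal (f2 (V h N w))) + ennreal (K * \<eta> * C)"
   if f: "!!x. 0 <= x ==> f1 x <= f2 x + K * \<eta> * exp (\<phi> * x)" "!!x. 0 <= f2 x" and [measurable]: "f2 \<in> borel_measurable borel" for f1 f2
  proof -
   have "(\<E> w. ennreal (f1 (V h N w))) <= (\<E> w. ennreal (f2 (V h N w)) + ennreal (K * \<eta>) * nexp (\<phi> * V h N w))"
    using f Keta V_nonneg[of h N] by (intro nn_integral_mono) (auto intro!: ennreal_leI simp flip: ennreal_mult ennreal_plus)
   also have "... = (\<E> w. ennreal (f2 (V h N w))) + ennreal (K * \<eta>) * (\<E> w. nexp (\<phi> * V h N w))"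
    by (subst nn_integral_add) (auto simp: nn_integral_cmult)
   also have "... <= (\<E> w. ennreal (f2 (V h N w))) + ennreal (K * \<eta>) * ennreal C"
    by (intro add_left_mono mult_left_mono CN) simp
   finally show ?thesis using Keta C by (simp add: ennreal_mult)
  qed
  have f12: "g x <= g' x + K * \<eta> * exp (\<phi> * x)" "g' x <= g x + K * \<eta> * exp (\<phi> * x)" if "0 <= x" for x
   using g_g'[OF that] by auto
  have x0': "ennreal (g' x0) <= ennreal (g x0) + ennreal (K * \<eta> * exp (\<phi> * x0))" "ennreal (g x0) <= ennreal (g' x0) + ennreal (K * \<eta> * exp (\<phi> * x0))"
   using f12[OF x0] g_nn[of x0] g'_nn[of x0] Keta by (auto intro!: ennreal_leI simp flip: ennreal_plus)
  have 1: "?D N * (\<E> w. ennreal (g (V h N w))) <= ennreal (g x0) + ennreal \<kappa> * above_sum h N + ennreal e"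
  proof -
   have "?D N * (\<E> w. ennreal (g (V h N w))) <= ?D N * ((\<E> w. ?g (V h N w)) + ennreal (K * \<eta> * C))"
    by (intro mult_left_mono dist f12 g'_nn) auto
   also have "... <= ?D N * (\<E> w. ?g (V h N w)) + 1 * ennreal (K * \<eta> * C)"
    unfolding distrib_left by (intro add_left_mono mult_right_mono D1) simp
   also have "... <= (?g x0 + (ennreal \<kappa> * above_sum h N + ennreal (e / 2))) + ennreal (K * \<eta> * C)"
    using upper by (simp add: add_right_mono)
   also have "... <= ((ennreal (g x0) + ennreal (K * \<eta> * exp (\<phi> * x0))) + (ennreal \<kappa> * above_sum h N + ennreal (e / 2))) + ennreal (K * \<eta> * C)"
    by (intro add_right_mono x0')
   also have "... = ennreal (g x0) + ennreal \<kappa> * above_sum h N + (ennreal (K * \<eta> * exp (\<phi> * x0)) + ennreal (e / 2) + ennreal (K * \<eta> * C))"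
    by (simp add: ac_simps)
   also have "ennreal (K * \<eta> * exp (\<phi> * x0)) + ennreal (e / 2) + ennreal (K * \<eta> * C) = ennreal (K * \<eta> * exp (\<phi> * x0) + e / 2 + K * \<eta> * C)"
    using Keta C e by (simp flip: ennreal_plus)
   also have "ennreal (g x0) + ennreal \<kappa> * above_sum h N + ... <= ennreal (g x0) + ennreal \<kappa> * above_sum h N + ennreal e"
   proof (intro add_left_mono ennreal_leI)
    have "K * \<eta> * exp (\<phi> * x0) + K * \<eta> * C <= \<eta> * E"
     using K \<eta> C C2 by (simp add: E_def algebra_simps)
    then show "K * \<eta> * exp (\<phi> * x0) + e / 2 + K * \<eta> * C <= e" using \<eta>E by simp
   qed
   finally show ?thesis .
  qed
  have 2: "ennreal (g x0) + ennreal \<kappa> * above_sum h N <= ?D N * (\<E> w. ennreal (g (V h N w))) + ennreal e"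
  proof -
   have "ennreal (g x0) + ennreal \<kappa> * above_sum h N <= (?g x0 + ennreal \<kappa> * above_sum h N) + ennreal (K * \<eta> * exp (\<phi> * x0))"
    using x0'(2) by (simp add: add.assoc add.left_commute add_mono)
   also have "... <= (?D N * (\<E> w. ?g (V h N w)) + ennreal (\<eta> * (K * (3 * C2 * C)) + e / 2)) + ennreal (K * \<eta> * exp (\<phi> * x0))"
    by (intro add_right_mono lower)
   also have "?D N * (\<E> w. ?g (V h N w)) <= ?D N * ((\<E> w. ennreal (g (V h N w))) + ennreal (K * \<eta> * C))"
    by (intro mult_left_mono dist f12 g_nn) auto
   also have "... <= ?D N * (\<E> w. ennreal (g (V h N w))) + 1 * ennreal (K * \<eta> * C)"
    unfolding distrib_left by (intro add_left_mono mult_right_mono D1) simp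
   finally have "ennreal (g x0) + ennreal \<kappa> * above_sum h N <= ?D N * (\<E> w. ennreal (g (V h N w)))
    + (ennreal (K * \<eta> * C) + ennreal (\<eta> * (K * (3 * C2 * C)) + e / 2) + ennreal (K * \<eta> * exp (\<phi> * x0)))"
    by (simp add: add.assoc)
   also have "ennreal (K * \<eta> * C) + ennreal (\<eta> * (K * (3 * C2 * C)) + e / 2) + ennreal (K * \<eta> * exp (\<phi> * x0)) = ennreal (\<eta> * E + e / 2)"
    using Keta K C C2 \<eta> e by (simp add: E_def algebra_simps flip: ennreal_plus)
   also have "?D N * (\<E> w. ennreal (g (V h N w))) + ... <= ?D N * (\<E> w. ennreal (g (V h N w))) + ennreal e"
    using \<eta>E by (intro add_left_mono ennreal_leI) simp
   finally show ?thesis .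
  qed
  have "?D N * (\<E> w. ennreal (g (V h N w))) <= ennreal (g x0) + ennreal \<kappa> * above_sum h N + ennreal e &
   ennreal (g x0) + ennreal \<kappa> * above_sum h N <= ?D N * (\<E> w. ennreal (g (V h N w))) + ennreal e"
   using 1 2 by (rule conjI)
  then show ?case unfolding DT unfolding h_def N_def .
 qed
qed

end

section \<open>Discounted time of the chain above the level\<close>

context refracted_chain
begin

definition \<rho> :: real where "\<rho> = exp (- \<phi> * b) / (\<phi> * q * \<delta> * Tail)"

lemma \<rho>_pos: "0 < \<rho>"
 using \<phi>_pos X.q_pos \<delta>_pos tail_split(4) by (simp add: \<rho>_def)

lemma w_r_compare:
 assumes eps: "0 < eps"
 shows "EX C>=0. ALL x>=0. F b x <= (\<rho> + eps) * r b x + C & \<rho> * r b x <= F b x + eps * r b x + C"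
proof -
 have "\<forall>\<^sub>F x in at_top. dist (F b x / r b x) \<rho> < eps"
  using w_r_ratio eps unfolding \<rho>_def by (rule tendstoD)
 then obtain a where a: "!!x. a <= x ==> dist (F b x / r b x) \<rho> < eps" by (auto simp: eventually_at_top_linorder)
 define a' where "a' = max 0 a"
 define C where "C = K0 * exp (k0 * a') + \<rho> * (1 + q * (K0 * exp (k0 * a')))"
 have pos: "0 <= K0 * exp (k0 * a')" "0 <= \<rho> * (1 + q * (K0 * exp (k0 * a')))"
  using K0_pos \<rho>_pos X.q_pos by auto
 have C0: "0 <= C" using pos by (simp add: C_def)
 have "F b x <= (\<rho> + eps) * r b x + C & \<rho> * r b x <= F b x + eps * r b x + C" if x: "0 <= x" for x
 proof (cases "a <= x")
  case True
  have r1: "0 < r b x" using r_ge_1[of b x] by simp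
  have "F b x / r b x <= \<rho> + eps" "\<rho> <= F b x / r b x + eps"
   using a[OF True] by (auto simp: dist_real_def abs_if split: if_splits)
  from mult_right_mono[OF this(1), of "r b x"] mult_right_mono[OF this(2), of "r b x"]
  have "F b x <= (\<rho> + eps) * r b x" "\<rho> * r b x <= F b x + eps * r b x"
   using r1 by (auto simp: distrib_right)
  then show ?thesis using C0 by simp
 next
  case False
  have e: "exp (k0 * (x - c)) <= exp (k0 * a')" if "0 <= c" for c
   using False k0_pos that by (auto simp: a'_def)
  have Fle: "F c x <= K0 * exp (k0 * a')" if "0 <= c" for c
   by (rule order_trans[OF F_exp_bound mult_left_mono[OF e[OF that]]]) (use K0_pos in simp)
  have "r b x <= 1 + q * (K0 * exp (k0 * a'))"
  proof -
   have "q * F 0 x <= q * (K0 * exp (k0 * a'))" using X.q_pos by (intro mult_left_mono Fle) auto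
   then show ?thesis using r_le[of b x] by linarith
  qed
  then have "\<rho> * r b x <= \<rho> * (1 + q * (K0 * exp (k0 * a')))" using \<rho>_pos by (intro mult_left_mono) auto
  moreover have "0 <= (\<rho> + eps) * r b x" "0 <= eps * r b x" using \<rho>_pos eps r_ge_1[of b x] by auto
  ultimately show ?thesis using Fle[of b] b_pos F_nonneg[of b x] pos by (auto simp: C_def)
 qed
 then show ?thesis using C0 by blast
qed

text \<open>
 \<open>r b\<close> is harmonic and \<open>F b\<close> has source \<open>1\<close> above \<open>b\<close>; as \<open>F b / r b\<close> tends to \<open>\<rho>\<close> at infinity and the
 discount kills the contribution of bounded levels, the discounted time above \<open>b\<close> is \<open>\<rho> * r b - F b\<close>.
\<close>
lemma above_sum_limit:
 assumes e: "0 < e"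
 shows "EX T0>0. ALL T>=T0. EV n.
  ennreal (F b x0) + above_sum (1 / real (Suc n)) (T * Suc n) <= ennreal (\<rho> * r b x0 + e) &
  ennreal (\<rho> * r b x0) <= ennreal (F b x0 + e) + above_sum (1 / real (Suc n)) (T * Suc n)"
proof -
 have r1: "1 <= r b x0" by (rule r_ge_1)
 define eps where "eps = min 1 (e / (4 * r b x0))"
 have eps: "0 < eps" "eps <= 1" using e r1 by (auto simp: eps_def)
 have epsr: "eps * r b x0 <= e / 4"
 proof -
  have "eps * r b x0 <= e / (4 * r b x0) * r b x0" using r1 by (intro mult_right_mono) (auto simp: eps_def)
  then show ?thesis using r1 by simp
 qed
 \<comment> \<open>The error \<open>e1\<close> of \<open>chain_limit\<close> enters once through
   \<open>F b\<close> and at most \<open>\<rho> + 1\<close> times through \<open>r b\<close>,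
   together \<open>(\<rho> + 2) * e1 = e / 4\<close>.\<close>
 define e1 where "e1 = e / (4 * (\<rho> + 2))"
 have e1: "0 < e1" using e \<rho>_pos by (simp add: e1_def)
 have e1': "(\<rho> + 2) * e1 = e / 4"
 proof -
  have "k * (e / (4 * k)) = e / 4" if "0 < k" for k using that by simp
  from this[of "\<rho> + 2"] show ?thesis using \<rho>_pos unfolding e1_def by simp
 qed
 obtain C where C: "0 <= C" "!!x. 0 <= x ==> F b x <= (\<rho> + eps) * r b x + C" "!!x. 0 <= x ==> \<rho> * r b x <= F b x + eps * r b x + C"
  using w_r_compare[OF eps(1)] by blast
 have "((%T. exp (- s * real T) * C) \<longlongrightarrow> 0) sequentially" if "0 < s" for s
  using that by real_asymp
 then have "EV T. exp (- q * real T) * C < e / 4"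
  using X.q_pos e by (intro order_tendstoD) auto
 then obtain T0 where T0: "!!T. T0 <= T ==> exp (- q * real T) * C < e / 4" by (auto simp: eventually_sequentially)
 have "EV n.
  ennreal (F b x0) + above_sum (1 / real (Suc n)) (T * Suc n) <= ennreal (\<rho> * r b x0 + e) &
  ennreal (\<rho> * r b x0) <= ennreal (F b x0 + e) + above_sum (1 / real (Suc n)) (T * Suc n)" if T: "Suc T0 <= T" for T
 proof -
  have T_pos: "0 < T" using T by simp
  have TC: "exp (- q * real T) * C < e / 4" by (rule T0) (use T in simp)
  show ?thesis
   using chain_limit[OF admissible_w zero_le_one T_pos e1] chain_limit[OF admissible_r order_refl T_pos e1]
  proof eventually_elim
   case (elim n)
   define h where "h = 1 / real (Suc n)"
   define N where "N = T * Suc n"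
   let ?D = "nexp (- q * real T)"
   define Aw where "Aw = ?D * (\<E> u. ennreal (F b (V h N u)))"
   define Ar where "Ar = ?D * (\<E> u. ennreal (r b (V h N u)))"
   define U where "U = above_sum h N"
   have w: "Aw <= ennreal (F b x0) + U + ennreal e1" "ennreal (F b x0) + U <= Aw + ennreal e1"
    using elim(1) unfolding h_def[symmetric] N_def[symmetric] Aw_def[symmetric] U_def[symmetric] by simp_all
   have r: "Ar <= ennreal (r b x0) + ennreal e1" "ennreal (r b x0) <= Ar + ennreal e1"
    using elim(2) unfolding h_def[symmetric] N_def[symmetric] Ar_def[symmetric] U_def[symmetric] by simp_all
   have h: "0 < h" by (simp add: h_def)
   note V_measurable [measurable del]
   have [measurable]: "V h N \<in> borel_measurable M" using h by (rule V_measurable)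
   have DC: "?D * ennreal C <= ennreal (e / 4)" using TC C by (simp add: ennreal_leI flip: ennreal_mult)
   have r0: "0 <= r b x" for x using r_ge_1[of b x] by simp
   have "(\<E> u. ennreal (F b (V h N u))) <= (\<E> u. ennreal (\<rho> + eps) * ennreal (r b (V h N u)) + ennreal C)"
    using C V_nonneg[of h N] r0 \<rho>_pos eps by (intro nn_integral_mono) (auto intro!: ennreal_leI simp flip: ennreal_mult ennreal_plus)
   also have "... = ennreal (\<rho> + eps) * (\<E> u. ennreal (r b (V h N u))) + ennreal C"
    by (simp add: nn_integral_add nn_integral_cmult X.emeasure_space_1)
   finally have "Aw <= ?D * (ennreal (\<rho> + eps) * (\<E> u. ennreal (r b (V h N u))) + ennreal C)"
    unfolding Aw_def by (rule mult_left_mono) simp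
   also have "... = ennreal (\<rho> + eps) * Ar + ?D * ennreal C"
    unfolding Ar_def by (simp add: distrib_left mult.left_commute)
   also have "... <= ennreal (\<rho> + eps) * (ennreal (r b x0) + ennreal e1) + ennreal (e / 4)"
    by (intro add_mono mult_left_mono r DC) simp
   also have "... = ennreal ((\<rho> + eps) * (r b x0 + e1) + e / 4)"
    using \<rho>_pos eps r1 e1 e by (simp flip: ennreal_mult ennreal_plus)
   finally have Aw_le: "Aw <= ennreal ((\<rho> + eps) * (r b x0 + e1) + e / 4)" .
   have "ennreal (F b x0) + U <= ennreal ((\<rho> + eps) * (r b x0 + e1) + e / 4) + ennreal e1"
    using w(2) Aw_le by (meson add_right_mono order_trans)
   also have "... = ennreal ((\<rho> + eps) * (r b x0 + e1) + e / 4 + e1)"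
    using \<rho>_pos eps r1 e1 e by (intro ennreal_plus[symmetric]) (auto intro!: add_nonneg_nonneg mult_nonneg_nonneg)
   also have "... <= ennreal (\<rho> * r b x0 + e)"
   proof (rule ennreal_leI)
    have "eps * e1 <= 1 * e1" using eps e1 by (intro mult_right_mono) auto
    then have "(\<rho> + eps) * (r b x0 + e1) + e / 4 + e1 <= \<rho> * r b x0 + eps * r b x0 + (\<rho> + 2) * e1 + e / 4"
     by (simp add: algebra_simps)
    then show "(\<rho> + eps) * (r b x0 + e1) + e / 4 + e1 <= \<rho> * r b x0 + e" using epsr e1' e by simp
   qed
   finally have 1: "ennreal (F b x0) + U <= ennreal (\<rho> * r b x0 + e)" .
   have "(\<E> u. ennreal \<rho> * ennreal (r b (V h N u))) <= (\<E> u. ennreal (F b (V h N u)) + ennreal eps * ennreal (r b (V h N u)) + ennreal C)"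
    using C V_nonneg[of h N] r0 \<rho>_pos eps F_nonneg by (intro nn_integral_mono) (auto intro!: ennreal_leI simp flip: ennreal_mult ennreal_plus)
   also have "... = (\<E> u. ennreal (F b (V h N u))) + ennreal eps * (\<E> u. ennreal (r b (V h N u))) + ennreal C"
    by (simp add: nn_integral_add nn_integral_cmult X.emeasure_space_1)
   finally have "?D * (\<E> u. ennreal \<rho> * ennreal (r b (V h N u)))
    <= ?D * ((\<E> u. ennreal (F b (V h N u))) + ennreal eps * (\<E> u. ennreal (r b (V h N u))) + ennreal C)"
    by (rule mult_left_mono) simp
   then have "ennreal \<rho> * Ar <= Aw + ennreal eps * Ar + ?D * ennreal C"
    unfolding Ar_def Aw_def by (simp add: nn_integral_cmult distrib_left mult.left_commute)
   also have "... <= (ennreal (F b x0) + U + ennreal e1) + ennreal eps * (ennreal (r b x0) + ennreal e1) + ennreal (e / 4)"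
    by (intro add_mono mult_left_mono w r DC) simp
   finally have Ar_le: "ennreal \<rho> * Ar <= (ennreal (F b x0) + U + ennreal e1) + ennreal eps * (ennreal (r b x0) + ennreal e1) + ennreal (e / 4)" .
   have "ennreal (\<rho> * r b x0) = ennreal \<rho> * ennreal (r b x0)" using \<rho>_pos r0 by (intro ennreal_mult) auto
   also have "... <= ennreal \<rho> * (Ar + ennreal e1)" by (intro mult_left_mono r) simp
   also have "... = ennreal \<rho> * Ar + ennreal \<rho> * ennreal e1" by (rule distrib_left)
   also have "... <= (ennreal (F b x0) + U + ennreal e1) + ennreal eps * (ennreal (r b x0) + ennreal e1) + ennreal (e / 4) + ennreal \<rho> * ennreal e1"
    by (intro add_right_mono Ar_le)
   also have "... = ennreal (F b x0) + (ennreal e1 + ennreal eps * (ennreal (r b x0) + ennreal e1) + ennreal (e / 4) + ennreal \<rho> * ennreal e1) + U"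
    by (simp add: ac_simps)
   also have "ennreal e1 + ennreal eps * (ennreal (r b x0) + ennreal e1) + ennreal (e / 4) + ennreal \<rho> * ennreal e1
    = ennreal (e1 + eps * (r b x0 + e1) + e / 4 + \<rho> * e1)"
    using \<rho>_pos eps r1 e1 e by (simp flip: ennreal_mult ennreal_plus)
   also have "ennreal (F b x0) + ennreal (e1 + eps * (r b x0 + e1) + e / 4 + \<rho> * e1) + U <= ennreal (F b x0) + ennreal e + U"
   proof (intro add_right_mono add_left_mono ennreal_leI)
    have "eps * e1 <= 1 * e1" using eps e1 by (intro mult_right_mono) auto
    then have "e1 + eps * (r b x0 + e1) + e / 4 + \<rho> * e1 <= eps * r b x0 + (\<rho> + 2) * e1 + e / 4"
     by (simp add: algebra_simps)
    then show "e1 + eps * (r b x0 + e1) + e / 4 + \<rho> * e1 <= e" using epsr e1' e by simp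
   qed
   also have "ennreal (F b x0) + ennreal e = ennreal (F b x0 + e)" using F_nonneg e by (simp flip: ennreal_plus)
   finally have 2: "ennreal (\<rho> * r b x0) <= ennreal (F b x0 + e) + U" .
   show ?case using 1 2 unfolding U_def h_def N_def by (rule conjI)
  qed
 qed
 then show ?thesis by (intro exI[of _ "Suc T0"]) auto
qed

end

section \<open>Pathwise construction by a fixed point equation\<close>

lemma cadlag_right: "cadlag f ==> 0 <= t ==> (f \<longlongrightarrow> f t) (at_right t)"
 by (simp add: cadlag_def)

text \<open>Bisection: one-sided limits bound the path on a neighbourhood of each point. The guards
  \<open>0 <= a\<close> and \<open>0 <= s\<close> are there because the bisection principle
  quantifies over all intervals, while the path is regular on the half-line only.\<close>

lemma cadlag_bounded:
 assumes f: "cadlag f" and "0 <= t0"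
 shows "EX B. \<forall>s\<in>{t0..t}. \<bar>f s\<bar> <= B"
proof (cases "t0 <= t")
 case True
 have "0 <= t0 --> (EX B. \<forall>s\<in>{t0..t}. 0 <= s --> \<bar>f s\<bar> <= B)"
 proof (rule Bolzano[OF True, where P = "%a b. 0 <= a --> (EX B. \<forall>s\<in>{a..b}. 0 <= s --> \<bar>f s\<bar> <= B)"])
  fix a b c assume h: "0 <= a --> (EX B. \<forall>s\<in>{a..b}. 0 <= s --> \<bar>f s\<bar> <= B)" "0 <= b --> (EX B. \<forall>s\<in>{b..c}. 0 <= s --> \<bar>f s\<bar> <= B)" "a <= b" "b <= c"
  show "0 <= a --> (EX B. \<forall>s\<in>{a..c}. 0 <= s --> \<bar>f s\<bar> <= B)"
  proof
   assume "0 <= a"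
   then obtain B1 B2 where B: "\<forall>s\<in>{a..b}. 0 <= s --> \<bar>f s\<bar> <= B1" "\<forall>s\<in>{b..c}. 0 <= s --> \<bar>f s\<bar> <= B2" using h by auto
   have "\<bar>f s\<bar> <= max B1 B2" if "s \<in> {a..c}" "0 <= s" for s
   proof (cases "s <= b")
    case True then show ?thesis using B(1) that by (simp add: le_max_iff_disj)
   next
    case False then show ?thesis using B(2) that by (simp add: le_max_iff_disj)
   qed
   then show "EX B. \<forall>s\<in>{a..c}. 0 <= s --> \<bar>f s\<bar> <= B" by blast
  qed
 next
  fix x assume x: "t0 <= x" "x <= t"
  have x0: "0 <= x" using x assms by simp
  have "\<forall>\<^sub>F s in at_right x. dist (f s) (f x) < 1" using cadlag_right[OF f x0] by (rule tendstoD) simp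
  then obtain d1 where d1: "0 < d1" "!!s. x < s ==> s < x + d1 ==> \<bar>f s - f x\<bar> < 1"
   unfolding eventually_at_right_field dist_real_def by (metis add.commute diff_add_cancel diff_gt_0_iff_gt)
  have "EX d2>0. EX l. ALL s. 0 <= s --> s < x --> x - d2 < s --> \<bar>f s - l\<bar> < 1"
  proof (cases "x = 0")
   case False
   then have "0 < x" using x0 by simp
   then obtain l where l: "(f \<longlongrightarrow> l) (at_left x)" using f unfolding cadlag_def by blast
   have "\<forall>\<^sub>F s in at_left x. dist (f s) l < 1" using l by (rule tendstoD) simp
   then obtain a where a: "a < x" "!!s. a < s ==> s < x ==> \<bar>f s - l\<bar> < 1"
    unfolding eventually_at_left_field dist_real_def by blast
   then show ?thesis by (intro exI[of _ "x - a"] conjI exI[of _ l]) auto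
  qed (auto intro: exI[of _ 1])
  then obtain d2 l where d2: "0 < d2" "!!s. 0 <= s ==> s < x ==> x - d2 < s ==> \<bar>f s - l\<bar> < 1" by blast
  show "EX d>0. ALL a b. a <= x & x <= b & b - a < d --> 0 <= a --> (EX B. \<forall>s\<in>{a..b}. 0 <= s --> \<bar>f s\<bar> <= B)"
  proof (rule exI[of _ "min d1 d2"], intro conjI allI impI)
   show "0 < min d1 d2" using d1 d2 by simp
   fix a b assume ab: "a <= x & x <= b & b - a < min d1 d2" "0 <= a"
   have "\<bar>f s\<bar> <= \<bar>f x\<bar> + \<bar>l\<bar> + 1" if s: "s \<in> {a..b}" for s
   proof -
    consider "s < x" | "s = x" | "x < s" by linarith
    then show ?thesis
    proof cases
     case 1 then show ?thesis using d2(2)[of s] s ab by auto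
    next
     case 3 then show ?thesis using d1(2)[of s] s ab by auto
    qed auto
   qed
   then show "EX B. \<forall>s\<in>{a..b}. 0 <= s --> \<bar>f s\<bar> <= B" by blast
  qed
 qed
 then obtain B where "\<forall>s\<in>{t0..t}. 0 <= s --> \<bar>f s\<bar> <= B" using assms by auto
 then show ?thesis using assms by (intro exI[of _ B]) auto
qed auto

text \<open>The class in which refraction times live. It is described by inequalities between two
  values and hence is stable under pointwise limits, as the compactness argument needs.\<close>

definition slow :: "real => real => (real => real) => bool" where
 "slow \<delta> t0 L \<longleftrightarrow> L t0 = 0 & (ALL s t. t0 <= s --> s <= t --> 0 <= L t - L s & L t - L s <= \<delta> * (t - s))"

lemma slowD:
 assumes "slow \<delta> t0 L" "t0 <= s" "s <= t"
 shows "L s <= L t" "L t - L s <= \<delta> * (t - s)" 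
 using assms by (auto simp: slow_def)

lemma slow_start: "slow \<delta> t0 L ==> L t0 = 0" by (simp add: slow_def)

lemma slow_right:
 assumes L: "slow \<delta> t0 L" and t: "t0 <= t"
 shows "(L \<longlongrightarrow> L t) (at_right t)"
proof (rule tendsto_sandwich)
 show "\<forall>\<^sub>F s in at_right t. L t <= L s"
  using eventually_at_right_less[of t]
 proof eventually_elim
  case (elim s)
  show ?case by (rule slowD(1)[OF L t less_imp_le[OF elim]])
 qed
 show "\<forall>\<^sub>F s in at_right t. L s <= L t + \<delta> * (s - t)"
  using eventually_at_right_less[of t]
 proof eventually_elim
  case (elim s)
  show ?case using slowD(2)[OF L t less_imp_le[OF elim]] by linarith
 qed
 show "((%s. L t) \<longlongrightarrow> L t) (at_right t)" by simp
 have "((%s. L t + \<delta> * (s - t)) \<longlongrightarrow> L t + \<delta> * (t - t)) (at_right t)" by (intro tendsto_intros)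
 then show "((%s. L t + \<delta> * (s - t)) \<longlongrightarrow> L t) (at_right t)" by simp
qed

text \<open>The Skorokhod regulator: adding it to \<xi> gives the path reflected at
  \<open>0\<close>. A starting point below \<open>0\<close> is lifted at once.\<close>

definition reg :: "(real => real) => real => real => real" where
 "reg \<xi> t0 t = max 0 (SUP s\<in>{t0..t}. - \<xi> s)"

definition free :: "(real => real) => real => real => (real => real) => real => real" where
 "free f t0 y L t = y + (f t - f t0) - L t"

text \<open>The path driven by \<open>f\<close> with control \<open>L\<close>, reflected at \<open>0\<close> if \<open>\<beta>\<close> holds.\<close>
definition con :: "bool => (real => real) => real => real => (real => real) => real => real" where
 "con \<beta> f t0 y L t = free f t0 y L t + of_bool \<beta> * reg (free f t0 y L) t0 t"

lemma reg_cong: "(!!s. s \<in> {t0..t} ==> \<xi> s = \<eta> s) ==> reg \<xi> t0 t = reg \<eta> t0 t"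
 unfolding reg_def by (intro arg_cong2[where f = max] refl SUP_cong) auto

lemma con_cong:
 assumes "!!s. s \<in> {t0..t} ==> L s = L' s" "t0 <= t"
 shows "con \<beta> f t0 y L t = con \<beta> f t0 y L' t"
proof -
 have "free f t0 y L s = free f t0 y L' s" if "s \<in> {t0..t}" for s using assms(1)[OF that] by (simp add: free_def)
 then show ?thesis using assms(2) reg_cong[of t0 t "free f t0 y L" "free f t0 y L'"] by (simp add: con_def)
qed

section \<open>The Skorokhod regulator of a right-continuous path\<close>

locale rc_path =
 fixes \<xi> :: "real => real" and t0 :: real
 assumes right: "!!t. t0 <= t ==> (\<xi> \<longlongrightarrow> \<xi> t) (at_right t)"
  and bdd: "!!t. EX B. \<forall>s\<in>{t0..t}. \<bar>\<xi> s\<bar> <= B"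
begin

lemma bdd_above: "bdd_above ((%s. - \<xi> s) ` {t0..t})"
proof -
 obtain B where "\<forall>s\<in>{t0..t}. \<bar>\<xi> s\<bar> <= B" using bdd by blast
 then show ?thesis by (intro bdd_aboveI[of _ B]) auto
qed

lemma reg_nonneg: "0 <= reg \<xi> t0 t" by (simp add: reg_def)

lemma reg_ge: "t0 <= s ==> s <= t ==> - \<xi> s <= reg \<xi> t0 t"
 unfolding reg_def by (intro max.coboundedI2 cSUP_upper bdd_above) auto

lemma reg_le: "0 <= c ==> t0 <= t ==> (!!s. t0 <= s ==> s <= t ==> - \<xi> s <= c) ==> reg \<xi> t0 t <= c"
 unfolding reg_def by (intro max.boundedI cSUP_least) auto

lemma reg_gt: "0 <= c ==> t0 <= t ==> c < reg \<xi> t0 t ==> EX s. t0 <= s & s <= t & c < - \<xi> s"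
 using reg_le[of c t] by (meson not_le)

lemma reg_mono: "t0 <= s ==> s <= t ==> reg \<xi> t0 s <= reg \<xi> t0 t"
 by (intro reg_le reg_nonneg) (auto intro: reg_ge)

lemma right_ge:
 assumes "t0 <= t" "0 < e"
 shows "EX d>0. ALL s. t <= s --> s < t + d --> \<bar>\<xi> s - \<xi> t\<bar> < e"
proof -
 have "\<forall>\<^sub>F s in at_right t. dist (\<xi> s) (\<xi> t) < e" using right[OF assms(1)] assms(2) by (rule tendstoD)
 then obtain c where c: "t < c" "!!s. t < s ==> s < c ==> \<bar>\<xi> s - \<xi> t\<bar> < e"
  unfolding eventually_at_right_field dist_real_def by blast
 show ?thesis
 proof (intro exI[of _ "c - t"] conjI allI impI)
  fix s assume "t <= s" "s < t + (c - t)"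
  then show "\<bar>\<xi> s - \<xi> t\<bar> < e" using c(2)[of s] assms(2) by (cases "s = t") auto
 qed (use c in simp)
qed

lemma reg_right_const:
 assumes t: "t0 <= t" and pos: "0 < \<xi> t + reg \<xi> t0 t"
 shows "EX d>0. ALL s. t <= s --> s < t + d --> reg \<xi> t0 s = reg \<xi> t0 t"
proof -
 obtain d where d: "0 < d" "!!s. t <= s ==> s < t + d ==> \<bar>\<xi> s - \<xi> t\<bar> < \<xi> t + reg \<xi> t0 t"
  using right_ge[OF t pos] by blast
 have "reg \<xi> t0 s = reg \<xi> t0 t" if s: "t <= s" "s < t + d" for s
 proof (rule antisym)
  show "reg \<xi> t0 s <= reg \<xi> t0 t"
  proof (rule reg_le[OF reg_nonneg])
   fix u assume u: "t0 <= u" "u <= s"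
   show "- \<xi> u <= reg \<xi> t0 t"
   proof (cases "u <= t")
    case True then show ?thesis using u by (intro reg_ge) auto
   next
    case False then show ?thesis using d(2)[of u] u s by auto
   qed
  qed (use t s in simp)
  show "reg \<xi> t0 t <= reg \<xi> t0 s" by (rule reg_mono[OF t s(1)])
 qed
 then show ?thesis using d(1) by blast
qed

lemma reg_right:
 assumes t: "t0 <= t"
 shows "(reg \<xi> t0 \<longlongrightarrow> reg \<xi> t0 t) (at_right t)"
proof (rule tendstoI)
 fix e :: real assume e: "0 < e"
 obtain d where d: "0 < d" "!!s. t <= s ==> s < t + d ==> \<bar>\<xi> s - \<xi> t\<bar> < e/2"
  using right_ge[OF t, of "e/2"] e by auto
 have "dist (reg \<xi> t0 s) (reg \<xi> t0 t) < e" if s: "t < s" "s < t + d" for s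
 proof -
  have "reg \<xi> t0 s <= reg \<xi> t0 t + e/2"
  proof (rule reg_le)
   fix u assume u: "t0 <= u" "u <= s"
   show "- \<xi> u <= reg \<xi> t0 t + e/2"
   proof (cases "u <= t")
    case True then show ?thesis using reg_ge[OF u(1) True] e by simp
   next
    case False then show ?thesis using d(2)[of u] u s reg_ge[OF t order_refl] by (auto simp: abs_if split: if_splits)
   qed
  qed (use t s e reg_nonneg[of t] in auto)
  moreover have "reg \<xi> t0 t <= reg \<xi> t0 s" using reg_mono[OF t] s by simp
  ultimately show ?thesis using e by (simp add: dist_real_def)
 qed
 then show "\<forall>\<^sub>F s in at_right t. dist (reg \<xi> t0 s) (reg \<xi> t0 t) < e"
  unfolding eventually_at_right_field using d(1) by (intro exI[of _ "t + d"]) auto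
qed

text \<open>The regulator grows only where the reflected path is at \<open>0\<close>. At the infimum
  \<open>u0\<close> of the times of growth it has not yet grown, because positivity at
  \<open>u0\<close> means that a larger value would already be attained earlier; and positivity at
  \<open>u0\<close> keeps it constant on an interval to the right.\<close>

lemma reg_flat:
 assumes st: "t0 <= s" "s <= t" and pos: "!!u. s <= u ==> u <= t ==> 0 < \<xi> u + reg \<xi> t0 u"
 shows "reg \<xi> t0 t = reg \<xi> t0 s"
proof (rule ccontr)
 assume ne: "reg \<xi> t0 t ~= reg \<xi> t0 s"
 define S where "S = {u. s <= u & u <= t & reg \<xi> t0 s < reg \<xi> t0 u}"
 have tS: "t \<in> S" using ne reg_mono[OF st] st by (auto simp: S_def)
 have bS: "bdd_below S" by (auto simp: S_def intro: bdd_belowI[of _ s])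
 define u0 where "u0 = Inf S"
 have u0: "s <= u0" "u0 <= t"
 proof -
  show "s <= u0" unfolding u0_def by (rule cInf_greatest) (use tS in \<open>auto simp: S_def\<close>)
  show "u0 <= t" unfolding u0_def by (rule cInf_lower[OF tS bS])
 qed
 have before: "reg \<xi> t0 u = reg \<xi> t0 s" if "s <= u" "u < u0" for u
 proof (rule ccontr)
  assume "reg \<xi> t0 u ~= reg \<xi> t0 s"
  then have "u \<in> S" using that u0 st reg_mono[of s u] by (auto simp: S_def)
  then have "u0 <= u" unfolding u0_def by (rule cInf_lower[OF _ bS])
  then show False using that by simp
 qed
 have p0: "0 < \<xi> u0 + reg \<xi> t0 u0" using pos u0 by simp
 have eq0: "reg \<xi> t0 u0 = reg \<xi> t0 s"
 proof (rule ccontr)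
  assume "reg \<xi> t0 u0 ~= reg \<xi> t0 s"
  then have lt: "reg \<xi> t0 s < reg \<xi> t0 u0" using reg_mono[of s u0] st u0 by simp
  have lt': "max (reg \<xi> t0 s) (- \<xi> u0) < reg \<xi> t0 u0" using lt p0 by simp
  have "0 <= max (reg \<xi> t0 s) (- \<xi> u0)" using reg_nonneg[of s] by simp
  then obtain w where w: "t0 <= w" "w <= u0" "max (reg \<xi> t0 s) (- \<xi> u0) < - \<xi> w"
   using reg_gt[OF _ _ lt'] st u0 by auto
  then have "w < u0" by (cases "w = u0") auto
  have "- \<xi> w <= reg \<xi> t0 s"
  proof (cases "w <= s")
   case True then show ?thesis using w by (intro reg_ge) auto
  next
   case False
   then show ?thesis using before[of w] \<open>w < u0\<close> reg_ge[OF w(1) order_refl] by simp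
  qed
  then show False using w by simp
 qed
 obtain d where d: "0 < d" "!!u. u0 <= u ==> u < u0 + d ==> reg \<xi> t0 u = reg \<xi> t0 u0"
  using reg_right_const[of u0] p0 u0 st by auto
 have "Inf S < u0 + d" using d(1) by (simp add: u0_def)
 then obtain u where "u \<in> S" "u < u0 + d" using cInf_lessD[of S] tS by blast
 moreover have "u0 <= u" using \<open>u \<in> S\<close> cInf_lower[OF _ bS] by (simp add: u0_def)
 ultimately show False using d(2)[of u] eq0 by (simp add: S_def)
qed

end

lemma rc_free:
 assumes f: "cadlag f" and t0: "0 <= t0" and L: "slow \<delta> t0 L"
 shows "rc_path (free f t0 y L) t0"
proof
 fix t assume t: "t0 <= t"
 have "((%t. free f t0 y L t) \<longlongrightarrow> free f t0 y L t) (at_right t)"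
  unfolding free_def using t t0 by (intro tendsto_intros cadlag_right[OF f] slow_right[OF L]) auto
 then show "(free f t0 y L \<longlongrightarrow> free f t0 y L t) (at_right t)" by simp
next
 fix t
 obtain B where B: "\<forall>s\<in>{t0..t}. \<bar>f s\<bar> <= B" using cadlag_bounded[OF f t0] by blast
 have "\<bar>free f t0 y L s\<bar> <= \<bar>y\<bar> + B + \<bar>f t0\<bar> + L t" if "s \<in> {t0..t}" for s
 proof -
  have "\<bar>f s\<bar> <= B" using B that by blast
  moreover have "0 <= L s" "L s <= L t" using slowD(1)[OF L, of t0 s] slowD(1)[OF L, of s t] slow_start[OF L] that by auto
  ultimately show ?thesis unfolding free_def by linarith
 qed
 then show "EX B. \<forall>s\<in>{t0..t}. \<bar>free f t0 y L s\<bar> <= B" by blast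
qed

lemma con_right:
 assumes f: "cadlag f" and t0: "0 <= t0" and L: "slow \<delta> t0 L" and t: "t0 <= t"
 shows "(con \<beta> f t0 y L \<longlongrightarrow> con \<beta> f t0 y L t) (at_right t)"
proof -
 interpret rc_path "free f t0 y L" t0 by (rule rc_free[OF f t0 L])
 have "((%t. con \<beta> f t0 y L t) \<longlongrightarrow> con \<beta> f t0 y L t) (at_right t)"
  unfolding con_def by (intro tendsto_intros right reg_right t)
 then show ?thesis by simp
qed

lemma right_measurable_from:
 fixes g :: "real => real"
 assumes "!!t. t0 <= t ==> (g \<longlongrightarrow> g t) (at_right t)"
 shows "(%t. g (max t0 t)) \<in> borel_measurable borel"
proof -
 have "((%s. g (t0 + s)) \<longlongrightarrow> g (t0 + t)) (at_right t)" if "0 <= t" for t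
 proof -
  have "filterlim (%s. t0 + s) (at_right (t0 + t)) (at_right t)"
   unfolding filterlim_at by (auto intro!: tendsto_eq_intros simp: eventually_at_filter)
  then show ?thesis using assms[of "t0 + t"] that by (auto intro: filterlim_compose)
 qed
 from right_continuous_borel_measurable[of "%s. g (t0 + s)", OF this]
 have "(%t. g (t0 + max 0 t)) \<in> borel_measurable borel" by simp
 from measurable_compose[OF _ this, of "%t. t - t0" borel]
 have "(%t. g (t0 + max 0 (t - t0))) \<in> borel_measurable borel" by simp
 moreover have "t0 + max 0 (t - t0) = max t0 t" for t by auto
 ultimately show ?thesis by simp
qed

section \<open>Occupation times and uniqueness for the fixed point equation\<close>

definition time_above :: "real => (real => real) => real => real => real" where
 "time_above b v t0 t = measure lborel {s\<in>{t0..t}. b < v s}"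

lemma sets_above:
 fixes v :: "real => real"
 assumes "(%t. v (max t0 t)) \<in> borel_measurable borel" "t0 <= a"
 shows "{s\<in>{a..t}. b < v s} \<in> sets lborel" "{s\<in>{a<..t}. b < v s} \<in> sets lborel"
proof -
 have mx: "max t0 s = s" if "a <= s" for s :: real using that assms(2) by (simp add: max_def)
 have "{s\<in>{a..t}. b < v s} = {a..t} \<inter> (%t. v (max t0 t)) -` {b<..}" "{s\<in>{a<..t}. b < v s} = {a<..t} \<inter> (%t. v (max t0 t)) -` {b<..}"
  by (auto simp: mx)
 moreover have "(%t. v (max t0 t)) -` {b<..} \<in> sets borel"
  using measurable_sets_borel[OF assms(1), of "{b<..}"] by simp
 ultimately show "{s\<in>{a..t}. b < v s} \<in> sets lborel" "{s\<in>{a<..t}. b < v s} \<in> sets lborel" by auto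
qed

lemma LBINT_above:
 assumes "(%t. v (max t0 t)) \<in> borel_measurable borel"
 shows "(LBINT s:{t0..t}. of_bool (v s > b)) = time_above b v t0 t"
proof -
 have "(LBINT s:{t0..t}. of_bool (v s > b)) = (LBINT s. ind {s\<in>{t0..t}. b < v s} s)"
  unfolding set_lebesgue_integral_def by (intro Bochner_Integration.integral_cong) (auto simp: indicator_def)
 also have "... = time_above b v t0 t" unfolding time_above_def by simp
 finally show ?thesis .
qed

lemma emeasure_above_finite:
 fixes a t :: real
 shows "emeasure lborel {s\<in>{a..t}. P s} ~= \<infinity>" "emeasure lborel {s\<in>{a<..t}. P s} ~= \<infinity>"
proof -
 have "emeasure lborel {s\<in>{a..t}. P s} <= emeasure lborel {a..t}" "emeasure lborel {s\<in>{a<..t}. P s} <= emeasure lborel {a..t}"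
  by (auto intro!: emeasure_mono)
 moreover have "emeasure lborel {a..t} < \<infinity>" by (simp add: emeasure_lborel_Icc_eq)
 ultimately show "emeasure lborel {s\<in>{a..t}. P s} ~= \<infinity>" "emeasure lborel {s\<in>{a<..t}. P s} ~= \<infinity>" by auto
qed

lemma time_above_diff:
 assumes v: "(%t. v (max t0 t)) \<in> borel_measurable borel" and st: "t0 <= s" "s <= t"
 shows "time_above b v t0 t - time_above b v t0 s = measure lborel {u\<in>{s<..t}. b < v u}"
proof -
 have "{u\<in>{t0..t}. b < v u} = {u\<in>{t0..s}. b < v u} \<union> {u\<in>{s<..t}. b < v u}" using st by auto
 moreover have "measure lborel ({u\<in>{t0..s}. b < v u} \<union> {u\<in>{s<..t}. b < v u}) = measure lborel {u\<in>{t0..s}. b < v u} + measure lborel {u\<in>{s<..t}. b < v u}"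
  by (rule measure_Union) (use sets_above[OF v] st emeasure_above_finite in auto)
 ultimately show ?thesis by (simp add: time_above_def)
qed

lemma time_above_slow:
 assumes v: "(%t. v (max t0 t)) \<in> borel_measurable borel" and \<delta>: "0 <= \<delta>"
 shows "slow \<delta> t0 (%t. \<delta> * time_above b v t0 t)"
 unfolding slow_def
proof (intro conjI allI impI)
 have "{s \<in> {t0..t0}. b < v s} \<subseteq> {t0}" by auto
 then have "measure lborel {s \<in> {t0..t0}. b < v s} <= measure lborel {t0}" by (intro measure_mono_fmeasurable sets_above(1)[OF v order_refl]) (auto simp: fmeasurable_def)
 then have "measure lborel {s \<in> {t0..t0}. b < v s} = 0" by (simp add: measure_le_0_iff)
 then show "\<delta> * time_above b v t0 t0 = 0" by (simp add: time_above_def)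
 fix s t assume st: "t0 <= s" "s <= t"
 have eq: "\<delta> * time_above b v t0 t - \<delta> * time_above b v t0 s = \<delta> * measure lborel {u\<in>{s<..t}. b < v u}"
  unfolding time_above_diff[OF v st, symmetric] by (simp add: right_diff_distrib)
 show "0 <= \<delta> * time_above b v t0 t - \<delta> * time_above b v t0 s" unfolding eq using \<delta> by simp
 have "measure lborel {u\<in>{s<..t}. b < v u} <= measure lborel {s<..t}"
  using sets_above[OF v st(1)] by (intro measure_mono_fmeasurable) (use st in \<open>auto simp: fmeasurable_def\<close>)
 also have "... = t - s" using st by simp
 finally show "\<delta> * time_above b v t0 t - \<delta> * time_above b v t0 s <= \<delta> * (t - s)"
  unfolding eq using \<delta> by (intro mult_left_mono)
qed

text \<open>The unknown is the control \<open>L\<close>, not the path: it has to be \<delta> times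
  the time that its own path spends above \<open>b\<close>. Without \<beta> this is the refraction
  equation; with \<beta> it is the equation of the glued process.\<close>

definition solves :: "bool => real => real => (real => real) => real => real => (real => real) => real => bool" where
 "solves \<beta> \<delta> b f t0 y L T \<longleftrightarrow> slow \<delta> t0 L & (ALL t. t0 <= t --> t <= T --> L t = \<delta> * time_above b (con \<beta> f t0 y L) t0 t)"

lemma solves_slow: "solves \<beta> \<delta> b f t0 y L T ==> slow \<delta> t0 L"
 by (simp add: solves_def)

lemma solves_eq: "solves \<beta> \<delta> b f t0 y L T ==> t0 <= t ==> t <= T ==> L t = \<delta> * time_above b (con \<beta> f t0 y L) t0 t"
 by (simp add: solves_def)

lemma con_nonneg:
 assumes "cadlag f" "0 <= t0" "slow \<delta> t0 L" "t0 <= t"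
 shows "0 <= con True f t0 y L t"
proof -
 interpret rc_path "free f t0 y L" t0 by (rule rc_free[OF assms(1-3)])
 show ?thesis using reg_ge[of t t] assms(4) by (simp add: con_def)
qed

lemma con_start: "slow \<delta> t0 L ==> con \<beta> f t0 y L t0 = y + of_bool \<beta> * max 0 (- y)"
 by (simp add: con_def free_def reg_def slow_start)

text \<open>
 Where two solutions differ, the larger one is slowed down more and is not being reflected, so the gap
 cannot have grown from \<open>0\<close>.
\<close>
lemma solves_le:
 assumes f: "cadlag f" and t0: "0 <= t0" and \<delta>: "0 <= \<delta>"
  and s1: "solves \<beta> \<delta> b f t0 y L1 T" and s2: "solves \<beta> \<delta> b f t0 y L2 T" and t: "t0 <= t" "t <= T"
 shows "con \<beta> f t0 y L1 t <= con \<beta> f t0 y L2 t"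
proof (rule ccontr)
 note l1 = solves_slow[OF s1] and l2 = solves_slow[OF s2]
 define V1 where "V1 = con \<beta> f t0 y L1"
 define V2 where "V2 = con \<beta> f t0 y L2"
 define \<xi>1 where "\<xi>1 = free f t0 y L1"
 define \<xi>2 where "\<xi>2 = free f t0 y L2"
 interpret P1: rc_path \<xi>1 t0 unfolding \<xi>1_def by (rule rc_free[OF f t0 l1])
 interpret P2: rc_path \<xi>2 t0 unfolding \<xi>2_def by (rule rc_free[OF f t0 l2])
 define D where "D u = V1 u - V2 u" for u
 assume "~ con \<beta> f t0 y L1 t <= con \<beta> f t0 y L2 t"
 then have Dt: "0 < D t" by (simp add: D_def V1_def V2_def)
 have V1: "V1 u = \<xi>1 u + of_bool \<beta> * reg \<xi>1 t0 u" and V2: "V2 u = \<xi>2 u + of_bool \<beta> * reg \<xi>2 t0 u" for u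
  by (simp_all add: V1_def V2_def con_def \<xi>1_def \<xi>2_def)
 have D: "D u = L2 u - L1 u + of_bool \<beta> * (reg \<xi>1 t0 u - reg \<xi>2 t0 u)" for u
  by (simp add: D_def V1 V2 \<xi>1_def \<xi>2_def free_def algebra_simps)
 have Dt0: "D t0 = 0" by (simp add: D_def V1_def V2_def con_start[OF l1] con_start[OF l2])
 have D_right: "(D \<longlongrightarrow> D u) (at_right u)" if "t0 <= u" for u
  unfolding D_def[abs_def] V1_def V2_def by (intro tendsto_diff con_right[OF f t0 l1 that] con_right[OF f t0 l2 that])
 have V2_nonneg: "0 <= V2 u" if "t0 <= u" \<beta> for u
  using con_nonneg[OF f t0 l2 that(1), of y] that(2) by (simp add: V2_def)
 define S where "S = {s. t0 <= s & s <= t & (ALL u. s <= u --> u <= t --> 0 < D u)}"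
 have tS: "t \<in> S" using t Dt by (auto simp: S_def)
 have bS: "bdd_below S" by (auto simp: S_def intro: bdd_belowI[of _ t0])
 define s0 where "s0 = Inf S"
 have s0: "t0 <= s0" "s0 <= t"
 proof -
  show "t0 <= s0" unfolding s0_def by (rule cInf_greatest) (use tS in \<open>auto simp: S_def\<close>)
  show "s0 <= t" unfolding s0_def by (rule cInf_lower[OF tS bS])
 qed
 have after: "0 < D u" if "s0 < u" "u <= t" for u
 proof -
  have "S ~= {}" "Inf S < u" using tS that(1) by (auto simp: s0_def)
  then obtain s where "s \<in> S" "s < u" using cInf_lessD by blast
  then show ?thesis using that by (auto simp: S_def)
 qed
 show False
 proof (cases "0 < D s0")
  \<comment> \<open>The gap cannot open by a jump at \<open>s0\<close>. Just before
    \<open>s0\<close> the control \<open>L2\<close> is within \<open>eps\<close> of its value, and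
    the first regulator too: \<open>V1\<close> is positive at \<open>s0\<close> in the reflected
    case, so its supremum is nearly attained earlier. Hence the gap was at least
    \<open>D s0 - 2 * eps > 0\<close> before \<open>s0\<close>, against the choice of
    \<open>s0\<close>.\<close>
  case True
  have s0t0: "t0 < s0" using True Dt0 s0 by (cases "s0 = t0") auto
  define eps where "eps = D s0 / 3"
  have eps: "0 < eps" using True by (simp add: eps_def)
  have "EX w. t0 <= w & w < s0 & of_bool \<beta> * reg \<xi>1 t0 s0 - eps <= of_bool \<beta> * reg \<xi>1 t0 w"
  proof (cases "\<beta> & eps < reg \<xi>1 t0 s0")
   case False
   then show ?thesis using s0t0 P1.reg_nonneg[of t0] eps by (intro exI[of _ t0]) auto
  next
   case True
   have "0 < V1 s0" using \<open>0 < D s0\<close> V2_nonneg[OF s0(1)] True by (simp add: D_def)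
   then have lt: "max (reg \<xi>1 t0 s0 - eps) (- \<xi>1 s0) < reg \<xi>1 t0 s0" using True eps by (simp add: V1)
   have "0 <= max (reg \<xi>1 t0 s0 - eps) (- \<xi>1 s0)" using True by (simp add: le_max_iff_disj)
   then obtain w where w: "t0 <= w" "w <= s0" "max (reg \<xi>1 t0 s0 - eps) (- \<xi>1 s0) < - \<xi>1 w"
    using P1.reg_gt[OF _ s0(1) lt] by blast
   then have "w ~= s0" by auto
   then show ?thesis using w P1.reg_ge[OF w(1) order_refl] True by (intro exI[of _ w]) auto
  qed
  then obtain w where w: "t0 <= w" "w < s0" "of_bool \<beta> * reg \<xi>1 t0 s0 - eps <= of_bool \<beta> * reg \<xi>1 t0 w" by blast
  define w' where "w' = max w (s0 - eps / (\<delta> + 1))"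
  have w': "t0 <= w'" "w' < s0" "w <= w'" "s0 - eps / (\<delta> + 1) <= w'" using w eps \<delta> by (auto simp: w'_def)
  have "w' \<notin> S"
  proof
   assume "w' \<in> S"
   then have "s0 <= w'" unfolding s0_def by (rule cInf_lower[OF _ bS])
   then show False using w'(2) by simp
  qed
  then obtain u where u: "w' <= u" "u <= t" "D u <= 0" using w' s0 by (auto simp: S_def not_less)
  have us0: "u < s0" using u after[of u] True by (cases u s0 rule: linorder_cases) auto
  have ut0: "t0 <= u" using u w' by simp
  have a: "L2 s0 - L2 u <= \<delta> * (s0 - u)" "L1 u <= L1 s0"
   using slowD(2)[OF l2 ut0, of s0] slowD(1)[OF l1 ut0, of s0] us0 by auto
  have "\<delta> * (s0 - u) <= \<delta> * (eps / (\<delta> + 1))" using u w' \<delta> by (intro mult_left_mono) auto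
  also have "... = eps * (\<delta> / (\<delta> + 1))" by simp
  also have "... <= eps * 1" using eps \<delta> by (intro mult_left_mono) auto
  finally have b: "\<delta> * (s0 - u) <= eps" by simp
  have c: "of_bool \<beta> * reg \<xi>1 t0 s0 - eps <= of_bool \<beta> * reg \<xi>1 t0 u"
   using w(3) P1.reg_mono[of w u] w w' u by (auto simp: of_bool_def)
  have d: "of_bool \<beta> * reg \<xi>2 t0 u <= of_bool \<beta> * reg \<xi>2 t0 s0"
   using P2.reg_mono[OF ut0, of s0] us0 by auto
  have "D s0 <= D u + 2 * eps" unfolding D using a b c d by (simp add: algebra_simps)
  then show False using u(3) True by (simp add: eps_def)
 next
  case False
  have s0t: "s0 < t" using False Dt s0 by (cases "s0 = t") auto
  have mono: "D t <= D s" if s: "s0 < s" "s <= t" for s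
  proof -
   have st0: "t0 <= s" using s s0 by simp
   have sT: "s <= T" using s t by simp
   have m1: "(%t. V1 (max t0 t)) \<in> borel_measurable borel" and m2: "(%t. V2 (max t0 t)) \<in> borel_measurable borel"
    unfolding V1_def V2_def by (rule right_measurable_from, rule con_right[OF f t0], rule l1 l2, assumption)+
   have L1: "L1 t - L1 s = \<delta> * measure lborel {u\<in>{s<..t}. b < V1 u}"
    using solves_eq[OF s1 t] solves_eq[OF s1 st0 sT] time_above_diff[OF m1 st0 s(2), of b]
    by (simp add: V1_def right_diff_distrib[symmetric])
   have L2: "L2 t - L2 s = \<delta> * measure lborel {u\<in>{s<..t}. b < V2 u}"
    using solves_eq[OF s2 t] solves_eq[OF s2 st0 sT] time_above_diff[OF m2 st0 s(2), of b]
    by (simp add: V2_def right_diff_distrib[symmetric])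
   have "{u\<in>{s<..t}. b < V2 u} \<subseteq> {u\<in>{s<..t}. b < V1 u}"
   proof
    fix u assume u: "u \<in> {u\<in>{s<..t}. b < V2 u}"
    then have "0 < D u" using after[of u] s by simp
    then show "u \<in> {u\<in>{s<..t}. b < V1 u}" using u by (simp add: D_def)
   qed
   then have "measure lborel {u\<in>{s<..t}. b < V2 u} <= measure lborel {u\<in>{s<..t}. b < V1 u}"
    by (rule measure_mono_fmeasurable) (use sets_above(2)[OF m2 st0] sets_above(2)[OF m1 st0] emeasure_above_finite(2) in \<open>auto simp: fmeasurable_def less_top\<close>)
   then have L: "L2 t - L2 s <= L1 t - L1 s" unfolding L1 L2 using \<delta> by (intro mult_left_mono)
   have R1: "of_bool \<beta> * reg \<xi>1 t0 t = of_bool \<beta> * reg \<xi>1 t0 s"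
   proof (cases \<beta>)
    case True
    have "reg \<xi>1 t0 t = reg \<xi>1 t0 s"
    proof (rule P1.reg_flat[OF st0 s(2)])
     fix u assume u: "s <= u" "u <= t"
     have "0 < D u" using after[of u] u s by simp
     then have "0 < V1 u" using V2_nonneg[of u] u st0 True by (simp add: D_def)
     then show "0 < \<xi>1 u + reg \<xi>1 t0 u" using True by (simp add: V1)
    qed
    then show ?thesis by simp
   qed simp
   have R2: "of_bool \<beta> * reg \<xi>2 t0 s <= of_bool \<beta> * reg \<xi>2 t0 t" using P2.reg_mono[OF st0 s(2)] by auto
   show ?thesis unfolding D right_diff_distrib using L R1 R2 by linarith
  qed
  have "\<forall>\<^sub>F s in at_right s0. s \<in> {s0<..<t}" using s0t by (rule eventually_at_right_real)
  then have "\<forall>\<^sub>F s in at_right s0. D t <= D s" by eventually_elim (use mono in auto)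
  then have "D t <= D s0" by (intro tendsto_lowerbound[OF D_right[OF s0(1)]]) auto
  then show False using False Dt by simp
 qed
qed

lemma solves_unique:
 assumes f: "cadlag f" and t0: "0 <= t0" and \<delta>: "0 <= \<delta>"
  and s1: "solves \<beta> \<delta> b f t0 y L1 T" and s2: "solves \<beta> \<delta> b f t0 y L2 T" and t: "t0 <= t" "t <= T"
 shows "con \<beta> f t0 y L1 t = con \<beta> f t0 y L2 t" "L1 t = L2 t"
proof -
 have eq: "con \<beta> f t0 y L1 u = con \<beta> f t0 y L2 u" if "t0 <= u" "u <= T" for u
  using solves_le[OF f t0 \<delta> s1 s2 that] solves_le[OF f t0 \<delta> s2 s1 that] by (rule antisym)
 show "con \<beta> f t0 y L1 t = con \<beta> f t0 y L2 t" by (rule eq[OF t])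
 have "{s\<in>{t0..t}. b < con \<beta> f t0 y L1 s} = {s\<in>{t0..t}. b < con \<beta> f t0 y L2 s}" using eq t by auto
 then show "L1 t = L2 t" using solves_eq[OF s1 t] solves_eq[OF s2 t] by (simp add: time_above_def)
qed

text \<open>
 A path with this property spends no time sliding along a refraction level.
\<close>
definition no_coincidence :: "real => (real => real) => bool" where
 "no_coincidence \<delta> f \<longleftrightarrow> (ALL l. (ALL s t. 0 <= s --> s <= t --> 0 <= l t - l s & l t - l s <= \<delta> * (t - s)) -->
  {t. 0 <= t & f t = l t} \<in> null_sets lborel)"

lemma slow_coincidence_null:
 assumes nc: "no_coincidence \<delta> f" and \<delta>: "0 <= \<delta>" and t0: "0 <= t0" and L: "slow \<delta> t0 L"
 shows "{t. 0 <= t & f t = c + L (max t0 t)} \<in> null_sets lborel"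
proof -
 have "0 <= (c + L (max t0 t)) - (c + L (max t0 s)) & (c + L (max t0 t)) - (c + L (max t0 s)) <= \<delta> * (t - s)" if "0 <= s" "s <= t" for s t
 proof -
  have mm: "t0 <= max t0 s" "max t0 s <= max t0 t" using that by auto
  have "\<delta> * (max t0 t - max t0 s) <= \<delta> * (t - s)" using \<delta> that by (intro mult_left_mono) auto
  then show ?thesis using slowD[OF L mm] by simp
 qed
 then show ?thesis using nc unfolding no_coincidence_def by (auto dest!: spec[of _ "%t. c + L (max t0 t)"])
qed

text \<open>At a time when the reflected path equals \<open>b > 0\<close> the regulator is constant
  on an interval to the right, so its value is also taken at a rational. Hence the level set is
  covered by countably many coincidence sets of \<open>f\<close> with translates of
  \<open>L\<close>.\<close>

lemma con_level_null:
 assumes f: "cadlag f" and nc: "no_coincidence \<delta> f" and \<delta>: "0 <= \<delta>" and t0: "0 <= t0" and L: "slow \<delta> t0 L" and b: "0 < b"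
 shows "{t. t0 <= t & con \<beta> f t0 y L t = b} \<in> null_sets lborel"
proof -
 define \<xi> where "\<xi> = free f t0 y L"
 interpret rc_path \<xi> t0 unfolding \<xi>_def by (rule rc_free[OF f t0 L])
 define N where "N c = {t. 0 <= t & f t = c + L (max t0 t)}" for c
 have N: "N c \<in> null_sets lborel" for c unfolding N_def by (rule slow_coincidence_null[OF nc \<delta> t0 L])
 define A where "A = N (b - y + f t0) \<union> (\<Union>q\<in>\<rat>. N (b - y + f t0 - reg \<xi> t0 q))"
 have "A \<in> null_sets lborel" unfolding A_def using N countable_rat by (intro null_sets.Un null_sets_UN') auto
 moreover have "{t. t0 <= t & con \<beta> f t0 y L t = b} \<subseteq> A"
 proof
  fix t assume "t \<in> {t. t0 <= t & con \<beta> f t0 y L t = b}"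
  then have t: "t0 <= t" and eq: "\<xi> t + of_bool \<beta> * reg \<xi> t0 t = b" by (auto simp: con_def \<xi>_def)
  show "t \<in> A"
  proof (cases \<beta>)
   case False
   then have "f t = (b - y + f t0) + L (max t0 t)" using eq t by (simp add: \<xi>_def free_def max_def)
   then show ?thesis using t t0 by (simp add: A_def N_def)
  next
   case True
   then have "0 < \<xi> t + reg \<xi> t0 t" using eq b by simp
   then obtain d where d: "0 < d" "!!s. t <= s ==> s < t + d ==> reg \<xi> t0 s = reg \<xi> t0 t"
    using reg_right_const[OF t] by blast
   obtain q where q: "q \<in> \<rat>" "t < q" "q < t + d" using Rats_dense_in_real[of t "t + d"] d(1) by auto
   have "reg \<xi> t0 q = reg \<xi> t0 t" using d(2)[of q] q by simp
   then have "f t = (b - y + f t0 - reg \<xi> t0 q) + L (max t0 t)" using eq t True by (simp add: \<xi>_def free_def max_def)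
   then show ?thesis using t t0 q by (auto simp: A_def N_def)
  qed
 qed
 moreover have "{t. t0 <= t & con \<beta> f t0 y L t = b} \<in> sets lborel"
 proof -
  have m: "(%t. con \<beta> f t0 y L (max t0 t)) \<in> borel_measurable borel"
   by (rule right_measurable_from, rule con_right[OF f t0 L])
  have "{t. t0 <= t & con \<beta> f t0 y L t = b} = {t0..} \<inter> (%t. con \<beta> f t0 y L (max t0 t)) -` {b}" by (auto simp: max_def)
  moreover have "(%t. con \<beta> f t0 y L (max t0 t)) -` {b} \<in> sets borel" using measurable_sets_borel[OF m, of "{b}"] by simp
  ultimately show ?thesis by auto
 qed
 ultimately show ?thesis by (metis (lifting) null_sets_subset)
qed

text \<open>
 Euler scheme with the control \<open>\<delta> 1{v > b}\<close>; the state consists of the control and the regulator.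
\<close>
primrec est :: "bool => real => real => (real => real) => real => real => real => nat => real \<times> real" where
 "est \<beta> \<delta> b f t0 y h 0 = (0, max 0 (- y))"
| "est \<beta> \<delta> b f t0 y h (Suc i) =
  (let (l, m) = est \<beta> \<delta> b f t0 y h i;
    l' = l + (if b < y + (f (t0 + real i * h) - f t0) - l + of_bool \<beta> * m then \<delta> * h else 0)
  in (l', max m (- (y + (f (t0 + real (Suc i) * h) - f t0) - l'))))"

section \<open>Convergence of the Euler scheme and existence of solutions\<close>

locale euler_scheme =
 fixes \<beta> :: bool and \<delta> b :: real and f :: "real => real" and t0 y h :: real
 assumes \<delta>: "0 <= \<delta>" and h: "0 < h"
begin

definition "el i = fst (est \<beta> \<delta> b f t0 y h i)"
definition "em i = snd (est \<beta> \<delta> b f t0 y h i)"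
definition "xi i = y + (f (t0 + real i * h) - f t0) - el i"
definition "vi i = xi i + of_bool \<beta> * em i"
text \<open>Rounding up makes \<open>sv\<close> constant on left-open cells with the value of the
  right grid point, so that grid points approach a given time from the side on which paths are
  continuous.\<close>

definition "sv s = vi (nat \<lceil>(s - t0) / h\<rceil>)"
definition "Lt t = \<delta> * time_above b sv t0 t"

lemma el_0: "el 0 = 0" by (simp add: el_def)

lemma el_Suc: "el (Suc i) = el i + (if b < vi i then \<delta> * h else 0)"
 by (simp add: el_def vi_def xi_def em_def Let_def split: prod.splits)

lemma em_Suc: "em (Suc i) = max (em i) (- xi (Suc i))"
 by (simp add: el_def xi_def em_def Let_def split: prod.splits)

lemma em_0: "em 0 = max 0 (- xi 0)" by (simp add: em_def xi_def el_0)

lemma em_nonneg: "0 <= em i"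
 by (induction i) (auto simp: em_0 em_Suc le_max_iff_disj)

lemma em_ge: "j <= i ==> - xi j <= em i"
 by (induction i) (auto simp: em_0 em_Suc le_max_iff_disj le_Suc_eq)

lemma em_le: "0 <= c ==> (!!j. j <= i ==> - xi j <= c) ==> em i <= c"
 by (induction i) (auto simp: em_0 em_Suc)

lemma sv_measurable: "(%t. sv (max t0 t)) \<in> borel_measurable borel"
proof -
 have "(%t. nat \<lceil>(max t0 t - t0) / h\<rceil>) \<in> measurable borel (count_space UNIV)" by measurable
 from measurable_compose[OF this, of vi borel] show ?thesis by (simp add: sv_def)
qed

lemma slow_Lt: "slow \<delta> t0 Lt"
 using time_above_slow[OF sv_measurable \<delta>] unfolding Lt_def[abs_def] .

lemma sv_cell:
 assumes "s \<in> {t0 + real i * h<..t0 + real (Suc i) * h}"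
 shows "sv s = vi (Suc i)"
proof -
 have "\<lceil>(s - t0) / h\<rceil> = int (Suc i)"
  using assms h by (intro ceiling_unique) (auto simp: field_simps)
 then show ?thesis unfolding sv_def by (metis nat_int)
qed

text \<open>The index is shifted by one because a cell is judged by its right grid point in
  \<open>Lt\<close> and by its left one in \<open>el\<close>.\<close>

lemma Lt_grid: "Lt (t0 + real i * h) = el (Suc i) - el 1"
proof (induction i)
 case 0
 then show ?case using slow_start[OF slow_Lt] by simp
next
 case (Suc i)
 have i: "t0 <= t0 + real i * h" "t0 + real i * h <= t0 + real (Suc i) * h" using h by (auto simp: algebra_simps)
 have "{u\<in>{t0 + real i * h<..t0 + real (Suc i) * h}. b < sv u} = (if b < vi (Suc i) then {t0 + real i * h<..t0 + real (Suc i) * h} else {})"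
  using sv_cell[of _ i] by (auto split: if_splits)
 then have "measure lborel {u\<in>{t0 + real i * h<..t0 + real (Suc i) * h}. b < sv u} = (if b < vi (Suc i) then h else 0)"
  using i by (auto simp: algebra_simps)
 then have "Lt (t0 + real (Suc i) * h) - Lt (t0 + real i * h) = (if b < vi (Suc i) then \<delta> * h else 0)"
  using time_above_diff[OF sv_measurable i, of b] by (simp add: Lt_def right_diff_distrib[symmetric])
 then show ?case using Suc.IH el_Suc[of "Suc i"] by simp
qed

lemma Lt_el: "\<bar>Lt (t0 + real i * h) - el i\<bar> <= \<delta> * h"
proof -
 have "0 <= \<delta> * h" using \<delta> h by simp
 then show ?thesis using el_Suc[of i] el_Suc[of 0] el_0 by (auto simp: Lt_grid)
qed

end

lemma grid_near:
 fixes h :: real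
 assumes "0 < h" "t0 <= s"
 shows "s <= t0 + real (nat \<lceil>(s - t0) / h\<rceil>) * h" "t0 + real (nat \<lceil>(s - t0) / h\<rceil>) * h < s + h"
proof -
 define k where "k = \<lceil>(s - t0) / h\<rceil>"
 have k: "real_of_int k - 1 < (s - t0) / h" "(s - t0) / h <= real_of_int k" unfolding k_def by linarith+
 have "0 <= (s - t0) / h" using assms by simp
 then have "0 <= k" using k by linarith
 then have "real (nat k) = real_of_int k" by simp
 then show "s <= t0 + real (nat k) * h" "t0 + real (nat k) * h < s + h" using k assms by (auto simp: field_simps)
qed

locale euler_family =
 fixes \<beta> :: bool and \<delta> b :: real and f :: "real => real" and t0 y :: real and H :: "nat => real"
 assumes f: "cadlag f" and nc: "no_coincidence \<delta> f" and \<delta>: "0 <= \<delta>" and b: "0 < b" and t0: "0 <= t0"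
  and H: "!!n. 0 < H n" and H_lim: "H ----> 0"
begin

sublocale E: euler_scheme \<beta> \<delta> b f t0 y "H n" for n by unfold_locales (rule \<delta>, rule H)

text \<open>Grid points just to the right of \<open>s\<close> decide: there \<open>xi\<close> is
  close to the free path by uniform convergence, and the free path is right-continuous. The discrete
  regulator is a maximum over grid points, hence nearly at most the true one at the last of them;
  conversely a near-maximiser \<open>u\<close> is followed closely by a grid point where the path
  has almost the same value.\<close>

lemma euler_sv_tendsto:
 assumes L: "slow \<delta> t0 L" and unif: "!!e. 0 < e ==> EV n. \<forall>t\<in>{t0..T}. \<bar>E.Lt n t - L t\<bar> < e"
  and s: "t0 <= s" "s < T"
 shows "(%n. E.sv n s) ----> con \<beta> f t0 y L s"
proof -
 define \<xi> where "\<xi> = free f t0 y L"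
 interpret rc_path \<xi> t0 unfolding \<xi>_def by (rule rc_free[OF f t0 L])
 define k where "k n = nat \<lceil>(s - t0) / H n\<rceil>" for n
 define t where "t n i = t0 + real i * H n" for n i
 have tk: "s <= t n (k n)" "t n (k n) < s + H n" for n
  unfolding t_def k_def using grid_near[OF H s(1)] by auto
 have small: "EV n. H n < e" if "0 < e" for e
  using order_tendstoD(2)[OF H_lim that] .
 have t_mono: "t n j <= t n i" if "j <= i" for n i j using that H[of n] by (simp add: t_def)
 have t_ge: "t0 <= t n j" for n j using H[of n] by (simp add: t_def)
 have close: "EV n. ALL j<=k n. \<bar>E.xi n j - \<xi> (t n j)\<bar> < e" if e: "0 < e" for e
 proof -
  have "0 < e / (2 * (\<delta> + 1))" using e \<delta> by simp
  from small[OF this] unif[of "e/2"] small[of "T - s"]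
  have "EV n. H n < e / (2 * (\<delta> + 1)) & (\<forall>t\<in>{t0..T}. \<bar>E.Lt n t - L t\<bar> < e/2) & H n < T - s"
   using e s by (auto intro!: eventually_conj)
  then show ?thesis
  proof eventually_elim
   case (elim n)
   show ?case
   proof (intro allI impI)
    fix j assume j: "j <= k n"
    have "H n < T - s" using elim by blast
    then have "t n j <= T" using t_mono[OF j, of n] tk(2)[of n] by linarith
    then have 1: "\<bar>E.Lt n (t n j) - L (t n j)\<bar> < e/2" using elim t_ge by auto
    have "\<delta> * H n <= (\<delta> + 1) * H n" using H[of n] by simp
    also have "... < (\<delta> + 1) * (e / (2 * (\<delta> + 1)))" using elim \<delta> by (intro mult_strict_left_mono) auto
    also have "... = e/2" using \<delta> by (simp add: field_simps)
    finally have 2: "\<delta> * H n < e/2" .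
    show "\<bar>E.xi n j - \<xi> (t n j)\<bar> < e"
     using E.Lt_el[of n j] 1 2 unfolding E.xi_def \<xi>_def free_def t_def by linarith
   qed
  qed
 qed
 have lim_ex: "(%n. E.xi n (k n)) ----> \<xi> s"
 proof (rule tendstoI)
  fix e :: real assume e: "0 < e"
  obtain d where d: "0 < d" "!!u. s <= u ==> u < s + d ==> \<bar>\<xi> u - \<xi> s\<bar> < e/2" using right_ge[OF s(1), of "e/2"] e by auto
  from close[of "e/2"] e have c: "EV n. ALL j<=k n. \<bar>E.xi n j - \<xi> (t n j)\<bar> < e/2" by simp
  from small[OF d(1)] c show "EV n. dist (E.xi n (k n)) (\<xi> s) < e"
  proof eventually_elim
   case (elim n)
   have "\<bar>\<xi> (t n (k n)) - \<xi> s\<bar> < e/2" using d(2)[of "t n (k n)"] tk[of n] elim by simp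
   moreover have "\<bar>E.xi n (k n) - \<xi> (t n (k n))\<bar> < e/2" using elim by simp
   ultimately show ?case unfolding dist_real_def by linarith
  qed
 qed
 have lim_em: "(%n. E.em n (k n)) ----> reg \<xi> t0 s"
 proof (rule tendstoI)
  fix e :: real assume e: "0 < e"
  have "\<forall>\<^sub>F u in at_right s. dist (reg \<xi> t0 u) (reg \<xi> t0 s) < e/2" using reg_right[OF s(1)] by (rule tendstoD) (use e in simp)
  then obtain d where d: "s < d" "!!u. s < u ==> u < d ==> \<bar>reg \<xi> t0 u - reg \<xi> t0 s\<bar> < e/2"
   unfolding eventually_at_right_field dist_real_def by blast
  have "EX d'>0. EV n. H n < d' --> reg \<xi> t0 s - e < E.em n (k n)"
  proof (cases "e/2 < reg \<xi> t0 s")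
   case False
   have "reg \<xi> t0 s - e < E.em n (k n)" for n using False e E.em_nonneg[of n "k n"] by simp
   then show ?thesis by (intro exI[of _ 1]) auto
  next
   case True
   then have "0 <= reg \<xi> t0 s - e/4" "reg \<xi> t0 s - e/4 < reg \<xi> t0 s" using e by auto
   from reg_gt[OF this(1) s(1) this(2)] obtain u where u: "t0 <= u" "u <= s" "reg \<xi> t0 s - e/4 < - \<xi> u" by blast
   obtain d' where d': "0 < d'" "!!w. u <= w ==> w < u + d' ==> \<bar>\<xi> w - \<xi> u\<bar> < e/4" using right_ge[OF u(1), of "e/4"] e by auto
   from close[of "e/4"] e have c: "EV n. ALL j<=k n. \<bar>E.xi n j - \<xi> (t n j)\<bar> < e/4" by simp
   have "EV n. H n < d' --> reg \<xi> t0 s - e < E.em n (k n)"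
    using c
   proof eventually_elim
    case (elim n)
    show ?case
    proof
     assume hd: "H n < d'"
     define j where "j = nat \<lceil>(u - t0) / H n\<rceil>"
     have "\<lceil>(u - t0) / H n\<rceil> <= \<lceil>(s - t0) / H n\<rceil>" using u H[of n] by (intro ceiling_mono divide_right_mono) auto
     then have j: "j <= k n" unfolding j_def k_def by (rule nat_mono)
     have tj: "u <= t n j" "t n j < u + H n" unfolding t_def j_def using grid_near[OF H u(1)] by auto
     have "\<bar>\<xi> (t n j) - \<xi> u\<bar> < e/4" using d'(2)[of "t n j"] tj hd by simp
     moreover have "\<bar>E.xi n j - \<xi> (t n j)\<bar> < e/4" using elim j by simp
     moreover have "- E.xi n j <= E.em n (k n)" by (rule E.em_ge[OF j])
     ultimately show "reg \<xi> t0 s - e < E.em n (k n)" using u(3) e by linarith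
    qed
   qed
   then show ?thesis using d'(1) by blast
  qed
  then obtain d' where d': "0 < d'" "EV n. H n < d' --> reg \<xi> t0 s - e < E.em n (k n)" by blast
  from close[of "e/2"] e have c: "EV n. ALL j<=k n. \<bar>E.xi n j - \<xi> (t n j)\<bar> < e/2" by simp
  have sd: "0 < d - s" using d(1) by simp
  from small[OF sd] small[OF d'(1)] d'(2) c show "EV n. dist (E.em n (k n)) (reg \<xi> t0 s) < e"
  proof eventually_elim
   case (elim n)
   have r: "reg \<xi> t0 (t n (k n)) < reg \<xi> t0 s + e/2"
   proof (cases "s = t n (k n)")
    case True
    then show ?thesis using e by simp
   next
    case False
    then have "\<bar>reg \<xi> t0 (t n (k n)) - reg \<xi> t0 s\<bar> < e/2" using d(2)[of "t n (k n)"] tk[of n] elim by simp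
    then show ?thesis by linarith
   qed
   have "E.em n (k n) <= reg \<xi> t0 (t n (k n)) + e/2"
   proof (rule E.em_le)
    show "0 <= reg \<xi> t0 (t n (k n)) + e/2" using reg_nonneg e by (simp add: add_nonneg_nonneg)
    fix j assume j: "j <= k n"
    have "- \<xi> (t n j) <= reg \<xi> t0 (t n (k n))" by (rule reg_ge[OF t_ge t_mono[OF j]])
    moreover have "\<bar>E.xi n j - \<xi> (t n j)\<bar> < e/2" using elim j by simp
    ultimately show "- E.xi n j <= reg \<xi> t0 (t n (k n)) + e/2" by linarith
   qed
   moreover have "reg \<xi> t0 s - e < E.em n (k n)" using elim by blast
   ultimately show ?case using r unfolding dist_real_def by linarith
  qed
 qed
 show ?thesis
  unfolding E.sv_def E.vi_def k_def[symmetric] con_def \<xi>_def[symmetric]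
  by (intro tendsto_add tendsto_mult tendsto_const lim_ex lim_em)
qed

text \<open>The controls \<open>Lt\<close> are \<delta>-Lipschitz, so Arzela-Ascoli yields a
  uniformly convergent subsequence. Passing to the limit in the equation needs convergence of the
  indicators of \<open>b < sv s\<close>, which fails only on the level set of the limit; that set is
  null by \<open>con_level_null\<close>.\<close>

lemma euler_subsequence:
 assumes T: "t0 <= T"
 shows "EX L k. strict_mono (k :: nat => nat) & solves \<beta> \<delta> b f t0 y L T &
  (ALL s. t0 <= s --> s < T --> (%n. E.sv (k n) s) ----> con \<beta> f t0 y L s)"
proof -
 have bnd: "norm (E.Lt n t) <= \<delta> * (T - t0)" if "t \<in> {t0..T}" for n t
 proof -
  have "0 <= E.Lt n t" "E.Lt n t <= \<delta> * (t - t0)" using slowD[OF E.slow_Lt, of t0 t n] slow_start[OF E.slow_Lt, of n] that by auto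
  moreover have "\<delta> * (t - t0) <= \<delta> * (T - t0)" using that \<delta> by (intro mult_left_mono) auto
  ultimately show ?thesis by simp
 qed
 have lip: "norm (E.Lt n t - E.Lt n u) <= \<delta> * \<bar>t - u\<bar>" if "t \<in> {t0..T}" "u \<in> {t0..T}" for n t u
  using slowD[OF E.slow_Lt, of t u n] slowD[OF E.slow_Lt, of u t n] that by (cases "t <= u") auto
 have equi: "EX d. 0 < d & (ALL n u. u \<in> {t0..T} & norm (t - u) < d --> norm (E.Lt n t - E.Lt n u) < e)" if t: "t \<in> {t0..T}" and e: "0 < e" for t e
 proof (intro exI[of _ "e / (\<delta> + 1)"] conjI allI impI)
  show "0 < e / (\<delta> + 1)" using e \<delta> by simp
  fix n u assume u: "u \<in> {t0..T} & norm (t - u) < e / (\<delta> + 1)"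
  have "\<delta> * \<bar>t - u\<bar> <= (\<delta> + 1) * \<bar>t - u\<bar>" by (intro mult_right_mono) auto
  also have "... < e" using u \<delta> by (simp add: field_simps)
  finally show "norm (E.Lt n t - E.Lt n u) < e" using lip[OF t, of u n] u by simp
 qed
 obtain g k where g: "continuous_on {t0..T} g" and k: "strict_mono (k :: nat => nat)"
  and unif: "!!e. 0 < e ==> EX N. ALL n x. n >= N & x \<in> {t0..T} --> norm (E.Lt (k n) x - g x) < e"
  using Arzela_Ascoli[OF compact_Icc bnd equi] by metis
 \<comment> \<open>Stopping at \<open>T\<close> extends the limit to the half-line within the class
   \<open>slow\<close>.\<close>
 define L where "L t = g (min t T)" for t
 have unif': "EV n. \<forall>t\<in>{t0..T}. \<bar>E.Lt (k n) t - L t\<bar> < e" if "0 < e" for e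
 proof -
  obtain N where N: "ALL n x. n >= N & x \<in> {t0..T} --> norm (E.Lt (k n) x - g x) < e" using unif[OF \<open>0 < e\<close>] by blast
  show ?thesis unfolding eventually_sequentially L_def by (intro exI[of _ N]) (use N in auto)
 qed
 have lim: "(%n. E.Lt (k n) t) ----> L t" if t: "t \<in> {t0..T}" for t
 proof (rule tendstoI)
  fix e :: real assume "0 < e"
  from unif'[OF this] show "EV n. dist (E.Lt (k n) t) (L t) < e"
   by eventually_elim (use t in \<open>auto simp: dist_real_def\<close>)
 qed
 have slow: "slow \<delta> t0 L"
  unfolding slow_def
 proof (intro conjI allI impI)
  have "(%n. E.Lt (k n) t0) ----> 0" using slow_start[OF E.slow_Lt] by simp
  then show "L t0 = 0" using lim[of t0] T by (auto intro: LIMSEQ_unique)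
  fix s t assume st: "t0 <= s" "s <= t"
  have mem: "min s T \<in> {t0..T}" "min t T \<in> {t0..T}" "min s T <= min t T" using st T by auto
  have conv: "(%n. E.Lt (k n) (min t T) - E.Lt (k n) (min s T)) ----> L t - L s"
   using tendsto_diff[OF lim[OF mem(2)] lim[OF mem(1)]] by (simp add: L_def)
  have inc: "0 <= E.Lt (k n) (min t T) - E.Lt (k n) (min s T)" "E.Lt (k n) (min t T) - E.Lt (k n) (min s T) <= \<delta> * (t - s)" for n
  proof -
   have "\<delta> * (min t T - min s T) <= \<delta> * (t - s)" using st \<delta> by (intro mult_left_mono) auto
   then show "0 <= E.Lt (k n) (min t T) - E.Lt (k n) (min s T)" "E.Lt (k n) (min t T) - E.Lt (k n) (min s T) <= \<delta> * (t - s)"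
    using slowD[OF E.slow_Lt, of "min s T" "min t T" "k n"] mem by auto
  qed
  show "0 <= L t - L s" using conv inc(1) by (intro LIMSEQ_le_const) auto
  show "L t - L s <= \<delta> * (t - s)" using conv inc(2) by (intro LIMSEQ_le_const2) auto
 qed
 interpret K: euler_family \<beta> \<delta> b f t0 y "%n. H (k n)"
  using f nc \<delta> b t0 H LIMSEQ_subseq_LIMSEQ[OF H_lim k] by unfold_locales (auto simp: comp_def)
 have sv: "(%n. E.sv (k n) s) ----> con \<beta> f t0 y L s" if "t0 <= s" "s < T" for s
  by (rule K.euler_sv_tendsto[OF slow unif' that])
 have "L t = \<delta> * time_above b (con \<beta> f t0 y L) t0 t" if t: "t0 <= t" "t <= T" for t
 proof -
  have cm: "(%t. con \<beta> f t0 y L (max t0 t)) \<in> borel_measurable borel"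
   by (rule right_measurable_from, rule con_right[OF f t0 slow])
  have sets: "{s\<in>{t0..t}. b < con \<beta> f t0 y L s} \<in> sets lborel" "{s\<in>{t0..t}. b < E.sv n s} \<in> sets lborel" for n
   by (rule sets_above(1)[OF cm order_refl], rule sets_above(1)[OF E.sv_measurable order_refl])
  have nul: "{s. t0 <= s & con \<beta> f t0 y L s = b} \<in> null_sets lborel" by (rule con_level_null[OF f nc \<delta> t0 slow b])
  have "(%n. \<integral>s. ind {s\<in>{t0..t}. b < E.sv (k n) s} s \<partial>lborel) ----> (\<integral>s. ind {s\<in>{t0..t}. b < con \<beta> f t0 y L s} s \<partial>lborel :: real)"
  proof (rule integral_dominated_convergence[where w = "ind {t0..t}"])
   show "integrable lborel (ind {t0..t} :: real => real)"
    using t by (simp add: integrable_indicator_iff)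
   show "AE s in lborel. norm (ind {s\<in>{t0..t}. b < E.sv (k n) s} s :: real) <= ind {t0..t} s" for n by (auto simp: indicator_def)
   have "AE s in lborel. s ~= t" by (rule AE_lborel_singleton)
   moreover have "AE s in lborel. s \<notin> {s. t0 <= s & con \<beta> f t0 y L s = b}" using nul by (rule AE_not_in)
   ultimately show "AE s in lborel. (%n. ind {s\<in>{t0..t}. b < E.sv (k n) s} s :: real) ----> ind {s\<in>{t0..t}. b < con \<beta> f t0 y L s} s"
   proof eventually_elim
    case (elim s)
    show ?case
    proof (cases "s \<in> {t0..t}")
     case True
     then have c: "(%n. E.sv (k n) s) ----> con \<beta> f t0 y L s" using sv[of s] elim t by simp
     have "con \<beta> f t0 y L s < b \<or> b < con \<beta> f t0 y L s" using elim True by auto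
     then have "EV n. (b < E.sv (k n) s) = (b < con \<beta> f t0 y L s)"
     proof
      assume lt: "con \<beta> f t0 y L s < b"
      from order_tendstoD(2)[OF c lt] show ?thesis by eventually_elim (use lt in auto)
     next
      assume lt: "b < con \<beta> f t0 y L s"
      from order_tendstoD(1)[OF c lt] show ?thesis by eventually_elim (use lt in auto)
     qed
     then have "EV n. ind {s\<in>{t0..t}. b < E.sv (k n) s} s = (ind {s\<in>{t0..t}. b < con \<beta> f t0 y L s} s :: real)"
      by eventually_elim (simp add: indicator_def)
     then show ?thesis by (rule tendsto_eventually)
    qed auto
   qed
  qed (use sets in auto)
  then have "(%n. time_above b (E.sv (k n)) t0 t) ----> time_above b (con \<beta> f t0 y L) t0 t" by (simp add: time_above_def)
  then have "(%n. E.Lt (k n) t) ----> \<delta> * time_above b (con \<beta> f t0 y L) t0 t"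
   unfolding E.Lt_def by (intro tendsto_intros)
  then show ?thesis using lim[of t] t by (auto intro: LIMSEQ_unique)
 qed
 then have "solves \<beta> \<delta> b f t0 y L T" using slow by (simp add: solves_def)
 then show ?thesis using k sv by blast
qed

text \<open>By uniqueness the solutions on the intervals up to \<open>t0 + m\<close> are consistent,
  so they can be glued.\<close>

lemma solution_exists: "EX L. ALL T. solves \<beta> \<delta> b f t0 y L T"
proof -
 have "EX L. solves \<beta> \<delta> b f t0 y L (t0 + real m)" for m using euler_subsequence[of "t0 + real m"] by auto
 then obtain S where S: "!!m. solves \<beta> \<delta> b f t0 y (S m) (t0 + real m)" by metis
 define m where "m t = nat \<lceil>t - t0\<rceil>" for t
 define L where "L t = S (m t) t" for t
 have m: "t <= t0 + real (m t)" for t unfolding m_def by linarith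
 have eq: "L t = S k t" if "t0 <= t" "t <= t0 + real k" for t k
 proof (cases "m t <= k")
  case True
  then have "solves \<beta> \<delta> b f t0 y (S k) (t0 + real (m t))" using S[of k] by (auto simp: solves_def)
  from solves_unique(2)[OF f t0 \<delta> S[of "m t"] this that(1) m] show ?thesis by (simp add: L_def)
 next
  case False
  then have "solves \<beta> \<delta> b f t0 y (S (m t)) (t0 + real k)" using S[of "m t"] by (auto simp: solves_def)
  from solves_unique(2)[OF f t0 \<delta> this S[of k] that] show ?thesis by (simp add: L_def)
 qed
 have slow: "slow \<delta> t0 L"
  unfolding slow_def
 proof (intro conjI allI impI)
  show "L t0 = 0" using eq[of t0 0] slow_start[OF solves_slow[OF S]] by simp
  fix s t assume st: "t0 <= s" "s <= t"
  have "L s = S (m t) s" "L t = S (m t) t" using eq[of s "m t"] eq[of t "m t"] st m[of t] by auto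
  then show "0 <= L t - L s" "L t - L s <= \<delta> * (t - s)" using slowD[OF solves_slow[OF S] st, of "m t"] by auto
 qed
 have "L t = \<delta> * time_above b (con \<beta> f t0 y L) t0 t" if t: "t0 <= t" for t
 proof -
  have c: "con \<beta> f t0 y L s = con \<beta> f t0 y (S (m t)) s" if s: "s \<in> {t0..t}" for s
  proof (rule con_cong)
   fix u assume "u \<in> {t0..s}"
   then show "L u = S (m t) u" using eq[of u "m t"] s m[of t] by auto
  qed (use s in auto)
  have "{s\<in>{t0..t}. b < con \<beta> f t0 y L s} = {s\<in>{t0..t}. b < con \<beta> f t0 y (S (m t)) s}" using c by auto
  then have "time_above b (con \<beta> f t0 y L) t0 t = time_above b (con \<beta> f t0 y (S (m t))) t0 t" by (simp add: time_above_def)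
  then show ?thesis using solves_eq[OF S t m] eq[OF t m] by simp
 qed
 then show ?thesis using slow by (auto simp: solves_def)
qed

text \<open>Otherwise a subsequence would stay at distance \<open>e\<close>; by compactness a
  further subsequence converges to a solution, and there is only one.\<close>

lemma euler_tendsto:
 assumes L: "!!T. solves \<beta> \<delta> b f t0 y L T" and s: "t0 <= s"
 shows "(%n. E.sv n s) ----> con \<beta> f t0 y L s"
proof (rule ccontr)
 assume "~ (%n. E.sv n s) ----> con \<beta> f t0 y L s"
 then obtain e where e: "0 < e" "~ (EV n. dist (E.sv n s) (con \<beta> f t0 y L s) < e)"
  unfolding tendsto_iff by blast
 then have "\<exists>\<^sub>F n in sequentially. ~ dist (E.sv n s) (con \<beta> f t0 y L s) < e" by (simp add: frequently_def)
 then have "infinite {n. ~ dist (E.sv n s) (con \<beta> f t0 y L s) < e}" by (simp add: frequently_cofinite[symmetric] cofinite_eq_sequentially)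
 then obtain r :: "nat => nat" where r: "strict_mono r" "!!n. r n \<in> {n. ~ dist (E.sv n s) (con \<beta> f t0 y L s) < e}"
  using infinite_enumerate by blast
 interpret R: euler_family \<beta> \<delta> b f t0 y "%n. H (r n)"
  using f nc \<delta> b t0 H LIMSEQ_subseq_LIMSEQ[OF H_lim r(1)] by unfold_locales (auto simp: comp_def)
 obtain L' k where k: "solves \<beta> \<delta> b f t0 y L' (s + 1)" "(%n. E.sv (r (k n)) s) ----> con \<beta> f t0 y L' s"
  using R.euler_subsequence[of "s + 1"] s by auto
 have "con \<beta> f t0 y L' s = con \<beta> f t0 y L s" by (rule solves_unique(1)[OF f t0 \<delta> k(1) L s]) simp
 then have "EV n. dist (E.sv (r (k n)) s) (con \<beta> f t0 y L s) < e" using tendstoD[OF k(2) e(1)] by simp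
 then obtain n where "dist (E.sv (r (k n)) s) (con \<beta> f t0 y L s) < e" by (auto simp: eventually_sequentially)
 then show False using r(2)[of "k n"] by simp
qed

end

section \<open>Identification of the stagewise process with the solution\<close>

lemma before_entry:
 assumes "ereal t < (INF s\<in>{s. t0 < s & P s}. ereal s)" "t0 < s" "s <= t"
 shows "~ P s"
proof
 assume "P s"
 then have "(INF s\<in>{s. t0 < s & P s}. ereal s) <= ereal s" using assms(2) by (intro INF_lower) simp
 then show False using assms(1,3) by (meson ereal_less_eq(3) leD le_less_trans order_trans)
qed

lemma entry_start: "ereal t0 <= (INF s\<in>{s. t0 < s & P s}. ereal s)"
 by (intro INF_greatest) auto

lemma at_entry:
 assumes e: "(INF s\<in>{s. t0 < s & P s}. ereal s) = ereal t0'" and d: "0 < d"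
 shows "EX s. t0' <= s & s < t0' + d & P s"
proof -
 have "(INF s\<in>{s. t0 < s & P s}. ereal s) < ereal (t0' + d)" unfolding e using d by simp
 then obtain s where s: "t0 < s" "P s" "ereal s < ereal (t0' + d)" unfolding INF_less_iff by auto
 have "(INF s\<in>{s. t0 < s & P s}. ereal s) <= ereal s" using s by (intro INF_lower) simp
 then show ?thesis using s unfolding e by auto
qed

lemma entry_le:
 fixes g :: "real => real"
 assumes e: "(INF s\<in>{s. t0 < s & c < g s}. ereal s) = ereal t0'" and g: "(g \<longlongrightarrow> g t0') (at_right t0')"
 shows "c <= g t0'"
proof (rule ccontr)
 assume "~ c <= g t0'"
 then have lt: "g t0' < c" by simp
 from order_tendstoD(2)[OF g lt] obtain a where a: "t0' < a" "!!s. t0' < s ==> s < a ==> g s < c"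
  unfolding eventually_at_right_field by blast
 obtain s where s: "t0' <= s" "s < t0' + (a - t0')" "c < g s" using at_entry[OF e, of "a - t0'"] a(1) by auto
 then show False using a(2)[of s] lt by (cases "s = t0'") auto
qed

lemma time_above_start:
 assumes "(%t. v (max t0 t)) \<in> borel_measurable borel"
 shows "time_above b v t0 t0 = 0"
 using slow_start[OF time_above_slow[OF assms, of 1]] by simp

lemma con_measurable:
 assumes "cadlag f" "0 <= t0" "slow \<delta> t0 L"
 shows "(%t. con \<beta> f t0 y L (max t0 t)) \<in> borel_measurable borel"
 by (rule right_measurable_from, rule con_right[OF assms])

lemma slow_zero: "0 <= \<delta> ==> slow \<delta> t0 (%_. 0)" by (simp add: slow_def)

text \<open>The description operator is resolved by translating every refracted solution into a
  fixed point: its drift integral is a control, and fixed points are unique. Extensionality settles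
  the times before \<open>t0\<close>.\<close>

lemma refracted_path_eq:
 assumes f: "cadlag f" and t0: "0 <= t0" and \<delta>: "0 <= \<delta>" and L: "!!T. solves False \<delta> b f t0 y L T" and t: "t0 <= t"
 shows "refracted_path \<delta> b f t0 y t = con False f t0 y L t"
proof -
 define A where "A = restrict (con False f t0 y L) {t0..}"
 have m: "(%t. con False f t0 y L (max t0 t)) \<in> borel_measurable borel" by (rule con_measurable[OF f t0 solves_slow[OF L]])
 have "refracted_path \<delta> b f t0 y = A"
  unfolding refracted_path_def
 proof (rule the_equality)
  show "refracted_solution \<delta> b f t0 y A"
   unfolding refracted_solution_def
  proof (intro conjI allI impI)
   show "A \<in> extensional {t0..}" by (simp add: A_def)
   have "A = (%t. if t \<in> {t0..} then con False f t0 y L (max t0 t) else undefined)" by (auto simp: A_def restrict_def max_def)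
   also have "... \<in> borel_measurable borel" using m by (intro measurable_If_set) auto
   finally show "A \<in> borel_measurable borel" .
   fix t assume t: "t0 <= t"
   have "(%t. A (max t0 t)) = (%t. con False f t0 y L (max t0 t))" by (auto simp: A_def)
   then have "(%t. A (max t0 t)) \<in> borel_measurable borel" using m by simp
   then have "(LBINT s:{t0..t}. of_bool (A s > b)) = time_above b A t0 t" by (rule LBINT_above)
   also have "{s\<in>{t0..t}. b < A s} = {s\<in>{t0..t}. b < con False f t0 y L s}" by (auto simp: A_def)
   then have "time_above b A t0 t = time_above b (con False f t0 y L) t0 t" by (simp add: time_above_def)
   finally have "\<delta> * (LBINT s:{t0..t}. of_bool (A s > b)) = L t" using solves_eq[OF L t order_refl] by simp
   moreover have "A t = y + (f t - f t0) - L t" using t by (simp add: A_def con_def free_def)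
   ultimately show "A t = y + (f t - f t0) - \<delta> * (LBINT s:{t0..t}. of_bool (A s > b))" by simp
  qed
 next
  fix B assume "refracted_solution \<delta> b f t0 y B"
  then have B: "B \<in> extensional {t0..}" "B \<in> borel_measurable borel"
   "!!t. t0 <= t ==> B t = y + (f t - f t0) - \<delta> * (LBINT s:{t0..t}. of_bool (B s > b))"
   unfolding refracted_solution_def by auto
  define K where "K t = \<delta> * time_above b B t0 t" for t
  have mB: "(%t. B (max t0 t)) \<in> borel_measurable borel" using B(2) by measurable
  have eq: "con False f t0 y K t = B t" if "t0 <= t" for t
   using B(3)[OF that] LBINT_above[OF mB] by (simp add: con_def free_def K_def)
  have "{s\<in>{t0..t}. b < con False f t0 y K s} = {s\<in>{t0..t}. b < B s}" for t using eq by auto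
  then have "solves False \<delta> b f t0 y K T" for T
   using time_above_slow[OF mB \<delta>, of b] unfolding solves_def by (simp add: time_above_def K_def[abs_def])
  from solves_unique(1)[OF f t0 \<delta> this L] have "B t = con False f t0 y L t" if "t0 <= t" for t using eq that by fastforce
  then show "B = A" using B(1) by (auto simp: A_def restrict_def extensional_def)
 qed
 then show ?thesis using t by (simp add: A_def)
qed

locale driven_path =
 fixes \<delta> b :: real and f :: "real => real" and y :: real and L :: "real => real"
 assumes f: "cadlag f" and npj: "no_positive_jumps f" and nc: "no_coincidence \<delta> f" and \<delta>: "0 <= \<delta>" and b: "0 < b"
  and y: "0 <= y" and L: "!!T. solves True \<delta> b f 0 y L T"
begin

definition "V = con True f 0 y L"

lemma slow_L: "slow \<delta> 0 L" using L by (rule solves_slow)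

lemma V_0: "V 0 = y" using y by (simp add: V_def con_start[OF slow_L])

lemma V_right: "0 <= t ==> (V \<longlongrightarrow> V t) (at_right t)"
 unfolding V_def by (rule con_right[OF f order_refl slow_L])

lemma V_nonneg: "0 <= t ==> 0 <= V t"
 unfolding V_def by (rule con_nonneg[OF f order_refl slow_L])

lemma V_measurable: "0 <= t0 ==> (%t. V (max t0 t)) \<in> borel_measurable borel"
 by (rule right_measurable_from, rule V_right) simp

text \<open>The flow property: with the reached level as starting point, the new regulator supplies
  exactly the later growth of the old one, and occupation times are additive.\<close>

lemma restart:
 assumes t0: "0 <= t0"
 defines "K \<equiv> %t. L t - L t0"
 shows "!!t. t0 <= t ==> con True f t0 (V t0) K t = V t" "!!T. solves True \<delta> b f t0 (V t0) K T"
proof -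
 have K: "slow \<delta> t0 K" using slow_L t0 unfolding slow_def K_def by auto
 define \<xi> where "\<xi> = free f 0 y L"
 define \<eta> where "\<eta> = free f t0 (V t0) K"
 interpret X: rc_path \<xi> 0 unfolding \<xi>_def by (rule rc_free[OF f order_refl slow_L])
 interpret Y: rc_path \<eta> t0 unfolding \<eta>_def by (rule rc_free[OF f t0 K])
 have \<eta>: "\<eta> s = \<xi> s + reg \<xi> 0 t0" for s by (simp add: \<eta>_def free_def V_def con_def \<xi>_def K_def)
 show eq: "con True f t0 (V t0) K t = V t" if t: "t0 <= t" for t
 proof -
  have "reg \<eta> t0 t + reg \<xi> 0 t0 = reg \<xi> 0 t"
  proof (rule antisym)
   have "reg \<eta> t0 t <= reg \<xi> 0 t - reg \<xi> 0 t0"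
   proof (rule Y.reg_le)
    fix s assume "t0 <= s" "s <= t"
    then show "- \<eta> s <= reg \<xi> 0 t - reg \<xi> 0 t0" using X.reg_ge[of s t] t0 by (simp add: \<eta>)
   qed (use X.reg_mono[OF t0 t] t in auto)
   then show "reg \<eta> t0 t + reg \<xi> 0 t0 <= reg \<xi> 0 t" by simp
   show "reg \<xi> 0 t <= reg \<eta> t0 t + reg \<xi> 0 t0"
   proof (rule X.reg_le)
    fix s assume s: "0 <= s" "s <= t"
    show "- \<xi> s <= reg \<eta> t0 t + reg \<xi> 0 t0"
    proof (cases "s <= t0")
     case True then show ?thesis using X.reg_ge[of s t0] s Y.reg_nonneg[of t] by simp
    next
     case False then show ?thesis using Y.reg_ge[of s t] s by (simp add: \<eta>)
    qed
   qed (use X.reg_nonneg[of t0] Y.reg_nonneg[of t] t t0 in auto)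
  qed
  then have "\<eta> t + reg \<eta> t0 t = \<xi> t + reg \<xi> 0 t" by (simp add: \<eta>)
  then show ?thesis unfolding con_def V_def \<eta>_def[unfolded V_def] \<xi>_def by (simp add: con_def)
 qed
 have "K t = \<delta> * time_above b (con True f t0 (V t0) K) t0 t" if t: "t0 <= t" for t
 proof -
  have "{s\<in>{t0..t}. b < con True f t0 (V t0) K s} = {s\<in>{t0..t}. b < V s}" using eq by auto
  then have "time_above b (con True f t0 (V t0) K) t0 t = time_above b V t0 t" by (simp add: time_above_def)
  also have "... = time_above b V 0 t - time_above b V 0 t0"
   using time_above_diff[OF V_measurable[of t0] order_refl t, of b] time_above_start[OF V_measurable[of t0], of b]
    time_above_diff[OF V_measurable[of 0] t0 t, of b] t0 by simp
  finally have "time_above b (con True f t0 (V t0) K) t0 t = time_above b V 0 t - time_above b V 0 t0" .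
  then show ?thesis
   using solves_eq[OF L, of t t] solves_eq[OF L, of t0 t0] t t0 by (simp add: K_def V_def right_diff_distrib)
 qed
 then show "solves True \<delta> b f t0 (V t0) K T" for T using K by (simp add: solves_def)
qed

lemma follows:
 assumes t0: "0 <= t0" and K: "slow \<delta> t0 K" and t: "t0 <= t"
  and eq: "!!s. t0 <= s ==> s <= t ==> K s = \<delta> * time_above b (con True f t0 (V t0) K) t0 s"
 shows "V t = con True f t0 (V t0) K t"
proof -
 have "solves True \<delta> b f t0 (V t0) K t" using K eq by (simp add: solves_def)
 from solves_unique(1)[OF f t0 \<delta> this restart(2)[OF t0] t order_refl] restart(1)[OF t0 t] show ?thesis by simp
qed

lemma refracted_stage:
 assumes t0: "0 <= t0" and t: "t0 <= t" and pos: "!!s. t0 < s ==> s < t ==> 0 <= refracted_path \<delta> b f t0 (V t0) s"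
 shows "V t = max 0 (refracted_path \<delta> b f t0 (V t0) t)"
proof -
 interpret F: euler_family False \<delta> b f t0 "V t0" "%n. inverse (real (Suc n))"
  using f nc \<delta> b t0 LIMSEQ_inverse_real_of_nat by unfold_locales auto
 obtain K where K: "!!T. solves False \<delta> b f t0 (V t0) K T" using F.solution_exists by blast
 note sK = solves_slow[OF K]
 define A where "A = free f t0 (V t0) K"
 interpret rc_path A t0 unfolding A_def by (rule rc_free[OF f t0 sK])
 have conA: "con False f t0 (V t0) K = A" by (auto simp: con_def A_def)
 have path: "refracted_path \<delta> b f t0 (V t0) s = A s" if "t0 <= s" for s
  using refracted_path_eq[OF f t0 \<delta> K that] by (simp add: conA)
 have A_nonneg: "0 <= A s" if "t0 <= s" "s < t" for s
 proof (cases "s = t0")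
  case True
  then show ?thesis using V_nonneg[OF t0] by (simp add: A_def free_def slow_start[OF sK])
 next
  case False
  then show ?thesis using pos[of s] path[of s] that by simp
 qed
 have con: "con True f t0 (V t0) K s = max 0 (A s)" if s: "t0 <= s" "s <= t" for s
 proof -
  have "reg A t0 s = max 0 (- A s)"
  proof (rule antisym)
   show "reg A t0 s <= max 0 (- A s)"
   proof (rule reg_le)
    fix u assume u: "t0 <= u" "u <= s"
    show "- A u <= max 0 (- A s)" using A_nonneg[of u] u s by (cases "u = s") auto
   qed (use s in auto)
   show "max 0 (- A s) <= reg A t0 s" using reg_ge[of s s] reg_nonneg[of s] s by simp
  qed
  then show ?thesis by (simp add: con_def A_def[symmetric])
 qed
 have "V t = con True f t0 (V t0) K t"
 proof (rule follows[OF t0 sK t])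
  fix s assume s: "t0 <= s" "s <= t"
  have "{u\<in>{t0..s}. b < con True f t0 (V t0) K u} = {u\<in>{t0..s}. b < A u}" using con s b by auto
  then show "K s = \<delta> * time_above b (con True f t0 (V t0) K) t0 s"
   using solves_eq[OF K s(1) order_refl] by (simp add: time_above_def conA)
 qed
 then show ?thesis using con[OF t order_refl] path[OF t] by simp
qed

lemma reflected_path_eq: "reflected_path f t0 t = con True f t0 0 (%_. 0) t"
 by (simp add: reflected_path_def con_def free_def reg_def max.commute)

text \<open>While the reflected path stays at most \<open>b\<close> the zero control solves the
  equation; the endpoint \<open>t\<close> may exceed \<open>b\<close>, but a single time is
  negligible.\<close>

lemma reflected_stage:
 assumes t0: "0 <= t0" and t: "t0 <= t" and Vt0: "V t0 = 0" and le: "!!s. t0 < s ==> s < t ==> reflected_path f t0 s <= b"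
 shows "V t = reflected_path f t0 t"
proof -
 have sl: "slow \<delta> t0 (%_. 0)" by (rule slow_zero[OF \<delta>])
 have "V t = con True f t0 (V t0) (%_. 0) t"
 proof (rule follows[OF t0 sl t])
  fix s assume s: "t0 <= s" "s <= t"
  have "{u\<in>{t0..s}. b < con True f t0 0 (%_. 0) u} \<subseteq> {t}"
  proof
   fix u assume u: "u \<in> {u\<in>{t0..s}. b < con True f t0 0 (%_. 0) u}"
   then have "u ~= t0" using b con_start[OF sl, of True f 0] by auto
   then have "~ u < t" using u le[of u] by (auto simp: reflected_path_eq)
   then show "u \<in> {t}" using u s by simp
  qed
  moreover have "{u\<in>{t0..s}. b < con True f t0 0 (%_. 0) u} \<in> sets lborel"
   by (rule sets_above(1)[OF con_measurable[OF f t0 sl] order_refl])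
  ultimately have "{u\<in>{t0..s}. b < con True f t0 0 (%_. 0) u} \<in> null_sets lborel"
   by (metis (lifting) null_sets_subset finite_imp_null_set_lborel finite.emptyI finite_insert)
  then have "time_above b (con True f t0 0 (%_. 0)) t0 s = 0" unfolding time_above_def by (metis (lifting) measure_eq_0_null_sets)
  then show "0 = \<delta> * time_above b (con True f t0 (V t0) (%_. 0)) t0 s" by (simp add: Vt0)
 qed
 then show ?thesis by (simp add: Vt0 reflected_path_eq)
qed

text \<open>Without positive jumps the level \<open>b\<close> is met exactly, so the next stage,
  which starts from \<open>b\<close>, continues \<open>V\<close>. The third claim records that the
  driving path rises by at least \<open>b / 2\<close> during the stage; this excludes an
  accumulation of stages.\<close>

lemma reflected_exit:
 assumes t0: "0 <= t0" and Vt0: "V t0 = 0" and e: "stage_end \<delta> b f (Reflected t0) = ereal t0'"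
 shows "t0 < t0'" "V t0' = b" "EX w. t0 <= w & w < t0' & b / 2 <= f t0' - f w"
proof -
 define \<xi> where "\<xi> t = f t - f t0" for t
 have \<xi>: "\<xi> = free f t0 0 (%_. 0)" by (simp add: \<xi>_def free_def fun_eq_iff)
 have sl: "slow \<delta> t0 (%_. 0)" by (rule slow_zero[OF \<delta>])
 interpret rc_path \<xi> t0 unfolding \<xi> by (rule rc_free[OF f t0 sl])
 define U where "U = reflected_path f t0"
 have Ucon: "U = con True f t0 0 (%_. 0)" by (simp add: U_def reflected_path_eq fun_eq_iff)
 have U: "U t = \<xi> t + reg \<xi> t0 t" for t by (simp add: Ucon con_def \<xi>)
 have e': "(INF t\<in>{t. t0 < t & b < U t}. ereal t) = ereal t0'" using e by (simp add: U_def)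
 have le: "t0 <= t0'" using entry_start[of t0 "%t. b < U t"] unfolding e' by simp
 have ge: "b <= U t0'" by (rule entry_le[OF e']) (unfold Ucon, rule con_right[OF f t0 sl le])
 show lt: "t0 < t0'" using ge le b con_start[OF sl, of True f 0] by (cases "t0 = t0'") (auto simp: Ucon)
 have before: "U s <= b" if "t0 < s" "s < t0'" for s
  using before_entry[of s t0 "%t. b < U t" s] e' that by auto
 show near: "EX w. t0 <= w & w < t0' & b / 2 <= f t0' - f w"
 proof (cases "b / 2 < reg \<xi> t0 t0'")
  case False
  then show ?thesis using ge lt U[of t0'] by (intro exI[of _ t0]) (simp add: \<xi>_def)
 next
  case True
  then have "0 <= reg \<xi> t0 t0' - b / 2" "reg \<xi> t0 t0' - b / 2 < reg \<xi> t0 t0'" using b by auto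
  from reg_gt[OF this(1) le this(2)] obtain w where w: "t0 <= w" "w <= t0'" "reg \<xi> t0 t0' - b / 2 < - \<xi> w" by blast
  then have "b / 2 < \<xi> t0' - \<xi> w" using ge U[of t0'] by simp
  then show ?thesis using w b by (intro exI[of _ w]) (auto simp: \<xi>_def less_le)
 qed
 have "U t0' <= b"
 proof (rule ccontr)
  \<comment> \<open>The regulator is within \<open>eps\<close> of its value at \<open>t0'\<close>
    from some \<open>w < t0'\<close> on, because at \<open>t0'\<close> the path is positive. Up to
    \<open>t0'\<close> the bound \<open>U s <= b\<close> then caps \<open>f\<close> and its left
    limit, and an overshoot of \<open>2 * eps\<close> would be a positive jump.\<close>
  assume "~ U t0' <= b"
  then have eps: "0 < (U t0' - b) / 2" by simp
  define eps where "eps = (U t0' - b) / 2"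
  have "EX w. t0 <= w & w < t0' & reg \<xi> t0 t0' - eps <= reg \<xi> t0 w"
  proof (cases "eps < reg \<xi> t0 t0'")
   case False
   then show ?thesis using lt reg_nonneg[of t0] by (intro exI[of _ t0]) auto
  next
   case True
   then have "0 <= reg \<xi> t0 t0' - eps" "reg \<xi> t0 t0' - eps < reg \<xi> t0 t0'" using eps by (auto simp: eps_def)
   from reg_gt[OF this(1) le this(2)] obtain w where w: "t0 <= w" "w <= t0'" "reg \<xi> t0 t0' - eps < - \<xi> w" by blast
   have "w ~= t0'" using w(3) U[of t0'] b eps by (auto simp: eps_def field_simps)
   then show ?thesis using w reg_ge[OF w(1) order_refl] by (intro exI[of _ w]) auto
  qed
  then obtain w where w: "t0 <= w" "w < t0'" "reg \<xi> t0 t0' - eps <= reg \<xi> t0 w" by blast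
  have "0 < t0'" using lt t0 by simp
  then obtain l where l: "(f \<longlongrightarrow> l) (at_left t0')" using f unfolding cadlag_def by blast
  then have fl: "f t0' <= l" using npj \<open>0 < t0'\<close> unfolding no_positive_jumps_def by blast
  have "\<forall>\<^sub>F s in at_left t0'. s \<in> {w<..<t0'}" using w(2) by (rule eventually_at_left_real)
  then have "\<forall>\<^sub>F s in at_left t0'. f s <= b + f t0 - (reg \<xi> t0 t0' - eps)"
  proof eventually_elim
   case (elim s)
   then have "U s <= b" using before[of s] w by simp
   moreover have "reg \<xi> t0 w <= reg \<xi> t0 s" using reg_mono[of w s] w elim by simp
   ultimately show ?case using w(3) unfolding U \<xi>_def by linarith
  qed
  then have "l <= b + f t0 - (reg \<xi> t0 t0' - eps)" by (intro tendsto_upperbound[OF l]) auto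
  then show False using fl U[of t0'] eps by (simp add: \<xi>_def eps_def field_simps)
 qed
 then show "V t0' = b" using reflected_stage[OF t0 le Vt0] before ge by (simp add: U_def)
qed

text \<open>By right-continuity the refracted path is at most \<open>0\<close> at its exit time,
  whether it creeps or jumps below; the truncation in \<open>refracted_stage\<close> then puts
  \<open>V\<close> at \<open>0\<close>.\<close>

lemma refracted_exit:
 assumes t0: "0 <= t0" and e: "stage_end \<delta> b f (Refracted t0 (V t0)) = ereal t0'"
 shows "t0 <= t0'" "V t0' = 0"
proof -
 interpret F: euler_family False \<delta> b f t0 "V t0" "%n. inverse (real (Suc n))"
  using f nc \<delta> b t0 LIMSEQ_inverse_real_of_nat by unfold_locales auto
 obtain K where K: "!!T. solves False \<delta> b f t0 (V t0) K T" using F.solution_exists by blast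
 define A where "A = con False f t0 (V t0) K"
 have path: "refracted_path \<delta> b f t0 (V t0) s = A s" if "t0 <= s" for s
  using refracted_path_eq[OF f t0 \<delta> K that] by (simp add: A_def)
 have set: "{t. t0 < t & refracted_path \<delta> b f t0 (V t0) t < 0} = {t. t0 < t & 0 < - A t}" using path by auto
 have e': "(INF t\<in>{t. t0 < t & 0 < - A t}. ereal t) = ereal t0'" using e by (simp add: set)
 show le: "t0 <= t0'" using entry_start[of t0 "%t. 0 < - A t"] unfolding e' by simp
 have "0 <= - A t0'"
  by (rule entry_le[OF e']) (unfold A_def, intro tendsto_minus con_right[OF f t0 solves_slow[OF K] le])
 moreover have "V t0' = max 0 (refracted_path \<delta> b f t0 (V t0) t0')"
 proof (rule refracted_stage[OF t0 le])
  fix s assume "t0 < s" "s < t0'"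
  then show "0 <= refracted_path \<delta> b f t0 (V t0) s"
   using before_entry[of s t0 "%t. 0 < - A t" s] e' path[of s] by auto
 qed
 ultimately show "V t0' = 0" using path[OF le] by simp
qed

fun on_track :: "stage => bool" where
 "on_track (Refracted t0 z) \<longleftrightarrow> 0 <= t0 & V t0 = z"
| "on_track (Reflected t0) \<longleftrightarrow> 0 <= t0 & V t0 = 0"

lemma stage_end_ge: "ereal (stage_start s) <= stage_end \<delta> b f s"
 by (cases s) (auto intro: entry_start)

lemma on_track_next:
 assumes s: "on_track s" and s': "next_stage \<delta> b f s = Some s'"
 shows "on_track s'" "stage_start s <= stage_start s'" "stage_end \<delta> b f s = ereal (stage_start s')"
proof -
 have "on_track s' & stage_start s <= stage_start s' & stage_end \<delta> b f s = ereal (stage_start s')"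
 proof (cases s)
  case (Refracted t0 z)
  then show ?thesis using s s' refracted_exit[of t0] by (auto split: ereal.splits simp del: stage_end.simps)
 next
  case (Reflected t0)
  then show ?thesis using s s' reflected_exit[of t0] by (auto split: ereal.splits simp del: stage_end.simps)
 qed
 then show "on_track s'" "stage_start s <= stage_start s'" "stage_end \<delta> b f s = ereal (stage_start s')" by auto
qed

lemma on_track_path:
 assumes s: "on_track s" and t: "stage_start s <= t" "ereal t < stage_end \<delta> b f s"
 shows "stage_path \<delta> b f s t = V t"
proof (cases s)
 case (Refracted t0 z)
 then have t0: "0 <= t0" "t0 <= t" and z: "V t0 = z" and e: "ereal t < (INF s\<in>{s. t0 < s & refracted_path \<delta> b f t0 z s < 0}. ereal s)"
  using s t by auto
 have pos: "0 <= refracted_path \<delta> b f t0 (V t0) s" if "t0 < s" "s <= t" for s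
  using before_entry[OF e that] by (simp add: z)
 have V: "V t = max 0 (refracted_path \<delta> b f t0 (V t0) t)" by (rule refracted_stage[OF t0]) (use pos in auto)
 show ?thesis
 proof (cases "t0 = t")
  case True
  have "V t0 = max 0 (refracted_path \<delta> b f t0 (V t0) t0)" using V True by simp
  interpret F: euler_family False \<delta> b f t0 "V t0" "%n. inverse (real (Suc n))"
   using f nc \<delta> b t0 LIMSEQ_inverse_real_of_nat by unfold_locales auto
  obtain K where K: "!!T. solves False \<delta> b f t0 (V t0) K T" using F.solution_exists by blast
  have "refracted_path \<delta> b f t0 (V t0) t0 = V t0"
   using refracted_path_eq[OF f t0(1) \<delta> K order_refl] con_start[OF solves_slow[OF K], of False] by simp
  then show ?thesis using True Refracted z by simp
 next
  case False
  then show ?thesis using V pos[of t] t0 Refracted z by simp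
 qed
next
 case (Reflected t0)
 then have t0: "0 <= t0" "t0 <= t" and z: "V t0 = 0" and e: "ereal t < (INF s\<in>{s. t0 < s & b < reflected_path f t0 s}. ereal s)"
  using s t by auto
 have le: "reflected_path f t0 s <= b" if "t0 < s" "s <= t" for s
  using before_entry[OF e that] by simp
 then show ?thesis using reflected_stage[OF t0 z] Reflected by simp
qed

context
 fixes x :: real
 assumes yx: "y = max 0 x"
begin

lemma stages_on_track: "stages \<delta> b x f n = Some s ==> on_track s"
proof (induction n arbitrary: s)
 case 0
 show ?case
 proof (cases "0 <= x")
  case True
  then have "s = Refracted 0 x" "V 0 = x" using 0 yx V_0 by auto
  then show ?thesis by (metis on_track.simps(1) order_refl)
 next
  case False
  then have "s = Reflected 0" "V 0 = 0" using 0 yx V_0 by auto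
  then show ?thesis by (metis on_track.simps(2) order_refl)
 qed
next
 case (Suc n)
 then obtain s' where s': "stages \<delta> b x f n = Some s'" "next_stage \<delta> b f s' = Some s" by (auto simp: bind_eq_Some_conv)
 show ?case by (rule on_track_next(1)[OF Suc.IH[OF s'(1)] s'(2)])
qed

text \<open>A deterministic argument: of two consecutive stages one is reflected and contains a rise
  of the driving path by \<open>b / 2\<close>. If all stages started before \<open>t\<close>, their
  starting times would accumulate at some \<open>r\<close>, and the left limit of the path at
  \<open>r\<close> forbids such rises.\<close>

lemma stages_cover:
 assumes t: "0 <= t"
 shows "EX n s. stages \<delta> b x f n = Some s & stage_start s <= t & ereal t < stage_end \<delta> b f s"
proof (rule ccontr)
 assume neg: "\<nexists>n s. stages \<delta> b x f n = Some s & stage_start s <= t & ereal t < stage_end \<delta> b f s"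
 have step: "EX s'. next_stage \<delta> b f s = Some s' & stage_start s' <= t" if s: "stages \<delta> b x f n = Some s" "stage_start s <= t" for n s
 proof -
  have "stage_end \<delta> b f s <= ereal t" using neg s by (meson not_le)
  then obtain t0' where t0': "stage_end \<delta> b f s = ereal t0'" "t0' <= t"
   using stage_end_ge[of s] by (cases "stage_end \<delta> b f s") auto
  then show ?thesis by (cases s) (auto simp del: stage_end.simps)
 qed
 have ex: "EX s. stages \<delta> b x f n = Some s & stage_start s <= t" for n
 proof (induction n)
  case 0
  then show ?case using t by simp
 next
  case (Suc n)
  then show ?case using step by fastforce
 qed
 define S where "S n = the (stages \<delta> b x f n)" for n
 define \<sigma> where "\<sigma> n = stage_start (S n)" for n
 have S: "stages \<delta> b x f n = Some (S n)" and \<sigma>t: "\<sigma> n <= t" for n using ex[of n] by (auto simp: S_def \<sigma>_def)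
 have nxt: "next_stage \<delta> b f (S n) = Some (S (Suc n))" for n using S[of n] S[of "Suc n"] by simp
 have tr: "on_track (S n)" for n by (rule stages_on_track[OF S])
 have \<sigma>_mono: "incseq \<sigma>" using on_track_next(2)[OF tr nxt] by (intro incseq_SucI) (simp add: \<sigma>_def)
 obtain r where r: "\<sigma> ----> r" "!!n. \<sigma> n <= r" using incseq_convergent[OF \<sigma>_mono, of t] \<sigma>t by metis
 have alt: "EX t0. S n = Reflected t0 \<or> S (Suc n) = Reflected t0" for n
  using nxt[of n] by (cases "S n") (auto split: ereal.splits simp del: stage_end.simps dest: sym)
 have rise: "EX w. \<sigma> n <= w & w < \<sigma> (n + 2) & (EX v. w < v & v <= \<sigma> (n + 2) & b / 2 <= f v - f w)" for n
 proof -
  have *: "EX w. \<sigma> m <= w & w < \<sigma> (Suc m) & b / 2 <= f (\<sigma> (Suc m)) - f w" if "S m = Reflected t0" for m t0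
   using reflected_exit(3)[of t0 "\<sigma> (Suc m)"] on_track_next(3)[OF tr nxt, of m] tr[of m] that by (auto simp: \<sigma>_def)
  have m: "\<sigma> n <= \<sigma> (Suc n)" "\<sigma> (Suc n) <= \<sigma> (n + 2)" using \<sigma>_mono by (auto simp: incseq_def)
  from alt[of n] obtain t0 where "S n = Reflected t0 \<or> S (Suc n) = Reflected t0" by blast
  then show ?thesis
  proof
   assume "S n = Reflected t0"
   from *[OF this] m show ?thesis by (meson less_le_trans)
  next
   assume "S (Suc n) = Reflected t0"
   from *[OF this] m show ?thesis by (auto intro: order_trans)
  qed
 qed
 have "\<sigma> n < r" for n using rise[of n] r(2)[of "n + 2"] by auto
 note less_r = this
 have "0 < r" using less_r[of 0] tr[of 0] by (cases "S 0") (auto simp: \<sigma>_def)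
 then obtain l where l: "(f \<longlongrightarrow> l) (at_left r)" using f unfolding cadlag_def by blast
 have "\<forall>\<^sub>F s in at_left r. dist (f s) l < b / 4" using l by (rule tendstoD) (use b in simp)
 then obtain a where a: "a < r" "!!s. a < s ==> s < r ==> \<bar>f s - l\<bar> < b / 4"
  unfolding eventually_at_left_field dist_real_def by blast
 from order_tendstoD(1)[OF r(1) a(1)] obtain n where n: "a < \<sigma> n" by (auto simp: eventually_sequentially)
 obtain w v where wv: "\<sigma> n <= w" "w < v" "v <= \<sigma> (n + 2)" "b / 2 <= f v - f w" using rise[of n] by blast
 have "v < r" using wv less_r[of "n + 2"] by simp
 then have "\<bar>f v - l\<bar> < b / 4" "\<bar>f w - l\<bar> < b / 4" using a(2)[of v] a(2)[of w] wv n by auto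
 then show False using wv(4) by linarith
qed

lemma refracted_reflected_eq:
 assumes "0 <= t"
 shows "refracted_reflected \<delta> b x f t = V t"
 unfolding refracted_reflected_def
proof (rule the_equality)
 show "EX n s. stages \<delta> b x f n = Some s & stage_start s <= t & ereal t < stage_end \<delta> b f s & V t = stage_path \<delta> b f s t"
  using stages_cover[OF assms] on_track_path[OF stages_on_track] by metis
qed (use on_track_path[OF stages_on_track] in auto)

end

end

section \<open>The Stieltjes measure of the refraction time\<close>

lemma interval_measure_eqI:
 fixes F :: "real => real"
 assumes mono: "!!x y. x <= y ==> F x <= F y" and cont: "!!a. continuous (at_right a) F"
  and sets: "sets N = sets borel" and N: "!!a c. a <= c ==> emeasure N {a<..c} = ennreal (F c - F a)"
 shows "interval_measure F = N"
proof (rule measure_eqI_generator_eq)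
 let ?E = "range (%(a, c). {a<..c::real})"
 have "{a<..c} \<inter> {a'<..c'} = {max a a'<..min c c'}" for a c a' c' :: real by auto
 then show "Int_stable ?E" unfolding Int_stable_def by (auto simp: image_iff)
 show "emeasure (interval_measure F) X = emeasure N X" if XE: "X \<in> ?E" for X
 proof -
  obtain a c where X: "X = {a<..c}" using XE by auto
  show ?thesis
  proof (cases "a <= c")
   case True
   then show ?thesis unfolding X N[OF True] by (rule emeasure_interval_measure_Ioc[OF _ mono cont])
  qed (simp add: X)
 qed
 show "sets (interval_measure F) = sigma_sets UNIV ?E" "sets N = sigma_sets UNIV ?E"
  using sets by (simp_all add: borel_sigma_sets_Ioc)
 show "range (%i. {- real i<..real i}) \<subseteq> ?E" by auto
 have "x \<in> {- real (nat \<lceil>\<bar>x\<bar>\<rceil> + 1)<..real (nat \<lceil>\<bar>x\<bar>\<rceil> + 1)}" for x by (simp; linarith)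
 then show "(\<Union>i. {- real i<..real i}) = UNIV" by blast
 show "emeasure (interval_measure F) {- real i<..real i} ~= \<infinity>" for i
  by (subst emeasure_interval_measure_Ioc[OF _ mono cont]) auto
qed auto

context driven_path
begin

lemma V_above_measurable: "{s. 0 <= s & b < V s} \<in> sets borel"
proof -
 have "{s. 0 <= s & b < V s} = {0..} \<inter> (%t. V (max 0 t)) -` {b<..}" by auto
 then show ?thesis using measurable_sets_borel[OF V_measurable[OF order_refl], of "{b<..}"] by auto
qed

text \<open>On a half-open interval the increment of the refraction time is \<delta> times the
  measure of the times with \<open>V\<close> above \<open>b\<close>, so its Stieltjes measure has
  density \<delta> on that set.\<close>

lemma nn_integral_refraction:
 assumes "y = max 0 x" and g[measurable]: "g \<in> borel_measurable borel"
 shows "(\<integral>\<^sup>+t\<in>{0..}. g t \<partial>interval_measure (refraction_time \<delta> b x f)) =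
  ennreal \<delta> * (\<L> t. g t * ind {s. 0 <= s & b < V s} t)"
proof -
 define S where "S = {s. 0 <= s & b < V s}"
 have S[measurable]: "S \<in> sets borel" unfolding S_def by (rule V_above_measurable)
 define F where "F t = \<delta> * time_above b V 0 t" for t
 have vm: "(%t. V (max 0 t)) \<in> borel_measurable borel" by (rule V_measurable) simp
 have F: "refraction_time \<delta> b x f = F"
 proof
  fix t
  have "(LBINT s:{0..t}. of_bool (refracted_reflected \<delta> b x f s > b)) = (LBINT s:{0..t}. of_bool (V s > b) :: real)"
   unfolding set_lebesgue_integral_def
   by (intro Bochner_Integration.integral_cong) (auto simp: indicator_def refracted_reflected_eq[OF assms(1)])
  then show "refraction_time \<delta> b x f t = F t" by (simp add: refraction_time_def LBINT_above[OF vm] F_def)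
 qed
 have slow: "slow \<delta> 0 F" unfolding F_def by (rule time_above_slow[OF vm \<delta>])
 have F0: "F t = F (max 0 t)" for t using slow_start[OF slow] by (cases "0 <= t") (auto simp: F_def time_above_def max_def)
 have inc: "F s <= F t" "F t - F s <= \<delta> * (t - s)" if "s <= t" for s t
 proof -
  have mm: "0 <= max 0 s" "max 0 s <= max 0 t" using that by auto
  have "\<delta> * (max 0 t - max 0 s) <= \<delta> * (t - s)" using that \<delta> by (intro mult_left_mono) auto
  then show "F s <= F t" "F t - F s <= \<delta> * (t - s)" using slowD[OF slow mm] F0[of s] F0[of t] by auto
 qed
 have "\<delta>-lipschitz_on UNIV F"
 proof (rule lipschitz_onI)
  fix s t show "dist (F s) (F t) <= \<delta> * dist s t"
   using inc[of s t] inc[of t s] by (cases "s <= t") (auto simp: dist_real_def)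
 qed (rule \<delta>)
 then have "isCont F a" for a using lipschitz_on_continuous_on continuous_on_eq_continuous_at[OF open_UNIV] by blast
 then have cont: "continuous (at_right a) F" for a using continuous_at_imp_continuous_at_within by blast
 have "interval_measure F = density lborel (%t. ennreal \<delta> * ind S t)"
 proof (rule interval_measure_eqI[OF inc(1) cont])
  show "sets (density lborel (%t. ennreal \<delta> * ind S t)) = sets borel" unfolding sets_density sets_lborel ..
  fix a c :: real assume ac: "a <= c"
  have "emeasure (density lborel (%t. ennreal \<delta> * ind S t)) {a<..c} = (\<L> t. ennreal \<delta> * ind (S \<inter> {a<..c}) t)"
   by (subst emeasure_density) (auto intro!: nn_integral_cong simp: indicator_def)
  also have "... = ennreal \<delta> * emeasure lborel (S \<inter> {a<..c})" by (rule nn_integral_cmult_indicator) auto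
  also have "emeasure lborel (S \<inter> {a<..c}) = ennreal (measure lborel (S \<inter> {a<..c}))"
  proof (rule emeasure_eq_ennreal_measure)
   have "emeasure lborel (S \<inter> {a<..c}) <= emeasure lborel {a<..c}" by (intro emeasure_mono) auto
   then show "emeasure lborel (S \<inter> {a<..c}) ~= \<top>" using ac by (auto simp: top_unique)
  qed
  also have "ennreal \<delta> * ennreal (measure lborel (S \<inter> {a<..c})) = ennreal (F c - F a)"
  proof (cases "0 <= a")
   case True
   then have "S \<inter> {a<..c} = {u\<in>{a<..c}. b < V u}" by (auto simp: S_def)
   then show ?thesis using time_above_diff[OF vm True ac, of b] \<delta>
    by (simp add: F_def right_diff_distrib[symmetric] ennreal_mult)
  next
   case False
   then have "S \<inter> {a<..c} = {u\<in>{0..c}. b < V u}" by (auto simp: S_def)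
   moreover have "F c - F a = F c" using F0[of a] slow_start[OF slow] False by simp
   ultimately show ?thesis using \<delta> by (simp add: F_def[of c] time_above_def ennreal_mult)
  qed
  finally show "emeasure (density lborel (%t. ennreal \<delta> * ind S t)) {a<..c} = ennreal (F c - F a)" .
 qed
 then have "(\<integral>\<^sup>+t\<in>{0..}. g t \<partial>interval_measure (refraction_time \<delta> b x f)) = (\<L> t. ennreal \<delta> * ind S t * (g t * ind {0..} t))"
  unfolding F by (simp add: nn_integral_density)
 also have "... = (\<L> t. ennreal \<delta> * (g t * ind S t))"
  by (intro nn_integral_cong) (auto simp: indicator_def S_def)
 also have "... = ennreal \<delta> * (\<L> t. g t * ind S t)" by (intro nn_integral_cmult) measurable
 finally show ?thesis by (simp add: S_def)
qed

end

lemma fmeasurable_Icc: "{a..c::real} \<in> fmeasurable lborel"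
 by (auto simp: fmeasurable_def emeasure_lborel_Icc_eq)

section \<open>Coincidence of a path with a drift line\<close>

text \<open>If a path meets a curve with slopes in \<open>[0, \<delta>]\<close> at \<open>t\<close>
  and at \<open>t + u\<close>, its increment lies in \<open>[0, \<delta> * u]\<close>. The test no
  longer mentions the curve, so one null set serves the uncountable family of all curves.\<close>

definition co :: "real => real => real => ennreal" where
 "co \<delta> u z = ind {0..} z * ind {0..} (\<delta> * u - z)"

definition co_time :: "real => (real => real) => nat => real => ennreal" where
 "co_time \<delta> f m h = (\<L> u. (\<L> t. co \<delta> u (f (max 0 (t + u)) - f (max 0 t)) * ind {0..real m} t)
  * ind {0..h} u)"

text \<open>For small \<open>u\<close> both \<open>K\<close> and its translate lie in a closed
  neighbourhood of \<open>K\<close> of measure below \<open>3/2\<close> times that of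
  \<open>K\<close>, so their intersection has at least half the measure of \<open>K\<close>.\<close>

lemma compact_shift_overlap:
 fixes K :: "real set"
 assumes K: "compact K" and pos: "0 < measure lborel K"
 shows "EX d>0. ALL u. 0 <= u --> u < d --> measure lborel K / 2 <= measure lborel {t\<in>K. t + u \<in> K}"
proof -
 define C where "C j = {x. infdist x K <= inverse (real (Suc j))}" for j :: nat
 have ne: "K ~= {}" using pos by auto
 have cl: "closed K" using K by (rule compact_imp_closed)
 have Kfm: "K \<in> fmeasurable lborel" using K emeasure_compact_finite[OF K] by (auto simp: fmeasurable_def borel_closed[OF cl])
 obtain B where B: "!!x. x \<in> K ==> \<bar>x\<bar> <= B" using K compact_imp_bounded bounded_real by metis
 have Ccl: "closed (C j)" for j unfolding C_def by (intro closed_Collect_le continuous_intros)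
 have Csub: "C j \<subseteq> {- (B + 1)..B + 1}" for j
 proof
  fix x assume "x \<in> C j"
  then have "infdist x K <= 1" using le_imp_inverse_le[of 1 "real (Suc j)"] by (simp add: C_def)
  moreover obtain k where "k \<in> K" "infdist x K = dist x k" using infdist_attains_inf[OF cl ne] by blast
  ultimately have "\<bar>x - k\<bar> <= 1" "\<bar>k\<bar> <= B" using B by (auto simp: dist_real_def)
  then show "x \<in> {- (B + 1)..B + 1}" by auto
 qed
 have Cfm: "C j \<in> fmeasurable lborel" for j
 proof (rule fmeasurableI2[OF _ Csub])
  show "{- (B + 1)..B + 1} \<in> fmeasurable lborel" by (rule fmeasurable_Icc)
  show "C j \<in> sets lborel" using borel_closed[OF Ccl] by simp
 qed
 have dec: "decseq C" unfolding C_def decseq_def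
  by (auto intro: order_trans le_imp_inverse_le)
 have "(\<Inter>j. C j) = K"
 proof
  show "(\<Inter>j. C j) \<subseteq> K"
  proof
   fix x assume "x \<in> (\<Inter>j. C j)"
   then have "infdist x K <= inverse (real (Suc j))" for j by (auto simp: C_def)
   then have "infdist x K <= 0" by (intro LIMSEQ_le_const[OF LIMSEQ_inverse_real_of_nat]) auto
   then show "x \<in> K" using in_closed_iff_infdist_zero[OF cl ne] infdist_nonneg[of x K] by auto
  qed
 qed (auto simp: C_def)
 moreover have "(%j. measure lborel (C j)) ----> measure lborel (\<Inter>j. C j)"
  using Cfm by (intro Lim_measure_decseq dec) (auto simp: fmeasurable_def less_top)
 ultimately have "(%j. measure lborel (C j)) ----> measure lborel K" by simp
 from order_tendstoD(2)[OF this, of "3/2 * measure lborel K"] pos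
 obtain j where j: "measure lborel (C j) < 3/2 * measure lborel K" by (auto simp: eventually_sequentially)
 show ?thesis
 proof (intro exI[of _ "inverse (real (Suc j))"] conjI allI impI)
  fix u :: real assume u: "0 <= u" "u < inverse (real (Suc j))"
  define Ku where "Ku = (%t. t + u) -` K"
  have Ku: "t \<in> Ku \<longleftrightarrow> t + u \<in> K" for t by (simp add: Ku_def)
  have Kub: "Ku \<in> sets borel" unfolding Ku_def using measurable_sets_borel[of "%t. t + u" borel K] borel_closed[OF cl] by simp
  have "emeasure lborel Ku = emeasure lborel K"
  proof -
   have "emeasure lborel K = emeasure (distr lborel borel ((+) u)) K" using lborel_distr_plus[of u] by simp
   also have "... = emeasure lborel ((+) u -` K)" using borel_closed[OF cl] by (subst emeasure_distr) auto
   also have "(+) u -` K = Ku" unfolding Ku_def vimage_def by (simp only: add.commute)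
   finally show ?thesis by simp
  qed
  then have mKu: "measure lborel Ku = measure lborel K" by (simp add: measure_def)
  have Kufm: "Ku \<in> fmeasurable lborel" using \<open>emeasure lborel Ku = emeasure lborel K\<close> Kfm Kub by (auto simp: fmeasurable_def)
  have "K \<union> Ku \<subseteq> C j"
  proof
   fix t assume "t \<in> K \<union> Ku"
   then have "t \<in> K \<or> t + u \<in> K" using Ku by auto
   then show "t \<in> C j"
   proof
    assume "t + u \<in> K"
    then have "infdist t K <= dist t (t + u)" by (rule infdist_le)
    then show "t \<in> C j" using u by (simp add: C_def dist_real_def)
   qed (simp add: C_def)
  qed
  then have "measure lborel (K \<union> Ku) <= measure lborel (C j)"
   using Kfm Kufm Cfm by (intro measure_mono_fmeasurable) (auto simp: fmeasurable_def)
  moreover have "measure lborel (K \<union> Ku) = measure lborel K + measure lborel Ku - measure lborel (K \<inter> Ku)"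
   by (rule measure_Un3[OF Kfm Kufm])
  moreover have "K \<inter> Ku = {t\<in>K. t + u \<in> K}" using Ku by auto
  ultimately show "measure lborel K / 2 <= measure lborel {t\<in>K. t + u \<in> K}" using j mKu by simp
 qed simp
qed

text \<open>A coincidence set of positive measure contains a compact set of positive measure. By the
  overlap with its translates, the set of pairs \<open>t\<close>, \<open>t + u\<close> in it has
  measure of order \<open>h\<close> when \<open>u\<close> runs through
  \<open>[0, h]\<close>.\<close>

lemma coincidence_time_lower:
 fixes f l :: "real => real"
 assumes right: "!!t. 0 <= t ==> (f \<longlongrightarrow> f t) (at_right t)" and \<delta>: "0 <= \<delta>"
  and l: "!!s t. 0 <= s ==> s <= t ==> 0 <= l t - l s & l t - l s <= \<delta> * (t - s)"
  and nn: "{t. 0 <= t & f t = l t} \<notin> null_sets lborel"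
 shows "EX m c d. 0 < c & 0 < d & (ALL h. 0 < h --> h < d --> ennreal (c * h) <= co_time \<delta> f m h)"
proof -
 define A where "A = {t. 0 <= t & f t = l t}"
 have fm: "(%t. f (max 0 t)) \<in> borel_measurable borel" by (rule right_measurable_from, rule right)
 have "slow \<delta> 0 (%t. l t - l 0)" using l by (simp add: slow_def)
 then have "(%t. l (max 0 t) - l 0) \<in> borel_measurable borel" by (intro right_measurable_from slow_right)
 then have "(%t. (l (max 0 t) - l 0) + l 0) \<in> borel_measurable borel" by measurable
 then have lm: "(%t. l (max 0 t)) \<in> borel_measurable borel" by simp
 have "A = {0..} \<inter> (%t. f (max 0 t) - l (max 0 t)) -` {0}" by (auto simp: A_def)
 moreover have "(%t. f (max 0 t) - l (max 0 t)) \<in> borel_measurable borel" using fm lm by measurable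
 from measurable_sets_borel[OF this, of "{0}"] have "(%t. f (max 0 t) - l (max 0 t)) -` {0} \<in> sets borel" by simp
 ultimately have A: "A \<in> sets borel" by auto
 have "EX m::nat. A \<inter> {0..real m} \<notin> null_sets lborel"
 proof (rule ccontr)
  assume "\<nexists>m::nat. A \<inter> {0..real m} \<notin> null_sets lborel"
  then have "(\<Union>m::nat. A \<inter> {0..real m}) \<in> null_sets lborel" by (intro null_sets_UN) auto
  moreover have "(\<Union>m::nat. A \<inter> {0..real m}) = A" using real_arch_simple by (fastforce simp: A_def)
  ultimately show False using nn by (simp add: A_def)
 qed
 then obtain m :: nat where m: "A \<inter> {0..real m} \<notin> null_sets lborel" by blast
 define B where "B = A \<inter> {0..real m}"
 have Bs: "B \<in> sets borel" using A by (auto simp: B_def)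
 have Bfm: "B \<in> fmeasurable lborel" by (rule fmeasurableI2[of "{0..real m}"]) (use Bs fmeasurable_Icc in \<open>auto simp: B_def\<close>)
 have "emeasure lborel B ~= 0" using m Bs by (auto simp: B_def null_sets_def)
 then have Bpos: "0 < measure lborel B" using emeasure_eq_measure2[OF Bfm] by (simp add: zero_less_measure_iff)
 obtain K where K: "closed K" "K \<subseteq> B" "emeasure lebesgue (B - K) < ennreal (measure lborel B)"
  by (rule sets_lebesgue_inner_closed[of B "measure lborel B"]) (use Bs Bpos in auto)
 have Kc: "compact K" unfolding compact_eq_bounded_closed using K by (auto intro: bounded_subset[of "{0..real m}"] simp: B_def)
 have Kb: "K \<in> sets borel" using K(1) by (rule borel_closed)
 have "measure lborel (B - K) = measure lborel B - measure lborel K"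
  by (rule measure_Diff) (use Bfm Kb Bs K(2) in \<open>auto simp: fmeasurable_def\<close>)
 moreover have "B - K \<in> fmeasurable lborel" by (rule fmeasurableI2[OF Bfm]) (use Kb Bs in auto)
 then have "measure lborel (B - K) < measure lborel B"
  using K(3) Bs Kb by (simp add: emeasure_eq_measure2 ennreal_less_iff)
 ultimately have Kpos: "0 < measure lborel K" by simp
 obtain d where d: "0 < d" "!!u. 0 <= u ==> u < d ==> measure lborel K / 2 <= measure lborel {t\<in>K. t + u \<in> K}"
  using compact_shift_overlap[OF Kc Kpos] by blast
 have "ennreal (measure lborel K / 2 * h) <= co_time \<delta> f m h" if h: "0 < h" "h < d" for h
 proof -
  have inner: "ennreal (measure lborel K / 2) <= (\<L> t. co \<delta> u (f (max 0 (t + u)) - f (max 0 t)) * ind {0..real m} t)" if u: "0 <= u" "u <= h" for u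
  proof -
   let ?D = "{t\<in>K. t + u \<in> K}"
   have "?D = K \<inter> (%t. t + u) -` K" by auto
   moreover have "(%t. t + u) -` K \<in> sets borel" using measurable_sets_borel[of "%t. t + u" borel K] Kb by simp
   ultimately have D: "?D \<in> sets borel" using Kb by auto
   have "ennreal (measure lborel K / 2) <= ennreal (measure lborel ?D)" using d(2)[of u] u h by (intro ennreal_leI) auto
   also have "... = emeasure lborel ?D"
    by (rule emeasure_eq_measure2[symmetric], rule fmeasurableI2[of K]) (use D emeasure_compact_finite[OF Kc] Kb in \<open>auto simp: fmeasurable_def\<close>)
   also have "... = (\<L> t. ind ?D t)" using D by simp
   also have "... <= (\<L> t. co \<delta> u (f (max 0 (t + u)) - f (max 0 t)) * ind {0..real m} t)"
   proof (rule nn_integral_mono)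
    fix t
    show "ind ?D t <= co \<delta> u (f (max 0 (t + u)) - f (max 0 t)) * ind {0..real m} t"
    proof (cases "t \<in> ?D")
     case True
     then have "t \<in> B" "t + u \<in> B" using K(2) by auto
     then have "0 <= t" "t <= real m" "f t = l t" "f (t + u) = l (t + u)" by (auto simp: A_def B_def)
     moreover have "ind ?D t = (1 :: ennreal)" using True by simp
     ultimately show ?thesis using l[of t "t + u"] u by (simp add: co_def)
    qed simp
   qed
   finally show ?thesis .
  qed
  have "ennreal (measure lborel K / 2 * h) = (\<L> u. ennreal (measure lborel K / 2) * ind {0..h} u)"
   using h ennreal_mult[of "measure lborel K / 2" h] by (simp add: nn_integral_cmult_indicator)
  also have "... <= co_time \<delta> f m h"
   unfolding co_time_def
  proof (rule nn_integral_mono)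
   fix u
   show "ennreal (measure lborel K / 2) * ind {0..h} u
    <= (\<L> t. co \<delta> u (f (max 0 (t + u)) - f (max 0 t)) * ind {0..real m} t) * ind {0..h} u"
    using inner[of u] by (cases "u \<in> {0..h}") simp_all
  qed
  finally show ?thesis .
 qed
 moreover have "0 < measure lborel K / 2" using Kpos by simp
 ultimately show ?thesis using d(1) by blast
qed

section \<open>Mean coincidence time of the process\<close>

locale rising_process = exp_process +
 fixes \<delta> :: real
 assumes \<delta>: "0 <= \<delta>" and above: "EX z>0. \<delta> * z < \<psi> z"
  and scale: "!!p. 0 < p ==> EX W. scale_process M X \<psi> p W"
  and stationary: "!!s u. 0 <= s ==> 0 <= u ==> distr M borel (%w. X (s + u) w - X s w) = distr M borel (X u)"
begin

definition "coprob u = (\<E> w. co \<delta> u (X (max 0 u) w))"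

lemma coprob_measurable [measurable]: "coprob \<in> borel_measurable borel"
 unfolding coprob_def[abs_def] co_def by measurable

text \<open>The coincidence event places \<open>X u\<close> in \<open>[0, a)\<close>, whose
  discounted occupation up to \<open>1 / p\<close> is bounded by \<open>S.dynkin_cv\<close> at the
  starting point \<open>0\<close>. There \<open>W\<close> grows at most like
  \<open>root p / p * exp (root p * x)\<close>, and the moment of
  \<open>exp (root p * X (1/p))\<close> is \<open>exp 1\<close>, which cancels the discount.\<close>

lemma coprob_resolvent:
 assumes p: "0 < p"
 shows "ennreal p * (\<L> u. coprob u * ind {0..1/p} u) <= ennreal (exp 1 * (\<delta> + 1) * (root p / p))"
proof -
 obtain W where "scale_process M X \<psi> p W" using scale[OF p] by blast
 then interpret S: scale_process M X \<psi> p W .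
 \<comment> \<open>The summand 1 makes \<open>\<delta> * u < a\<close> strict on the closed interval
   up to \<open>1 / p\<close>, as the half-open window requires.\<close>
 define a where "a = (\<delta> + 1) * (1/p)"
 define f :: "real => real" where "f = ind {0..<a}"
 let ?\<Phi> = "root p"
 have \<Phi>: "0 < ?\<Phi>" by (rule root_pos[OF p])
 have a: "0 < a" using \<delta> p by (simp add: a_def)
 have fm[measurable]: "f \<in> borel_measurable borel" unfolding f_def by measurable
 have fr: "(f \<longlongrightarrow> f x) (at_right x)" for x unfolding f_def by (rule S.indicator_Ico_right)
 have "occ p f (1/p) 0 <= S.cv f 0 + occ p f (1/p) 0" by simp
 also have "... = nexp (- p * (1/p)) * (\<E> w. S.cv f (0 + X (1/p) w))"
  by (rule S.dynkin_cv[OF fm _ _ _ fr, of 1 0, symmetric]) (use p in \<open>auto simp: f_def indicator_def\<close>)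
 also have "... = nexp (- 1) * (\<E> w. S.cv f (X (1/p) w))" using p by simp
 finally have o: "occ p f (1/p) 0 <= nexp (- 1) * (\<E> w. S.cv f (X (1/p) w))" .
 have "(\<E> w. S.cv f (X (1/p) w)) <= (\<E> w. ennreal (?\<Phi> / p * a) * nexp (?\<Phi> * X (1/p) w))"
 proof (rule nn_integral_mono)
  fix w
  have "S.cv f x <= ennreal (?\<Phi> / p * a) * nexp (?\<Phi> * x)" for x
  proof -
   have "S.cv f x <= (\<L> y. ennreal (?\<Phi> / p * exp (?\<Phi> * x)) * ind {0..a} y)"
    unfolding S.cv_def
   proof (rule nn_integral_mono)
    fix y
    have "W (x - y) <= ?\<Phi> / p * exp (?\<Phi> * x)" if "0 <= y"
    proof -
     have "W (x - y) = W (x - y) * exp (- ?\<Phi> * (x - y)) * exp (?\<Phi> * (x - y))" by (simp add: mult.assoc exp_add[symmetric])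
     also have "... <= ?\<Phi> / p * exp (?\<Phi> * (x - y))" by (intro mult_right_mono S.W_exp_le) simp
     also have "... <= ?\<Phi> / p * exp (?\<Phi> * x)" using \<Phi> p that by (intro mult_left_mono) auto
     finally show ?thesis .
    qed
    then show "ennreal (W (x - y) * f y) <= ennreal (?\<Phi> / p * exp (?\<Phi> * x)) * ind {0..a} y"
     by (auto simp: f_def indicator_def intro: ennreal_leI)
   qed
   also have "... = ennreal (?\<Phi> / p * exp (?\<Phi> * x)) * ennreal a" using a by (simp add: nn_integral_cmult_indicator)
   also have "... = ennreal (?\<Phi> / p * a) * nexp (?\<Phi> * x)" using \<Phi> p a by (simp add: ennreal_mult'[symmetric] field_simps)
   finally show ?thesis .
  qed
  then show "S.cv f (X (1/p) w) <= ennreal (?\<Phi> / p * a) * nexp (?\<Phi> * X (1/p) w)" .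
 qed
 also have "... = ennreal (?\<Phi> / p * a) * ennreal (exp 1)"
  using X_measurable[of "1/p"] nn_mgf[of "1/p" ?\<Phi>] \<psi>_root[OF p] p \<Phi> by (simp add: nn_integral_cmult)
 finally have "nexp (- 1) * (\<E> w. S.cv f (X (1/p) w)) <= nexp (- 1) * (ennreal (?\<Phi> / p * a) * ennreal (exp 1))"
  by (intro mult_left_mono) auto
 also have "... = ennreal (exp (- 1) * (?\<Phi> / p * a * exp 1))" using \<Phi> p a by (simp only: ennreal_mult' less_imp_le exp_ge_zero divide_nonneg_nonneg mult_nonneg_nonneg)
 also have "exp (- 1) * (?\<Phi> / p * a * exp 1) = ?\<Phi> / p * a" by (simp add: exp_minus)
 finally have occ: "occ p f (1/p) 0 <= ennreal (?\<Phi> / p * a)" using o by simp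
 have "(\<L> u. coprob u * ind {0..1/p} u) <= (\<L> u. ennreal (exp 1) * ((\<E> w. ennreal (exp (- p * u) * f (0 + X (max 0 u) w))) * ind {0..1/p} u))"
 proof (rule nn_integral_mono)
  fix u
  show "coprob u * ind {0..1/p} u <= ennreal (exp 1) * ((\<E> w. ennreal (exp (- p * u) * f (0 + X (max 0 u) w))) * ind {0..1/p} u)"
  proof (cases "u \<in> {0..1/p}")
   case True
   have "p * u <= 1" using True p by (simp add: field_simps)
   then have e: "1 <= exp 1 * exp (- p * u)" by (simp add: exp_add[symmetric])
   have "\<delta> * u <= \<delta> * (1/p)" using True \<delta> by (intro mult_left_mono) auto
   then have ua: "\<delta> * u < a" using p by (simp add: a_def field_simps)
   have "coprob u <= (\<E> w. ennreal (exp 1) * ennreal (exp (- p * u) * f (0 + X (max 0 u) w)))"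
    unfolding coprob_def
   proof (rule nn_integral_mono)
    fix w
    show "co \<delta> u (X (max 0 u) w) <= ennreal (exp 1) * ennreal (exp (- p * u) * f (0 + X (max 0 u) w))"
    proof (cases "0 <= X (max 0 u) w & X (max 0 u) w <= \<delta> * u")
     case True
     then have "f (X (max 0 u) w) = 1" using ua by (simp add: f_def)
     then show ?thesis using True e by (simp add: co_def ennreal_mult'[symmetric] ennreal_1[symmetric] ennreal_leI del: ennreal_1)
    qed (auto simp: co_def)
   qed
   also have "... = ennreal (exp 1) * (\<E> w. ennreal (exp (- p * u) * f (0 + X (max 0 u) w)))"
    using fm X_measurable[of "max 0 u"] by (intro nn_integral_cmult) auto
   finally show ?thesis using True by simp
  qed simp
 qed
 also have "... = ennreal (exp 1) * occ p f (1/p) 0" unfolding occ_def by (intro nn_integral_cmult) measurable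
 also have "... <= ennreal (exp 1) * ennreal (?\<Phi> / p * a)" by (intro mult_left_mono occ) simp
 finally have "ennreal p * (\<L> u. coprob u * ind {0..1/p} u) <= ennreal p * (ennreal (exp 1) * ennreal (?\<Phi> / p * a))"
  by (intro mult_left_mono) auto
 also have "... = ennreal (p * (exp 1 * (?\<Phi> / p * a)))"
  using \<Phi> p a by (simp only: ennreal_mult' less_imp_le exp_ge_zero divide_nonneg_nonneg mult_nonneg_nonneg)
 also have "p * (exp 1 * (?\<Phi> / p * a)) = exp 1 * (\<delta> + 1) * (?\<Phi> / p)" using p by (simp add: a_def)
 finally show ?thesis .
qed

text \<open>Since \<open>p / root p = \<psi> (root p) / root p\<close>, superlinear growth of \<psi>
  and monotonicity of \<open>\<psi> z / z\<close> make the ratio small.\<close>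

lemma root_ratio_small:
 assumes unb: "!!B. EX z>0. B * z <= \<psi> z" and e: "0 < e"
 shows "EX p0>0. ALL p>=p0. root p / p <= e"
proof -
 obtain z where z: "0 < z" "1 / e * z <= \<psi> z" using unb by blast
 have p0: "0 < \<psi> z" using z e by (meson divide_pos_pos less_le_trans mult_pos_pos zero_less_one)
 have "root p / p <= e" if p: "\<psi> z <= p" for p
 proof -
  have pp: "0 < p" using p p0 by simp
  have "z <= root p" using \<psi>_gt_root[OF pp, of z] p by (meson not_le)
  then have "\<psi> z / z <= \<psi> (root p) / root p" using \<psi>_ratio_mono z by blast
  moreover have "1 / e <= \<psi> z / z" using z by (simp add: pos_le_divide_eq)
  ultimately have "1 / e <= p / root p" using \<psi>_root[OF pp] by simp
  then show ?thesis using e root_pos[OF pp] pp by (simp add: field_simps)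
 qed
 then show ?thesis using p0 by blast
qed

text \<open>If \<open>\<psi>\<close> grows linearly with slope \<open>c\<close>, then \<open>X u / u\<close> tends to \<open>c > \<delta>\<close> in probability.\<close>
lemma coprob_small:
 assumes bd: "!!z. 0 < z ==> \<psi> z <= B * z" and e: "0 < e"
 shows "EX d>0. ALL u. 0 < u --> u < d --> coprob u <= ennreal e"
proof -
 define R where "R = (%z. \<psi> z / z) ` {0<..}"
 define c where "c = Sup R"
 have R: "bdd_above R" "R ~= {}" using bd by (auto simp: R_def field_simps intro!: bdd_aboveI[of _ B])
 have up: "\<psi> z / z <= c" if "0 < z" for z unfolding c_def by (rule cSup_upper[OF _ R(1)]) (use that in \<open>auto simp: R_def\<close>)
 obtain z1 where z1: "0 < z1" "\<delta> * z1 < \<psi> z1" using above by blast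
 then have "\<delta> < \<psi> z1 / z1" by (simp add: field_simps)
 then have c\<delta>: "\<delta> < c" using up[OF z1(1)] by simp
 have lim: "((%z. \<psi> z / z) \<longlongrightarrow> c) at_top"
 proof (rule tendstoI)
  fix r :: real assume r: "0 < r"
  have "c - r < Sup R" using r by (simp add: c_def)
  then obtain z0 where z0: "0 < z0" "c - r < \<psi> z0 / z0" using less_cSup_iff[OF R(2,1)] by (auto simp: R_def)
  show "\<forall>\<^sub>F z in at_top. dist (\<psi> z / z) c < r"
   using eventually_ge_at_top[of z0]
  proof eventually_elim
   case (elim z)
   then have "\<psi> z0 / z0 <= \<psi> z / z" using \<psi>_ratio_mono z0 by blast
   then show ?case using z0 up[of z] elim by (simp add: dist_real_def)
  qed
 qed
 have scaled: "((%u. u * \<psi> (k / u)) \<longlongrightarrow> k * c) (at_right 0)" if k: "0 < k" for k :: real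
 proof -
  have "filterlim (%u. k * inverse u) at_top (at_right (0::real))"
   using k by (intro filterlim_tendsto_pos_mult_at_top[OF tendsto_const] filterlim_inverse_at_top_right) auto
  then have "((%u. k * (\<psi> (k * inverse u) / (k * inverse u))) \<longlongrightarrow> k * c) (at_right 0)"
   by (intro tendsto_mult tendsto_const filterlim_compose[OF lim])
  then show ?thesis using k by (simp add: field_simps)
 qed
 \<comment> \<open>The mean square of \<open>exp (X u / u) - exp c\<close>, expanded. It tends to
   \<open>0\<close> because \<open>u * \<psi> (k / u)\<close> tends to \<open>k * c\<close>, while
   on the coincidence event the square is at least \<open>g\<close>; Chebyshev's inequality
   concludes.\<close>
 define v where "v u = exp (u * \<psi> (2 / u)) - 2 * exp c * exp (u * \<psi> (1 / u)) + (exp c)\<^sup>2" for u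
 define g where "g = (exp c - exp \<delta>)\<^sup>2"
 have g: "0 < g" using c\<delta> by (simp add: g_def)
 have "(v \<longlongrightarrow> exp (2 * c) - 2 * exp c * exp (1 * c) + (exp c)\<^sup>2) (at_right 0)"
  unfolding v_def[abs_def] by (intro tendsto_intros scaled) auto
 then have "(v \<longlongrightarrow> 0) (at_right 0)" by (simp add: exp_double power2_eq_square)
 from order_tendstoD(2)[OF this, of "e * g"] e g obtain d where d: "0 < d" "!!u. 0 < u ==> u < d ==> v u < e * g"
  unfolding eventually_at_right_field by auto
 have "coprob u <= ennreal e" if u: "0 < u" "u < d" for u
 proof -
  have [measurable]: "X u \<in> borel_measurable M" using u X_measurable by simp
  have i1: "integrable M (%w. exp (1/u * X u w))" "integrable M (%w. exp (2/u * X u w))" using mgf_integrable[of u "1/u"] mgf_integrable[of u "2/u"] u by auto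
  have sq: "(exp (1/u * X u w) - exp c)\<^sup>2 = exp (2/u * X u w) - 2 * exp c * exp (1/u * X u w) + (exp c)\<^sup>2" for w
   by (simp add: power2_diff power2_eq_square[of "exp (X u w / u)"] exp_add[symmetric])
  have int: "integrable M (%w. (exp (1/u * X u w) - exp c)\<^sup>2)" unfolding sq
   by (intro Bochner_Integration.integrable_add Bochner_Integration.integrable_diff integrable_mult_right i1) auto
  have "(LINT w|M. (exp (1/u * X u w) - exp c)\<^sup>2) = v u"
   unfolding sq v_def using i1 mgf[of u "1/u"] mgf[of u "2/u"] u by (simp add: prob_space)
  then have ev: "(\<E> w. ennreal ((exp (1/u * X u w) - exp c)\<^sup>2)) = ennreal (v u)"
   using nn_integral_eq_integral[OF int] by simp
  have "ennreal g * coprob u = (\<E> w. ennreal g * co \<delta> u (X u w))"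
   unfolding coprob_def using u by (subst nn_integral_cmult) (auto simp: co_def)
  also have "... <= (\<E> w. ennreal ((exp (1/u * X u w) - exp c)\<^sup>2))"
  proof (rule nn_integral_mono)
   fix w
   show "ennreal g * co \<delta> u (X u w) <= ennreal ((exp (1/u * X u w) - exp c)\<^sup>2)"
   proof (cases "X u w <= \<delta> * u")
    case True
    then have "exp (1/u * X u w) <= exp \<delta>" using u by (simp add: field_simps)
    then have "exp c - exp \<delta> <= exp c - exp (1/u * X u w)" by simp
    then have "g <= (exp c - exp (1/u * X u w))\<^sup>2" unfolding g_def using c\<delta> by (intro power_mono) auto
    then have "ennreal g <= ennreal ((exp (1/u * X u w) - exp c)\<^sup>2)" by (intro ennreal_leI) (simp add: power2_commute)
    then show ?thesis by (auto simp: co_def indicator_def)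
   qed (auto simp: co_def)
  qed
  also have "... <= ennreal (e * g)" unfolding ev using d(2)[OF u] by (intro ennreal_leI) simp
  finally have "ennreal g * coprob u <= ennreal g * ennreal e" using e g by (simp add: ennreal_mult' mult.commute)
  then show ?thesis using g by (subst (asm) ennreal_mult_le_mult_iff) auto
 qed
 then show ?thesis using d(1) by blast
qed

text \<open>Two regimes. If \<psi> grows at most linearly, \<open>coprob\<close> itself is small
  near \<open>0\<close>. Otherwise \<open>root p / p\<close> tends to \<open>0\<close> and the
  resolvent bound applies, with \<open>p = Suc n\<close> matching the length of the averaging
  interval.\<close>

lemma coprob_average:
 "(%n. ennreal (real (Suc n)) * (\<L> u. coprob u * ind {0..1 / real (Suc n)} u)) ----> 0"
 (is "?A ----> 0")
proof -
 have ev: "EV n. ?A n <= ennreal e" if e: "0 < e" for e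
 proof (cases "EX B. ALL s>0. \<psi> s <= B * s")
  case True
  then obtain B where "!!s. 0 < s ==> \<psi> s <= B * s" by blast
  from coprob_small[OF this e] obtain d where d: "0 < d" "!!u. 0 < u ==> u < d ==> coprob u <= ennreal e" by blast
  have "EV n. inverse (real (Suc n)) < d" using order_tendstoD(2)[OF LIMSEQ_inverse_real_of_nat d(1)] .
  then show ?thesis
  proof eventually_elim
   case (elim n)
   have "(\<L> u. coprob u * ind {0..1 / real (Suc n)} u) <= (\<L> u. ennreal e * ind {0..1 / real (Suc n)} u)"
   proof (rule nn_integral_mono_AE)
    show "AE u in lborel. coprob u * ind {0..1 / real (Suc n)} u <= ennreal e * ind {0..1 / real (Suc n)} u"
     using AE_lborel_singleton[of 0]
    proof eventually_elim
     case (elim u)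
     show ?case
     proof (cases "u \<in> {0..1 / real (Suc n)}")
      case True
      then have "0 < u" "u < d" using elim \<open>inverse (real (Suc n)) < d\<close> by (auto simp: divide_inverse)
      then show ?thesis using d(2)[of u] True by simp
     qed simp
    qed
   qed
   also have "... = ennreal e * ennreal (1 / real (Suc n))" by (simp add: nn_integral_cmult_indicator)
   finally have "?A n <= ennreal (real (Suc n)) * (ennreal e * ennreal (1 / real (Suc n)))" by (intro mult_left_mono) auto
   also have "... = ennreal (real (Suc n) * (e * (1 / real (Suc n))))" using e by (simp only: ennreal_mult' less_imp_le of_nat_0_le_iff)
   also have "real (Suc n) * (e * (1 / real (Suc n))) = e" by simp
   finally show ?case .
  qed
 next
  case False
  then have unb: "EX s>0. B * s <= \<psi> s" for B by (meson less_imp_le not_le)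
  have e': "0 < e / (exp 1 * (\<delta> + 1))" using e \<delta> by simp
  obtain p0 where p0: "0 < p0" "!!p. p0 <= p ==> root p / p <= e / (exp 1 * (\<delta> + 1))" using root_ratio_small[OF unb e'] by blast
  have "EV n. p0 <= real (Suc n)"
   using filterlim_compose[OF filterlim_real_sequentially filterlim_Suc] unfolding filterlim_at_top by blast
  then show ?thesis
  proof eventually_elim
   case (elim n)
   have "?A n <= ennreal (exp 1 * (\<delta> + 1) * (root (real (Suc n)) / real (Suc n)))" by (rule coprob_resolvent) simp
   also have "exp 1 * (\<delta> + 1) * (root (real (Suc n)) / real (Suc n)) <= exp 1 * (\<delta> + 1) * (e / (exp 1 * (\<delta> + 1)))"
    using p0(2)[OF elim] \<delta> by (intro mult_left_mono) auto
   then have "ennreal (exp 1 * (\<delta> + 1) * (root (real (Suc n)) / real (Suc n))) <= ennreal e"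
    using \<delta> by (intro ennreal_leI) simp
   finally show ?case .
  qed
 qed
 show ?thesis
 proof (rule order_tendstoI)
  fix a :: ennreal assume a: "0 < a"
  obtain z where z: "0 < z" "z < a" using dense[OF a] by blast
  then obtain e where e: "0 < e" "ennreal e < a" by (cases z) auto
  from ev[OF e(1)] show "EV n. ?A n < a" by eventually_elim (use e(2) in simp)
 qed auto
qed

lemma co_time_expectation:
 "(\<E> w. co_time \<delta> (%t. X t w) m h) = ennreal (real m) * (\<L> u. coprob u * ind {0..h} u)"
proof -
 interpret PL: pair_sigma_finite lborel M by standard
 have inner: "(\<E> w. co \<delta> u (X (max 0 (t + u)) w - X (max 0 t) w)) = coprob u" if "0 <= t" "0 <= u" for t u
 proof -
  have [measurable]: "X (t + u) \<in> borel_measurable M" "X t \<in> borel_measurable M" "X u \<in> borel_measurable M"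
   using X_measurable that by auto
  have "(\<E> w. co \<delta> u (X (t + u) w - X t w)) = (\<integral>\<^sup>+z. co \<delta> u z \<partial>distr M borel (%w. X (t + u) w - X t w))"
   unfolding co_def by (subst nn_integral_distr) auto
  also have "... = (\<E> w. co \<delta> u (X u w))"
   unfolding stationary[OF that] co_def by (subst nn_integral_distr) auto
  finally show ?thesis using that by (simp add: coprob_def)
 qed
 have "(\<E> w. co_time \<delta> (%t. X t w) m h) = (\<L> u. (\<E> w. (\<L> t. co \<delta> u (X (max 0 (t + u)) w - X (max 0 t) w) * ind {0..real m} t) * ind {0..h} u))"
  unfolding co_time_def co_def by (rule PL.Fubini') measurable
 also have "... = (\<L> u. ennreal (real m) * (coprob u * ind {0..h} u))"
 proof (rule nn_integral_cong)
  fix u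
  show "(\<E> w. (\<L> t. co \<delta> u (X (max 0 (t + u)) w - X (max 0 t) w) * ind {0..real m} t) * ind {0..h} u)
   = ennreal (real m) * (coprob u * ind {0..h} u)"
  proof (cases "u \<in> {0..h}")
   case True
   have "(\<E> w. (\<L> t. co \<delta> u (X (max 0 (t + u)) w - X (max 0 t) w) * ind {0..real m} t))
    = (\<L> t. (\<E> w. co \<delta> u (X (max 0 (t + u)) w - X (max 0 t) w) * ind {0..real m} t))"
    unfolding co_def by (rule PL.Fubini') measurable
   also have "... = (\<L> t. coprob u * ind {0..real m} t)"
   proof (rule nn_integral_cong)
    fix t
    show "(\<E> w. co \<delta> u (X (max 0 (t + u)) w - X (max 0 t) w) * ind {0..real m} t) = coprob u * ind {0..real m} t"
     using inner[of t u] True by (cases "t \<in> {0..real m}") auto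
   qed
   also have "... = coprob u * ennreal (real m)" by (simp add: nn_integral_cmult_indicator)
   finally show ?thesis using True by (simp add: mult.commute)
  qed simp
 qed
 also have "... = ennreal (real m) * (\<L> u. coprob u * ind {0..h} u)" by (intro nn_integral_cmult) measurable
 finally show ?thesis .
qed

lemma co_time_measurable: "(%w. co_time \<delta> (%t. X t w) m h) \<in> borel_measurable M"
 unfolding co_time_def co_def by measurable

text \<open>By Fatou's lemma the lower limit of the rescaled coincidence times is almost surely
  \<open>0\<close> for every horizon \<open>m\<close>, whereas any curve with a coincidence set of
  positive measure would keep it above some \<open>c > 0\<close>.\<close>

lemma AE_no_coincidence: "AE w in M. no_coincidence \<delta> (%t. X t w)"
proof -
 let ?J = "%m n w. ennreal (real (Suc n)) * co_time \<delta> (%t. X t w) m (1 / real (Suc n))"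
 have Jm[measurable]: "?J m n \<in> borel_measurable M" for m n using co_time_measurable by measurable
 have "AE w in M. liminf (%n. ?J m n w) = 0" for m :: nat
 proof -
  have E: "(\<E> w. ?J m n w) = ennreal (real m) * (ennreal (real (Suc n)) * (\<L> u. coprob u * ind {0..1 / real (Suc n)} u))" for n
   using co_time_measurable by (subst nn_integral_cmult) (simp_all only: co_time_expectation mult.left_commute)
  have "(%n. (\<E> w. ?J m n w)) ----> ennreal (real m) * 0"
   unfolding E by (intro ennreal_tendsto_cmult coprob_average) simp
  then have "liminf (%n. (\<E> w. ?J m n w)) = 0" by (intro lim_imp_Liminf) auto
  moreover have "(\<E> w. liminf (%n. ?J m n w)) <= liminf (%n. (\<E> w. ?J m n w))"
   by (rule nn_integral_liminf) (rule Jm)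
  ultimately have "(\<E> w. liminf (%n. ?J m n w)) = 0" by simp
  moreover have "(%w. liminf (%n. ?J m n w)) \<in> borel_measurable M" by (intro borel_measurable_liminf Jm)
  ultimately show ?thesis using nn_integral_0_iff_AE by blast
 qed
 then have "AE w in M. ALL m. liminf (%n. ?J m n w) = 0" by (simp add: AE_all_countable)
 then show ?thesis
 proof eventually_elim
  case (elim w)
  show ?case
   unfolding no_coincidence_def
  proof (intro allI impI, rule ccontr)
   fix l assume l: "ALL s t. 0 <= s --> s <= t --> 0 <= l t - l s & l t - l s <= \<delta> * (t - s)"
    and nn: "{t. 0 <= t & X t w = l t} \<notin> null_sets lborel"
   obtain m c d where mcd: "0 < c" "0 < d" "!!h. 0 < h ==> h < d ==> ennreal (c * h) <= co_time \<delta> (%t. X t w) m h"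
    using coincidence_time_lower[of "%t. X t w" \<delta> l, OF X_right \<delta> _ nn] l by blast
   have "EV n. inverse (real (Suc n)) < d" using order_tendstoD(2)[OF LIMSEQ_inverse_real_of_nat mcd(2)] .
   then have "EV n. ennreal c <= ?J m n w"
   proof eventually_elim
    case (elim n)
    have "ennreal c = ennreal (real (Suc n)) * ennreal (c * (1 / real (Suc n)))" 
     using mcd(1) by (subst ennreal_mult'[symmetric]) simp_all
    also have "... <= ?J m n w" by (intro mult_left_mono mcd(3)) (use elim in \<open>auto simp: divide_inverse\<close>)
    finally show ?case .
   qed
   then have "ennreal c <= liminf (%n. ?J m n w)" by (rule Liminf_bounded)
   then show False using elim mcd(1) by simp
  qed
 qed
qed

end

section \<open>Spectrally negative processes\<close>

definition lk :: "real => real => real" where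
 "lk z x = exp (z * x) - 1 - z * x * ind {-1<..} x"

text \<open>Second-order Taylor expansion for \<open>x > -1\<close>; for \<open>x \<le> -1\<close>
  the compensator is absent and the integrand lies in \<open>[-1, 0]\<close>. The signs are recorded
  because Fatou's lemma will need them.\<close>

lemma lk_bound:
 assumes "0 <= z" "x < 0"
 shows "lk z x <= z\<^sup>2 * min 1 (x\<^sup>2)" "- 1 <= lk z x" "- 1 < x ==> 0 <= lk z x" "x <= -1 ==> lk z x <= 0"
proof -
 have e: "exp (z * x) <= 1 + z * x + (z * x)\<^sup>2 / 2 * exp 0" if neg: "z * x < 0"
 proof -
  obtain t where t: "z * x < t" "t < 0" "exp (z * x) = (\<Sum>m<2. exp 0 / fact m * (z * x) ^ m) + exp t / fact 2 * (z * x) ^ 2"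
   using Maclaurin_minus[of "z * x" 2 "%_. exp" exp] neg by (auto intro!: derivative_eq_intros)
  have "exp t / fact 2 * (z * x) ^ 2 <= exp 0 / 2 * (z * x)\<^sup>2" using t(2) by (intro mult_right_mono) auto
  then show ?thesis using t(3) by (simp add: numeral_2_eq_2)
 qed
 have s: "z * x <= 0" using assms by (simp add: mult_nonneg_nonpos)
 have e1: "exp (z * x) <= 1" using s by simp
 show a: "- 1 < x ==> 0 <= lk z x" using exp_ge_add_one_self[of "z * x"] unfolding lk_def by (simp del: exp_ge_add_one_self)
 show b: "x <= -1 ==> lk z x <= 0" using e1 by (simp add: lk_def)
 show "- 1 <= lk z x" using a s by (cases "- 1 < x") (auto simp: lk_def)
 show "lk z x <= z\<^sup>2 * min 1 (x\<^sup>2)"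
 proof (cases "- 1 < x")
  case True
  then have "x\<^sup>2 <= 1" using assms by (simp add: abs_square_le_1)
  have "lk z x <= (z * x)\<^sup>2 / 2" using e s True by (cases "z * x = 0") (auto simp: lk_def)
  also have "... <= z\<^sup>2 * x\<^sup>2" by (simp add: power_mult_distrib)
  finally show ?thesis using \<open>x\<^sup>2 <= 1\<close> by simp
 next
  case False
  then have "lk z x <= 0" using b by simp
  also have "0 <= z\<^sup>2 * min 1 (x\<^sup>2)" by simp
  finally show ?thesis .
 qed
qed

lemma neg_levy_measure_integrable:
 assumes "neg_levy_measure \<nu>"
 shows "integrable \<nu> (%x. min 1 (x\<^sup>2))"
proof (rule integrableI_nonneg)
 have [measurable_cong]: "sets \<nu> = sets borel" using assms by (simp add: neg_levy_measure_def)
 show "(%x. min 1 (x\<^sup>2)) \<in> borel_measurable \<nu>" by measurable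
qed (use assms in \<open>auto simp: neg_levy_measure_def\<close>)

lemma levy_khintchine_quadratic:
 assumes \<nu>: "neg_levy_measure \<nu>"
 shows "EX C. ALL z>=0. levy_khintchine \<gamma> \<sigma> \<nu> z <= C * (1 + z\<^sup>2)"
proof -
 define K where "K = (LINT x|\<nu>. min 1 (x\<^sup>2))"
 have K: "0 <= K" unfolding K_def by (intro Bochner_Integration.integral_nonneg) auto
 have "levy_khintchine \<gamma> \<sigma> \<nu> z <= (\<bar>\<gamma>\<bar> + \<sigma>\<^sup>2 + K) * (1 + z\<^sup>2)" if z: "0 <= z" for z
 proof -
  have "(LINT x:{..<0}|\<nu>. lk z x) <= (LINT x|\<nu>. z\<^sup>2 * min 1 (x\<^sup>2))"
   unfolding set_lebesgue_integral_def
   by (rule integral_mono') (use neg_levy_measure_integrable[OF \<nu>] lk_bound(1)[OF z] in \<open>auto simp: indicator_def\<close>)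
  then have 1: "(LINT x:{..<0}|\<nu>. lk z x) <= K * z\<^sup>2" by (simp add: K_def mult.commute)
  have "z <= 1 + z\<^sup>2" using sum_squares_ge_zero[of "z - 1/2" 0] by (simp add: power2_eq_square algebra_simps)
  then have "\<bar>\<gamma>\<bar> * z <= \<bar>\<gamma>\<bar> * (1 + z\<^sup>2)" by (intro mult_left_mono) auto
  moreover have "\<gamma> * z <= \<bar>\<gamma>\<bar> * z" using z by (intro mult_right_mono) auto
  moreover have "\<sigma>\<^sup>2 / 2 * z\<^sup>2 <= \<sigma>\<^sup>2 * (1 + z\<^sup>2)" by (intro mult_mono) auto
  moreover have "K * z\<^sup>2 <= K * (1 + z\<^sup>2)" using K by (intro mult_left_mono) auto
  ultimately show ?thesis using 1 unfolding levy_khintchine_def lk_def distrib_right by linarith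
 qed
 then show ?thesis by blast
qed

text \<open>As \<open>z \<rightarrow> \<infinity>\<close>, \<open>lk z x / z\<close> tends to \<open>- x\<close> on \<open>(-1, 0)\<close>, so that Fatou's lemma bounds the drift.\<close>
lemma levy_khintchine_drift:
 assumes \<nu>: "neg_levy_measure \<nu>" and le: "!!z. 0 < z ==> levy_khintchine \<gamma> \<sigma> \<nu> z <= \<delta> * z"
 shows "\<gamma> - (LINT y:{-1<..<0}|\<nu>. y) <= \<delta>"
proof -
 have sets[measurable_cong]: "sets \<nu> = sets borel" using \<nu> by (simp add: neg_levy_measure_def)
 have im: "integrable \<nu> (%x. min 1 (x\<^sup>2))" by (rule neg_levy_measure_integrable[OF \<nu>])
 define K where "K = (LINT x|\<nu>. min 1 (x\<^sup>2))"
 have K: "0 <= K" unfolding K_def by (intro Bochner_Integration.integral_nonneg) auto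
 define g where "g n x = lk (real (Suc n)) x / real (Suc n) * ind {-1<..<0} x" for n x
 have g0: "0 <= g n x" for n x using lk_bound(3)[of "real (Suc n)" x] by (auto simp: g_def indicator_def)
 have gm[measurable]: "g n \<in> borel_measurable \<nu>" for n unfolding g_def lk_def by measurable
 have gi: "integrable \<nu> (g n)" for n
 proof (rule Bochner_Integration.integrable_bound[of _ "%x. real (Suc n) * min 1 (x\<^sup>2)"])
  show "integrable \<nu> (%x. real (Suc n) * min 1 (x\<^sup>2))" using im by simp
  have "g n x <= real (Suc n) * min 1 (x\<^sup>2)" for x
  proof (cases "x \<in> {-1<..<0}")
   case True
   then have "lk (real (Suc n)) x / real (Suc n) <= (real (Suc n))\<^sup>2 * min 1 (x\<^sup>2) / real (Suc n)"
    by (intro divide_right_mono lk_bound(1)) auto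
   then show ?thesis using True by (simp add: g_def power2_eq_square)
  qed (simp add: g_def)
  then show "AE x in \<nu>. norm (g n x) <= norm (real (Suc n) * min 1 (x\<^sup>2))" using g0 by simp
 qed (rule gm)
 have gle: "(LINT x|\<nu>. g n x) <= \<delta> - \<gamma> + K * inverse (real (Suc n))" for n
 proof -
  let ?z = "real (Suc n)"
  have bd: "\<bar>lk ?z x * ind {..<0} x\<bar> <= (?z\<^sup>2 + 1) * min 1 (x\<^sup>2)" for x
  proof (cases "x < 0")
   case True
   have "- (min 1 (x\<^sup>2)) <= lk ?z x"
   proof (cases "- 1 < x")
    case True
    then show ?thesis using lk_bound(3)[OF _ \<open>x < 0\<close>, of ?z] by (smt (verit) min_def of_nat_0_le_iff zero_le_power2)
   next
    case False
    then have "1 <= x\<^sup>2" using power_mono[of 1 "- x" 2] by simp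
    then show ?thesis using lk_bound(2)[OF _ True, of ?z] by simp
   qed
   moreover have "0 <= min 1 (x\<^sup>2)" "0 <= ?z\<^sup>2 * min 1 (x\<^sup>2)" by auto
   moreover have "lk ?z x <= ?z\<^sup>2 * min 1 (x\<^sup>2)" by (rule lk_bound(1)) (use True in auto)
   ultimately have "\<bar>lk ?z x\<bar> <= ?z\<^sup>2 * min 1 (x\<^sup>2) + min 1 (x\<^sup>2)" by linarith
   then show ?thesis using True unfolding distrib_right by (simp del: of_nat_Suc)
  qed simp
  have li: "integrable \<nu> (%x. lk ?z x * ind {..<0} x)"
   by (rule Bochner_Integration.integrable_bound[of _ "%x. (?z\<^sup>2 + 1) * min 1 (x\<^sup>2)"])
    (use im bd in \<open>auto simp: lk_def abs_mult\<close>)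
  \<comment> \<open>On \<open>x \<le> -1\<close> the integrand \<open>lk\<close> is at least
    \<open>-1\<close> and \<open>min 1 (x\<^sup>2)\<close> is 1, so adding the latter makes the sum
    nonnegative there. The price \<open>K / z\<close> vanishes in the limit.\<close>
  have "(LINT x|\<nu>. g n x) <= (LINT x|\<nu>. inverse ?z * (lk ?z x * ind {..<0} x + min 1 (x\<^sup>2)))"
  proof (rule integral_mono)
   show "integrable \<nu> (%x. inverse ?z * (lk ?z x * ind {..<0} x + min 1 (x\<^sup>2)))" using li im by simp
   fix x
   have "?z * g n x <= lk ?z x * ind {..<0} x + min 1 (x\<^sup>2)"
   proof (cases "x \<in> {-1<..<0}")
    case False
    then have g: "g n x = 0" by (simp add: g_def)
    show ?thesis
    proof (cases "x < 0")
     case True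
     then have "1 <= x\<^sup>2" using False power_mono[of 1 "- x" 2] by auto
     then show ?thesis using lk_bound(2)[OF _ True, of ?z] g True by simp
    qed (simp add: g)
   qed (simp add: g_def)
   then show "g n x <= inverse ?z * (lk ?z x * ind {..<0} x + min 1 (x\<^sup>2))" by (simp add: field_simps)
  qed (rule gi)
  also have "... = inverse ?z * ((LINT x:{..<0}|\<nu>. lk ?z x) + K)"
   using li im by (simp add: K_def set_lebesgue_integral_def mult.commute)
  also have "(LINT x:{..<0}|\<nu>. lk ?z x) <= \<delta> * ?z - \<gamma> * ?z - \<sigma>\<^sup>2 / 2 * ?z\<^sup>2"
   using le[of ?z] by (simp add: levy_khintchine_def lk_def[abs_def])
  then have "(LINT x:{..<0}|\<nu>. lk ?z x) <= \<delta> * ?z - \<gamma> * ?z" using zero_le_power2[of \<sigma>] zero_le_power2[of ?z] by (smt (verit) divide_nonneg_nonneg mult_nonneg_nonneg)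
  then have "inverse ?z * ((LINT x:{..<0}|\<nu>. lk ?z x) + K) <= inverse ?z * (\<delta> * ?z - \<gamma> * ?z + K)"
   by (intro mult_left_mono) auto
  also have "... = \<delta> - \<gamma> + K * inverse ?z" by (simp add: field_simps)
  finally show ?thesis .
 qed
 have lim: "(%n. g n x) ----> - x * ind {-1<..<0} x" for x
 proof (cases "x \<in> {-1<..<0}")
  case True
  have "(%n. (exp (real (Suc n) * x) - 1) * inverse (real (Suc n))) ----> 0"
  proof (rule Lim_null_comparison[OF always_eventually LIMSEQ_inverse_real_of_nat], rule allI)
   fix n
   have "real (Suc n) * x <= 0" using True by (intro mult_nonneg_nonpos) auto
   then have "exp (real (Suc n) * x) <= 1" by simp
   then have "\<bar>exp (real (Suc n) * x) - 1\<bar> <= 1" using exp_gt_zero[of "real (Suc n) * x"] by linarith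
   then have "\<bar>exp (real (Suc n) * x) - 1\<bar> * inverse (real (Suc n)) <= 1 * inverse (real (Suc n))" by (intro mult_right_mono) auto
   then show "norm ((exp (real (Suc n) * x) - 1) * inverse (real (Suc n))) <= inverse (real (Suc n))"
    by (simp add: abs_mult)
  qed
  from tendsto_diff[OF this tendsto_const[of x]]
  have "(%n. (exp (real (Suc n) * x) - 1) * inverse (real (Suc n)) - x) ----> 0 - x" .
  moreover have "(exp (real (Suc n) * x) - 1) * inverse (real (Suc n)) - x = g n x" for n
   using True by (simp add: g_def lk_def field_simps)
  ultimately show ?thesis using True by simp
 qed (simp add: g_def)
 have "(\<integral>\<^sup>+x. ennreal (- x * ind {-1<..<0} x) \<partial>\<nu>) = (\<integral>\<^sup>+x. liminf (%n. ennreal (g n x)) \<partial>\<nu>)"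
  by (intro nn_integral_cong lim_imp_Liminf[symmetric] tendsto_ennrealI lim) auto
 also have "... <= liminf (%n. \<integral>\<^sup>+x. ennreal (g n x) \<partial>\<nu>)" by (intro nn_integral_liminf) measurable
 also have "... <= liminf (%n. ennreal (\<delta> - \<gamma> + K * inverse (real (Suc n))))"
  using gle nn_integral_eq_integral[OF gi] g0 by (intro Liminf_mono always_eventually allI) (auto intro: ennreal_leI)
 also have "... = ennreal (\<delta> - \<gamma> + K * 0)"
  by (intro lim_imp_Liminf tendsto_ennrealI tendsto_intros LIMSEQ_inverse_real_of_nat) auto
 finally have nn: "(\<integral>\<^sup>+x. ennreal (- x * ind {-1<..<0} x) \<partial>\<nu>) <= ennreal (\<delta> - \<gamma>)" by simp
 have "(LINT x|\<nu>. g n x) >= 0" for n using g0 by (intro Bochner_Integration.integral_nonneg) auto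
 then have "0 <= \<delta> - \<gamma> + K * inverse (real (Suc n))" for n using gle order_trans by blast
 moreover have "(%n. \<delta> - \<gamma> + K * inverse (real (Suc n))) ----> \<delta> - \<gamma> + K * 0"
  by (intro tendsto_intros LIMSEQ_inverse_real_of_nat)
 ultimately have pos: "0 <= \<delta> - \<gamma>" by (intro LIMSEQ_le_const[where X = "%n. \<delta> - \<gamma> + K * inverse (real (Suc n))"]) auto
 have "(LINT x|\<nu>. - x * ind {-1<..<0} x) <= \<delta> - \<gamma>"
 proof -
  have "(LINT x|\<nu>. - x * ind {-1<..<0} x) = enn2real (\<integral>\<^sup>+x. ennreal (- x * ind {-1<..<0} x) \<partial>\<nu>)"
   by (rule integral_eq_nn_integral) (auto simp: indicator_def)
  also have "... <= enn2real (ennreal (\<delta> - \<gamma>))" by (rule enn2real_mono[OF nn]) simp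
  finally show ?thesis using pos by simp
 qed
 moreover have "(LINT x|\<nu>. - x * ind {-1<..<0} x) = - (LINT y:{-1<..<0}|\<nu>. y)"
  by (simp add: set_lebesgue_integral_def mult.commute)
 ultimately show ?thesis by simp
qed

section \<open>Regular modifications and exponential moments of the Levy process\<close>

locale nice_levy = levy_process +
 assumes zero: "!!w. X 0 w = 0" and cadlag: "!!w. cadlag (%t. X t w)" and npj: "!!w. no_positive_jumps (%t. X t w)"

lemma (in prob_space) indep_vars_cong_AE:
 fixes A B :: "'i => 'a => real"
 assumes A: "indep_vars (%_. borel) A I" and eq: "!!i. i \<in> I ==> AE w in M. A i w = B i w"
  and B: "!!i. i \<in> I ==> random_variable borel (B i)" and I: "finite I"
 shows "indep_vars (%_. borel) B I"
proof (cases "I = {}")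
 case True
 then show ?thesis by (simp add: indep_vars_def indep_sets_def)
next
 case False
 have A': "random_variable borel (A i)" if "i \<in> I" for i using A that by (simp add: indep_vars_def2)
 have "AE w in M. \<forall>i\<in>I. A i w = B i w" using I eq by (simp add: AE_finite_all)
 then have "AE w in M. (\<lambda>i\<in>I. A i w) = (\<lambda>i\<in>I. B i w)" by eventually_elim auto
 then have "distr M (Pi\<^sub>M I (%_. borel)) (%w. \<lambda>i\<in>I. A i w) = distr M (Pi\<^sub>M I (%_. borel)) (%w. \<lambda>i\<in>I. B i w)"
  using A' B by (intro distr_cong_AE measurable_restrict) auto
 moreover have "Pi\<^sub>M I (%i. distr M borel (A i)) = Pi\<^sub>M I (%i. distr M borel (B i))"
  using A' B eq by (intro PiM_cong refl distr_cong_AE) auto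
 ultimately show ?thesis
  using A indep_vars_iff_distr_eq_PiM'[OF False, of A "%_. borel"] indep_vars_iff_distr_eq_PiM'[OF False, of B "%_. borel"] A' B by simp
qed

text \<open>On the exceptional null set the path is replaced by \<open>0\<close>, which is itself
  regular and free of jumps. Regularity of every path is what the joint measurability lemma asks
  for.\<close>

lemma spectrally_negative_modification:
 assumes "spectrally_negative_levy_process M X"
 obtains X' where "nice_levy M X'" "AE w in M. ALL t. X' t w = X t w"
proof -
 interpret L: spectrally_negative_levy_process M X by fact
 have "AE w in M. X 0 w = 0 & cadlag (%t. X t w) & no_positive_jumps (%t. X t w)"
  using L.starts_at_zero L.cadlag_paths L.no_positive_jumps by eventually_elim auto
 then obtain N where N: "N \<in> null_sets M"
  "!!w. w \<in> space M - N ==> X 0 w = 0 & cadlag (%t. X t w) & no_positive_jumps (%t. X t w)"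
  by (rule AE_E3) auto
 define X' where "X' t w = (if w \<in> space M - N then X t w else 0)" for t w
 have "AE w in M. w \<notin> N" using N(1) by (rule AE_not_in)
 then have eq: "AE w in M. ALL t. X' t w = X t w" using AE_space by eventually_elim (simp add: X'_def)
 have m: "X' t \<in> borel_measurable M" if "0 <= t" for t
  unfolding X'_def using N(1) L.measurable_process[OF that] by (intro measurable_If_set) auto
 have good: "X' 0 w = 0 & cadlag (%t. X' t w) & no_positive_jumps (%t. X' t w)" for w
 proof (cases "w \<in> space M - N")
  case True
  then show ?thesis using N(2)[of w] by (simp add: X'_def)
 next
  case False
  have "0 <= l" if "((%_. 0 :: real) \<longlongrightarrow> l) (at_left t)" for l t :: real
   using that tendsto_unique[OF _ that tendsto_const[of 0]] by simp
  then show ?thesis using False by (auto simp: X'_def cadlag_def no_positive_jumps_def intro!: exI[of _ 0])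
 qed
 have "nice_levy M X'"
 proof
  show "AE w in M. X' 0 w = 0" "AE w in M. cadlag (%t. X' t w)" using good by auto
  fix t :: "nat => real" and n assume t: "mono t" "0 <= t 0"
  have t0: "0 <= t i" for i using t monoD[OF t(1), of 0 i] by simp
  show "L.indep_vars (%_. borel) (%i w. X' (t (Suc i)) w - X' (t i) w) {..<n}"
  proof (rule L.indep_vars_cong_AE[OF L.independent_increments[OF t]])
   fix i
   show "AE w in M. X (t (Suc i)) w - X (t i) w = X' (t (Suc i)) w - X' (t i) w" using eq by eventually_elim simp
   show "(%w. X' (t (Suc i)) w - X' (t i) w) \<in> borel_measurable M" using m t0 by (intro borel_measurable_diff) auto
  qed simp
 next
  fix s t :: real assume st: "0 <= s" "s <= t"
  have "distr M borel (%w. X' t w - X' s w) = distr M borel (%w. X t w - X s w)"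
   using eq m L.measurable_process st by (intro distr_cong_AE) (auto elim: eventually_mono)
  moreover have "distr M borel (X' (t - s)) = distr M borel (X (t - s))"
   using eq m L.measurable_process st by (intro distr_cong_AE) (auto elim: eventually_mono)
  ultimately show "distr M borel (%w. X' t w - X' s w) = distr M borel (X' (t - s))"
   using L.stationary_increments[OF st] by simp
 qed (use m good in auto)
 then show ?thesis using eq that by blast
qed

context nice_levy
begin

lemma right: "0 <= t ==> ((%s. X s w) \<longlongrightarrow> X t w) (at_right t)"
 using cadlag_right[OF cadlag] .

definition "nnm z t = (\<E> w. nexp (z * X t w))"

lemma nnm_increment:
 assumes "0 <= s" "s <= t"
 shows "(\<E> w. nexp (y * (X t w - X s w))) = nnm y (t - s)"
proof -
 have [measurable]: "X t \<in> borel_measurable M" "X s \<in> borel_measurable M" "X (t - s) \<in> borel_measurable M"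
  using assms measurable_process by auto
 have "(\<E> w. nexp (y * (X t w - X s w))) = (\<integral>\<^sup>+z. nexp (y * z) \<partial>distr M borel (%w. X t w - X s w))"
  by (subst nn_integral_distr) auto
 also have "... = nnm y (t - s)"
  unfolding stationary_increments[OF assms] nnm_def by (subst nn_integral_distr) auto
 finally show ?thesis .
qed

lemma nnm_add:
 assumes "0 <= s" "0 <= t"
 shows "nnm y (s + t) = nnm y s * nnm y t"
proof -
 define r where "r i = (if i = 0 then 0 else if i = 1 then s else s + t)" for i :: nat
 have "mono r" using assms by (auto simp: mono_def r_def)
 from independent_increments[OF this, of 2]
 have "indep_vars (%_. borel) (%i w. X (r (Suc i)) w - X (r i) w) {..<2}" by (simp add: r_def)
 from indep_vars_compose2[OF this, of "%_ z. nexp (y * z)" "%_. borel"]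
 have "indep_vars (%_. borel) (%i w. nexp (y * (X (r (Suc i)) w - X (r i) w))) {..<2}" by simp
 from indep_vars_nn_integral[OF _ this]
 have "(\<E> w. (\<Prod>i<2. nexp (y * (X (r (Suc i)) w - X (r i) w))))
   = (\<Prod>i<2. (\<E> w. nexp (y * (X (r (Suc i)) w - X (r i) w))))" by simp
 then have "(\<E> w. nexp (y * X s w) * nexp (y * (X (s + t) w - X s w)))
   = nnm y s * (\<E> w. nexp (y * (X (s + t) w - X s w)))"
  by (simp add: numeral_2_eq_2 r_def zero nnm_def)
 moreover have "nexp (y * X s w) * nexp (y * (X (s + t) w - X s w)) = nexp (y * X (s + t) w)" for w
  by (simp add: ennreal_mult'[symmetric] exp_add[symmetric] right_diff_distrib)
 ultimately show ?thesis using nnm_increment[of s "s + t"] assms by (simp add: nnm_def)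
qed

lemma right_grid:
 fixes t :: real
 assumes "0 <= t"
 obtains k :: "nat => nat" where "!!n. t < real (k n) / real (Suc n)" "(%n. real (k n) / real (Suc n)) ----> t"
proof -
 define k where "k n = nat \<lfloor>t * real (Suc n)\<rfloor> + 1" for n
 have k: "t < real (k n) / real (Suc n)" "real (k n) / real (Suc n) <= t + inverse (real (Suc n))" for n
 proof -
  have "0 <= t * real (Suc n)" using assms by simp
  then have "t * real (Suc n) < real (k n)" "real (k n) <= (t + inverse (real (Suc n))) * real (Suc n)"
   unfolding k_def distrib_right by (simp_all del: of_nat_Suc; linarith)+
  then show "t < real (k n) / real (Suc n)" "real (k n) / real (Suc n) <= t + inverse (real (Suc n))"
   by (simp_all only: pos_less_divide_eq pos_divide_le_eq of_nat_0_less_iff zero_less_Suc)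
 qed
 have up: "(%n. t + inverse (real (Suc n))) ----> t"
  using tendsto_add[OF tendsto_const[of t] LIMSEQ_inverse_real_of_nat] by simp
 have "(%n. real (k n) / real (Suc n)) ----> t"
  by (rule tendsto_sandwich[OF _ _ tendsto_const up]; rule always_eventually, rule allI, rule k less_imp_le[OF k(1)])
 then show ?thesis using k(1) that by blast
qed

text \<open>Multiplicativity settles rational times. Fatou's lemma along rationals decreasing to
  \<open>t\<close> gives only one inequality, since no dominating function is available.\<close>

lemma nnm_eq:
 assumes int: "integrable M (%w. exp (z * X 1 w))" and t: "0 <= t"
 shows "nnm z t = nexp (t * laplace_exponent M X z)"
proof -
 let ?\<psi> = "laplace_exponent M X z"
 have "0 < (\<integral>w. exp (z * X 1 w) \<partial>M)"
 proof -
  have "0 <= (\<integral>w. exp (z * X 1 w) \<partial>M)" by (intro Bochner_Integration.integral_nonneg) simp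
  moreover have "(\<integral>w. exp (z * X 1 w) \<partial>M) ~= 0"
  proof
   assume "(\<integral>w. exp (z * X 1 w) \<partial>M) = 0"
   then have "AE w in M. exp (z * X 1 w) = 0" using integral_nonneg_eq_0_iff_AE[OF int] by simp
   then show False using AE_False by simp
  qed
  ultimately show ?thesis by linarith
 qed
 then have one: "nnm z 1 = ennreal (exp ?\<psi>)"
  unfolding nnm_def laplace_exponent_def using nn_integral_eq_integral[OF int] by simp
 have mult: "nnm z (real k * h) = nnm z h ^ k" if "0 <= h" for k h
 proof (induction k)
  case 0
  then show ?case by (simp add: nnm_def zero emeasure_space_1)
 next
  case (Suc k)
  have "nnm z (real (Suc k) * h) = nnm z (h + real k * h)" by (simp add: algebra_simps)
  then show ?case using nnm_add[of h "real k * h"] that Suc.IH by simp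
 qed
 have grid: "nnm z (real k / real (Suc n)) = nexp (real k / real (Suc n) * ?\<psi>)" for k n
 proof -
  have pw: "nnm z (1 / real (Suc n)) ^ Suc n = ennreal (exp ?\<psi>)" using mult[of "1 / real (Suc n)" "Suc n"] one by simp
  then obtain r where r: "0 <= r" "nnm z (1 / real (Suc n)) = ennreal r"
   by (cases "nnm z (1 / real (Suc n))") (auto simp: ennreal_top_mult ennreal_mult_top power_eq_top_ennreal)
  have "ennreal (r ^ Suc n) = ennreal (exp ?\<psi>)" using pw unfolding r(2) by (simp only: ennreal_power[OF r(1)])
  then have "r ^ Suc n = exp ?\<psi>" using r(1) by (subst (asm) ennreal_inj) auto
  also have "... = exp (?\<psi> / real (Suc n)) ^ Suc n" by (simp add: exp_of_nat_mult[symmetric] del: of_nat_Suc power_Suc)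
  finally have "r = exp (?\<psi> / real (Suc n))" by (rule power_inject_base) (use r in auto)
  then show ?thesis using mult[of "1 / real (Suc n)" k] r by (simp add: ennreal_power exp_of_nat_mult[symmetric])
 qed
 have le: "nnm z u <= nexp (u * ?\<psi>)" if u: "0 <= u" "!!n. u < v n" "v ----> u" "!!n. nnm z (v n) = nexp (v n * ?\<psi>)" for u v
 proof -
  have v: "filterlim v (at_right u) sequentially" using u by (intro filterlim_at_withinI) (auto simp: eventually_sequentially less_imp_neq[THEN not_sym])
  have vm: "X (v n) \<in> borel_measurable M" for n using u(1) u(2)[of n] by (intro measurable_process) simp
  have "nnm z u = (\<E> w. liminf (%n. nexp (z * X (v n) w)))"
   unfolding nnm_def
   by (intro nn_integral_cong lim_imp_Liminf[symmetric] tendsto_ennrealI tendsto_intros filterlim_compose[OF right v] u) auto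
  also have "... <= liminf (%n. nnm z (v n))"
   unfolding nnm_def using vm by (intro nn_integral_liminf) measurable
  also have "... = nexp (u * ?\<psi>)"
   unfolding u(4) by (intro lim_imp_Liminf tendsto_ennrealI tendsto_intros u) auto
  finally show ?thesis .
 qed
 show ?thesis
 proof (rule antisym)
  obtain k where k: "!!n. t < real (k n) / real (Suc n)" "(%n. real (k n) / real (Suc n)) ----> t"
   by (rule right_grid[OF t]) blast
  show "nnm z t <= nexp (t * ?\<psi>)" by (rule le[OF t k grid])
  \<comment> \<open>The complement of \<open>t\<close> in the integer \<open>k 0\<close>: the
    product of the moments at \<open>t\<close> and \<open>s\<close> is known exactly and the one at
    \<open>s\<close> is bounded above, so the one at \<open>t\<close> is bounded below.\<close>
  define s where "s = real (k 0) - t"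
  have s: "0 <= s" using k(1)[of 0] by (simp add: s_def)
  obtain k' where k': "!!n. s < real (k' n) / real (Suc n)" "(%n. real (k' n) / real (Suc n)) ----> s"
   by (rule right_grid[OF s]) blast
  have "nnm z s <= nexp (s * ?\<psi>)" by (rule le[OF s k' grid])
  then have "nnm z t * nnm z s <= nnm z t * nexp (s * ?\<psi>)" by (intro mult_left_mono) auto
  moreover have "nnm z t * nnm z s = nexp (t * ?\<psi>) * nexp (s * ?\<psi>)"
   using nnm_add[OF t s, of z] grid[of "k 0" 0]
   by (simp add: s_def ennreal_mult'[symmetric] exp_add[symmetric] algebra_simps)
  ultimately have "nexp (s * ?\<psi>) * nexp (t * ?\<psi>) <= nexp (s * ?\<psi>) * nnm z t" by (simp add: mult.commute)
  then show "nexp (t * ?\<psi>) <= nnm z t" by (subst (asm) ennreal_mult_le_mult_iff) auto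
 qed
qed

lemma mgf_all:
 assumes int: "integrable M (%w. exp (z * X 1 w))" and t: "0 <= t"
 shows "integrable M (%w. exp (z * X t w))" "(LINT w|M. exp (z * X t w)) = exp (t * laplace_exponent M X z)"
proof -
 have [measurable]: "X t \<in> borel_measurable M" by (rule measurable_process[OF t])
 have n: "(\<E> w. nexp (z * X t w)) = nexp (t * laplace_exponent M X z)"
  using nnm_eq[OF assms] by (simp add: nnm_def)
 then show i: "integrable M (%w. exp (z * X t w))" by (intro integrableI_nonneg) auto
 show "(LINT w|M. exp (z * X t w)) = exp (t * laplace_exponent M X z)"
  using n by (simp add: integral_eq_nn_integral)
qed

text \<open>Chernoff's bound with arbitrarily large exponent: as \<open>exp (z * D)\<close> has mean
  at most 1 for all \<open>z > 0\<close>, the probability of \<open>D \<ge> c\<close> is at most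
  \<open>exp (- z * c)\<close> for all \<open>z\<close>.\<close>

lemma increment_bound:
 assumes int: "!!z. 0 < z ==> integrable M (%w. exp (z * X 1 w))"
  and le: "!!z. 0 < z ==> laplace_exponent M X z <= \<delta> * z" and st: "0 <= s" "s <= t"
 shows "AE w in M. X t w - X s w <= \<delta> * (t - s)"
proof -
 have [measurable]: "X t \<in> borel_measurable M" "X s \<in> borel_measurable M" using measurable_process st by auto
 define D where "D w = X t w - X s w - \<delta> * (t - s)" for w
 have [measurable]: "D \<in> borel_measurable M" unfolding D_def by measurable
 have exp_le: "(\<E> w. nexp (z * D w)) <= 1" if z: "0 < z" for z
 proof -
  have "exp (z * D w) = exp (z * (X t w - X s w)) * exp (- (z * \<delta> * (t - s)))" for w
   by (simp add: D_def exp_add[symmetric] algebra_simps)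
  then have "(\<E> w. nexp (z * D w)) = (\<E> w. nexp (z * (X t w - X s w))) * nexp (- (z * \<delta> * (t - s)))"
   by (simp add: ennreal_mult nn_integral_multc)
  also have "... = ennreal (exp ((t - s) * laplace_exponent M X z) * exp (- (z * \<delta> * (t - s))))"
   using nnm_increment[OF st, of z] nnm_eq[OF int[OF z], of "t - s"] st by (simp add: ennreal_mult)
  also have "... <= ennreal 1"
  proof (rule ennreal_leI)
   have "(t - s) * laplace_exponent M X z <= (t - s) * (\<delta> * z)" using le[OF z] st by (intro mult_left_mono) auto
   then show "exp ((t - s) * laplace_exponent M X z) * exp (- (z * \<delta> * (t - s))) <= 1"
    by (simp add: exp_add[symmetric] algebra_simps)
  qed
  finally show ?thesis by simp
 qed
 have "AE w in M. D w < inverse (real (Suc k))" for k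
 proof -
  let ?c = "inverse (real (Suc k))" and ?B = "{w\<in>space M. inverse (real (Suc k)) <= D w}"
  have "prob ?B <= exp (- ?c) ^ Suc n" for n
  proof -
   have "ennreal (prob ?B) * nexp (real (Suc n) * ?c) = (\<E> w. ind ?B w * nexp (real (Suc n) * ?c))"
    by (simp add: nn_integral_multc emeasure_eq_measure)
   also have "... <= (\<E> w. nexp (real (Suc n) * D w))"
    by (intro nn_integral_mono) (auto simp: indicator_def intro!: ennreal_leI mult_left_mono)
   also have "... <= 1" by (rule exp_le) simp
   finally have "ennreal (prob ?B * exp (real (Suc n) * ?c)) <= ennreal 1" by (simp add: ennreal_mult del: of_nat_Suc)
   then have "prob ?B * exp (real (Suc n) * ?c) <= 1" by (subst (asm) ennreal_le_iff) auto
   then have "prob ?B <= exp (- (real (Suc n) * ?c))" by (simp add: exp_minus field_simps del: of_nat_Suc)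
   also have "... = exp (- ?c) ^ Suc n" by (simp add: exp_of_nat_mult[symmetric] del: of_nat_Suc power_Suc)
   finally show ?thesis .
  qed
  moreover have "(%n. exp (- ?c) ^ Suc n) ----> 0"
   by (intro LIMSEQ_Suc LIMSEQ_realpow_zero) auto
  ultimately have "prob ?B <= 0" by (intro LIMSEQ_le_const[where X = "%n. exp (- ?c) ^ Suc n"]) blast+
  then have "prob ?B = 0" using measure_nonneg[of M ?B] by linarith
  then have "AE w in M. w \<notin> ?B" by (intro AE_not_in) (simp add: null_sets_def emeasure_eq_measure)
  then show ?thesis using AE_space by eventually_elim auto
 qed
 then have "AE w in M. ALL k. D w < inverse (real (Suc k))" by (simp add: AE_all_countable)
 then show ?thesis
 proof eventually_elim
  case (elim w)
  have "D w <= 0" by (rule LIMSEQ_le_const[OF LIMSEQ_inverse_real_of_nat]) (use elim in \<open>auto intro: less_imp_le\<close>)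
  then show ?case by (simp add: D_def)
 qed
qed

text \<open>The increment bound holds simultaneously for rational times and extends by
  right-continuity, so \<open>X t - \<delta> * t\<close> is nonincreasing, and a monotone path plus
  a drift has bounded variation. Through this lemma the drift condition reaches the
  exponent.\<close>

lemma bounded_variation_if_slow:
 assumes int: "!!z. 0 < z ==> integrable M (%w. exp (z * X 1 w))" and \<delta>: "0 <= \<delta>"
  and le: "!!z. 0 < z ==> laplace_exponent M X z <= \<delta> * z"
 shows "bounded_variation_paths M X"
 unfolding bounded_variation_paths_def
proof -
 have "AE w in M. \<forall>s\<in>\<rat>. \<forall>t\<in>\<rat>. 0 <= s --> s <= t --> X t w - X s w <= \<delta> * (t - s)"
  using increment_bound[OF int le] by (auto simp: AE_ball_countable countable_rat)
 then show "AE w in M. locally_bounded_variation (%t. X t w)"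
 proof eventually_elim
  case (elim w)
  define g where "g t = X t w - \<delta> * t" for t
  have g_right: "(g \<longlongrightarrow> g t) (at_right t)" if "0 <= t" for t
   unfolding g_def[abs_def] by (intro tendsto_intros right that)
  have rat: "g t <= g s" if "s \<in> \<rat>" "t \<in> \<rat>" "0 <= s" "s <= t" for s t
  proof -
   have "X t w - X s w <= \<delta> * (t - s)" using elim that by blast
   then show ?thesis by (simp add: g_def right_diff_distrib)
  qed
  have anti: "g t <= g s" if st: "0 <= s" "s <= t" for s t
  proof (rule ccontr)
   assume "~ g t <= g s"
   then have lt: "g s < g t" and s_lt: "s < t" using st by (auto simp: less_le)
   define m where "m = (g s + g t) / 2"
   have m: "g s < m" "m < g t" using lt by (auto simp: m_def)
   obtain a where a: "s < a" "!!u. s < u ==> u < a ==> g u < m"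
    using order_tendstoD(2)[OF g_right[OF st(1)] m(1)] unfolding eventually_at_right_field by blast
   obtain c where c: "t < c" "!!u. t < u ==> u < c ==> m < g u"
    using order_tendstoD(1)[OF g_right m(2)] st unfolding eventually_at_right_field by force
   obtain s' where s': "s' \<in> \<rat>" "s < s'" "s' < min a t" using Rats_dense_in_real[of s "min a t"] a s_lt by auto
   obtain t' where t': "t' \<in> \<rat>" "t < t'" "t' < c" using Rats_dense_in_real[OF c(1)] by auto
   have "g t' <= g s'" using s' t' st by (intro rat) auto
   then show False using a(2)[of s'] c(2)[of t'] s' t' by auto
  qed
  have inc: "X t w - X s w <= \<delta> * (t - s)" if "0 <= s" "s <= t" for s t
   using anti[OF that] by (simp add: g_def algebra_simps)
  show ?case
   unfolding locally_bounded_variation_def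
  proof (intro allI impI)
   fix T :: real assume T: "0 <= T"
   have "(\<Sum>i<n. \<bar>X (t (Suc i)) w - X (t i) w\<bar>) <= 4 * \<delta> * T + \<bar>X T w\<bar>" if t: "mono t & 0 <= t 0 & t n <= T" for n and t :: "nat => real"
   proof -
    have t0: "0 <= t i" for i using t monoD[of t 0 i] by auto
    have "\<bar>X (t (Suc i)) w - X (t i) w\<bar> <= 2 * \<delta> * (t (Suc i) - t i) - (X (t (Suc i)) w - X (t i) w)" for i
    proof -
     have ti: "t i <= t (Suc i)" using t by (simp add: mono_def)
     then have "0 <= \<delta> * (t (Suc i) - t i)" using \<delta> by simp
     then show ?thesis using inc[OF t0 ti] by (simp add: mult.assoc abs_le_iff)
    qed
    then have "(\<Sum>i<n. \<bar>X (t (Suc i)) w - X (t i) w\<bar>) <= (\<Sum>i<n. 2 * \<delta> * (t (Suc i) - t i) - (X (t (Suc i)) w - X (t i) w))"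
     by (intro sum_mono)
    also have "... = 2 * \<delta> * (t n - t 0) - (X (t n) w - X (t 0) w)"
     by (induction n) (simp_all add: algebra_simps)
    also have "... <= 4 * \<delta> * T + \<bar>X T w\<bar>"
    proof -
     have "X T w - X (t n) w <= \<delta> * (T - t n)" "X (t 0) w - X 0 w <= \<delta> * (t 0 - 0)" using inc[of "t n" T] inc[of 0 "t 0"] t t0[of n] by auto
     moreover have "\<delta> * t n <= \<delta> * T" "0 <= \<delta> * t n" "0 <= \<delta> * t 0" "\<delta> * t 0 <= \<delta> * t n" "0 <= \<delta> * T"
      using t t0 \<delta> T by (auto intro!: mult_left_mono simp: mono_def)
     ultimately show ?thesis by (simp add: zero algebra_simps)
    qed
    finally show ?thesis .
   qed
   then show "EX B. ALL n t. mono t & 0 <= t 0 & t n <= T --> (\<Sum>i<n. \<bar>X (t (Suc i)) w - X (t i) w\<bar>) <= B" by blast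
  qed
 qed
qed

end

section \<open>Discounted occupation of the Euler scheme\<close>

lemma (in euler_scheme) vi_euler:
 assumes "\<beta>" "t0 = 0" "0 <= y"
 shows "vi i = euler \<delta> b h y (%j. f (real (Suc j) * h) - f (real j * h)) i"
proof -
 have \<beta>: "of_bool \<beta> = (1 :: real)" using assms(1) by simp
 have vi: "vi i = xi i + em i" for i by (simp add: vi_def \<beta>)
 show ?thesis
 proof (induction i)
  case 0
  have "xi 0 = y" unfolding xi_def el_0 by (simp add: assms(2))
  then show ?case using assms(3) by (simp add: vi em_0)
 next
  case (Suc i)
  \<comment> \<open>The discrete Skorokhod representation of the Lindley recursion: updating the
    maximum in \<open>em\<close> amounts to truncating at \<open>0\<close>.\<close>
  have "vi (Suc i) = max 0 (xi (Suc i) + em i)" by (simp add: vi em_Suc max_def)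
  also have "xi (Suc i) + em i = vi i + (f (real (Suc i) * h) - f (real i * h)) - (if b < vi i then \<delta> * h else 0)"
   unfolding vi xi_def el_Suc by (simp add: assms(2) del: of_nat_Suc)
  finally show ?case using Suc.IH by simp
 qed
qed

lemma no_coincidence_shift:
 assumes "no_coincidence \<delta> f"
 shows "no_coincidence \<delta> (%t. x + f t)"
 unfolding no_coincidence_def
proof (intro allI impI)
 fix l assume "ALL s t. 0 <= s --> s <= t --> 0 <= l t - l s & l t - l s <= \<delta> * (t - s)"
 then have "{t. 0 <= t & f t = l t - x} \<in> null_sets lborel"
  using assms unfolding no_coincidence_def by (auto dest!: spec[of _ "%t. l t - x"])
 moreover have "{t. 0 <= t & f t = l t - x} = {t. 0 <= t & x + f t = l t}" by auto
 ultimately show "{t. 0 <= t & x + f t = l t} \<in> null_sets lborel" by simp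
qed

lemma cadlag_shift: "cadlag f ==> cadlag (%t. x + f t)"
 unfolding cadlag_def by (blast intro: tendsto_add[OF tendsto_const])

lemma no_positive_jumps_shift:
 assumes "no_positive_jumps f"
 shows "no_positive_jumps (%t. x + f t)"
 unfolding no_positive_jumps_def
proof (intro allI impI)
 fix t l assume t: "(0::real) < t" and l: "((%t. x + f t) \<longlongrightarrow> l) (at_left t)"
 have "(f \<longlongrightarrow> l - x) (at_left t)" using tendsto_diff[OF l tendsto_const[of x]] by simp
 then show "x + f t <= l" using assms t unfolding no_positive_jumps_def by fastforce
qed

definition euler_occ :: "real => real => real => real => (real => real) => real => ennreal" where
 "euler_occ q \<delta> b x f h = (\<L> s. nexp (- q * s) * ind {0<..} s *
  ind {b<..} (euler \<delta> b h x (%j. f (real (Suc j) * h) - f (real j * h)) (nat \<lceil>s / h\<rceil>)))"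

lemma nn_exp_positive:
 fixes q :: real
 assumes "0 < q"
 shows "(\<L> s. nexp (- q * s) * ind {0<..} s) = ennreal (1 / q)"
proof -
 have "(\<L> s. nexp (- q * s) * ind {0<..} s) = (\<L> s. ennreal (exp (- q * s) * ind {0..} s))"
  using AE_lborel_singleton[of 0] by (intro nn_integral_cong_AE) (auto simp: indicator_def elim!: eventually_mono)
 then show ?thesis using nn_exp_Ici[OF assms, of 0] by simp
qed

text \<open>The step processes converge to \<open>D.V\<close> at every time, so their indicators
  above \<open>b\<close> converge off the null level set, and the discount is an integrable
  bound.\<close>

lemma euler_occ_tendsto:
 assumes f: "cadlag f" and npj: "no_positive_jumps f" and nc: "no_coincidence \<delta> f" and \<delta>: "0 <= \<delta>" and b: "0 < b" and q: "0 < q"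
 shows "(%n. ennreal \<delta> * euler_occ q \<delta> b (max 0 x) f (1 / real (Suc n))) ---->
  (\<integral>\<^sup>+t\<in>{0..}. nexp (- q * t) \<partial>interval_measure (refraction_time \<delta> b x f))"
proof -
 have H: "(%n. 1 / real (Suc n)) ----> 0" using LIMSEQ_inverse_real_of_nat by (simp add: inverse_eq_divide)
 interpret E: euler_family True \<delta> b f 0 "max 0 x" "%n. 1 / real (Suc n)"
  using f nc \<delta> b H by unfold_locales auto
 obtain L where L: "!!T. solves True \<delta> b f 0 (max 0 x) L T" using E.solution_exists by blast
 interpret D: driven_path \<delta> b f "max 0 x" L using f npj nc \<delta> b L by unfold_locales auto
 let ?w = "%s. nexp (- q * s) * ind {0<..} s :: ennreal"
 have sv: "E.E.sv n s = euler \<delta> b (1 / real (Suc n)) (max 0 x) (%j. f (real (Suc j) * (1 / real (Suc n))) - f (real j * (1 / real (Suc n)))) (nat \<lceil>s / (1 / real (Suc n))\<rceil>)" for n s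
  unfolding E.E.sv_def by (subst E.E.vi_euler) simp_all
 have svm: "(%s. E.E.sv n (max 0 s)) \<in> borel_measurable borel" for n by (rule E.E.sv_measurable)
 have occ: "euler_occ q \<delta> b (max 0 x) f (1 / real (Suc n)) = (\<L> s. ?w s * ind {b<..} (E.E.sv n (max 0 s)))" for n
  unfolding euler_occ_def by (intro nn_integral_cong) (auto simp: indicator_def sv simp del: of_nat_Suc)
 have lev: "{t. 0 <= t & D.V t = b} \<in> null_sets lborel"
  unfolding D.V_def by (rule con_level_null[OF f nc \<delta> order_refl D.slow_L b])
 have "(%n. euler_occ q \<delta> b (max 0 x) f (1 / real (Suc n))) ----> (\<L> s. ?w s * ind {b<..} (D.V (max 0 s)))"
  unfolding occ
 proof (rule nn_integral_dominated_convergence[where w = ?w])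
  show "(%s. ?w s * ind {b<..} (E.E.sv n (max 0 s))) \<in> borel_measurable lborel" for n using svm[of n] by measurable
  show "(%s. ?w s * ind {b<..} (D.V (max 0 s))) \<in> borel_measurable lborel" using D.V_measurable[OF order_refl] by measurable
  show "(\<L> s. ?w s) < \<infinity>" unfolding nn_exp_positive[OF q] by simp
  show "AE s in lborel. (%n. ?w s * ind {b<..} (E.E.sv n (max 0 s))) ----> ?w s * ind {b<..} (D.V (max 0 s))"
   using AE_not_in[OF lev]
  proof eventually_elim
   case (elim s)
   show ?case
   proof (cases "0 < s")
    case True
    have c: "(%n. E.E.sv n s) ----> D.V s" unfolding D.V_def by (rule E.euler_tendsto[OF L]) (use True in simp)
    have "D.V s < b \<or> b < D.V s" using elim True by auto
    then have "EV n. (b < E.E.sv n s) = (b < D.V s)"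
    proof
     assume lt: "D.V s < b"
     from order_tendstoD(2)[OF c lt] show ?thesis by eventually_elim (use lt in auto)
    next
     assume lt: "b < D.V s"
     from order_tendstoD(1)[OF c lt] show ?thesis by eventually_elim (use lt in auto)
    qed
    then show ?thesis using True by (intro tendsto_eventually) (auto elim!: eventually_mono simp: indicator_def)
   qed simp
  qed
 qed (auto simp: indicator_def)
 also have "(\<L> s. ?w s * ind {b<..} (D.V (max 0 s))) = (\<L> s. nexp (- q * s) * ind {s. 0 <= s & b < D.V s} s)"
  using AE_lborel_singleton[of 0] by (intro nn_integral_cong_AE) (auto simp: indicator_def elim!: eventually_mono)
 finally have "(%n. euler_occ q \<delta> b (max 0 x) f (1 / real (Suc n))) ----> (\<L> s. nexp (- q * s) * ind {s. 0 <= s & b < D.V s} s)" .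
 moreover have "(\<integral>\<^sup>+t\<in>{0..}. nexp (- q * t) \<partial>interval_measure (refraction_time \<delta> b x f))
   = ennreal \<delta> * (\<L> s. nexp (- q * s) * ind {s. 0 <= s & b < D.V s} s)"
  by (rule D.nn_integral_refraction[OF refl]) measurable
 ultimately show ?thesis by (simp add: ennreal_tendsto_cmult)
qed

lemma nat_ceiling_measurable:
 fixes h :: real
 shows "(%s. nat \<lceil>s / h\<rceil>) \<in> measurable borel (count_space UNIV)"
 by measurable

lemma step_measurable:
 fixes v :: "nat => real" and h :: real
 shows "(%s. v (nat \<lceil>s / h\<rceil>)) \<in> borel_measurable borel"
 using measurable_compose[OF nat_ceiling_measurable, of v borel] by simp

context refracted_chain
begin

lemma euler_occ_V:
 "euler_occ q \<delta> b x0 (%t. X t w) h = (\<L> s. nexp (- q * s) * ind {0<..} s * ind {b<..} (V h (nat \<lceil>s / h\<rceil>) w))"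
 by (simp add: euler_occ_def V_def)

lemma V_joint:
 assumes "0 < h"
 shows "(%p. V h (nat \<lceil>snd p / h\<rceil>) (fst p)) \<in> borel_measurable (M \<Otimes>\<^sub>M lborel)"
proof (rule measurable_compose_countable)
 show "(%p. V h i (fst p)) \<in> borel_measurable (M \<Otimes>\<^sub>M lborel)" for i
  by (rule measurable_compose[OF measurable_fst V_measurable[OF assms]])
 show "(%p. nat \<lceil>snd p / h\<rceil>) \<in> measurable (M \<Otimes>\<^sub>M lborel) (count_space UNIV)"
  using measurable_compose[OF measurable_snd, of "%s. nat \<lceil>s / h\<rceil>" lborel "count_space UNIV" M] nat_ceiling_measurable[of h] by simp
qed

lemma euler_occ_measurable:
 assumes h: "0 < h"
 shows "(%w. euler_occ q \<delta> b x0 (%t. X t w) h) \<in> borel_measurable M"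
proof -
 note [measurable] = V_joint[OF h]
 show ?thesis unfolding euler_occ_V by (intro lborel.borel_measurable_nn_integral) (auto simp: split_beta')
qed

text \<open>The step process of \<^const>\<open>euler_occ\<close> is sampled at the right end of each cell, the one of \<^const>\<open>above_sum\<close> at the left end.\<close>
lemma euler_occ_sum:
 assumes h: "0 < h"
 shows "(\<L> s. nexp (- q * s) * ind {0<..real N * h} s * ind {b<..} (V h (nat \<lceil>s / h\<rceil>) w))
  = (\<Sum>i<N. nexp (- q * (real i * h)) * (ennreal ((1 - exp (- q * h)) / q) * ind {b<..} (V h (Suc i) w)))"
proof (induction N)
 case (Suc N)
 note V_measurable [measurable del] step_measurable [measurable]
 let ?c = "real N * h" and ?d = "real (Suc N) * h"
 have cd: "0 <= ?c" "?c <= ?d" using h by (auto simp: algebra_simps)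
 have cell: "nat \<lceil>s / h\<rceil> = Suc N" if "s \<in> {?c<..?d}" for s
 proof -
  have "\<lceil>s / h\<rceil> = int (Suc N)" using that h by (intro ceiling_unique) (auto simp: field_simps)
  then show ?thesis by (metis nat_int)
 qed
 have split: "ind {0<..?d} s = (ind {0<..?c} s + ind {?c<..?d} s :: ennreal)" for s
  using cd by (auto simp: indicator_def)
 have "(\<L> s. nexp (- q * s) * ind {0<..?d} s * ind {b<..} (V h (nat \<lceil>s / h\<rceil>) w))
   = (\<L> s. nexp (- q * s) * ind {0<..?c} s * ind {b<..} (V h (nat \<lceil>s / h\<rceil>) w))
   + (\<L> s. nexp (- q * s) * ind {?c<..?d} s * ind {b<..} (V h (nat \<lceil>s / h\<rceil>) w))"
  unfolding split distrib_left distrib_right by (intro nn_integral_add) measurable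
 also have "(\<L> s. nexp (- q * s) * ind {?c<..?d} s * ind {b<..} (V h (nat \<lceil>s / h\<rceil>) w))
   = (\<L> s. nexp (- q * s) * ind {?c..?d} s * ind {b<..} (V h (Suc N) w))"
  using AE_lborel_singleton[of ?c] by (intro nn_integral_cong_AE) (auto simp: indicator_def cell less_le simp del: of_nat_Suc elim!: eventually_mono)
 also have "... = (\<L> s. nexp (- q * s) * ind {?c..?d} s) * ind {b<..} (V h (Suc N) w)"
  by (intro nn_integral_multc) measurable
 also have "(\<L> s. nexp (- q * s) * ind {?c..?d} s) = ennreal (exp (- q * ?d) / (- q) - exp (- q * ?c) / (- q))"
  by (rule nn_integral_FTC_Icc) (use cd X.q_pos in \<open>auto intro!: derivative_eq_intros\<close>)
 also have "exp (- q * ?d) / (- q) - exp (- q * ?c) / (- q) = exp (- q * ?c) * ((1 - exp (- q * h)) / q)"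
  by (simp add: exp_add[symmetric] algebra_simps diff_divide_distrib)
 also have "ennreal (exp (- q * ?c) * ((1 - exp (- q * h)) / q)) = nexp (- q * ?c) * ennreal ((1 - exp (- q * h)) / q)"
  using X.q_pos h by (intro ennreal_mult) auto
 finally show ?case unfolding sum.lessThan_Suc Suc.IH[symmetric] mult.assoc .
next
 case 0
 have e: "{0<..real 0 * h} = {}" by simp
 show ?case unfolding e by simp
qed

end

section \<open>The discounted refraction time\<close>

text \<open>For \<open>x < a\<close> the oriented integral runs over an interval where
  \<open>f\<close> vanishes; so it agrees with the unoriented one in all cases, which links the
  stated formulas to \<open>cv\<close>.\<close>

lemma LBINT_nonneg_cut:
 fixes f :: "real => real"
 assumes f: "f \<in> borel_measurable borel" "!!y. 0 <= f y" and z: "!!y. x < y ==> y < a ==> f y = 0"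
 shows "(LBINT y=a..x. f y) = enn2real (\<L> y. ennreal (f y * ind {a..x} y))"
proof (cases "a <= x")
 case True
 have "(LBINT y=a..x. f y) = (\<integral>y. f y * ind {a..x} y \<partial>lborel)"
  using True by (simp add: interval_integral_Icc set_lebesgue_integral_def mult.commute)
 also have "... = enn2real (\<L> y. ennreal (f y * ind {a..x} y))"
  using f by (intro integral_eq_nn_integral) auto
 finally show ?thesis .
next
 case False
 have "(LBINT y=x..a. f y) = (LBINT y:{x<..<a}. f y)" using False by (simp add: interval_integral_Ioo)
 also have "... = (\<integral>y. 0 \<partial>(lborel :: real measure))"
  unfolding set_lebesgue_integral_def using z by (intro Bochner_Integration.integral_cong) (auto simp: indicator_def)
 finally have "(LBINT y=a..x. f y) = 0" by (subst interval_integral_endpoints_reverse) simp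
 then show ?thesis using False by simp
qed

context scale_process
begin

lemma LBINT_W: "(LBINT y=0..ereal (x - c). W y) = enn2real (cv (ind {c..}) x)"
proof -
 have "(LBINT y=ereal 0..ereal (x - c). W y) = enn2real (\<L> y. ennreal (W y * ind {0..x - c} y))"
  by (rule LBINT_nonneg_cut) (auto simp: W_nonneg W_neg W_borel)
 also have "(\<L> y. ennreal (W y * ind {0..x - c} y)) = cv (ind {c..}) x"
  by (subst cv_flip) (auto intro!: nn_integral_cong simp: indicator_def W_neg)
 finally show ?thesis by (simp add: zero_ereal_def)
qed

text \<open>The integrand is bounded below by its value at \<open>b\<close>.\<close>
lemma tail_integral_infinite:
 assumes b: "0 < b"
 shows "(\<integral>\<^sup>+y\<in>{b..}. ennreal (exp (- root q * y) * W y) \<partial>lborel) = \<infinity>"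
proof -
 define c where "c = exp (- root q * b) * W b"
 have c: "0 < c" using W_pos[OF b] by (simp add: c_def)
 have "ennreal (c * real n) <= (\<integral>\<^sup>+y\<in>{b..}. ennreal (exp (- root q * y) * W y) \<partial>lborel)" for n
 proof -
  have "ennreal (c * real n) = (\<L> y. ennreal c * ind {b..b + real n} y)"
   using c by (simp add: nn_integral_cmult_indicator ennreal_mult)
  also have "... <= (\<integral>\<^sup>+y\<in>{b..}. ennreal (exp (- root q * y) * W y) \<partial>lborel)"
   using W_exp_mono[of b] by (intro nn_integral_mono) (auto simp: indicator_def c_def mult.commute intro!: ennreal_leI)
  finally show ?thesis .
 qed
 moreover have "EX n. K < c * real n" for K using reals_Archimedean3[OF c] by (metis mult.commute)
 ultimately show ?thesis
  by (cases "\<integral>\<^sup>+y\<in>{b..}. ennreal (exp (- root q * y) * W y) \<partial>lborel") (auto simp: ennreal_le_iff not_le[symmetric])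
qed

end

context refracted_scales
begin

lemma scale_bar_eq: "scale_bar WY (x - b) = F b x"
 by (simp add: scale_bar_def F_def Y.LBINT_W)

text \<open>The stated integral is the part of \<open>Y.cv W x\<close> with sources above
  \<open>b\<close>. Splitting \<open>W\<close> at \<open>b\<close> in \<open>cv_identity\<close>
  expresses it through \<open>Z\<close>, \<open>F 0\<close> and \<open>G b\<close>.\<close>

lemma scale_r_eq: "scale_r \<delta> b q W WY x = r b x"
proof -
 let ?f = "%y. W y * ind {b..} y :: real"
 have Z: "scale_Z q W x = Z x" using X.LBINT_W[of x 0] by (simp add: scale_Z_def Z_def)
 have "(LBINT y=b..x. WY (x - y) * W y) = enn2real (\<L> y. ennreal (WY (x - y) * W y * ind {b..x} y))"
  by (rule LBINT_nonneg_cut) (auto simp: X.W_nonneg Y.W_nonneg Y.W_neg intro!: borel_measurable_times X.W_borel measurable_compose[OF _ Y.W_borel])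
 also have "(\<L> y. ennreal (WY (x - y) * W y * ind {b..x} y)) = Y.cv ?f x"
  unfolding Y.cv_def by (intro nn_integral_cong) (auto simp: indicator_def Y.W_neg)
 finally have I: "(LBINT y=b..x. WY (x - y) * W y) = enn2real (Y.cv ?f x)" .
 have sum: "W y = Wcut b y + ?f y" for y
  using b_pos X.W_neg[of y] by (auto simp: indicator_def Wcut_def)
 have add: "Y.cv W x = Y.cv (Wcut b) x + Y.cv ?f x"
  by (subst sum[abs_def], rule Y.cv_add) (auto simp: Wcut_good X.W_nonneg)
 have id: "ennreal ((Z x - 1) / q) + ennreal \<delta> * (ennreal (G b x) + Y.cv ?f x) = ennreal (F 0 x)"
  using cv_identity[of x] unfolding cv_F cv_Z add cv_G .
 have "Y.cv ?f x ~= \<top>"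
 proof
  assume "Y.cv ?f x = \<top>"
  then show False using id \<delta>_pos by (simp add: ennreal_mult_top)
 qed
 then obtain v where v: "Y.cv ?f x = ennreal v" "0 <= v" by (cases "Y.cv ?f x") auto
 have "(Z x - 1) / q + \<delta> * (G b x + v) = F 0 x"
  using id v \<delta>_pos X.q_pos Z_ge_1[of x] F_nonneg[of 0 x] G_nonneg[of b x] by (simp flip: ennreal_mult ennreal_plus)
 then have "F 0 x = (Z x - 1) / q + \<delta> * (G b x + v)" ..
 then have "r b x = Z x + q * \<delta> * v" using X.q_pos by (simp add: r_def field_simps)
 then show ?thesis using v by (simp add: scale_r_def Z I)
qed

end

context refracted_chain
begin

definition right_sum :: "real => nat => ennreal" where
 "right_sum h N = (\<Sum>i<N. nexp (- q * (real i * h)) * (\<E> w. ennreal ((1 - exp (- q * h)) / q) * ind {b<..} (V h (Suc i) w)))"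

text \<open>Shifting the index by one turns one sum into the other up to the first and the last
  term, each at most \<open>h\<close>; the weights then differ by the discount of one step.\<close>

lemma above_sum_right_sum:
 assumes h: "0 < h"
 shows "nexp (- q * h) * right_sum h N <= above_sum h N + ennreal h" "above_sum h N <= ennreal h + right_sum h N"
proof -
 define u where "u i = nexp (- q * (real i * h)) * (\<E> w. ennreal ((1 - exp (- q * h)) / q) * ind {b<..} (V h i w))" for i
 have above: "above_sum h N = (\<Sum>i<N. u i)" for N by (simp add: above_sum_def u_def)
 have "(1 - exp (- q * h)) / q <= h" using exp_ge_add_one_self[of "- q * h"] X.q_pos by (simp add: field_simps)
 then have u: "u i <= ennreal h" for i
 proof -
  have "u i <= 1 * (\<E> w. ennreal h * 1)"
   unfolding u_def using \<open>_ <= h\<close> h X.q_pos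
   by (intro mult_mono nn_integral_mono ennreal_leI) (auto simp: indicator_def ennreal_le_1)
  then show ?thesis by (simp add: X.emeasure_space_1)
 qed
 have "nexp (- q * h) * right_sum h N = (\<Sum>i<N. u (Suc i))"
 proof -
  have "nexp (- q * h) * nexp (- q * (real i * h)) = nexp (- q * (real (Suc i) * h))" for i
   by (simp add: ennreal_mult'[symmetric] exp_add[symmetric] distrib_left distrib_right)
  then show ?thesis unfolding right_sum_def u_def sum_distrib_left by (simp only: mult.assoc[symmetric])
 qed
 then have eq: "above_sum h N + u N = u 0 + nexp (- q * h) * right_sum h N"
  unfolding above by (metis sum.lessThan_Suc sum.lessThan_Suc_shift)
 have "nexp (- q * h) * right_sum h N <= above_sum h N + u N" unfolding eq by simp
 also have "... <= above_sum h N + ennreal h" by (intro add_left_mono u)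
 finally show "nexp (- q * h) * right_sum h N <= above_sum h N + ennreal h" .
 have "above_sum h N <= above_sum h N + u N" by simp
 also have "... <= ennreal h + 1 * right_sum h N"
  unfolding eq using h X.q_pos by (intro add_mono u mult_right_mono) (auto simp: ennreal_le_1)
 finally show "above_sum h N <= ennreal h + right_sum h N" by simp
qed

lemma expected_occ_right_sum:
 assumes h: "0 < h"
 shows "right_sum h N <= (\<E> w. euler_occ q \<delta> b x0 (%t. X t w) h)"
  "(\<E> w. euler_occ q \<delta> b x0 (%t. X t w) h) <= right_sum h N + ennreal (exp (- q * (real N * h)) / q)"
proof -
 define R where "R w = (\<L> s. nexp (- q * s) * ind {0<..real N * h} s * ind {b<..} (V h (nat \<lceil>s / h\<rceil>) w))" for w
 have Rs: "R w = (\<Sum>i<N. nexp (- q * (real i * h)) * (ennreal ((1 - exp (- q * h)) / q) * ind {b<..} (V h (Suc i) w)))" for w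
  unfolding R_def by (rule euler_occ_sum[OF h])
 note V_measurable [measurable del]
 have [measurable]: "V h i \<in> borel_measurable M" for i by (rule V_measurable[OF h])
 have Rm: "R \<in> borel_measurable M" unfolding Rs[abs_def] by measurable
 have ER: "(\<E> w. R w) = right_sum h N"
  unfolding Rs right_sum_def by (simp add: nn_integral_sum nn_integral_cmult)
 have "R w <= euler_occ q \<delta> b x0 (%t. X t w) h" for w
  unfolding R_def euler_occ_V by (intro nn_integral_mono) (auto simp: indicator_def)
 then show "right_sum h N <= (\<E> w. euler_occ q \<delta> b x0 (%t. X t w) h)"
  unfolding ER[symmetric] by (intro nn_integral_mono)
 have "euler_occ q \<delta> b x0 (%t. X t w) h <= R w + ennreal (exp (- q * (real N * h)) / q)" for w
 proof -
  note step_measurable [measurable]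
  have "euler_occ q \<delta> b x0 (%t. X t w) h <= (\<L> s. nexp (- q * s) * ind {0<..real N * h} s * ind {b<..} (V h (nat \<lceil>s / h\<rceil>) w)
    + ennreal (exp (- q * s) * ind {real N * h..} s))"
   unfolding euler_occ_V by (intro nn_integral_mono) (auto simp: indicator_def)
  also have "... = R w + (\<L> s. ennreal (exp (- q * s) * ind {real N * h..} s))"
   unfolding R_def by (rule nn_integral_add) measurable
  finally show ?thesis using nn_exp_Ici[OF X.q_pos, of "real N * h"] by simp
 qed
 then have "(\<E> w. euler_occ q \<delta> b x0 (%t. X t w) h) <= (\<E> w. R w + ennreal (exp (- q * (real N * h)) / q))" by (intro nn_integral_mono)
 also have "... = right_sum h N + ennreal (exp (- q * (real N * h)) / q)"
  using Rm by (simp add: nn_integral_add ER X.emeasure_space_1)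
 finally show "(\<E> w. euler_occ q \<delta> b x0 (%t. X t w) h) <= right_sum h N + ennreal (exp (- q * (real N * h)) / q)" .
qed

lemma expected_occ_limit:
 "(%n. (\<E> w. euler_occ q \<delta> b x0 (%t. X t w) (1 / real (Suc n)))) ----> ennreal (\<rho> * r b x0 - F b x0)"
 "0 <= \<rho> * r b x0 - F b x0"
proof -
 define h where "h n = 1 / real (Suc n)" for n
 have h: "0 < h n" for n by (simp add: h_def)
 have h0: "h ----> 0" using LIMSEQ_inverse_real_of_nat by (simp add: h_def[abs_def] inverse_eq_divide)
 define \<alpha> where "\<alpha> n = (\<E> w. euler_occ q \<delta> b x0 (%t. X t w) (h n))" for n
 have "\<alpha> n <= ennreal (1 / q)" for n
  using expected_occ_right_sum(2)[OF h, of n 0] by (simp add: \<alpha>_def right_sum_def)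
 then obtain a where a: "!!n. \<alpha> n = ennreal (a n)" "!!n. 0 <= a n" "!!n. a n <= 1 / q"
 proof -
  assume le: "!!n. \<alpha> n <= ennreal (1 / q)"
   and *: "!!a. (!!n. \<alpha> n = ennreal (a n)) ==> (!!n. 0 <= a n) ==> (!!n. a n <= 1 / q) ==> thesis"
  have fin: "\<alpha> n < \<top>" for n using le[of n] by (simp add: le_less_trans)
  show thesis
  proof (rule *[of "%n. enn2real (\<alpha> n)"])
   show "enn2real (\<alpha> n) <= 1 / q" for n using le[of n] X.q_pos by (intro enn2real_leI) auto
  qed (use fin in auto)
 qed
 define l where "l = \<rho> * r b x0 - F b x0"
 have lim: "a ----> l"
 proof (rule tendstoI)
  fix e' :: real assume e': "0 < e'"
  define e where "e = e' / 4"
  have e: "0 < e" using e' by (simp add: e_def)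
  obtain T0 where T0: "!!T. T0 <= T ==> EV n.
    ennreal (F b x0) + above_sum (h n) (T * Suc n) <= ennreal (\<rho> * r b x0 + e) &
    ennreal (\<rho> * r b x0) <= ennreal (F b x0 + e) + above_sum (h n) (T * Suc n)"
   using above_sum_limit[OF e] unfolding h_def by blast
  have "((%T. exp (- s * real T) / s) \<longlongrightarrow> 0) sequentially" if "0 < s" for s using that by real_asymp
  from order_tendstoD(2)[OF this[OF X.q_pos] e] obtain T1 where T1: "!!T. T1 <= T ==> exp (- q * real T) / q < e"
   by (auto simp: eventually_sequentially)
  define T where "T = max T0 T1"
  have Te: "exp (- q * real T) / q < e" by (rule T1) (simp add: T_def)
  have "EV n. h n < e" using order_tendstoD(2)[OF h0 e] .
  moreover have "EV n.
    ennreal (F b x0) + above_sum (h n) (T * Suc n) <= ennreal (\<rho> * r b x0 + e) &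
    ennreal (\<rho> * r b x0) <= ennreal (F b x0 + e) + above_sum (h n) (T * Suc n)" by (rule T0) (simp add: T_def)
  ultimately show "EV n. dist (a n) l < e'"
  proof eventually_elim
   case (elim n)
   let ?A = "above_sum (h n) (T * Suc n)" and ?R = "right_sum (h n) (T * Suc n)"
   have Nh: "real (T * Suc n) * h n = real T" by (simp add: h_def field_simps)
   have R1: "?R <= ennreal (a n)" using expected_occ_right_sum(1)[OF h] unfolding a(1)[symmetric] \<alpha>_def .
   then obtain R where R: "?R = ennreal R" "0 <= R" by (cases ?R) (auto simp: top_unique)
   have "?A <= ennreal (h n) + ennreal R" using above_sum_right_sum(2)[OF h, of n "T * Suc n"] R by simp
   then obtain A where A: "?A = ennreal A" "0 <= A" by (cases ?A) (auto simp: top_unique simp flip: ennreal_plus)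
   have 1: "R <= a n" using R1 R a(2) by simp
   have "ennreal (a n) <= ennreal R + ennreal (exp (- q * real T) / q)"
    using expected_occ_right_sum(2)[OF h, of n "T * Suc n"] unfolding Nh R(1) \<alpha>_def[symmetric] a(1) .
   then have 2: "a n <= R + e" using Te R X.q_pos by (simp flip: ennreal_plus)
   have "nexp (- q * h n) * ennreal R <= ennreal A + ennreal (h n)" using above_sum_right_sum(1)[OF h, of n "T * Suc n"] R A by simp
   then have "exp (- q * h n) * R <= A + h n" using R A h[of n] by (simp flip: ennreal_plus ennreal_mult)
   \<comment> \<open>The discount mismatch of one step costs at most \<open>h n\<close>, because
     \<open>R\<close> is at most \<open>1 / q\<close>.\<close>
   moreover have "R - h n * (q * R) <= exp (- q * h n) * R"
    using mult_right_mono[OF exp_ge_add_one_self[of "- q * h n"] R(2)] by (simp add: algebra_simps)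
   moreover have "R <= 1 / q" using 1 a(3)[of n] by simp
   then have "q * R <= 1" using X.q_pos by (simp add: field_simps)
   then have "h n * (q * R) <= h n * 1" using h[of n] by (intro mult_left_mono) auto
   ultimately have 3: "R <= A + 2 * h n" by linarith
   have 4: "A <= h n + R" using \<open>?A <= _\<close> A R h[of n] by (simp flip: ennreal_plus)
   have "0 <= \<rho> * r b x0" using \<rho>_pos r_ge_1[of b x0] by simp
   then have 5: "F b x0 + A <= \<rho> * r b x0 + e" "\<rho> * r b x0 <= F b x0 + e + A"
    using elim A F_nonneg[of b x0] e by (simp_all flip: ennreal_plus)
   show ?case using 1 2 3 4 5 elim(1) unfolding dist_real_def l_def e_def by linarith
  qed
 qed
 then show "0 <= \<rho> * r b x0 - F b x0" unfolding l_def[symmetric] using a(2) by (intro LIMSEQ_le_const) auto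
 show "(%n. (\<E> w. euler_occ q \<delta> b x0 (%t. X t w) (1 / real (Suc n)))) ----> ennreal (\<rho> * r b x0 - F b x0)"
  using tendsto_ennrealI[OF lim] by (simp add: a(1)[symmetric] \<alpha>_def h_def l_def)
qed

end

section \<open>From the Levy hypotheses to the analytic setting\<close>

locale refracted_setting = nice_levy +
 fixes \<gamma> \<sigma> \<delta> :: real and \<nu> :: "real measure"
 assumes triplet: "has_levy_triplet M X \<gamma> \<sigma> \<nu>" and \<delta>: "0 <= \<delta>"
  and drift: "bounded_variation_paths M X ==> \<delta> < \<gamma> - (LINT y:{-1<..<0}|\<nu>. y)"
begin

abbreviation "\<psi> \<equiv> laplace_exponent M X"

lemma mgf_one: "0 <= z ==> integrable M (%w. exp (z * X 1 w))"
 using triplet by (simp add: has_levy_triplet_def)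

lemma neg_levy: "neg_levy_measure \<nu>" using triplet by (simp add: has_levy_triplet_def)

lemma \<psi>_lk: "0 <= z ==> \<psi> z = levy_khintchine \<gamma> \<sigma> \<nu> z"
 using triplet by (simp add: has_levy_triplet_def)

text \<open>If the exponent stayed below \<open>\<delta> * z\<close>, the paths would have bounded
  variation and, by the asymptotics of the exponent, a drift at most \<delta>, against the
  hypothesis. In the case of unbounded variation the first conclusion alone is the
  contradiction.\<close>

lemma \<psi>_above: "EX z>0. \<delta> * z < \<psi> z"
proof (rule ccontr)
 assume "~ (EX z>0. \<delta> * z < \<psi> z)"
 then have le: "\<psi> z <= \<delta> * z" if "0 < z" for z using that by (meson not_le)
 have "bounded_variation_paths M X" by (rule bounded_variation_if_slow[OF mgf_one \<delta> le]) auto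
 moreover have "\<gamma> - (LINT y:{-1<..<0}|\<nu>. y) <= \<delta>"
  by (rule levy_khintchine_drift[OF neg_levy, of \<gamma> \<sigma>]) (use le \<psi>_lk in auto)
 ultimately show False using drift by simp
qed

text \<open>Taking \<open>d = 0\<close> gives \<open>X\<close> and \<open>d = \<delta>\<close> gives
  \<open>Y\<close>, so both processes share one verification.\<close>

lemma exp_process_drift:
 assumes "0 <= d" "d <= \<delta>"
 shows "exp_process M (%t w. X t w - d * t) (%z. \<psi> z - d * z)"
proof
 fix t z :: real assume t: "0 <= t" and z: "0 <= z"
 have eq: "exp (z * (X t w - d * t)) = exp (z * X t w) * exp (- (z * d * t))" for w
  by (simp add: exp_add[symmetric] algebra_simps)
 show "integrable M (%w. exp (z * (X t w - d * t)))"
  unfolding eq using mgf_all(1)[OF mgf_one[OF z] t] by simp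
 show "(LINT w|M. exp (z * (X t w - d * t))) = exp (t * (\<psi> z - d * z))"
 proof -
  have "exp (t * (\<psi> z - d * z)) = exp (t * \<psi> z) * exp (- (z * d * t))"
   by (simp add: exp_add[symmetric] algebra_simps)
  then show ?thesis unfolding eq using mgf_all[OF mgf_one[OF z] t] by simp
 qed
next
 obtain C where C: "!!z. 0 <= z ==> \<psi> z <= C * (1 + z\<^sup>2)"
  using levy_khintchine_quadratic[OF neg_levy, of \<gamma> \<sigma>] \<psi>_lk by auto
 have "\<psi> z - d * z <= C * (1 + z\<^sup>2)" if "0 <= z" for z
  using C[OF that] mult_nonneg_nonneg[OF assms(1) that] by linarith
 then show "EX C. ALL z>=0. \<psi> z - d * z <= C * (1 + z\<^sup>2)" by blast
 obtain z where z: "0 < z" "\<delta> * z < \<psi> z" using \<psi>_above by blast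
 moreover have "d * z <= \<delta> * z" using assms z by (intro mult_right_mono) auto
 ultimately have "0 < \<psi> z - d * z" by linarith
 then show "EX z>0. 0 < \<psi> z - d * z" using z(1) by blast
qed (auto intro!: tendsto_intros right borel_measurable_diff measurable_process simp: zero)

lemma laplace_drift:
 assumes "0 <= z"
 shows "laplace_exponent M (%t w. X t w - d * t) z = \<psi> z - d * z"
proof -
 have eq: "exp (z * (X 1 w - d * 1)) = exp (z * X 1 w) * exp (- (d * z))" for w
  by (simp add: exp_add[symmetric] algebra_simps)
 have "(\<integral>w. exp (z * (X 1 w - d * 1)) \<partial>M) = exp (\<psi> z) * exp (- (d * z))"
  unfolding eq using mgf_all[OF mgf_one[OF assms], of 1] by simp
 then show ?thesis
  unfolding laplace_exponent_def[of M "%t w. X t w - d * t"] by (simp add: exp_add[symmetric])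
qed

lemma scale_process_drift:
 assumes d: "0 <= d" "d <= \<delta>" and q: "0 < q" and W: "scale_function M (%t w. X t w - d * t) q W"
 shows "scale_process M (%t w. X t w - d * t) (%z. \<psi> z - d * z) q W"
  "exp_process.root (%z. \<psi> z - d * z) q = laplace_root M (%t w. X t w - d * t) q"
proof -
 interpret E: exp_process M "%t w. X t w - d * t" "%z. \<psi> z - d * z" by (rule exp_process_drift[OF d])
 show root: "E.root q = laplace_root M (%t w. X t w - d * t) q"
  unfolding E.root_def laplace_root_def using laplace_drift by (intro arg_cong[where f = Sup]) auto
 show "scale_process M (%t w. X t w - d * t) (%z. \<psi> z - d * z) q W"
 proof
  show "0 < q" by (rule q)
  show "continuous_on {0..} W" "strict_mono_on {0..} W" "!!x. x < 0 ==> W x = 0"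
   using W by (auto simp: scale_function_def)
  fix z assume z: "E.root q < z"
  then have "0 <= z" using E.root_pos[OF q] by simp
  then show "set_integrable lborel {0..} (%x. exp (- z * x) * W x)"
   "(LBINT x:{0..}. exp (- z * x) * W x) = 1 / ((\<psi> z - d * z) - q)"
   using W z laplace_drift by (auto simp: scale_function_def root)
 qed
qed

lemma scale_process_zero:
 assumes "0 < q" "scale_function M X q W"
 shows "scale_process M X \<psi> q W"
 using scale_process_drift(1)[of 0 q W] assms \<delta> by simp

end

locale refracted_levy = refracted_setting +
 fixes b x :: real and W WY :: "real => real => real"
 assumes b: "0 < b" and W: "!!q. 0 < q ==> scale_function M X q (W q)"
  and WY: "!!q. 0 < q ==> scale_function M (%t w. X t w - \<delta> * t) q (WY q)"
begin

abbreviation "\<phi>' q \<equiv> laplace_root M (%t w. X t w - \<delta> * t) q"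

lemma scales:
 assumes "0 < \<delta>" "0 < q"
 shows "refracted_scales M X \<psi> q (W q) \<delta> (WY q) b"
 using scale_process_zero[OF assms(2) W] scale_process_drift(1)[OF \<delta> order_refl assms(2) WY] assms b
 by (intro refracted_scales.intro refracted_scales_axioms.intro) auto

lemma chain:
 assumes \<delta>0: "0 < \<delta>" and q: "0 < q"
 shows "refracted_chain M X \<psi> q (W q) \<delta> (WY q) b (q + \<delta> * \<phi>' q) (W (q + \<delta> * \<phi>' q)) (WY (q + \<delta> * \<phi>' q)) (max 0 x)"
proof -
 interpret S: refracted_scales M X \<psi> q "W q" \<delta> "WY q" b by (rule scales[OF assms])
 have root: "S.Y.root q = \<phi>' q" by (rule scale_process_drift(2)[OF \<delta> order_refl q WY[OF q]])
 have p: "0 < q + \<delta> * \<phi>' q" using S.\<phi>_pos q \<delta> by (simp add: root add_pos_nonneg)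
 show ?thesis
 proof (intro refracted_chain.intro refracted_chain_axioms.intro)
  show "refracted_scales M X \<psi> q (W q) \<delta> (WY q) b" by (rule scales[OF assms])
  show "refracted_scales M X \<psi> (q + \<delta> * \<phi>' q) (W (q + \<delta> * \<phi>' q)) \<delta> (WY (q + \<delta> * \<phi>' q)) b" by (rule scales[OF \<delta>0 p])
 qed (auto simp: root intro: independent_increments stationary_increments)
qed

lemma AE_no_coincidence: "AE w in M. no_coincidence \<delta> (%t. X t w)"
proof -
 interpret E: exp_process M X \<psi> using exp_process_drift[of 0] \<delta> by simp
 interpret R: rising_process M X \<psi> \<delta>
  using \<delta> \<psi>_above scale_process_zero[OF _ W] stationary_increments by unfold_locales auto
 show ?thesis by (rule R.AE_no_coincidence)
qed

text \<open>The Euler occupations converge on almost every path and are bounded by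
  \<open>1 / q\<close>, so their expectations converge to the wanted value. The fifth claim keeps
  only \<open>r \<ge> 1\<close> and the bound \<open>1 / (\<delta> * \<phi>)\<close> on the tail
  integral; free of both \<open>r\<close> and the tail, it can be followed as \<open>q\<close> tends
  to \<open>0\<close>.\<close>

lemma expected_discounted:
 assumes \<delta>0: "0 < \<delta>" and q: "0 < q"
 shows "expected_discounted_L M X \<delta> b x q =
   ennreal (exp (- \<phi>' q * b) * scale_r \<delta> b q (W q) (WY q) x /
    (\<phi>' q * q * enn2real (\<integral>\<^sup>+y\<in>{b..}. ennreal (exp (- \<phi>' q * y) * W q y) \<partial>lborel)) - \<delta> * scale_bar (WY q) (x - b))" (is ?value)
  and "(\<integral>\<^sup>+y\<in>{b..}. ennreal (exp (- \<phi>' q * y) * W q y) \<partial>lborel) < \<infinity>" (is ?finite)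
  and "0 < enn2real (\<integral>\<^sup>+y\<in>{b..}. ennreal (exp (- \<phi>' q * y) * W q y) \<partial>lborel)" (is ?pos)
  and "0 < \<phi>' q" (is ?root)
  and "ennreal (\<delta> * (exp (- \<phi>' q * b) / q - scale_bar (WY q) (x - b))) <= expected_discounted_L M X \<delta> b x q" (is ?lower)
  and "0 <= exp (- \<phi>' q * b) * scale_r \<delta> b q (W q) (WY q) x /
    (\<phi>' q * q * enn2real (\<integral>\<^sup>+y\<in>{b..}. ennreal (exp (- \<phi>' q * y) * W q y) \<partial>lborel)) - \<delta> * scale_bar (WY q) (x - b)" (is ?nonneg)
proof -
 interpret C: refracted_chain M X \<psi> q "W q" \<delta> "WY q" b "q + \<delta> * \<phi>' q" "W (q + \<delta> * \<phi>' q)" "WY (q + \<delta> * \<phi>' q)" "max 0 x"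
  by (rule chain[OF assms])
 have root: "C.Y.root q = \<phi>' q" by (rule scale_process_drift(2)[OF \<delta> order_refl q WY[OF q]])
 have Tail: "C.Tail = enn2real (\<integral>\<^sup>+y\<in>{b..}. ennreal (exp (- \<phi>' q * y) * W q y) \<partial>lborel)" by (simp add: C.Tail_def root)
 show ?finite using C.tail_split(1) by (simp add: root)
 show ?pos using C.tail_split(4) by (simp add: Tail)
 show ?root using C.\<phi>_pos by (simp add: root)
 have r: "C.r b (max 0 x) = scale_r \<delta> b q (W q) (WY q) x"
  unfolding C.scale_r_eq by (cases "0 <= x") (auto simp: C.r_neg max_def)
 have F: "C.F b (max 0 x) = scale_bar (WY q) (x - b)"
  unfolding C.scale_bar_eq using b by (cases "0 <= x") (auto simp: C.F_zero max_def)
 define v where "v = C.\<rho> * C.r b (max 0 x) - C.F b (max 0 x)"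
 define u where "u n k = ennreal \<delta> * euler_occ q \<delta> b (max 0 x) (%t. X t k) (1 / real (Suc n))" for n k
 define g where "g k = (\<integral>\<^sup>+t\<in>{0..}. nexp (- q * t) \<partial>interval_measure (refraction_time \<delta> b x (%t. x + X t k)))" for k
 have um: "u n \<in> borel_measurable M" for n
  unfolding u_def by (intro borel_measurable_times_ennreal borel_measurable_const C.euler_occ_measurable) simp
 have lim: "AE k in M. (%n. u n k) ----> g k"
  using AE_no_coincidence
 proof eventually_elim
  case (elim k)
  have "(%n. ennreal \<delta> * euler_occ q \<delta> b (max 0 x) (%t. x + X t k) (1 / real (Suc n))) ----> g k"
   unfolding g_def by (intro euler_occ_tendsto cadlag_shift no_positive_jumps_shift no_coincidence_shift cadlag npj elim \<delta> b q)
  then show ?case by (simp add: u_def euler_occ_def)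
 qed
 \<comment> \<open>Measurability of \<open>g\<close> is not immediate from the stagewise
   construction. The lower limit is measurable and agrees with \<open>g\<close> almost everywhere,
   which fixes the value of the outer integral.\<close>
 define g' where "g' k = liminf (%n. u n k)" for k
 have eq: "AE k in M. g k = g' k" using lim by eventually_elim (auto simp: g'_def intro!: lim_imp_Liminf[symmetric])
 have "(%n. (\<E> k. u n k)) ----> (\<E> k. g' k)"
 proof (rule nn_integral_dominated_convergence[where w = "%_. ennreal \<delta> * ennreal (1 / q)"])
  show "g' \<in> borel_measurable M" unfolding g'_def by (intro borel_measurable_liminf um)
  show "AE k in M. (%n. u n k) ----> g' k" using lim eq by eventually_elim simp
  have "euler_occ q \<delta> b (max 0 x) f h <= ennreal (1 / q)" for f h
   unfolding euler_occ_def nn_exp_positive[OF q, symmetric] by (intro nn_integral_mono) (auto simp: indicator_def)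
  then show "AE k in M. u n k <= ennreal \<delta> * ennreal (1 / q)" for n unfolding u_def by (intro AE_I2 mult_left_mono) auto
  show "(\<E> k. ennreal \<delta> * ennreal (1 / q)) < \<infinity>" by (simp add: emeasure_space_1 ennreal_mult_less_top)
 qed (use um in auto)
 moreover have "(%n. (\<E> k. u n k)) ----> ennreal \<delta> * ennreal v"
 proof -
  have "(\<E> k. u n k) = ennreal \<delta> * (\<E> k. euler_occ q \<delta> b (max 0 x) (%t. X t k) (1 / real (Suc n)))" for n
   unfolding u_def by (intro nn_integral_cmult C.euler_occ_measurable) simp
  then show ?thesis using C.expected_occ_limit(1) by (auto simp: v_def intro!: ennreal_tendsto_cmult)
 qed
 ultimately have "(\<E> k. g' k) = ennreal \<delta> * ennreal v" by (rule LIMSEQ_unique)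
 moreover have "expected_discounted_L M X \<delta> b x q = (\<E> k. g' k)"
  unfolding expected_discounted_L_def g_def[symmetric] by (rule nn_integral_cong_AE[OF eq])
 ultimately have val: "expected_discounted_L M X \<delta> b x q = ennreal (\<delta> * v)" using \<delta> by (simp add: ennreal_mult')
 have dv: "\<delta> * v = exp (- \<phi>' q * b) * scale_r \<delta> b q (W q) (WY q) x / (\<phi>' q * q * C.Tail) - \<delta> * scale_bar (WY q) (x - b)"
 proof -
  have "\<delta> * (P / (a * q * \<delta> * T) * R - B) = P * R / (a * q * T) - \<delta> * B" for P a T R B :: real
   using \<delta>0 by (simp add: field_simps)
  then show ?thesis unfolding v_def r F C.\<rho>_def root .
 qed
 show ?value using val dv unfolding Tail by simp
 have v0: "0 <= v" using C.expected_occ_limit(2) by (simp add: v_def)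
 then have "0 <= \<delta> * v" using \<delta> by simp
 then show ?nonneg unfolding dv Tail .
 have "\<phi>' q * \<delta> * C.Tail <= 1"
 proof -
  have "a * \<delta> * T <= 1" if "0 <= 1 / (\<delta> * a) - T" "0 < a" for a T :: real
   using that \<delta>0 by (simp add: field_simps)
  from this[OF C.tail_split(3) C.\<phi>_pos] show ?thesis unfolding root .
 qed
 then have "\<phi>' q * q * \<delta> * C.Tail <= q" using mult_left_mono[of "\<phi>' q * \<delta> * C.Tail" 1 q] q by (simp add: mult_ac)
 moreover have "0 < \<phi>' q * q * \<delta> * C.Tail" using C.\<phi>_pos q \<delta>0 C.tail_split(4) by (simp add: root)
 ultimately have "exp (- \<phi>' q * b) / q <= C.\<rho>"
  unfolding C.\<rho>_def root using q by (intro divide_left_mono) auto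
 also have "... <= C.\<rho> * C.r b (max 0 x)" using C.\<rho>_pos C.r_ge_1[of b "max 0 x"] by simp
 finally have "exp (- \<phi>' q * b) / q - scale_bar (WY q) (x - b) <= v" by (simp add: v_def F)
 then show ?lower unfolding val using \<delta> by (intro ennreal_leI mult_left_mono)
qed

lemma expected_discounted_mono:
 assumes "0 <= q"
 shows "expected_discounted_L M X \<delta> b x q <= expected_discounted_L M X \<delta> b x 0"
 unfolding expected_discounted_L_def using assms
 by (intro nn_integral_mono) (auto intro!: ennreal_leI simp: indicator_def)

text \<open>The lower bound for discount \<open>q\<close> has the form \<delta> times
  \<open>K / q - C\<close> with constants independent of \<open>q \<le> 1\<close>: \<phi> is
  increasing in \<open>q\<close>, which gives \<open>K\<close>, and the subtracted term stays
  bounded.\<close>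

lemma expected_undiscounted:
 assumes \<delta>0: "0 < \<delta>"
 shows "expected_discounted_L M X \<delta> b x 0 = \<infinity>"
proof -
 interpret E: exp_process M "%t w. X t w - \<delta> * t" "%z. \<psi> z - \<delta> * z" by (rule exp_process_drift[OF \<delta> order_refl])
 \<comment> \<open>The exponent at which the exponent of \<open>Y\<close> equals 2 leaves a distance
   \<open>2 - q\<close> of at least 1 from the pole, so the exponential bound is uniform in
   \<open>q \<le> 1\<close>.\<close>
 define C where "C = E.root 2 * exp ((E.root 2 + 1) * (x - b))"
 define K where "K = exp (- \<phi>' 1 * b)"
 have low: "ennreal (\<delta> * (K * real (Suc n) - C)) <= expected_discounted_L M X \<delta> b x 0" for n
 proof -
  define q where "q = 1 / real (Suc n)"
  have q: "0 < q" "q <= 1" by (simp_all add: q_def)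
  interpret S: refracted_scales M X \<psi> q "W q" \<delta> "WY q" b by (rule scales[OF \<delta>0 q(1)])
  have root: "E.root q = \<phi>' q" "E.root 1 = \<phi>' 1"
   using scale_process_drift(2)[OF \<delta> order_refl _ WY] q by auto
  have "\<phi>' q <= \<phi>' 1" using E.root_mono[OF q] root by simp
  then have "K <= exp (- \<phi>' q * b)" using b by (simp add: K_def)
  then have 1: "K * real (Suc n) <= exp (- \<phi>' q * b) / q" unfolding q_def by (simp add: mult_right_mono del: of_nat_Suc)
  have lt: "E.root q < E.root 2"
  proof (rule ccontr)
   assume "~ E.root q < E.root 2"
   then have "\<psi> (E.root 2) - \<delta> * E.root 2 <= q"
    using E.\<psi>_lt_root[OF q(1) E.root_pos[of 2]] E.\<psi>_root[OF q(1)] by (cases "E.root 2 = E.root q") auto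
   then show False using E.\<psi>_root[of 2] q by simp
  qed
  have "S.Y.cv (ind {b..}) x <= ennreal (1 * E.root 2 / (\<psi> (E.root 2) - \<delta> * E.root 2 - q) * exp ((E.root 2 + 1) * (x - b)))"
   by (rule S.Y.cv_exp_bound[OF S.Ici_good(1-4) lt])
  also have "... <= ennreal C"
  proof (rule ennreal_leI)
   have "1 * E.root 2 / (\<psi> (E.root 2) - \<delta> * E.root 2 - q) <= E.root 2"
    using E.\<psi>_root[of 2] E.root_pos[of 2] q by (simp add: field_simps)
   then show "1 * E.root 2 / (\<psi> (E.root 2) - \<delta> * E.root 2 - q) * exp ((E.root 2 + 1) * (x - b)) <= C"
    unfolding C_def by (intro mult_right_mono) auto
  qed
  finally have "scale_bar (WY q) (x - b) <= C"
   using E.root_pos[of 2] unfolding S.scale_bar_eq S.F_def by (intro enn2real_leI) (auto simp: C_def)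
  then have "\<delta> * (K * real (Suc n) - C) <= \<delta> * (exp (- \<phi>' q * b) / q - scale_bar (WY q) (x - b))"
   using 1 \<delta> by (intro mult_left_mono) auto
  then have "ennreal (\<delta> * (K * real (Suc n) - C)) <= expected_discounted_L M X \<delta> b x q"
   using expected_discounted(5)[OF \<delta>0 q(1)] by (meson ennreal_leI order_trans)
  also have "... <= expected_discounted_L M X \<delta> b x 0" using q by (intro expected_discounted_mono) simp
  finally show ?thesis .
 qed
 have K: "0 < \<delta> * K" using \<delta>0 by (simp add: K_def)
 show ?thesis
 proof (cases "expected_discounted_L M X \<delta> b x 0")
  case (real v)
  obtain n where n: "v + \<delta> * C < real n * (\<delta> * K)" using reals_Archimedean3[OF K] by blast
  also have "... <= real (Suc n) * (\<delta> * K)" using K by (intro mult_right_mono) auto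
  finally have "v < \<delta> * (K * real (Suc n) - C)" by (simp add: algebra_simps)
  then have False using low[of n] real by (simp add: ennreal_le_iff2)
  then show ?thesis ..
 qed simp
qed

lemma expected_discounted_zero:
 assumes "\<delta> = 0"
 shows "expected_discounted_L M X \<delta> b x q = 0"
proof -
 have "refraction_time \<delta> b x f = (%_. 0)" for f by (auto simp: refraction_time_def assms)
 moreover have "interval_measure (%_. 0) = density lborel (%_. 0)"
  by (rule interval_measure_eqI) (auto simp: emeasure_density)
 ultimately show ?thesis by (simp add: expected_discounted_L_def nn_integral_density)
qed

text \<open>For \<open>\<delta> = 0\<close> the roots of \<open>X\<close> and \<open>Y\<close>
  agree, the integrand of the denominator is bounded away from \<open>0\<close>, and the integral is
  infinite. The quotient is then \<open>0\<close> in the extended reals, in accordance with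
  \<open>L\<close> being zero.\<close>

theorem discounted_value:
 assumes q: "0 < q"
 shows "enn2ereal (expected_discounted_L M X \<delta> b x q) =
  ereal (exp (- \<phi>' q * b)) * (ereal (scale_r \<delta> b q (W q) (WY q) x) /
   (ereal (\<phi>' q * q) * enn2ereal (\<integral>\<^sup>+y\<in>{b..}. ennreal (exp (- \<phi>' q * y) * W q y) \<partial>lborel)))
  - ereal (\<delta> * scale_bar (WY q) (x - b))"
proof (cases "\<delta> = 0")
 case True
 interpret S: scale_process M X \<psi> q "W q" by (rule scale_process_zero[OF q W[OF q]])
 have root: "S.root q = \<phi>' q" using scale_process_drift(2)[OF \<delta> order_refl q WY[OF q]] True by simp
 have "(\<integral>\<^sup>+y\<in>{b..}. ennreal (exp (- \<phi>' q * y) * W q y) \<partial>lborel) = \<infinity>"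
  using S.tail_integral_infinite[OF b] by (simp add: root)
 moreover have "\<phi>' q ~= 0" using S.root_pos[OF q] by (simp add: root)
 ultimately show ?thesis
  using expected_discounted_zero[OF True] q S.root_pos[OF q] True by (simp add: zero_ereal_def[symmetric] zero_ennreal.rep_eq root)
next
 case False
 then have \<delta>0: "0 < \<delta>" using \<delta> by simp
 let ?I = "\<integral>\<^sup>+y\<in>{b..}. ennreal (exp (- \<phi>' q * y) * W q y) \<partial>lborel"
 note ed = expected_discounted[OF \<delta>0 q]
 define T where "T = enn2real ?I"
 have "enn2ereal ?I = ereal T" using ed(2) by (cases ?I) (auto simp: T_def)
 moreover have "enn2ereal (expected_discounted_L M X \<delta> b x q) =
   ereal (exp (- \<phi>' q * b) * scale_r \<delta> b q (W q) (WY q) x / (\<phi>' q * q * T) - \<delta> * scale_bar (WY q) (x - b))"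
  unfolding ed(1) T_def using ed(6) by (rule enn2ereal_ennreal)
 moreover have "\<phi>' q * q * T ~= 0" using ed(3,4) q by (simp add: T_def)
 ultimately show ?thesis by (simp only: times_ereal.simps ereal_divide if_False ereal_minus times_divide_eq_right)
qed

end

section \<open>Transfer from the modification to the given process\<close>

lemma (in levy_process) refracted_levy_cong:
 assumes X': "nice_levy M X'" and eq: "AE w in M. ALL t. X' t w = X t w"
 shows "laplace_exponent M (%t w. X' t w - d * t) = laplace_exponent M (%t w. X t w - d * t)"
  "has_levy_triplet M X' \<gamma> \<sigma> \<nu> \<longleftrightarrow> has_levy_triplet M X \<gamma> \<sigma> \<nu>"
  "bounded_variation_paths M X' \<longleftrightarrow> bounded_variation_paths M X"
  "expected_discounted_L M X' \<delta> b x q = expected_discounted_L M X \<delta> b x q"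
proof -
 interpret N: nice_levy M X' by (rule X')
 have [measurable]: "X' 1 \<in> borel_measurable M" "X 1 \<in> borel_measurable M" using N.measurable_process measurable_process by auto
 have e: "AE w in M. exp (z * (X' 1 w - d * 1)) = exp (z * (X 1 w - d * 1))" for z d
  using eq by eventually_elim simp
 show lap: "laplace_exponent M (%t w. X' t w - d * t) = laplace_exponent M (%t w. X t w - d * t)" for d
  unfolding laplace_exponent_def using integral_cong_AE[OF _ _ e] by (auto simp: fun_eq_iff)
 have "integrable M (%w. exp (z * X' 1 w)) = integrable M (%w. exp (z * X 1 w))" for z
  using e[of z 0] by (intro integrable_cong_AE) auto
 then show "has_levy_triplet M X' \<gamma> \<sigma> \<nu> \<longleftrightarrow> has_levy_triplet M X \<gamma> \<sigma> \<nu>"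
  using lap[of 0] by (simp add: has_levy_triplet_def)
 have "AE w in M. locally_bounded_variation (%t. X' t w) = locally_bounded_variation (%t. X t w)"
  using eq by eventually_elim simp
 then show "bounded_variation_paths M X' \<longleftrightarrow> bounded_variation_paths M X"
  unfolding bounded_variation_paths_def by (rule eventually_subst)
 show "expected_discounted_L M X' \<delta> b x q = expected_discounted_L M X \<delta> b x q"
  unfolding expected_discounted_L_def
  by (rule nn_integral_cong_AE) (use eq in \<open>auto elim: eventually_mono\<close>)
qed

text \<open>All quantities involved depend on \<open>X\<close> only up to a null set, so they may be
  computed for the regular modification. Extended reals let one formula include
  \<open>\<delta> = 0\<close>, where the denominator is infinite. In that case \<open>L\<close>
  vanishes, hence the restriction to \<open>0 < \<delta>\<close> for the infinite value at
  \<open>q = 0\<close>.\<close>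

theorem corollary4p4:
  fixes M :: "'a measure" and X Y :: "real \<Rightarrow> 'a \<Rightarrow> real"
    and \<gamma> \<sigma> \<delta> b x :: real and \<nu> :: "real measure"
    and W WY :: "real \<Rightarrow> real \<Rightarrow> real" and \<phi> :: "real \<Rightarrow> real"
  assumes X: "spectrally_negative_levy_process M X"
    and triplet: "has_levy_triplet M X \<gamma> \<sigma> \<nu>"
    and b: "0 < b" and \<delta>: "0 \<le> \<delta>"
    and drift: "bounded_variation_paths M X \<Longrightarrow> \<delta> < \<gamma> - (LINT y:{-1<..<0}|\<nu>. y)"
    and Y: "Y = (\<lambda>t \<omega>. X t \<omega> - \<delta> * t)"
    and \<phi>: "\<phi> = laplace_root M Y"
    and W: "\<And>q. 0 < q \<Longrightarrow> scale_function M X q (W q)"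
    and WY: "\<And>q. 0 < q \<Longrightarrow> scale_function M Y q (WY q)"
  shows "(\<forall>q>0.
            enn2ereal (expected_discounted_L M X \<delta> b x q) =
              ereal (exp (- \<phi> q * b)) *
                (ereal (scale_r \<delta> b q (W q) (WY q) x) /
                 (ereal (\<phi> q * q) *
                   enn2ereal (\<integral>\<^sup>+y\<in>{b..}. ennreal (exp (- \<phi> q * y) * W q y) \<partial>lborel)))
              - ereal (\<delta> * scale_bar (WY q) (x - b)))
       \<and> (0 < \<delta> \<longrightarrow> expected_discounted_L M X \<delta> b x 0 = \<infinity>)"
proof -
 interpret X: spectrally_negative_levy_process M X by fact
 obtain X' where X': "nice_levy M X'" "AE w in M. ALL t. X' t w = X t w"
  using spectrally_negative_modification[OF X] by blast
 note cong = X.refracted_levy_cong[OF X']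
 have lap: "laplace_exponent M X' = laplace_exponent M X" using cong(1)[of 0] by simp
 have Y': "laplace_root M (%t w. X' t w - \<delta> * t) = \<phi>" by (simp add: fun_eq_iff laplace_root_def cong(1) \<phi> Y)
 interpret refracted_levy M X' \<gamma> \<sigma> \<delta> \<nu> b x W WY
 proof (intro refracted_levy.intro refracted_setting.intro refracted_setting_axioms.intro refracted_levy_axioms.intro)
  show "nice_levy M X'" by (rule X')
  show "has_levy_triplet M X' \<gamma> \<sigma> \<nu>" using triplet by (simp add: cong)
  show "bounded_variation_paths M X' ==> \<delta> < \<gamma> - (LINT y:{-1<..<0}|\<nu>. y)" using drift by (simp add: cong)
  show "scale_function M X' q (W q)" if "0 < q" for q
   using W[OF that] by (simp add: scale_function_def laplace_root_def lap)
  show "scale_function M (%t w. X' t w - \<delta> * t) q (WY q)" if "0 < q" for q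
   using WY[OF that] by (simp add: scale_function_def laplace_root_def cong(1) Y)
 qed (use b \<delta> in auto)
 show ?thesis using discounted_value expected_undiscounted unfolding Y' by (simp add: cong(4))
qed

end
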